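(* Let $\Gamma=\mathbb{Z}/2\mathbb{Z}$, generated by $\sigma$, let $p$ be an odd prime, let $u$ be an integer, and let $\mathcal{C}$ be the set of all finite $p$-$\Gamma$-groups. Let $H$ be a finite $p$-$\Gamma$-group. If $H\cong\mathcal{F}_n^{\mathcal{C}}/[Y(S)]$ for some $n$ and some subset $S\subseteq\mathcal{F}_n^{\mathcal{C}}$ of size $n+u$, then $$\mu_u(V_{\mathcal{C},H})=\frac{1}{|\mathrm{Aut}_\Gamma(H)|\,|Y(H)|^u}\prod_{i=1+u+d(H)-r(H)}^\infty(1-p^{-i}).$$ If $H$ is not of this form for any $n$, then $\mu_u(V_{\mathcal{C},H})=0$.
   Context: A $p$-$\Gamma$-group is a (pro-)$p$ group with a continuous $\Gamma$-action. $Y(g)=g^{-1}\sigma(g)$ (so $|Y(H)|=[H:H^\Gamma]$). $\mathcal{F}_n$ is the closed $\Gamma$-subgroup generated by $\{x_i^{-1}\sigma(x_i)\}$ in the free pro-odd group on $\{x_{i,\gamma}:1\le i\le n,\gamma\in\Gamma\}$ with $\tau(x_{i,\gamma})=x_{i,\tau\gamma}$, $x_i=x_{i,1}$; $G^{\mathcal{C}}$ denotes the pro-$\mathcal{C}$ completion (here the pro-$p$ completion); $[Y(S)]$ is the closed normal $\Gamma$-subgroup generated by $Y(r)$, $r\in S$. $d(H)$ is the minimal number of generators of $H$, and $r(H)$ is its relation rank: $r(H)=\dim_{\mathbb{F}_p}N/N^p[N,F]$ for a presentation $1\to N\to F\to H\to1$ with $F$ free pro-$p$ on $d(H)$ generators.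 $\mathcal{P}$ is the set of isomorphism classes of admissible $\Gamma$-groups (pro-odd, topologically generated as closed $\Gamma$-subgroups by the $g^{-1}\sigma(g)$) with all pro-$\mathcal{D}$ completions finite for finite $\mathcal{D}$; $\mu_u$ is the Borel probability measure on $\mathcal{P}$ with $\mu_u(U)=\lim_n\mathrm{Prob}(X_{u,n}\in U)$ for $U$ in the algebra generated by basic opens $\{X:X^{\mathcal{D}}\cong H'\}$ ($\mathcal{D}$ finite), where $X_{u,n}=\mathcal{F}_n/[Y(S)]$ with $S$ being $n+u$ independent Haar-random elements. $V_{\mathcal{C},H}=\{X\in\mathcal{P}:X^{\mathcal{C}}\cong H\}$. *)

theory Defs
  imports "HOL-Probability.Probability" "HOL-Algebra.Bij" "HOL-Algebra.Generated_Groups"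
    "HOL-Algebra.FiniteProduct"
begin

section \<open>Topological groups with an action of the group of order two\<close>

text \<open>
  An action of \<open>\<Gamma> = {1, \<sigma>}\<close> on a topological group is the same as a continuous automorphism
  \<open>act\<close> (the action of \<open>\<sigma>\<close>) whose square is the identity.
\<close>

record 'a gstruct = "'a monoid" +
  topo :: "'a topology"
  act :: "'a \<Rightarrow> 'a"

locale gamma_group = group G for G :: "('a, 'b) gstruct_scheme" (structure) +
  assumes topspace_topo: "topspace (topo G) = carrier G"
    and continuous_mult:
      "continuous_map (prod_topology (topo G) (topo G)) (topo G) (\<lambda>(x, y). x \<otimes> y)"
    and continuous_inv: "continuous_map (topo G) (topo G) (\<lambda>x. inv x)"
    and act_hom: "act G \<in> hom G G"
    and continuous_act: "continuous_map (topo G) (topo G) (act G)"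
    and act_act: "x \<in> carrier G \<Longrightarrow> act G (act G x) = x"

definition gamma_iso :: "'a gstruct \<Rightarrow> 'c gstruct \<Rightarrow> bool"  (infix \<open>\<cong>\<^sub>\<Gamma>\<close> 50) where
  "G \<cong>\<^sub>\<Gamma> K \<longleftrightarrow>
     (\<exists>h \<in> iso G K. homeomorphic_map (topo G) (topo K) h \<and>
        (\<forall>x \<in> carrier G. h (act G x) = act K (h x)))"

definition gamma_subgroup :: "'a gstruct \<Rightarrow> 'a set \<Rightarrow> bool" where
  "gamma_subgroup G K \<longleftrightarrow> subgroup K G \<and> act G ` K \<subseteq> K"

definition gamma_restrict :: "'a gstruct \<Rightarrow> 'a set \<Rightarrow> 'a gstruct" where
  "gamma_restrict G K = G\<lparr>carrier := K, topo := subtopology (topo G) K\<rparr>"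

text \<open>The topology below is the quotient topology: \<open>\<Union>U\<close> is the preimage of a set \<open>U\<close> of cosets.\<close>

definition gamma_quotient :: "'a gstruct \<Rightarrow> 'a set \<Rightarrow> 'a set gstruct" where
  "gamma_quotient G N = monoid.extend (G Mod N)
     (gstruct.fields
        (topology (\<lambda>U. U \<subseteq> rcosets\<^bsub>G\<^esub> N \<and> openin (topo G) (\<Union>U)))
        (image (act G)))"

definition gamma_product :: "'a gstruct \<Rightarrow> 'c gstruct \<Rightarrow> ('a \<times> 'c) gstruct" where
  "gamma_product G K = monoid.extend (G \<times>\<times> K)
     (gstruct.fields (prod_topology (topo G) (topo K)) (map_prod (act G) (act K)))"

definition closed_gamma_gen :: "'a gstruct \<Rightarrow> 'a set \<Rightarrow> 'a set" where
  "closed_gamma_gen G A = (\<lambda>K. gamma_subgroup G K \<and> closedin (topo G) K) hull A"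

definition closed_normal_gamma_gen :: "'a gstruct \<Rightarrow> 'a set \<Rightarrow> 'a set" where
  "closed_normal_gamma_gen G A =
     (\<lambda>N. N \<lhd> G \<and> gamma_subgroup G N \<and> closedin (topo G) N) hull A"

definition Y :: "'a gstruct \<Rightarrow> 'a \<Rightarrow> 'a" where
  "Y G g = inv\<^bsub>G\<^esub> g \<otimes>\<^bsub>G\<^esub> act G g"

text \<open>The quotient written \<open>G/[Y(S)]\<close>.\<close>

definition Y_quotient :: "'a gstruct \<Rightarrow> 'a set \<Rightarrow> 'a set gstruct" where
  "Y_quotient G S = gamma_quotient G (closed_normal_gamma_gen G (Y G ` S))"

definition gamma_Aut :: "'a gstruct \<Rightarrow> ('a \<Rightarrow> 'a) set" where
  "gamma_Aut G = {f \<in> auto G. continuous_map (topo G) (topo G) f \<and>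
     (\<forall>x \<in> carrier G. f (act G x) = act G (f x))}"

definition finite_gamma_group :: "'a gstruct \<Rightarrow> bool" where
  "finite_gamma_group G \<longleftrightarrow>
     gamma_group G \<and> finite (carrier G) \<and> topo G = discrete_topology (carrier G)"

definition finite_p_gamma_group :: "nat \<Rightarrow> 'a gstruct \<Rightarrow> bool" where
  "finite_p_gamma_group p G \<longleftrightarrow> finite_gamma_group G \<and> (\<exists>k. order G = p ^ k)"


section \<open>Completions with respect to a class of finite groups\<close>

text \<open>
  Every finite \<open>\<Gamma>\<close>-group has an isomorphic copy with carrier in \<^typ>\<open>nat\<close>, so a class of finite
  \<open>\<Gamma>\<close>-groups is given as a set of structures on \<^typ>\<open>nat\<close>.
\<close>

definition p_gamma_groups :: "nat \<Rightarrow> nat gstruct set" where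
  "p_gamma_groups p = {G. finite_p_gamma_group p G}"

definition odd_gamma_groups :: "nat gstruct set" where
  "odd_gamma_groups = {G. finite_gamma_group G \<and> odd (order G)}"

text \<open>
  The smallest isomorphism-closed class containing \<open>C\<close> and closed under \<open>\<Gamma>\<close>-subgroups,
  \<open>\<Gamma>\<close>-quotients and finite direct products (including the empty one).
\<close>

inductive_set gamma_closure :: "nat gstruct set \<Rightarrow> nat gstruct set"
  for C :: "nat gstruct set" where
  base: "G \<in> C \<Longrightarrow> G \<in> gamma_closure C"
| triv: "finite_gamma_group L \<Longrightarrow> order L = 1 \<Longrightarrow> L \<in> gamma_closure C"
| sub: "G \<in> gamma_closure C \<Longrightarrow> gamma_subgroup G K \<Longrightarrow>
    finite_gamma_group L \<Longrightarrow> gamma_restrict G K \<cong>\<^sub>\<Gamma> L \<Longrightarrow> L \<in> gamma_closure C"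
| quot: "G \<in> gamma_closure C \<Longrightarrow> N \<lhd> G \<Longrightarrow> gamma_subgroup G N \<Longrightarrow>
    finite_gamma_group L \<Longrightarrow> gamma_quotient G N \<cong>\<^sub>\<Gamma> L \<Longrightarrow> L \<in> gamma_closure C"
| prod: "G \<in> gamma_closure C \<Longrightarrow> K \<in> gamma_closure C \<Longrightarrow>
    finite_gamma_group L \<Longrightarrow> gamma_product G K \<cong>\<^sub>\<Gamma> L \<Longrightarrow> L \<in> gamma_closure C"

definition completion_index :: "nat gstruct set \<Rightarrow> 'a gstruct \<Rightarrow> 'a set set" where
  "completion_index C G = {N. N \<lhd> G \<and> gamma_subgroup G N \<and> closedin (topo G) N \<and>
     (\<exists>K \<in> gamma_closure C. gamma_quotient G N \<cong>\<^sub>\<Gamma> K)}"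

text \<open>
  The inverse limit of the quotients \<open>G/N\<close>, \<open>N \<in> completion_index C G\<close>; for \<open>M \<subseteq> N\<close> the transition
  map \<open>G/M \<rightarrow> G/N\<close> sends a coset of \<open>M\<close> to the unique coset of \<open>N\<close> containing it.
\<close>

definition completion_carrier :: "nat gstruct set \<Rightarrow> 'a gstruct \<Rightarrow> ('a set \<Rightarrow> 'a set) set" where
  "completion_carrier C G = {f \<in> (\<Pi>\<^sub>E N \<in> completion_index C G. rcosets\<^bsub>G\<^esub> N).
     \<forall>M \<in> completion_index C G. \<forall>N \<in> completion_index C G. M \<subseteq> N \<longrightarrow> f M \<subseteq> f N}"

definition completion :: "nat gstruct set \<Rightarrow> 'a gstruct \<Rightarrow> ('a set \<Rightarrow> 'a set) gstruct" where
  "completion C G =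
     \<lparr>carrier = completion_carrier C G,
      mult = (\<lambda>f g. \<lambda>N \<in> completion_index C G. f N <#>\<^bsub>G\<^esub> g N),
      one = (\<lambda>N \<in> completion_index C G. N),
      topo = subtopology
        (product_topology (\<lambda>N. topo (gamma_quotient G N)) (completion_index C G))
        (completion_carrier C G),
      act = (\<lambda>f. \<lambda>N \<in> completion_index C G. act G ` f N)\<rparr>"

definition completion_map :: "nat gstruct set \<Rightarrow> 'a gstruct \<Rightarrow> 'a \<Rightarrow> ('a set \<Rightarrow> 'a set)" where
  "completion_map C G g = (\<lambda>N \<in> completion_index C G. N #>\<^bsub>G\<^esub> g)"


section \<open>Free groups\<close>

text \<open>
  The free group on \<open>X\<close> consists of the classes of words in the letters \<open>x\<^sup>\<plusminus>\<close>, encoded as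
  \<open>(x, True)\<close> and \<open>(x, False)\<close>, modulo cancellation.
\<close>

inductive word_eq :: "('x \<times> bool) list \<Rightarrow> ('x \<times> bool) list \<Rightarrow> bool" where
  refl: "word_eq v v"
| sym: "word_eq v w \<Longrightarrow> word_eq w v"
| trans: "word_eq u v \<Longrightarrow> word_eq v w \<Longrightarrow> word_eq u w"
| cancel: "word_eq (v @ [(x, b), (x, \<not> b)] @ w) (v @ w)"

definition word_rel :: "'x set \<Rightarrow> (('x \<times> bool) list \<times> ('x \<times> bool) list) set" where
  "word_rel X = {(v, w). v \<in> lists (X \<times> UNIV) \<and> w \<in> lists (X \<times> UNIV) \<and> word_eq v w}"

text \<open>
  The discrete free group on \<open>X\<close>, with \<open>\<sigma>\<close> acting through an involution \<open>s\<close> of \<open>X\<close>.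
\<close>

definition free_gamma_group :: "'x set \<Rightarrow> ('x \<Rightarrow> 'x) \<Rightarrow> ('x \<times> bool) list set gstruct" where
  "free_gamma_group X s =
     \<lparr>carrier = lists (X \<times> UNIV) // word_rel X,
      mult = (\<lambda>A B. word_rel X `` {a @ b | a b. a \<in> A \<and> b \<in> B}),
      one = word_rel X `` {[]},
      topo = discrete_topology (lists (X \<times> UNIV) // word_rel X),
      act = image (map (apfst s))\<rparr>"

definition free_gen :: "'x set \<Rightarrow> 'x \<Rightarrow> ('x \<times> bool) list set" where
  "free_gen X x = word_rel X `` {[(x, True)]}"


section \<open>The groups \<open>\<F>\<^sub>n\<close>\<close>

text \<open>
  The index set \<open>\<Gamma>\<close> of the generators \<open>x\<^bsub>i,\<gamma>\<^esub>\<close> is \<^typ>\<open>bool\<close>, with \<open>False\<close> for the identity and \<open>True\<close>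
  for \<open>\<sigma>\<close>, so that \<open>\<sigma>\<close> acts on it by translation as negation.
\<close>

definition gen_index :: "nat \<Rightarrow> (nat \<times> bool) set" where
  "gen_index n = {1..n} \<times> UNIV"

type_synonym fr_elem =
  "((nat \<times> bool) \<times> bool) list set set \<Rightarrow> ((nat \<times> bool) \<times> bool) list set set"

abbreviation free_discrete :: "nat \<Rightarrow> ((nat \<times> bool) \<times> bool) list set gstruct" where
  "free_discrete n \<equiv> free_gamma_group (gen_index n) (map_prod id Not)"

text \<open>
  The \<open>\<Gamma>\<close>-stable normal subgroups of odd index are cofinal among all normal subgroups of odd index
  (intersect \<open>N\<close> with \<open>\<sigma>(N)\<close>), so this is the free pro-odd group.
\<close>

definition free_pro_odd :: "nat \<Rightarrow> fr_elem gstruct" where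
  "free_pro_odd n = completion odd_gamma_groups (free_discrete n)"

definition x_gen :: "nat \<Rightarrow> nat \<Rightarrow> fr_elem" where
  "x_gen n i = completion_map odd_gamma_groups (free_discrete n)
     (free_gen (gen_index n) (i, False))"

definition \<F> :: "nat \<Rightarrow> fr_elem gstruct" where
  "\<F> n = gamma_restrict (free_pro_odd n)
     (closed_gamma_gen (free_pro_odd n) ((\<lambda>i. Y (free_pro_odd n) (x_gen n i)) ` {1..n}))"


section \<open>The space \<open>\<P>\<close> of isomorphism classes\<close>

definition pro_odd :: "'a gstruct \<Rightarrow> bool" where
  "pro_odd G \<longleftrightarrow> gamma_group G \<and> compact_space (topo G) \<and> Hausdorff_space (topo G) \<and>
     (\<forall>A. connectedin (topo G) A \<longrightarrow> (\<exists>a. A \<subseteq> {a})) \<and>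
     (\<forall>N. N \<lhd> G \<and> openin (topo G) N \<longrightarrow> odd (card (rcosets\<^bsub>G\<^esub> N)))"

definition admissible :: "'a gstruct \<Rightarrow> bool" where
  "admissible G \<longleftrightarrow> pro_odd G \<and> closed_gamma_gen G (Y G ` carrier G) = carrier G"

definition finite_class :: "nat gstruct set \<Rightarrow> bool" where
  "finite_class D \<longleftrightarrow> finite D \<and> (\<forall>G \<in> D. finite_gamma_group G)"

definition in_P :: "'a gstruct \<Rightarrow> bool" where
  "in_P G \<longleftrightarrow> admissible G \<and> (\<forall>D. finite_class D \<longrightarrow> finite (carrier (completion D G)))"

text \<open>
  A group satisfying \<^const>\<open>in_P\<close> embeds into the product of its completions at the countably many
  finite sets of finite \<open>\<Gamma>\<close>-groups (up to isomorphism), all of which are finite.  Hence it has at most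
  continuum many elements and an isomorphic copy with carrier in \<^typ>\<open>nat set\<close>; isomorphism classes
  are formed among structures on that type.
\<close>

type_synonym gclass = "nat set gstruct set"

definition iso_class :: "'a gstruct \<Rightarrow> gclass" where
  "iso_class G = {K. gamma_group K \<and> K \<cong>\<^sub>\<Gamma> G}"

definition \<P> :: "gclass set" where
  "\<P> = {iso_class G | G :: nat set gstruct. in_P G}"

definition V :: "nat gstruct set \<Rightarrow> 'h gstruct \<Rightarrow> gclass set" where
  "V C H = {c \<in> \<P>. \<exists>G \<in> c. completion C G \<cong>\<^sub>\<Gamma> H}"

definition basic_opens :: "gclass set set" where
  "basic_opens = {V D H' | D (H' :: nat gstruct). finite_class D \<and> finite_gamma_group H'}"

definition P_topology :: "gclass topology" where
  "P_topology = topology_generated_by basic_opens"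

definition basic_algebra :: "gclass set set" where
  "basic_algebra = algebra \<P> hull basic_opens"


section \<open>Haar measure, the random groups and their limit measure\<close>

definition haar_prob :: "'a gstruct \<Rightarrow> 'a measure \<Rightarrow> bool" where
  "haar_prob G \<nu> \<longleftrightarrow> prob_space \<nu> \<and> space \<nu> = carrier G \<and>
     sets \<nu> = sigma_sets (carrier G) {U. openin (topo G) U} \<and>
     (\<forall>g \<in> carrier G. \<forall>A \<in> sets \<nu>. emeasure \<nu> (g <#\<^bsub>G\<^esub> A) = emeasure \<nu> A)"

text \<open>
  \<open>Prob(X\<^bsub>u,n\<^esub> \<in> U)\<close>, where \<open>\<nu>\<close> is the Haar measure of \<open>\<F> n\<close>.  For \<open>n + u < 0\<close> the value is
  meaningless; only the limit in \<open>n\<close> is used.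
\<close>

definition prob_X :: "fr_elem measure \<Rightarrow> int \<Rightarrow> nat \<Rightarrow> gclass set \<Rightarrow> real" where
  "prob_X \<nu> u n U =
     (let I = {..<nat (int n + u)}; M = (\<Pi>\<^sub>M i\<in>I. \<nu>)
      in measure M {s \<in> space M. iso_class (Y_quotient (\<F> n) (s ` I)) \<in> U})"

text \<open>
  The defining property of \<open>\<mu>\<^sub>u\<close>; as \<^const>\<open>basic_algebra\<close> is closed under intersections and
  generates the Borel sets, at most one measure has it.
\<close>

definition is_mu :: "(nat \<Rightarrow> fr_elem measure) \<Rightarrow> int \<Rightarrow> gclass measure \<Rightarrow> bool" where
  "is_mu \<nu> u \<mu> \<longleftrightarrow> prob_space \<mu> \<and> space \<mu> = \<P> \<and>
     sets \<mu> = sigma_sets \<P> {U. openin P_topology U} \<and>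
     (\<forall>U \<in> basic_algebra. (\<lambda>n. prob_X (\<nu> n) u n U) \<longlonglongrightarrow> measure \<mu> U)"


section \<open>Generator rank and relation rank\<close>

definition gen_rank :: "'a gstruct \<Rightarrow> nat" where
  "gen_rank H = (LEAST k. \<exists>A \<subseteq> carrier H. finite A \<and> card A = k \<and> generate H A = carrier H)"

text \<open>
  With the trivial action, the completion at the \<open>p\<close>-\<open>\<Gamma>\<close>-groups is the ordinary pro-\<open>p\<close> completion.
\<close>

definition free_pro_p ::
    "nat \<Rightarrow> nat \<Rightarrow> ((nat \<times> bool) list set set \<Rightarrow> (nat \<times> bool) list set set) gstruct" where
  "free_pro_p p d = completion (p_gamma_groups p) (free_gamma_group {..<d} id)"

text \<open>
  \<open>N\<^sup>p[N,F]\<close> as a closed subgroup; it is used only for trivial actions, where all subgroups are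
  \<open>\<Gamma>\<close>-subgroups.
\<close>

definition p_commutator :: "nat \<Rightarrow> 'a gstruct \<Rightarrow> 'a set \<Rightarrow> 'a set" where
  "p_commutator p F N = closed_gamma_gen F
     ({n [^]\<^bsub>F\<^esub> p | n. n \<in> N} \<union>
      {n \<otimes>\<^bsub>F\<^esub> f \<otimes>\<^bsub>F\<^esub> inv\<^bsub>F\<^esub> n \<otimes>\<^bsub>F\<^esub> inv\<^bsub>F\<^esub> f | n f. n \<in> N \<and> f \<in> carrier F})"

text \<open>
  \<open>W\<close>, an abelian group of exponent dividing \<open>p\<close>, has an \<open>\<F>\<^sub>p\<close>-basis with \<open>r\<close> elements; the scalars
  are represented by \<open>0, \<dots>, p - 1\<close>.
\<close>

definition has_Fp_dim :: "nat \<Rightarrow> ('a, 'b) monoid_scheme \<Rightarrow> nat \<Rightarrow> bool" where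
  "has_Fp_dim p W r \<longleftrightarrow> (\<exists>B \<subseteq> carrier W. finite B \<and> card B = r \<and>
     bij_betw (\<lambda>c. finprod W (\<lambda>b. b [^]\<^bsub>W\<^esub> (c b :: nat)) B) (B \<rightarrow>\<^sub>E {..<p}) (carrier W))"

text \<open>The value does not depend on the presentation \<open>\<phi>\<close>.\<close>

definition relation_rank :: "nat \<Rightarrow> 'a gstruct \<Rightarrow> nat" where
  "relation_rank p H = (SOME r. \<exists>\<phi>. let F = free_pro_p p (gen_rank H); N = kernel F H \<phi> in
     \<phi> \<in> hom F H \<and> \<phi> ` carrier F = carrier H \<and> continuous_map (topo F) (topo H) \<phi> \<and>
     has_Fp_dim p ((F\<lparr>carrier := N\<rparr>) Mod p_commutator p F N) r)"


section \<open>Groups of the form \<open>\<F>\<^sub>n\<^sup>C/[Y(S)]\<close>\<close>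

definition presentable :: "nat gstruct set \<Rightarrow> int \<Rightarrow> 'h gstruct \<Rightarrow> bool" where
  "presentable C u H \<longleftrightarrow> (\<exists>n S. S \<subseteq> carrier (completion C (\<F> n)) \<and> finite S \<and>
     int (card S) = int n + u \<and> H \<cong>\<^sub>\<Gamma> Y_quotient (completion C (\<F> n)) S)"

end

theory Submission
  imports Defs "HOL-Algebra.Multiplicative_Group" "HOL-Algebra.Group_Action" "HOL-Number_Theory.Cong"
begin

text \<open>
  Write \<open>F = \<F>\<^sub>n\<close> and \<open>y\<^sub>i = Y(x\<^sub>i)\<close>.  As \<open>p\<close> is odd, every element of a finite \<open>p\<close>-\<open>\<Gamma>\<close>-group inverted by \<open>\<sigma>\<close>
  is of the form \<open>Y(g)\<close>, so continuous equivariant maps from \<open>F\<close> to a finite \<open>p\<close>-\<open>\<Gamma>\<close>-group are given by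
  arbitrary \<open>\<sigma>\<close>-inverted values of the \<open>y\<^sub>i\<close>.  The pro-\<open>p\<close> completion of \<open>F/[Y(S)]\<close> is \<open>H\<close> iff the kernel \<open>N\<close> of
  some surjection \<open>F \<rightarrow> H\<close> is the least \<open>\<Gamma>\<close>-stable open normal subgroup of \<open>p\<close>-power index containing \<open>Y(S)\<close>;
  by refinement to chief factors this means that \<open>Y(S) \<subseteq> N\<close> and that no nontrivial \<open>F\<close>-invariant character
  of \<open>N\<close> of order \<open>p\<close> on which \<open>\<sigma>\<close> acts by a sign kills \<open>Y(S)\<close>.

  If a nontrivial character is fixed by \<open>\<sigma>\<close>, then \<open>H\<close> has a central extension \<open>E\<close> with nontrivial
  \<open>\<sigma>\<close>-fixed kernel and generated by \<open>Y(E)\<close>, and \<open>H\<close> is not presentable: a value of \<open>Y\<close> in that kernel is both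
  fixed and inverted, hence trivial.  Otherwise \<open>\<sigma>\<close> inverts all the characters, the values of a basis
  \<open>\<chi>\<^sub>1, \<dots>, \<chi>\<^sub>m\<close> of them at \<open>Y(s)\<close> are uniform given \<open>Y(s) \<in> N\<close> (translating \<open>s\<close> by \<open>a \<in> N\<close> multiplies
  \<open>\<chi>(Y(s))\<close> by \<open>\<chi>(a)\<^sup>-\<^sup>2\<close>), and generation means that an \<open>m \<times> (n + u)\<close> matrix over the
  field with \<open>p\<close> elements has rank \<open>m\<close>.
  Counting the maps \<open>F \<rightarrow> \<int>/p\<close> whose coboundary is inflated from \<open>H\<close> in two ways gives \<open>m = r(H) + n - d(H)\<close>,
  and the number of kernels \<open>N\<close> is asymptotically \<open>|Y(H)|\<^sup>n / |Aut\<^sub>\<Gamma>(H)|\<close>.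
\<close>

section \<open>Groups with an involution\<close>

text \<open>The random group is a quotient of \<open>\<F> n\<close> itself, while
  \<open>presentable\<close> concerns a quotient of its pro-p completion. Both are translated into
  one condition on \<open>S\<close> inside \<open>\<F> n\<close>, \<open>generates_kernel\<close>,
  which speaks only of normal subgroups of p-power index. The set \<open>V\<close> refers to all
  finite p-\<open>\<Gamma>\<close>-groups, but limits are prescribed only for sets built from finite
  classes; for \<open>H\<close> of order p^h it is still basic open, because a wrong completion
  shows up in quotients of order at most p^(h+1). The constants arise as follows. The number of
  2-cocycles of \<open>H\<close> does not involve the free group, so comparing ranks n and d(H)
  gives m. An m x (n+u) matrix has rank m with probability the product over i < m of 1 - p^(i-n-u);
  read backwards, its exponents start at n+u-m+1 = 1+u+d(H)-r(H), free of n. All n+u values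
  \<open>Y(s)\<close> lie in a given kernel with probability |Y(H)|^(-n-u), and the number of
  kernels cancels |Y(H)|^n.\<close>

text \<open>Only translations and the involution are required to be open: this is what completions are easily seen to
  satisfy, and joint continuity is never needed.\<close>

locale tg = group G for G :: "'a gstruct" (structure) +
  assumes topspace_eq: "topspace (topo G) = carrier G"
    and ltrans_open: "\<lbrakk>a \<in> carrier G; openin (topo G) U\<rbrakk> \<Longrightarrow> openin (topo G) (l_coset G a U)"
    and rtrans_open: "\<lbrakk>a \<in> carrier G; openin (topo G) U\<rbrakk> \<Longrightarrow> openin (topo G) (U #> a)"
    and act_hom: "act G \<in> hom G G"
    and act_open: "openin (topo G) U \<Longrightarrow> openin (topo G) (act G ` U)"
    and act_act: "x \<in> carrier G \<Longrightarrow> act G (act G x) = x"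

lemma group_hom_iff: "group_hom G H h \<longleftrightarrow> group G \<and> group H \<and> h \<in> hom G H"
  by (auto simp: group_hom_def group_hom_axioms_def)

text \<open>Freezing one argument of the jointly continuous product gives continuous translations.
  The image of an open set under a translation is its preimage under the inverse translation, and
  the involution is its own inverse.\<close>

lemma gamma_group_tg:
  fixes G :: "'a gstruct" (structure)
  assumes "gamma_group G" shows "tg G"
proof -
  interpret gamma_group G by fact
  have sub: "U \<subseteq> carrier G" if "openin (topo G) U" for U
    using openin_subset[OF that] topspace_topo by simp
  show ?thesis
  proof
    fix a U assume a: "a \<in> carrier G" and U: "openin (topo G) U"
    have "continuous_map (topo G) (topo G) (\<lambda>x. case (inv a, x) of (x, y) \<Rightarrow> x \<otimes> y)"
      using continuous_map_compose[OF _ continuous_mult, of "topo G" "\<lambda>x. (inv a, x)"]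
        continuous_map_pairedI[of "topo G" "topo G" "\<lambda>x. inv a" "topo G" "\<lambda>x. x"]
        a topspace_topo by (simp add: o_def)
    hence "openin (topo G) {x \<in> topspace (topo G). inv a \<otimes> x \<in> U}"
      using openin_continuous_map_preimage[OF _ U] by simp
    moreover have "{x \<in> topspace (topo G). inv a \<otimes> x \<in> U} = l_coset G a U"
      using a sub[OF U] unfolding topspace_topo l_coset_def
      by (auto simp: m_assoc[symmetric]) (metis inv_closed inv_solve_left subsetD)?
    ultimately show "openin (topo G) (l_coset G a U)" by simp
    have "continuous_map (topo G) (topo G) (\<lambda>x. case (x, inv a) of (x, y) \<Rightarrow> x \<otimes> y)"
      using continuous_map_compose[OF _ continuous_mult, of "topo G" "\<lambda>x. (x, inv a)"]
        continuous_map_pairedI[of "topo G" "topo G" "\<lambda>x. x" "topo G" "\<lambda>x. inv a"]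
        a topspace_topo by (simp add: o_def)
    hence "openin (topo G) {x \<in> topspace (topo G). x \<otimes> inv a \<in> U}"
      using openin_continuous_map_preimage[OF _ U] by simp
    moreover have "{x \<in> topspace (topo G). x \<otimes> inv a \<in> U} = U #> a"
      using a sub[OF U] unfolding topspace_topo r_coset_def
      by (auto simp: m_assoc subset_iff) (metis inv_closed inv_solve_right)?
    ultimately show "openin (topo G) (U #> a)" by simp
  next
    fix U assume U: "openin (topo G) U"
    have "openin (topo G) {x \<in> topspace (topo G). act G x \<in> U}"
      using openin_continuous_map_preimage[OF continuous_act U] by simp
    moreover have "{x \<in> topspace (topo G). act G x \<in> U} = act G ` U"
      using sub[OF U] act_act act_hom unfolding topspace_topo hom_def
      by (auto simp: image_iff subset_iff) (metis)
    ultimately show "openin (topo G) (act G ` U)" by simp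
  qed (use topspace_topo act_hom act_act in auto)
qed

text \<open>Continuity is encoded by an open kernel. For a finite discrete target the two amount to
  the same, and this form makes no mention of a topology on \<open>A\<close>.\<close>

definition ghom :: "'a gstruct \<Rightarrow> 'b gstruct \<Rightarrow> ('a \<Rightarrow> 'b) set" where
  "ghom G A = {\<phi> \<in> hom G A. openin (topo G) (kernel G A \<phi>) \<and>
     (\<forall>x \<in> carrier G. \<phi> (act G x) = act A (\<phi> x))}"

definition gsurj :: "'a gstruct \<Rightarrow> 'b gstruct \<Rightarrow> ('a \<Rightarrow> 'b) set" where
  "gsurj G A = {\<phi> \<in> ghom G A. \<phi> ` carrier G = carrier A}"

lemma finite_gammaD:
  assumes "finite_gamma_group A"
  shows "group A" "finite (carrier A)" "topo A = discrete_topology (carrier A)"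
    "act A \<in> hom A A" "\<And>x. x \<in> carrier A \<Longrightarrow> act A (act A x) = x" "tg A"
    "\<And>x. x \<in> carrier A \<Longrightarrow> act A x \<in> carrier A"
  using assms gamma_group_tg[of A]
  by (auto simp: finite_gamma_group_def gamma_group_def gamma_group_axioms_def hom_def)

lemma finite_gammaI:
  assumes "group A" "finite (carrier A)" "topo A = discrete_topology (carrier A)"
    "act A \<in> hom A A" "\<And>x. x \<in> carrier A \<Longrightarrow> act A (act A x) = x"
  shows "finite_gamma_group A"
proof -
  interpret group A by fact
  have "act A x \<in> carrier A" if "x \<in> carrier A" for x using assms(4) that by (auto simp: hom_def)
  thus ?thesis using assms
    unfolding finite_gamma_group_def gamma_group_def gamma_group_axioms_def
    by (auto simp flip: prod_topology_discrete_topology)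
qed

context tg begin

lemma act_closed[simp]: "x \<in> carrier G \<Longrightarrow> act G x \<in> carrier G"
  using act_hom by (auto simp: hom_def)

lemma act_mult: "\<lbrakk>x \<in> carrier G; y \<in> carrier G\<rbrakk> \<Longrightarrow> act G (x \<otimes> y) = act G x \<otimes> act G y"
  using act_hom by (auto simp: hom_def)

lemma act_one[simp]: "act G \<one> = \<one>"
  using hom_one[OF act_hom is_group is_group] .

lemma act_inv: "x \<in> carrier G \<Longrightarrow> act G (inv x) = inv (act G x)"
  using act_mult[of x "inv x"] by (metis act_closed act_one inv_closed inv_equality r_inv act_mult l_inv)

lemma Y_closed[simp]: "x \<in> carrier G \<Longrightarrow> Y G x \<in> carrier G"
  by (simp add: Y_def)

lemma act_Y: "x \<in> carrier G \<Longrightarrow> act G (Y G x) = inv (Y G x)"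
  by (simp add: Y_def act_mult act_act act_inv inv_mult_group)

lemma open_sub: "openin (topo G) U \<Longrightarrow> U \<subseteq> carrier G"
  using openin_subset topspace_eq by metis

lemma gamma_subgroup_image_eq:
  "gamma_subgroup G N \<Longrightarrow> act G ` N = N"
  unfolding gamma_subgroup_def
  by (auto simp: subset_iff image_iff) (metis act_act subgroup.mem_carrier)

text \<open>The subgroup is a union of left translates of \<open>L\<close>. This is how equalisers
  and kernels of derived maps are shown to be open: it suffices to find an open neighbourhood of the
  identity inside them.\<close>

lemma open_superset:
  assumes "subgroup K G" "openin (topo G) L" "\<one> \<in> L" "L \<subseteq> K"
  shows "openin (topo G) K"
proof -
  interpret K: subgroup K G by fact
  have "K = (\<Union>k\<in>K. l_coset G k L)"
    using assms(3,4) by (force simp: l_coset_def)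
  moreover have "openin (topo G) (\<Union>k\<in>K. l_coset G k L)"
    using ltrans_open assms(2) by (auto intro!: openin_Union)
  ultimately show ?thesis by simp
qed

lemma open_rcosets_union:
  assumes "openin (topo G) N" "U \<subseteq> rcosets N"
  shows "openin (topo G) (\<Union>U)"
  using assms rtrans_open by (intro openin_Union) (auto simp: RCOSETS_def)

lemma open_subgroup_closed:
  assumes "subgroup N G" "openin (topo G) N"
  shows "closedin (topo G) N"
proof -
  interpret N: subgroup N G by fact
  have "carrier G - N = (\<Union>x\<in>carrier G - N. N #> x)"
  proof (intro equalityI subsetI)
    fix y assume "y \<in> (\<Union>x\<in>carrier G - N. N #> x)"
    then obtain x n where x: "x \<in> carrier G" "x \<notin> N" "n \<in> N" "y = n \<otimes> x" by (auto simp: r_coset_def)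
    have "x \<in> N" if "n \<otimes> x \<in> N"
    proof -
      have "inv n \<otimes> (n \<otimes> x) \<in> N" using x that by blast
      moreover have "inv n \<otimes> (n \<otimes> x) = x" using x by (simp add: m_assoc[symmetric])
      ultimately show ?thesis by simp
    qed
    thus "y \<in> carrier G - N" using x by auto
  qed (use rcos_self[OF _ N.is_subgroup] in blast)
  moreover have "openin (topo G) (\<Union>x\<in>carrier G - N. N #> x)"
    using assms(2) rtrans_open by (auto intro!: openin_Union)
  ultimately show ?thesis using N.subset topspace_eq by (simp add: closedin_def)
qed

lemma fibre_open:
  assumes "\<phi> \<in> hom G A" "group A" "openin (topo G) (kernel G A \<phi>)"
  shows "openin (topo G) {x \<in> carrier G. \<phi> x \<in> B}"
proof -
  interpret group_hom G A \<phi> using assms by (simp add: group_hom_iff)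
  have "{x \<in> carrier G. \<phi> x \<in> B} = (\<Union>x\<in>{x \<in> carrier G. \<phi> x \<in> B}. kernel G A \<phi> #> x)"
    by (force simp: r_coset_def kernel_def)
  moreover have "openin (topo G) \<dots>"
    using assms(3) rtrans_open by (auto intro!: openin_Union)
  ultimately show ?thesis by simp
qed

lemma ghom_kernel:
  assumes "\<phi> \<in> ghom G A" "tg A"
  shows "kernel G A \<phi> \<lhd> G" "gamma_subgroup G (kernel G A \<phi>)" "openin (topo G) (kernel G A \<phi>)"
    "closedin (topo G) (kernel G A \<phi>)" "group_hom G A \<phi>"
proof -
  interpret A: tg A by fact
  interpret group_hom G A \<phi> using assms by (auto simp: group_hom_iff ghom_def)
  show 1: "kernel G A \<phi> \<lhd> G" by (rule normal_kernel)
  show "gamma_subgroup G (kernel G A \<phi>)"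
    using assms(1) subgroup_kernel by (auto simp: gamma_subgroup_def ghom_def kernel_def)
  show 3: "openin (topo G) (kernel G A \<phi>)" using assms by (simp add: ghom_def)
  show "closedin (topo G) (kernel G A \<phi>)" by (rule open_subgroup_closed[OF subgroup_kernel 3])
  show "group_hom G A \<phi>" ..
qed

lemma coset_eq_iff:
  assumes "N \<lhd> G" "x \<in> carrier G" "y \<in> carrier G"
  shows "N #> x = N #> y \<longleftrightarrow> x \<otimes> inv y \<in> N"
proof -
  interpret normal N G by fact
  show ?thesis
    using assms repr_independence[OF _ _ is_subgroup] rcos_self[OF assms(2) is_subgroup]
      rcos_module[OF is_group, of y x] by blast
qed

end

section \<open>Quotients and isomorphisms\<close>

lemma extend_simps[simp]:
  "carrier (monoid.extend M (gstruct.fields t a)) = carrier M"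
  "mult (monoid.extend M (gstruct.fields t a)) = mult M"
  "one (monoid.extend M (gstruct.fields t a)) = one M"
  "topo (monoid.extend M (gstruct.fields t a)) = t"
  "act (monoid.extend M (gstruct.fields t a)) = a"
  by (simp_all add: monoid.defs gstruct.defs)

lemma gamma_quotient_simps[simp]:
  "carrier (gamma_quotient G N) = rcosets\<^bsub>G\<^esub> N"
  "mult (gamma_quotient G N) = set_mult G"
  "one (gamma_quotient G N) = N"
  "act (gamma_quotient G N) = image (act G)"
  by (simp_all add: gamma_quotient_def FactGroup_def)

lemma group_cong_gamma:
  assumes "carrier A = carrier B" "mult A = mult B" "one A = one B"
  shows "group A \<longleftrightarrow> group B" "hom A K = hom B K" "hom K A = hom K B" "kernel A K = kernel B K"
    "iso A K = iso B K" "iso K A = iso K B"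
  using assms unfolding group_def group_axioms_def monoid_def hom_def kernel_def Units_def iso_def
  by (simp_all add: fun_eq_iff)

text \<open>The constant \<open>topology\<close> returns the intended open sets only for a predicate
  satisfying \<open>istopology\<close>. The point to check is intersections: distinct cosets are
  disjoint, so \<open>\<Union>(S \<inter> T) = \<Union>S \<inter> \<Union>T\<close>.\<close>

lemma (in tg) openin_gamma_quotient:
  assumes "N \<lhd> G"
  shows "openin (topo (gamma_quotient G N)) U \<longleftrightarrow> U \<subseteq> rcosets N \<and> openin (topo G) (\<Union>U)"
proof -
  interpret normal N G by fact
  have "istopology (\<lambda>U. U \<subseteq> rcosets N \<and> openin (topo G) (\<Union>U))"
    unfolding istopology_def
  proof (intro conjI allI impI)
    fix S T assume "S \<subseteq> rcosets N \<and> openin (topo G) (\<Union>S)" "T \<subseteq> rcosets N \<and> openin (topo G) (\<Union>T)"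
    hence S: "S \<subseteq> rcosets N" "T \<subseteq> rcosets N" "openin (topo G) (\<Union>S)" "openin (topo G) (\<Union>T)" by auto
    have "\<Union>(S \<inter> T) = \<Union>S \<inter> \<Union>T"
    proof -
      have "A = B" if "A \<in> rcosets N" "B \<in> rcosets N" "z \<in> A" "z \<in> B" for A B z
        using rcos_disjoint[OF is_subgroup] that by (auto simp: pairwise_def disjnt_iff)
      hence "z \<in> \<Union>(S \<inter> T)" if "z \<in> A" "A \<in> S" "z \<in> B" "B \<in> T" for z A B
        using S(1,2) that by blast
      thus ?thesis by blast
    qed
    thus "S \<inter> T \<subseteq> rcosets N" "openin (topo G) (\<Union>(S \<inter> T))" using S by auto
  next
    fix K assume "\<forall>S\<in>K. S \<subseteq> rcosets N \<and> openin (topo G) (\<Union>S)"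
    moreover have "\<Union>(\<Union>K) = (\<Union>S\<in>K. \<Union>S)" by auto
    ultimately show "\<Union>K \<subseteq> rcosets N" "openin (topo G) (\<Union>(\<Union>K))" by auto
  qed
  thus ?thesis by (simp add: gamma_quotient_def)
qed

lemma homeo_discrete:
  assumes "bij_betw h S T"
  shows "homeomorphic_map (discrete_topology S) (discrete_topology T) h"
  using assms by (intro bijective_open_imp_homeomorphic_map) (auto simp: bij_betw_def open_map_def)

lemma (in tg) quotient_discrete:
  assumes "N \<lhd> G" "openin (topo G) N"
  shows "topo (gamma_quotient G N) = discrete_topology (rcosets N)"
  unfolding topology_eq using openin_gamma_quotient[OF assms(1)] open_rcosets_union[OF assms(2)] by auto

text \<open>The first isomorphism theorem, made equivariant and topological. The kernel is open, so
  both sides are discrete and the bijection is automatically a homeomorphism.\<close>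

lemma (in tg) quotient_iso:
  assumes "\<phi> \<in> gsurj G A" "group A" "topo A = discrete_topology (carrier A)" "tg A"
  shows "gamma_quotient G (kernel G A \<phi>) \<cong>\<^sub>\<Gamma> A"
proof -
  let ?N = "kernel G A \<phi>" and ?h = "\<lambda>X. the_elem (\<phi> ` X)"
  have gh: "\<phi> \<in> ghom G A" using assms by (simp add: gsurj_def)
  note k = ghom_kernel[OF gh assms(4)]
  interpret A: tg A by fact
  interpret \<phi>: group_hom G A \<phi> by (rule k(5))
  have iso: "?h \<in> iso (G Mod ?N) A"
    using \<phi>.FactGroup_iso_set assms(1) by (auto simp: gsurj_def)
  have iso': "?h \<in> iso (gamma_quotient G ?N) A"
    using iso group_cong_gamma(5)[of "gamma_quotient G ?N" "G Mod ?N" A] by (simp add: FactGroup_def)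
  have hx: "?h (?N #> x) = \<phi> x" if "x \<in> carrier G" for x
  proof -
    have "\<phi> ` (?N #> x) = {\<phi> x}" using that by (force simp: r_coset_def kernel_def)
    thus ?thesis by simp
  qed
  have ax: "act G ` (?N #> x) = ?N #> act G x" if "x \<in> carrier G" for x
  proof -
    have "act G ` ?N = ?N" using gamma_subgroup_image_eq k(2) by blast
    have "act G ` (?N #> x) = act G ` ?N #> act G x"
      using that by (force simp: r_coset_def kernel_def act_mult image_iff)
    thus ?thesis using \<open>act G ` ?N = ?N\<close> by simp
  qed
  have "homeomorphic_map (topo (gamma_quotient G ?N)) (topo A) ?h"
    unfolding quotient_discrete[OF k(1,3)] assms(3)
    by (rule homeo_discrete) (use iso' in \<open>auto simp: iso_def\<close>)
  moreover have "?h (act (gamma_quotient G ?N) X) = act A (?h X)" if "X \<in> carrier (gamma_quotient G ?N)" for X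
  proof -
    from that obtain x where x: "x \<in> carrier G" "X = ?N #> x"
      unfolding gamma_quotient_simps RCOSETS_def by blast
    have "act A (\<phi> x) = \<phi> (act G x)" using gh x by (simp add: ghom_def)
    thus ?thesis by (simp only: x(2) gamma_quotient_simps ax[OF x(1)] hx[OF x(1)] hx[OF act_closed[OF x(1)]])
  qed
  ultimately show ?thesis using iso' unfolding gamma_iso_def by blast
qed

lemma (in tg) act_coset:
  assumes "gamma_subgroup G N" "x \<in> carrier G"
  shows "act G ` (N #> x) = N #> act G x"
proof -
  have "N \<subseteq> carrier G" using assms by (auto simp: gamma_subgroup_def dest: subgroup.subset)
  have "act G ` (N #> x) = act G ` N #> act G x"
    using assms(2) \<open>N \<subseteq> carrier G\<close> by (force simp: r_coset_def act_mult image_iff subset_iff)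
  thus ?thesis using gamma_subgroup_image_eq[OF assms(1)] by simp
qed

lemma (in tg) quotient_tg:
  assumes N: "N \<lhd> G" "gamma_subgroup G N"
  shows "group (gamma_quotient G N)" "act (gamma_quotient G N) \<in> hom (gamma_quotient G N) (gamma_quotient G N)"
    "\<And>X. X \<in> rcosets N \<Longrightarrow> act G ` (act G ` X) = X"
    "(\<lambda>x. N #> x) \<in> hom G (gamma_quotient G N)"
    "kernel G (gamma_quotient G N) (\<lambda>x. N #> x) = N"
proof -
  interpret normal N G by fact
  show g: "group (gamma_quotient G N)"
    using factorgroup_is_group group_cong_gamma(1)[of "G Mod N" "gamma_quotient G N"]
    by (simp add: FactGroup_def)
  show "act (gamma_quotient G N) \<in> hom (gamma_quotient G N) (gamma_quotient G N)"
  proof (rule homI)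
    fix X assume "X \<in> carrier (gamma_quotient G N)"
    then obtain x where "x \<in> carrier G" "X = N #> x" by (auto simp: RCOSETS_def)
    thus "act (gamma_quotient G N) X \<in> carrier (gamma_quotient G N)"
      by (simp add: act_coset[OF N(2)] rcosetsI subset)
  next
    fix X Y assume "X \<in> carrier (gamma_quotient G N)" "Y \<in> carrier (gamma_quotient G N)"
    then obtain x y where "x \<in> carrier G" "X = N #> x" "y \<in> carrier G" "Y = N #> y" by (auto simp: RCOSETS_def)
    thus "act (gamma_quotient G N) (X \<otimes>\<^bsub>gamma_quotient G N\<^esub> Y) =
      act (gamma_quotient G N) X \<otimes>\<^bsub>gamma_quotient G N\<^esub> act (gamma_quotient G N) Y"
      by (simp add: act_coset[OF N(2)] rcos_sum act_mult)
  qed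
  show "act G ` (act G ` X) = X" if "X \<in> rcosets N" for X
  proof -
    obtain x where "x \<in> carrier G" "X = N #> x" using \<open>X \<in> rcosets N\<close> by (auto simp: RCOSETS_def)
    thus ?thesis by (simp add: act_coset[OF N(2)] act_act)
  qed
  show "(\<lambda>x. N #> x) \<in> hom G (gamma_quotient G N)"
    by (auto simp: hom_def RCOSETS_def rcos_sum)
  show "kernel G (gamma_quotient G N) (\<lambda>x. N #> x) = N"
    using coset_join1[OF _ _ is_subgroup] coset_join2[OF _ is_subgroup] subset by (auto simp: kernel_def)
qed

lemma (in tg) quotient_finite:
  assumes N: "N \<lhd> G" "gamma_subgroup G N" "openin (topo G) N" "finite (rcosets N)"
  shows "finite_gamma_group (gamma_quotient G N)" "(\<lambda>x. N #> x) \<in> gsurj G (gamma_quotient G N)"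
proof -
  show "finite_gamma_group (gamma_quotient G N)"
    using quotient_tg[OF N(1,2)] N quotient_discrete[OF N(1,3)] by (intro finite_gammaI) auto
  show "(\<lambda>x. N #> x) \<in> gsurj G (gamma_quotient G N)"
    using quotient_tg[OF N(1,2)] N act_coset[OF N(2)]
    by (auto simp: gsurj_def ghom_def RCOSETS_def)
qed

lemma gamma_isoD:
  assumes "A \<cong>\<^sub>\<Gamma> B" obtains h where "h \<in> iso A B" "homeomorphic_map (topo A) (topo B) h"
    "\<And>x. x \<in> carrier A \<Longrightarrow> h (act A x) = act B (h x)" "bij_betw h (carrier A) (carrier B)" "h \<in> hom A B"
  using assms unfolding gamma_iso_def by (auto simp: iso_def)

lemma gamma_iso_trans:
  assumes "A \<cong>\<^sub>\<Gamma> B" "B \<cong>\<^sub>\<Gamma> C" shows "A \<cong>\<^sub>\<Gamma> C"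
proof -
  obtain h where h: "h \<in> iso A B" "homeomorphic_map (topo A) (topo B) h"
    "\<And>x. x \<in> carrier A \<Longrightarrow> h (act A x) = act B (h x)" "bij_betw h (carrier A) (carrier B)"
    using gamma_isoD[OF assms(1)] by metis
  obtain k where k: "k \<in> iso B C" "homeomorphic_map (topo B) (topo C) k"
    "\<And>x. x \<in> carrier B \<Longrightarrow> k (act B x) = act C (k x)"
    using gamma_isoD[OF assms(2)] by metis
  have "k \<circ> h \<in> iso A C" using h k by (auto simp: iso_def bij_betw_trans hom_def Pi_iff bij_betw_apply)
  moreover have "homeomorphic_map (topo A) (topo C) (k \<circ> h)" by (rule homeomorphic_map_compose[OF h(2) k(2)])
  moreover have "\<forall>x\<in>carrier A. (k \<circ> h) (act A x) = act C ((k \<circ> h) x)"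
    using h(3,4) k(3) by (auto simp: bij_betw_def)
  ultimately show ?thesis unfolding gamma_iso_def by blast
qed

lemma gamma_iso_sym:
  assumes "A \<cong>\<^sub>\<Gamma> B" "group A" "\<And>x. x \<in> carrier A \<Longrightarrow> act A x \<in> carrier A"
    "topspace (topo A) = carrier A"
  shows "B \<cong>\<^sub>\<Gamma> A"
proof -
  obtain h where h: "h \<in> iso A B" "homeomorphic_map (topo A) (topo B) h"
    "\<And>x. x \<in> carrier A \<Longrightarrow> h (act A x) = act B (h x)" "bij_betw h (carrier A) (carrier B)"
    using gamma_isoD[OF assms(1)] by metis
  let ?k = "inv_into (carrier A) h"
  interpret group A by fact
  have "?k \<in> iso B A" using iso_set_sym[OF h(1)] .
  moreover have "homeomorphic_map (topo B) (topo A) ?k"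
  proof -
    obtain g where g: "homeomorphic_maps (topo A) (topo B) h g" using h(2) homeomorphic_map_maps by blast
    hence gm: "homeomorphic_map (topo B) (topo A) g"
      using homeomorphic_map_maps homeomorphic_maps_sym by blast
    have "?k y = g y" if "y \<in> topspace (topo B)" for y
    proof -
      have "g y \<in> carrier A" "h (g y) = y"
        using g that assms(4) by (auto simp: homeomorphic_maps_def continuous_map_def)
      thus ?thesis using inv_into_f_eq[of h "carrier A" "g y" y] h(4) by (simp add: bij_betw_def)
    qed
    thus ?thesis using gm homeomorphic_map_eq by metis
  qed
  moreover have "?k (act B y) = act A (?k y)" if "y \<in> carrier B" for y
  proof -
    from that h(4) obtain x where x: "x \<in> carrier A" "y = h x" unfolding bij_betw_def by blast
    have "?k (act B y) = ?k (h (act A x))" using x h(3) by simp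
    also have "\<dots> = act A x" using bij_betw_inv_into_left[OF h(4)] assms(3) x by simp
    also have "\<dots> = act A (?k y)" using bij_betw_inv_into_left[OF h(4)] x by simp
    finally show ?thesis .
  qed
  ultimately show ?thesis unfolding gamma_iso_def by blast
qed

lemma finite_gamma_iso_sym:
  assumes "A \<cong>\<^sub>\<Gamma> B" "finite_gamma_group A" shows "B \<cong>\<^sub>\<Gamma> A"
  by (rule gamma_iso_sym) (use assms finite_gammaD[OF assms(2)] in auto)

lemma (in tg) tg_iso_sym:
  assumes "G \<cong>\<^sub>\<Gamma> B" shows "B \<cong>\<^sub>\<Gamma> G"
  by (rule gamma_iso_sym) (use assms topspace_eq is_group in auto)

text \<open>The trivial coset, as a point of the quotient, is the preimage of the open point
  \<open>\<one>\<close> of the finite discrete group \<open>A\<close>. Hence an abstract isomorphism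
  already forces \<open>N\<close> to be open, and \<open>N\<close> becomes the kernel of a
  surjection onto \<open>A\<close>.\<close>

lemma (in tg) quotient_iso_ghom:
  assumes N: "N \<lhd> G" "gamma_subgroup G N" and i: "gamma_quotient G N \<cong>\<^sub>\<Gamma> A" and A: "finite_gamma_group A"
  shows "\<exists>\<phi> \<in> gsurj G A. kernel G A \<phi> = N" "openin (topo G) N" "finite (rcosets N)" "card (rcosets N) = order A"
proof -
  obtain h where h: "h \<in> iso (gamma_quotient G N) A" "homeomorphic_map (topo (gamma_quotient G N)) (topo A) h"
    "\<And>x. x \<in> carrier (gamma_quotient G N) \<Longrightarrow> h (act (gamma_quotient G N) x) = act A (h x)"
    "bij_betw h (rcosets N) (carrier A)" "h \<in> hom (gamma_quotient G N) A"
    using gamma_isoD[OF i] by (metis gamma_quotient_simps(1))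
  show "finite (rcosets N)" using h(4) finite_gammaD(2)[OF A] bij_betw_finite by blast
  show "card (rcosets N) = order A" using h(4) bij_betw_same_card by (auto simp: order_def)
  interpret N: normal N G by fact
  interpret A: group A using finite_gammaD[OF A] by simp
  interpret Q: group "gamma_quotient G N" using quotient_tg[OF N] by simp
  have NQ: "N \<in> rcosets N" using N.subgroup_in_rcosets[OF is_group] .
  have h1: "h N = \<one>\<^bsub>A\<^esub>" using hom_one[OF h(5) Q.is_group A.is_group] by simp
  let ?\<phi> = "\<lambda>x. h (N #> x)"
  have hom: "?\<phi> \<in> hom G A" using h(5) quotient_tg(4)[OF N] by (auto simp: hom_def RCOSETS_def)
  have rc: "N #> x \<in> rcosets N" if "x \<in> carrier G" for x using that by (auto simp: RCOSETS_def)
  have ker: "kernel G A ?\<phi> = N"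
  proof -
    have "h (N #> x) = \<one>\<^bsub>A\<^esub> \<longleftrightarrow> N #> x = N" if "x \<in> carrier G" for x
      using h(4) h1 NQ rc[OF that] by (metis bij_betw_def inj_on_eq_iff)
    thus ?thesis using quotient_tg(5)[OF N] by (auto simp: kernel_def)
  qed
  have "openin (topo A) {\<one>\<^bsub>A\<^esub>}" using finite_gammaD[OF A] by simp
  hence "openin (topo (gamma_quotient G N)) {X \<in> topspace (topo (gamma_quotient G N)). h X \<in> {\<one>\<^bsub>A\<^esub>}}"
    using homeomorphic_imp_continuous_map[OF h(2)] openin_continuous_map_preimage by blast
  moreover have "topspace (topo (gamma_quotient G N)) \<subseteq> rcosets N"
    using openin_gamma_quotient[OF N(1)] by (metis openin_topspace)
  moreover have "\<exists>X\<in>topspace (topo (gamma_quotient G N)). h X = \<one>\<^bsub>A\<^esub>"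
    using homeomorphic_imp_surjective_map[OF h(2)] finite_gammaD[OF A] A.one_closed
    by (metis (no_types, lifting) imageE topspace_discrete_topology)
  ultimately have "openin (topo (gamma_quotient G N)) {N}"
    using h(4) h1 NQ by (smt (verit) Collect_cong bij_betw_def empty_iff inj_on_eq_iff insert_iff mem_Collect_eq subset_iff singleton_conv)
  thus op: "openin (topo G) N" using openin_gamma_quotient[OF N(1)] by simp
  have "?\<phi> (act G x) = act A (?\<phi> x)" if "x \<in> carrier G" for x
    using h(3)[of "N #> x"] that act_coset[OF N(2)] by (auto simp: RCOSETS_def)
  moreover have "?\<phi> ` carrier G = carrier A" using h(4) by (auto simp: bij_betw_def RCOSETS_def image_iff)
  ultimately have "?\<phi> \<in> gsurj G A" using hom ker op by (auto simp: gsurj_def ghom_def)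
  thus "\<exists>\<phi> \<in> gsurj G A. kernel G A \<phi> = N" using ker by blast
qed


text \<open>All structures, groups or not, on \<open>{..<m}\<close> whose operations are extensional
  functions. There are finitely many of them, yet every finite \<open>\<Gamma>\<close>-group of
  order \<open>m\<close> has a copy among them; this is the source of the finite classes needed for
  basic open sets.\<close>

definition canonical :: "nat \<Rightarrow> nat gstruct set" where
  "canonical m = (\<lambda>(f, e, a). \<lparr>carrier = {..<m}, mult = f, one = e, topo = discrete_topology {..<m}, act = a\<rparr>) `
     (({..<m} \<rightarrow>\<^sub>E ({..<m} \<rightarrow>\<^sub>E {..<m})) \<times> {..<m} \<times> ({..<m} \<rightarrow>\<^sub>E {..<m}))"

lemma finite_canonical: "finite (canonical m)"
  unfolding canonical_def by (intro finite_imageI finite_cartesian_product finite_PiE) auto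

lemma canonical_order: "B \<in> canonical m \<Longrightarrow> order B = m"
  unfolding canonical_def order_def by (elim imageE) (simp add: case_prod_beta)

lemma canonical_copy:
  assumes "finite_gamma_group A"
  shows "\<exists>B \<in> canonical (order A). finite_gamma_group B \<and> A \<cong>\<^sub>\<Gamma> B"
proof -
  note A = finite_gammaD[OF assms]
  interpret A: tg A by (rule A(6))
  let ?m = "order A"
  obtain e where e: "bij_betw e (carrier A) {..<?m}"
    using ex_bij_betw_finite_nat[OF A(2)] by (auto simp: order_def atLeast0LessThan)
  let ?e' = "inv_into (carrier A) e"
  have e': "\<And>x. x < ?m \<Longrightarrow> ?e' x \<in> carrier A" "\<And>x. x < ?m \<Longrightarrow> e (?e' x) = x"
    "\<And>x. x \<in> carrier A \<Longrightarrow> ?e' (e x) = x" "\<And>x. x \<in> carrier A \<Longrightarrow> e x < ?m"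
    using e by (auto simp: bij_betw_def inv_into_into f_inv_into_f)
  define B where "B = \<lparr>carrier = {..<?m}, mult = (\<lambda>x\<in>{..<?m}. \<lambda>y\<in>{..<?m}. e (?e' x \<otimes>\<^bsub>A\<^esub> ?e' y)),
    one = e \<one>\<^bsub>A\<^esub>, topo = discrete_topology {..<?m}, act = (\<lambda>x\<in>{..<?m}. e (act A (?e' x)))\<rparr>"
  have "B \<in> canonical ?m"
    unfolding canonical_def B_def using e' by (intro image_eqI[where x = "(\<lambda>x\<in>{..<?m}. \<lambda>y\<in>{..<?m}. e (?e' x \<otimes>\<^bsub>A\<^esub> ?e' y), e \<one>\<^bsub>A\<^esub>, \<lambda>x\<in>{..<?m}. e (act A (?e' x)))"]) auto
  moreover have iso: "e \<in> iso A B"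
    unfolding iso_def hom_def using e e' by (auto simp: B_def)
  moreover have "group B"
    using A.iso_imp_img_group[OF iso] by (simp add: B_def)
  moreover have "A \<cong>\<^sub>\<Gamma> B"
    unfolding gamma_iso_def
    using iso homeo_discrete[OF e] e' A(3) by (intro bexI[of _ e]) (auto simp: B_def)
  moreover have "act B \<in> hom B B"
    using e' A(4) by (auto simp: B_def hom_def Pi_iff)
  moreover have "act B (act B x) = x" if "x \<in> carrier B" for x
    using that e' A(5,7) by (auto simp: B_def)
  moreover have "finite (carrier B)" "topo B = discrete_topology (carrier B)" by (auto simp: B_def)
  ultimately show ?thesis using finite_gammaI by blast
qed

lemma gamma_iso_order: "A \<cong>\<^sub>\<Gamma> B \<Longrightarrow> order A = order B"
  by (erule gamma_isoD) (simp add: order_def bij_betw_same_card)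

section \<open>Classes of finite groups and their completion indices\<close>

abbreviation p_index :: "nat \<Rightarrow> 'a gstruct \<Rightarrow> 'a set set" where
  "p_index p G \<equiv> completion_index (p_gamma_groups p) G"

definition fin_class :: "(nat \<Rightarrow> bool) \<Rightarrow> nat gstruct set" where
  "fin_class Q = {A. finite_gamma_group A \<and> Q (order A)}"

text \<open>A condition on the order that passes to divisors and to products survives every closure
  rule: orders of subgroups and quotients divide the order by Lagrange, and orders of products
  multiply.\<close>

lemma gamma_closure_fin_class:
  assumes C: "C \<subseteq> fin_class Q" and Q: "Q 1" "\<And>a b. Q b \<Longrightarrow> a dvd b \<Longrightarrow> Q a" "\<And>a b. Q a \<Longrightarrow> Q b \<Longrightarrow> Q (a * b)"
  shows "gamma_closure C \<subseteq> fin_class Q"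
proof
  fix A assume "A \<in> gamma_closure C" thus "A \<in> fin_class Q"
  proof induction
    case (sub G K L)
    interpret group G using sub finite_gammaD by (auto simp: fin_class_def)
    have "subgroup K G" using sub by (simp add: gamma_subgroup_def)
    hence "card K dvd order G" using lagrange by (metis dvd_triv_right)
    moreover have "order L = card K" using gamma_iso_order[OF sub.hyps(4)] by (simp add: gamma_restrict_def order_def)
    ultimately show ?case using sub Q(2) by (auto simp: fin_class_def)
  next
    case (quot G N L)
    interpret group G using quot finite_gammaD by (auto simp: fin_class_def)
    have "subgroup N G" using quot by (simp add: gamma_subgroup_def)
    hence "card (rcosets\<^bsub>G\<^esub> N) dvd order G" using lagrange by (metis dvd_triv_left)
    moreover have "order L = card (rcosets\<^bsub>G\<^esub> N)" using gamma_iso_order[OF quot.hyps(5)] by (simp add: order_def)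
    ultimately show ?case using quot Q(2) by (auto simp: fin_class_def)
  next
    case (prod G K L)
    have "order L = order G * order K" using gamma_iso_order[OF prod.hyps(4)]
      by (simp add: gamma_product_def order_def card_cartesian_product)
    thus ?case using prod Q(3) by (auto simp: fin_class_def)
  qed (use C Q in \<open>auto simp: fin_class_def\<close>)
qed

lemma gamma_closure_finite:
  assumes "\<And>A. A \<in> C \<Longrightarrow> finite_gamma_group A" "A \<in> gamma_closure C"
  shows "finite_gamma_group A"
  using gamma_closure_fin_class[of C "\<lambda>_. True"] assms by (auto simp: fin_class_def)

text \<open>Members of the index become kernels of surjections. Intersecting them, or moving them
  between a group and its quotient, then means pairing, pulling back or descending maps.\<close>

lemma (in tg) completion_index_iff:
  assumes "\<And>A. A \<in> C \<Longrightarrow> finite_gamma_group A"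
  shows "N \<in> completion_index C G \<longleftrightarrow> (\<exists>A \<in> gamma_closure C. \<exists>\<phi> \<in> gsurj G A. kernel G A \<phi> = N)"
proof
  assume N: "N \<in> completion_index C G"
  then obtain A where "A \<in> gamma_closure C" "gamma_quotient G N \<cong>\<^sub>\<Gamma> A" by (auto simp: completion_index_def)
  thus "\<exists>A \<in> gamma_closure C. \<exists>\<phi> \<in> gsurj G A. kernel G A \<phi> = N"
    using quotient_iso_ghom(1)[of N A] N gamma_closure_finite[OF assms] by (auto simp: completion_index_def)
next
  assume "\<exists>A \<in> gamma_closure C. \<exists>\<phi> \<in> gsurj G A. kernel G A \<phi> = N"
  then obtain A \<phi> where A: "A \<in> gamma_closure C" "\<phi> \<in> gsurj G A" "kernel G A \<phi> = N" by blast
  have f: "finite_gamma_group A" using gamma_closure_finite[OF assms A(1)] .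
  note f' = finite_gammaD[OF f]
  have "\<phi> \<in> ghom G A" using A by (simp add: gsurj_def)
  from ghom_kernel[OF this f'(6)] quotient_iso[OF A(2) f'(1,3,6)] show "N \<in> completion_index C G"
    using A by (auto simp: completion_index_def)
qed

lemma (in tg) completion_indexD:
  assumes "\<And>A. A \<in> C \<Longrightarrow> finite_gamma_group A" "N \<in> completion_index C G"
  shows "N \<lhd> G" "gamma_subgroup G N" "openin (topo G) N" "finite (rcosets N)"
proof -
  show N: "N \<lhd> G" "gamma_subgroup G N" using assms(2) by (auto simp: completion_index_def)
  obtain A where A: "A \<in> gamma_closure C" "gamma_quotient G N \<cong>\<^sub>\<Gamma> A"
    using assms(2) by (auto simp: completion_index_def)
  show "openin (topo G) N" "finite (rcosets N)"
    using quotient_iso_ghom[OF N A(2) gamma_closure_finite[OF assms(1) A(1)]] by auto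
qed

text \<open>The hypothesis on \<open>C\<close> involves only canonical structures of one order, so a
  finite class can satisfy it.\<close>

lemma (in tg) completion_indexI:
  assumes N: "N \<lhd> G" "gamma_subgroup G N" "openin (topo G) N" "finite (rcosets N)"
    and C: "canonical (card (rcosets N)) \<inter> {A. finite_gamma_group A} \<subseteq> C"
  shows "N \<in> completion_index C G"
proof -
  obtain B where B: "B \<in> canonical (card (rcosets N))" "finite_gamma_group B" "gamma_quotient G N \<cong>\<^sub>\<Gamma> B"
    using canonical_copy[OF quotient_finite(1)[OF N]] by (auto simp: order_def)
  hence "B \<in> gamma_closure C" using C by (auto intro: gamma_closure.base)
  interpret normal N G by fact
  show ?thesis unfolding completion_index_def using N B \<open>B \<in> gamma_closure C\<close> open_subgroup_closed[OF is_subgroup] by blast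
qed

text \<open>For a condition that passes to divisors and products the closure adds no new orders, so
  the index can be described by the cardinality of the quotient alone.\<close>

lemma (in tg) completion_index_fin_class:
  assumes Q: "Q 1" "\<And>a b. Q b \<Longrightarrow> a dvd b \<Longrightarrow> Q a" "\<And>a b. Q a \<Longrightarrow> Q b \<Longrightarrow> Q (a * b)"
  shows "completion_index (fin_class Q) G =
    {N. N \<lhd> G \<and> gamma_subgroup G N \<and> openin (topo G) N \<and> finite (rcosets N) \<and> Q (card (rcosets N))}"
proof (intro equalityI subsetI CollectI)
  fix N assume N: "N \<in> completion_index (fin_class Q) G"
  have f: "\<And>A. A \<in> fin_class Q \<Longrightarrow> finite_gamma_group A" by (simp add: fin_class_def)
  note d = completion_indexD[OF f N]
  obtain A where A: "A \<in> gamma_closure (fin_class Q)" "gamma_quotient G N \<cong>\<^sub>\<Gamma> A"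
    using N by (auto simp: completion_index_def)
  have "Q (card (rcosets N))"
  proof -
    have "order (gamma_quotient G N) = order A" using gamma_iso_order[OF A(2)] .
    moreover have "A \<in> fin_class Q" by (rule subsetD[OF gamma_closure_fin_class[OF subset_refl Q] A(1)])
    ultimately show ?thesis by (simp add: fin_class_def order_def)
  qed
  thus "N \<lhd> G \<and> gamma_subgroup G N \<and> openin (topo G) N \<and> finite (rcosets N) \<and> Q (card (rcosets N))" using d by simp
next
  fix N assume "N \<in> {N. N \<lhd> G \<and> gamma_subgroup G N \<and> openin (topo G) N \<and> finite (rcosets N) \<and> Q (card (rcosets N))}"
  thus "N \<in> completion_index (fin_class Q) G"
    by (intro completion_indexI) (auto simp: fin_class_def canonical_order)
qed

lemma (in tg) completion_index_carrier: "carrier G \<in> completion_index C G"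
proof -
  have c: "carrier G \<lhd> G" by (simp add: normal_inv_iff subgroup_self)
  have g: "gamma_subgroup G (carrier G)" by (auto simp: gamma_subgroup_def subgroup_self)
  have o: "openin (topo G) (carrier G)" using topspace_eq openin_topspace by metis
  have r: "rcosets (carrier G) = {carrier G}"
    using coset_join2[OF _ subgroup_self] by (auto simp: RCOSETS_def)
  have "finite_gamma_group (gamma_quotient G (carrier G))" using quotient_finite(1)[OF c g o] r by simp
  then obtain B where B: "B \<in> canonical (order (gamma_quotient G (carrier G)))" "finite_gamma_group B" "gamma_quotient G (carrier G) \<cong>\<^sub>\<Gamma> B"
    using canonical_copy by blast
  have "order B = 1" using gamma_iso_order[OF B(3)] r by (simp add: order_def)
  hence "B \<in> gamma_closure C" using B(2) gamma_closure.triv by blast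
  thus ?thesis unfolding completion_index_def
    using c g B open_subgroup_closed[OF subgroup_self o] by blast
qed

lemma gamma_iso_refl: "A \<cong>\<^sub>\<Gamma> A"
  unfolding gamma_iso_def using iso_set_refl by (intro bexI[of _ id]) (auto simp: iso_def hom_def bij_betw_def)

lemma image_restrict:
  assumes "tg G" "finite_gamma_group L" "\<phi> \<in> ghom G L"
  defines "K \<equiv> \<phi> ` carrier G"
  shows "gamma_subgroup L K" "finite_gamma_group (gamma_restrict L K)" "\<phi> \<in> gsurj G (gamma_restrict L K)"
    "kernel G (gamma_restrict L K) \<phi> = kernel G L \<phi>"
proof -
  interpret tg G by fact
  note L = finite_gammaD[OF assms(2)]
  interpret L: tg L by (rule L(6))
  interpret \<phi>: group_hom G L \<phi> using assms(3) by (auto simp: ghom_def group_hom_iff)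
  have ac: "act L (\<phi> x) = \<phi> (act G x)" if "x \<in> carrier G" for x using assms(3) that by (simp add: ghom_def)
  show sg: "gamma_subgroup L K"
    unfolding gamma_subgroup_def K_def using \<phi>.img_is_subgroup ac by auto
  hence s: "subgroup K L" by (simp add: gamma_subgroup_def)
  have K: "K \<subseteq> carrier L" using s subgroup.subset by blast
  show "finite_gamma_group (gamma_restrict L K)"
  proof (rule finite_gammaI)
    show "group (gamma_restrict L K)"
      using subgroup.subgroup_is_group[OF s L(1)] group_cong_gamma(1)[of "L\<lparr>carrier := K\<rparr>" "gamma_restrict L K"]
      by (simp add: gamma_restrict_def)
    show "finite (carrier (gamma_restrict L K))" using K L(2) by (simp add: gamma_restrict_def finite_subset)
    show "topo (gamma_restrict L K) = discrete_topology (carrier (gamma_restrict L K))"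
      using K L(3) by (simp add: gamma_restrict_def subtopology_discrete_topology Int_absorb1)
    show "act (gamma_restrict L K) \<in> hom (gamma_restrict L K) (gamma_restrict L K)"
      using sg L.act_mult[OF subsetD[OF K] subsetD[OF K]] by (auto simp: gamma_restrict_def hom_def gamma_subgroup_def)
    show "act (gamma_restrict L K) (act (gamma_restrict L K) x) = x" if "x \<in> carrier (gamma_restrict L K)" for x
      using that K L(5) by (auto simp: gamma_restrict_def)
  qed
  show k: "kernel G (gamma_restrict L K) \<phi> = kernel G L \<phi>" by (simp add: kernel_def gamma_restrict_def)
  show "\<phi> \<in> gsurj G (gamma_restrict L K)"
    using assms(3) k by (auto simp: gsurj_def ghom_def gamma_restrict_def hom_def K_def)
qed

lemma finite_gamma_product:
  assumes "finite_gamma_group A" "finite_gamma_group B"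
  shows "finite_gamma_group (gamma_product A B)"
proof -
  note A = finite_gammaD[OF assms(1)] and B = finite_gammaD[OF assms(2)]
  interpret A: tg A by (rule A(6))
  interpret B: tg B by (rule B(6))
  show ?thesis
  proof (rule finite_gammaI)
    show "group (gamma_product A B)"
      using DirProd_group[OF A(1) B(1)] group_cong_gamma(1)[of "A \<times>\<times> B" "gamma_product A B"]
      by (simp add: gamma_product_def)
    show "act (gamma_product A B) \<in> hom (gamma_product A B) (gamma_product A B)"
      using A.act_mult B.act_mult by (auto simp: gamma_product_def hom_def)
  qed (use A B in \<open>auto simp: gamma_product_def simp flip: prod_topology_discrete_topology\<close>)
qed

text \<open>\<open>N \<inter> M\<close> is the kernel of the diagonal map into the product of the
  two quotients. The image of that map is a \<open>\<Gamma>\<close>-subgroup of the product, hence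
  again in the closure of \<open>C\<close>.\<close>

lemma (in tg) completion_index_Int:
  assumes C: "\<And>A. A \<in> C \<Longrightarrow> finite_gamma_group A"
    and "N \<in> completion_index C G" "M \<in> completion_index C G"
  shows "N \<inter> M \<in> completion_index C G"
proof -
  obtain A \<phi> where A: "A \<in> gamma_closure C" "\<phi> \<in> gsurj G A" "kernel G A \<phi> = N"
    using completion_index_iff[OF C] assms by blast
  obtain B \<psi> where B: "B \<in> gamma_closure C" "\<psi> \<in> gsurj G B" "kernel G B \<psi> = M"
    using completion_index_iff[OF C] assms by blast
  have fin: "finite_gamma_group A" "finite_gamma_group B" using gamma_closure_finite[OF C] A B by auto
  note fP = finite_gamma_product[OF fin]
  obtain L :: "nat gstruct" where L: "finite_gamma_group L" "gamma_product A B \<cong>\<^sub>\<Gamma> L"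
    using canonical_copy[OF fP] by metis
  have LC: "L \<in> gamma_closure C" using gamma_closure.prod A B L by blast
  obtain h where h: "h \<in> iso (gamma_product A B) L"
    "\<And>x. x \<in> carrier (gamma_product A B) \<Longrightarrow> h (act (gamma_product A B) x) = act L (h x)"
    "bij_betw h (carrier (gamma_product A B)) (carrier L)" "h \<in> hom (gamma_product A B) L"
    using gamma_isoD[OF L(2)] by metis
  interpret A: tg A by (rule finite_gammaD(6)[OF fin(1)])
  interpret B: tg B by (rule finite_gammaD(6)[OF fin(2)])
  interpret L: tg L by (rule finite_gammaD(6)[OF L(1)])
  interpret P: tg "gamma_product A B" by (rule finite_gammaD(6)[OF fP])
  have hA: "\<phi> \<in> hom G A" "\<And>x. x \<in> carrier G \<Longrightarrow> \<phi> (act G x) = act A (\<phi> x)" "\<And>x. x \<in> carrier G \<Longrightarrow> \<phi> x \<in> carrier A"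
    using A by (auto simp: gsurj_def ghom_def hom_def)
  have hB: "\<psi> \<in> hom G B" "\<And>x. x \<in> carrier G \<Longrightarrow> \<psi> (act G x) = act B (\<psi> x)" "\<And>x. x \<in> carrier G \<Longrightarrow> \<psi> x \<in> carrier B"
    using B by (auto simp: gsurj_def ghom_def hom_def)
  let ?\<chi> = "\<lambda>x. h (\<phi> x, \<psi> x)"
  have pc: "carrier (gamma_product A B) = carrier A \<times> carrier B" by (simp add: gamma_product_def)
  have h1: "h (\<one>\<^bsub>A\<^esub>, \<one>\<^bsub>B\<^esub>) = \<one>\<^bsub>L\<^esub>" using hom_one[OF h(4) P.is_group L.is_group] by (simp add: gamma_product_def)
  have hinj: "h (a, b) = \<one>\<^bsub>L\<^esub> \<longleftrightarrow> a = \<one>\<^bsub>A\<^esub> \<and> b = \<one>\<^bsub>B\<^esub>" if "a \<in> carrier A" "b \<in> carrier B" for a b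
    using inj_on_eq_iff[of h "carrier (gamma_product A B)" "(a,b)" "(\<one>\<^bsub>A\<^esub>, \<one>\<^bsub>B\<^esub>)"] h(3) that h1 unfolding pc bij_betw_def by auto
  have ker: "kernel G L ?\<chi> = N \<inter> M"
    using A(3) B(3) hA(3) hB(3) hinj by (auto simp: kernel_def)
  have "?\<chi> \<in> hom G L"
  proof (rule homI)
    fix x y assume xy: "x \<in> carrier G" "y \<in> carrier G"
    have "h ((\<phi> x, \<psi> x) \<otimes>\<^bsub>gamma_product A B\<^esub> (\<phi> y, \<psi> y)) = ?\<chi> x \<otimes>\<^bsub>L\<^esub> ?\<chi> y"
      using hom_mult[OF h(4)] xy hA(3) hB(3) pc by simp
    thus "?\<chi> (x \<otimes> y) = ?\<chi> x \<otimes>\<^bsub>L\<^esub> ?\<chi> y"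
      using hom_mult[OF hA(1) xy] hom_mult[OF hB(1) xy] by (simp add: gamma_product_def)
  qed (use h(3) hA(3) hB(3) pc in \<open>auto simp: bij_betw_def\<close>)
  moreover have "?\<chi> (act G x) = act L (?\<chi> x)" if "x \<in> carrier G" for x
    using h(2)[of "(\<phi> x, \<psi> x)"] hA hB that pc by (simp add: gamma_product_def)
  moreover have "openin (topo G) (N \<inter> M)" using completion_indexD(3)[OF C] assms by auto
  ultimately have gh: "?\<chi> \<in> ghom G L" using ker by (simp add: ghom_def)
  note r = image_restrict[OF tg_axioms L(1) gh]
  have "gamma_restrict L (?\<chi> ` carrier G) \<in> gamma_closure C"
    using gamma_closure.sub[OF LC r(1,2) gamma_iso_refl] .
  thus ?thesis using completion_index_iff[OF C] r(3,4) ker by blast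
qed

section \<open>Completions\<close>

locale completed = tg G for G :: "'a gstruct" (structure) +
  fixes C :: "nat gstruct set"
  assumes Cfin: "\<And>A. A \<in> C \<Longrightarrow> finite_gamma_group A"
begin

abbreviation "J \<equiv> completion_index C G"
abbreviation "Gh \<equiv> completion C G"
abbreviation "\<iota> \<equiv> completion_map C G"

lemma JD: assumes "N \<in> J"
  shows "N \<lhd> G" "gamma_subgroup G N" "openin (topo G) N" "finite (rcosets N)" "subgroup N G" "N \<subseteq> carrier G"
  using completion_indexD[OF Cfin assms] by (auto dest: normal_imp_subgroup subgroup.subset)

text \<open>The index is downward directed. This is what allows one coordinate of the inverse limit
  to control any finite number of others.\<close>

lemma J_Inter:
  assumes "finite F" "F \<subseteq> J" shows "\<exists>L\<in>J. \<forall>N\<in>F. L \<subseteq> N"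
  using assms
proof induction
  case empty thus ?case using completion_index_carrier by blast
next
  case (insert N F)
  then obtain L where L: "L \<in> J" "\<forall>N\<in>F. L \<subseteq> N" by auto
  have "L \<inter> N \<in> J" by (rule completion_index_Int[OF Cfin]) (use L insert in auto)
  thus ?case using L by (intro bexI[of _ "L \<inter> N"]) auto
qed

lemma Gh_simps:
  "carrier Gh = completion_carrier C G"
  "f \<otimes>\<^bsub>Gh\<^esub> g = (\<lambda>N\<in>J. f N <#> g N)"
  "\<one>\<^bsub>Gh\<^esub> = (\<lambda>N\<in>J. N)"
  "act Gh f = (\<lambda>N\<in>J. act G ` f N)"
  by (simp_all add: completion_def)

lemma coset_eq_of_mem:
  assumes "N \<in> J" "X \<in> rcosets N" "g \<in> X"
  shows "X = N #> g"
proof -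
  obtain x where x: "x \<in> carrier G" "X = N #> x" using assms(2) by (auto simp: RCOSETS_def)
  thus ?thesis using repr_independence[OF _ x(1) JD(5)[OF assms(1)]] assms(3) by simp
qed

lemma coset_self: "\<lbrakk>N \<in> J; g \<in> carrier G\<rbrakk> \<Longrightarrow> g \<in> N #> g"
  using rcos_self JD(5) by blast

lemma coset_in: "\<lbrakk>N \<in> J; g \<in> carrier G\<rbrakk> \<Longrightarrow> N #> g \<in> rcosets N"
  using rcosetsI JD(6) by blast

lemma coset_mono: "M \<subseteq> N \<Longrightarrow> M #> g \<subseteq> N #> g"
  by (auto simp: r_coset_def)

lemma memI:
  assumes "f \<in> extensional J"
    "\<And>M N. \<lbrakk>M \<in> J; N \<in> J; M \<subseteq> N\<rbrakk> \<Longrightarrow> \<exists>g\<in>carrier G. f M = M #> g \<and> f N = N #> g"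
  shows "f \<in> carrier Gh"
  unfolding Gh_simps completion_carrier_def
proof (intro CollectI conjI ballI impI)
  have "f N \<in> rcosets N" if "N \<in> J" for N
    using assms(2)[OF that that] coset_in[OF that] by auto
  thus "f \<in> (\<Pi>\<^sub>E N\<in>J. rcosets N)" using assms(1) by (auto simp: PiE_def)
  fix M N assume "M \<in> J" "N \<in> J" "M \<subseteq> N"
  thus "f M \<subseteq> f N" using assms(2)[of M N] coset_mono[of M N] by metis
qed

lemma mem_rcosets: "\<lbrakk>f \<in> carrier Gh; N \<in> J\<rbrakk> \<Longrightarrow> f N \<in> rcosets N"
  unfolding Gh_simps completion_carrier_def by auto

lemma mem_ext: "f \<in> carrier Gh \<Longrightarrow> f \<in> extensional J"
  unfolding Gh_simps completion_carrier_def by (auto simp: PiE_def)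

lemma mem_rep:
  assumes "f \<in> carrier Gh" "N \<in> J" obtains g where "g \<in> carrier G" "f N = N #> g"
  using mem_rcosets[OF assms] by (auto simp: RCOSETS_def)

lemma mem_up:
  assumes "f \<in> carrier Gh" "M \<in> J" "N \<in> J" "M \<subseteq> N" "g \<in> carrier G" "f M = M #> g"
  shows "f N = N #> g"
proof -
  have "f M \<subseteq> f N" using assms(1-4) unfolding Gh_simps completion_carrier_def by blast
  hence "g \<in> f N" using coset_self[OF assms(2,5)] assms(6) by auto
  thus ?thesis using coset_eq_of_mem[OF assms(3) mem_rcosets[OF assms(1,3)]] by blast
qed

lemma mem_eqI:
  assumes "f \<in> carrier Gh" "h \<in> carrier Gh" "\<And>N. N \<in> J \<Longrightarrow> f N = h N" shows "f = h"
  using assms mem_ext by (auto intro: extensionalityI)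

lemma mem_agree_up:
  assumes "f \<in> carrier Gh" "h \<in> carrier Gh" "M \<in> J" "N \<in> J" "M \<subseteq> N" "f M = h M"
  shows "f N = h N"
  by (metis assms mem_rep mem_up)

lemma coset_mult: "\<lbrakk>N \<in> J; x \<in> carrier G; y \<in> carrier G\<rbrakk> \<Longrightarrow> (N #> x) <#> (N #> y) = N #> (x \<otimes> y)"
  using normal.rcos_sum[OF JD(1)] by blast

lemma mult_closed: assumes "f \<in> carrier Gh" "h \<in> carrier Gh" shows "f \<otimes>\<^bsub>Gh\<^esub> h \<in> carrier Gh"
proof (rule memI)
  fix M N assume *: "M \<in> J" "N \<in> J" "M \<subseteq> N"
  obtain x where x: "x \<in> carrier G" "f M = M #> x" using mem_rep assms * by blast
  obtain y where y: "y \<in> carrier G" "h M = M #> y" using mem_rep assms * by blast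
  have "f N = N #> x" "h N = N #> y" using mem_up assms * x y by blast+
  thus "\<exists>g\<in>carrier G. (f \<otimes>\<^bsub>Gh\<^esub> h) M = M #> g \<and> (f \<otimes>\<^bsub>Gh\<^esub> h) N = N #> g"
    using * x y by (intro bexI[of _ "x \<otimes> y"]) (simp_all add: Gh_simps coset_mult)
qed (simp add: Gh_simps)

lemma one_closed': "\<one>\<^bsub>Gh\<^esub> \<in> carrier Gh"
proof (rule memI)
  fix M N assume *: "M \<in> J" "N \<in> J" "M \<subseteq> N"
  show "\<exists>g\<in>carrier G. \<one>\<^bsub>Gh\<^esub> M = M #> g \<and> \<one>\<^bsub>Gh\<^esub> N = N #> g"
    using * JD(6) by (intro bexI[of _ \<one>]) (simp_all add: Gh_simps)
qed (simp add: Gh_simps)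

lemma Gh_group: "group Gh"
proof (rule groupI)
  fix f g h assume fgh: "f \<in> carrier Gh" "g \<in> carrier Gh" "h \<in> carrier Gh"
  show "f \<otimes>\<^bsub>Gh\<^esub> g \<otimes>\<^bsub>Gh\<^esub> h = f \<otimes>\<^bsub>Gh\<^esub> (g \<otimes>\<^bsub>Gh\<^esub> h)"
    using normal.rcosets_assoc[OF JD(1)] mem_rcosets fgh by (auto simp: Gh_simps fun_eq_iff restrict_def)
next
  fix f assume f: "f \<in> carrier Gh"
  show "\<one>\<^bsub>Gh\<^esub> \<otimes>\<^bsub>Gh\<^esub> f = f"
  proof (rule mem_eqI)
    fix N assume N: "N \<in> J"
    show "(\<one>\<^bsub>Gh\<^esub> \<otimes>\<^bsub>Gh\<^esub> f) N = f N"
      using N normal.rcosets_mult_eq[OF JD(1)[OF N] mem_rcosets[OF f N]] by (simp add: Gh_simps)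
  qed (use f mult_closed one_closed' in auto)
  define h where "h = (\<lambda>N\<in>J. set_inv (f N))"
  have "h \<in> carrier Gh"
  proof (rule memI)
    fix M N assume *: "M \<in> J" "N \<in> J" "M \<subseteq> N"
    obtain x where x: "x \<in> carrier G" "f M = M #> x" using mem_rep f * by blast
    thus "\<exists>g\<in>carrier G. h M = M #> g \<and> h N = N #> g"
      using * mem_up[OF f *(1,2,3) x] normal.rcos_inv[OF JD(1)]
      by (intro bexI[of _ "inv x"]) (auto simp: h_def)
  qed (simp add: h_def)
  moreover have "h \<otimes>\<^bsub>Gh\<^esub> f = \<one>\<^bsub>Gh\<^esub>"
    using normal.rcosets_inv_mult_group_eq[OF JD(1)] mem_rcosets[OF f]
    by (auto simp: Gh_simps h_def fun_eq_iff restrict_def)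
  ultimately show "\<exists>h\<in>carrier Gh. h \<otimes>\<^bsub>Gh\<^esub> f = \<one>\<^bsub>Gh\<^esub>" by blast
qed (use mult_closed one_closed' in auto)

text \<open>A basic open set of the product constrains finitely many coordinates; by directedness
  there is one coordinate \<open>L\<close> below all of them, and compatibility lets
  \<open>L\<close> decide them. All topology on completions is done through this
  description.\<close>

lemma openin_Gh:
  "openin (topo Gh) U \<longleftrightarrow> U \<subseteq> carrier Gh \<and> (\<forall>f\<in>U. \<exists>L\<in>J. {h\<in>carrier Gh. h L = f L} \<subseteq> U)"
proof -
  let ?P = "product_topology (\<lambda>N. topo (gamma_quotient G N)) J"
  have t: "topo Gh = subtopology ?P (carrier Gh)" by (simp add: completion_def)
  have d: "topo (gamma_quotient G N) = discrete_topology (rcosets N)" if "N \<in> J" for N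
    using quotient_discrete JD that by blast
  have tP: "carrier Gh \<subseteq> topspace ?P"
  proof -
    have "(\<Pi>\<^sub>E N\<in>J. topspace (topo (gamma_quotient G N))) = (\<Pi>\<^sub>E N\<in>J. rcosets N)"
      by (rule PiE_cong) (simp add: d)
    thus ?thesis unfolding topspace_product_topology Gh_simps completion_carrier_def by auto
  qed
  show ?thesis
  proof (intro iffI conjI ballI)
    assume U: "openin (topo Gh) U"
    then obtain T where T: "openin ?P T" "U = T \<inter> carrier Gh" unfolding t openin_subtopology by blast
    thus "U \<subseteq> carrier Gh" by blast
    fix f assume f: "f \<in> U"
    have fT: "f \<in> T" using f T by blast
    from bspec[OF T(1)[unfolded openin_product_topology_alt] fT]
    obtain X where X: "finite {i \<in> J. X i \<noteq> topspace (topo (gamma_quotient G i))}"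
      "f \<in> Pi\<^sub>E J X" "Pi\<^sub>E J X \<subseteq> T"
      by (elim exE conjE)
    obtain L where L: "L \<in> J" "\<forall>N\<in>{i \<in> J. X i \<noteq> topspace (topo (gamma_quotient G i))}. L \<subseteq> N"
      using J_Inter[OF X(1)] by blast
    have "h \<in> U" if h: "h \<in> carrier Gh" "h L = f L" for h
    proof -
      have "h N \<in> X N" if N: "N \<in> J" for N
      proof (cases "X N = topspace (topo (gamma_quotient G N))")
        case True thus ?thesis using d[OF N] mem_rcosets[OF h(1) N] by simp
      next
        case False
        hence "h N = f N" using mem_agree_up[of h f L N] h L N f T by blast
        thus ?thesis using X(2) N by auto
      qed
      hence "h \<in> Pi\<^sub>E J X" using mem_ext[OF h(1)] by (auto simp: PiE_iff)
      thus ?thesis using X T h by blast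
    qed
    thus "\<exists>L\<in>J. {h\<in>carrier Gh. h L = f L} \<subseteq> U" using L by blast
  next
    assume U: "U \<subseteq> carrier Gh \<and> (\<forall>f\<in>U. \<exists>L\<in>J. {h\<in>carrier Gh. h L = f L} \<subseteq> U)"
    have "openin (topo Gh) {h\<in>carrier Gh. h L = f L}" if "L \<in> J" "f \<in> U" for L f
    proof -
      have "openin ?P {h\<in>topspace ?P. h L \<in> {f L}}"
        using openin_continuous_map_preimage[OF continuous_map_product_projection[OF that(1)], of "\<lambda>N. topo (gamma_quotient G N)" "{f L}"]
          d[OF that(1)] mem_rcosets[OF _ that(1)] U that by auto
      moreover have "{h\<in>carrier Gh. h L = f L} = {h\<in>topspace ?P. h L \<in> {f L}} \<inter> carrier Gh" using tP by auto
      ultimately show ?thesis unfolding t openin_subtopology by blast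
    qed
    hence "\<forall>f\<in>U. \<exists>T. openin (topo Gh) T \<and> f \<in> T \<and> T \<subseteq> U" using U by blast
    thus "openin (topo Gh) U" by (subst openin_subopen)
  qed
qed

lemma act_closed': assumes "f \<in> carrier Gh" shows "act Gh f \<in> carrier Gh"
proof (rule memI)
  fix M N assume *: "M \<in> J" "N \<in> J" "M \<subseteq> N"
  obtain x where x: "x \<in> carrier G" "f M = M #> x" using mem_rep assms * by blast
  thus "\<exists>g\<in>carrier G. act Gh f M = M #> g \<and> act Gh f N = N #> g"
    using * mem_up[OF assms * x] act_coset[OF JD(2)] by (intro bexI[of _ "act G x"]) (simp_all add: Gh_simps)
qed (simp add: Gh_simps)

lemma act_act': assumes "f \<in> carrier Gh" shows "act Gh (act Gh f) = f"
proof (rule mem_eqI)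
  fix N assume N: "N \<in> J"
  obtain x where x: "x \<in> carrier G" "f N = N #> x" using mem_rep assms N by blast
  thus "act Gh (act Gh f) N = f N" using N act_coset[OF JD(2)] by (simp add: Gh_simps act_act)
qed (use assms act_closed' in auto)

lemma mult_at: "N \<in> J \<Longrightarrow> (f \<otimes>\<^bsub>Gh\<^esub> g) N = f N <#> g N" by (simp add: Gh_simps)
lemma act_at: "N \<in> J \<Longrightarrow> act Gh f N = act G ` f N" by (simp add: Gh_simps)

lemma Gh_tg: "tg Gh"
proof -
  interpret Gh: group Gh by (rule Gh_group)
  show ?thesis
  proof
    show "topspace (topo Gh) = carrier Gh"
    proof
      show "topspace (topo Gh) \<subseteq> carrier Gh" using openin_Gh openin_topspace by blast
      have "openin (topo Gh) (carrier Gh)" unfolding openin_Gh using completion_index_carrier by blast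
      thus "carrier Gh \<subseteq> topspace (topo Gh)" by (rule openin_subset)
    qed
  next
    fix a U assume a: "a \<in> carrier Gh" and U: "openin (topo Gh) U"
    show "openin (topo Gh) (l_coset Gh a U)"
      unfolding openin_Gh
    proof (intro conjI ballI)
      show "l_coset Gh a U \<subseteq> carrier Gh" using a U Gh.l_coset_subset_G openin_Gh by blast
      fix f assume "f \<in> l_coset Gh a U"
      then obtain k where k: "k \<in> U" "f = a \<otimes>\<^bsub>Gh\<^esub> k" by (auto simp: l_coset_def)
      then obtain L where L: "L \<in> J" "{h\<in>carrier Gh. h L = k L} \<subseteq> U" using U openin_Gh by blast
      have kc: "k \<in> carrier Gh" using k U openin_Gh by blast
      have "h \<in> l_coset Gh a U" if h: "h \<in> carrier Gh" "h L = f L" for h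
      proof -
        have "(inv\<^bsub>Gh\<^esub> a \<otimes>\<^bsub>Gh\<^esub> h) L = (inv\<^bsub>Gh\<^esub> a \<otimes>\<^bsub>Gh\<^esub> f) L" using L h by (simp add: mult_at)
        also have "inv\<^bsub>Gh\<^esub> a \<otimes>\<^bsub>Gh\<^esub> f = k" using k a kc by (simp add: Gh.m_assoc[symmetric])
        finally have "inv\<^bsub>Gh\<^esub> a \<otimes>\<^bsub>Gh\<^esub> h \<in> U" using L a h by auto
        moreover have "h = a \<otimes>\<^bsub>Gh\<^esub> (inv\<^bsub>Gh\<^esub> a \<otimes>\<^bsub>Gh\<^esub> h)" using a h by (simp add: Gh.m_assoc[symmetric])
        ultimately show ?thesis by (auto simp: l_coset_def)
      qed
      thus "\<exists>L\<in>J. {h\<in>carrier Gh. h L = f L} \<subseteq> l_coset Gh a U" using L by blast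
    qed
    show "openin (topo Gh) (U #>\<^bsub>Gh\<^esub> a)"
      unfolding openin_Gh
    proof (intro conjI ballI)
      show "U #>\<^bsub>Gh\<^esub> a \<subseteq> carrier Gh" using a U Gh.r_coset_subset_G openin_Gh by blast
      fix f assume "f \<in> U #>\<^bsub>Gh\<^esub> a"
      then obtain k where k: "k \<in> U" "f = k \<otimes>\<^bsub>Gh\<^esub> a" by (auto simp: r_coset_def)
      then obtain L where L: "L \<in> J" "{h\<in>carrier Gh. h L = k L} \<subseteq> U" using U openin_Gh by blast
      have kc: "k \<in> carrier Gh" using k U openin_Gh by blast
      have "h \<in> U #>\<^bsub>Gh\<^esub> a" if h: "h \<in> carrier Gh" "h L = f L" for h
      proof -
        have "(h \<otimes>\<^bsub>Gh\<^esub> inv\<^bsub>Gh\<^esub> a) L = (f \<otimes>\<^bsub>Gh\<^esub> inv\<^bsub>Gh\<^esub> a) L" using L h by (simp add: mult_at)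
        also have "f \<otimes>\<^bsub>Gh\<^esub> inv\<^bsub>Gh\<^esub> a = k" using k a kc by (simp add: Gh.m_assoc)
        finally have "h \<otimes>\<^bsub>Gh\<^esub> inv\<^bsub>Gh\<^esub> a \<in> U" using L a h by auto
        moreover have "h = (h \<otimes>\<^bsub>Gh\<^esub> inv\<^bsub>Gh\<^esub> a) \<otimes>\<^bsub>Gh\<^esub> a" using a h by (simp add: Gh.m_assoc)
        ultimately show ?thesis by (auto simp: r_coset_def)
      qed
      thus "\<exists>L\<in>J. {h\<in>carrier Gh. h L = f L} \<subseteq> U #>\<^bsub>Gh\<^esub> a" using L by blast
    qed
  next
    fix U assume U: "openin (topo Gh) U"
    show "openin (topo Gh) (act Gh ` U)"
      unfolding openin_Gh
    proof (intro conjI ballI)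
      show "act Gh ` U \<subseteq> carrier Gh" using U act_closed' openin_Gh by blast
      fix f assume "f \<in> act Gh ` U"
      then obtain k where k: "k \<in> U" "f = act Gh k" by auto
      then obtain L where L: "L \<in> J" "{h\<in>carrier Gh. h L = k L} \<subseteq> U" using U openin_Gh by blast
      have kc: "k \<in> carrier Gh" using k U openin_Gh by blast
      have "h \<in> act Gh ` U" if h: "h \<in> carrier Gh" "h L = f L" for h
      proof -
        have "act Gh h L = act Gh f L" using L h by (simp add: act_at)
        hence "act Gh h \<in> U" using L k h act_closed' act_act'[OF kc] by auto
        thus ?thesis using act_act'[OF h(1)] by (metis imageI)
      qed
      thus "\<exists>L\<in>J. {h\<in>carrier Gh. h L = f L} \<subseteq> act Gh ` U" using L by blast
    qed
  next
    show "act Gh \<in> hom Gh Gh"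
    proof (rule homI)
      fix f h assume fh: "f \<in> carrier Gh" "h \<in> carrier Gh"
      show "act Gh (f \<otimes>\<^bsub>Gh\<^esub> h) = act Gh f \<otimes>\<^bsub>Gh\<^esub> act Gh h"
      proof (rule mem_eqI)
        fix N assume N: "N \<in> J"
        obtain x where x: "x \<in> carrier G" "f N = N #> x" using mem_rep fh N by blast
        obtain y where y: "y \<in> carrier G" "h N = N #> y" using mem_rep fh N by blast
        show "act Gh (f \<otimes>\<^bsub>Gh\<^esub> h) N = (act Gh f \<otimes>\<^bsub>Gh\<^esub> act Gh h) N"
          using N x y act_coset[OF JD(2)[OF N]] by (simp add: act_at mult_at coset_mult act_mult)
      qed (use fh act_closed' mult_closed in auto)
    qed (rule act_closed')
  qed (rule act_act')
qed

lemma iota_at: "N \<in> J \<Longrightarrow> \<iota> g N = N #> g" by (simp add: completion_map_def)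

lemma iota_closed: "g \<in> carrier G \<Longrightarrow> \<iota> g \<in> carrier Gh"
  by (rule memI) (auto simp: completion_map_def)

lemma iota_hom: "\<iota> \<in> hom G Gh"
proof (rule homI)
  fix x y assume "x \<in> carrier G" "y \<in> carrier G"
  thus "\<iota> (x \<otimes> y) = \<iota> x \<otimes>\<^bsub>Gh\<^esub> \<iota> y"
    by (intro mem_eqI) (auto simp: iota_closed mult_closed iota_at mult_at coset_mult)
qed (rule iota_closed)

lemma iota_act: "x \<in> carrier G \<Longrightarrow> \<iota> (act G x) = act Gh (\<iota> x)"
  by (intro mem_eqI) (auto simp: iota_closed act_closed' iota_at act_at act_coset[OF JD(2)])

lemma iota_Y: assumes "x \<in> carrier G" shows "\<iota> (Y G x) = Y Gh (\<iota> x)"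
proof -
  interpret Gh: group Gh by (rule Gh_group)
  interpret i: group_hom G Gh \<iota> using iota_hom by (simp add: group_hom_iff is_group Gh_group)
  show ?thesis using assms by (simp add: Y_def iota_act)
qed

text \<open>The extension of \<open>\<phi>\<close> to the completion. When the kernel of
  \<open>\<phi>\<close> belongs to the index, an element of the completion has a coset as its
  coordinate there, and \<open>\<phi>\<close> is constant on that coset, so the choice made by
  \<open>SOME\<close> does not matter.\<close>

definition ext :: "('a \<Rightarrow> 'b) \<Rightarrow> 'b gstruct \<Rightarrow> ('a set \<Rightarrow> 'a set) \<Rightarrow> 'b" where
  "ext \<phi> A f = \<phi> (SOME g. g \<in> f (kernel G A \<phi>))"

lemma ext_eq:
  assumes \<phi>: "\<phi> \<in> ghom G A" and A: "tg A" and K: "kernel G A \<phi> \<in> J"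
    and f: "f \<in> carrier Gh" and g: "g \<in> carrier G" "f (kernel G A \<phi>) = kernel G A \<phi> #> g"
  shows "ext \<phi> A f = \<phi> g"
proof -
  interpret group_hom G A \<phi> by (rule ghom_kernel(5)[OF \<phi> A])
  have "\<phi> x = \<phi> g" if "x \<in> f (kernel G A \<phi>)" for x
    using that g by (auto simp: r_coset_def kernel_def)
  moreover have "g \<in> f (kernel G A \<phi>)" using g coset_self[OF K] by simp
  ultimately show ?thesis unfolding ext_def by (metis someI)
qed

lemma ext_ghom:
  assumes \<phi>: "\<phi> \<in> ghom G A" and A: "tg A" and K: "kernel G A \<phi> \<in> J"
  shows "ext \<phi> A \<in> ghom Gh A" "\<And>g. g \<in> carrier G \<Longrightarrow> ext \<phi> A (\<iota> g) = \<phi> g"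
    "ext \<phi> A ` carrier Gh = \<phi> ` carrier G"
    "kernel Gh A (ext \<phi> A) = {f\<in>carrier Gh. f (kernel G A \<phi>) = kernel G A \<phi>}"
proof -
  let ?K = "kernel G A \<phi>"
  interpret A: tg A by fact
  interpret \<phi>: group_hom G A \<phi> by (rule ghom_kernel(5)[OF \<phi> A])
  note ee = ext_eq[OF assms]
  show 1: "ext \<phi> A (\<iota> g) = \<phi> g" if "g \<in> carrier G" for g
    using ee[OF iota_closed[OF that] that iota_at[OF K]] .
  show 2: "ext \<phi> A ` carrier Gh = \<phi> ` carrier G"
  proof (intro equalityI subsetI)
    fix y assume "y \<in> ext \<phi> A ` carrier Gh"
    then obtain f where f: "f \<in> carrier Gh" "y = ext \<phi> A f" by auto
    then obtain g where "g \<in> carrier G" "f ?K = ?K #> g" using mem_rep K by blast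
    thus "y \<in> \<phi> ` carrier G" using ee[OF f(1)] f by auto
  next
    fix y assume "y \<in> \<phi> ` carrier G"
    then obtain g where "g \<in> carrier G" "y = \<phi> g" by auto
    thus "y \<in> ext \<phi> A ` carrier Gh" using 1[of g] iota_closed[of g] by (metis imageI)
  qed
  show 3: "kernel Gh A (ext \<phi> A) = {f\<in>carrier Gh. f ?K = ?K}"
  proof -
    have "ext \<phi> A f = \<one>\<^bsub>A\<^esub> \<longleftrightarrow> f ?K = ?K" if f: "f \<in> carrier Gh" for f
    proof -
      obtain g where g: "g \<in> carrier G" "f ?K = ?K #> g" using mem_rep f K by blast
      have "\<phi> g = \<one>\<^bsub>A\<^esub> \<longleftrightarrow> g \<in> ?K" using g by (simp add: kernel_def)
      also have "\<dots> \<longleftrightarrow> ?K #> g = ?K"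
        using coset_join1[OF _ g(1) JD(5)[OF K]] coset_join2[OF g(1) JD(5)[OF K]] JD(6)[OF K] by blast
      finally show ?thesis using ee[OF f g] g by simp
    qed
    thus ?thesis unfolding kernel_def by blast
  qed
  have cl: "ext \<phi> A f \<in> carrier A" if "f \<in> carrier Gh" for f
  proof -
    have "ext \<phi> A f \<in> \<phi> ` carrier G" using imageI[OF that, of "ext \<phi> A"] 2 by simp
    thus ?thesis by auto
  qed
  have "ext \<phi> A \<in> hom Gh A"
  proof (rule homI)
    fix f h assume fh: "f \<in> carrier Gh" "h \<in> carrier Gh"
    obtain x where x: "x \<in> carrier G" "f ?K = ?K #> x" using mem_rep fh K by blast
    obtain y where y: "y \<in> carrier G" "h ?K = ?K #> y" using mem_rep fh K by blast
    have "(f \<otimes>\<^bsub>Gh\<^esub> h) ?K = ?K #> (x \<otimes> y)" using x y K by (simp add: mult_at coset_mult)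
    thus "ext \<phi> A (f \<otimes>\<^bsub>Gh\<^esub> h) = ext \<phi> A f \<otimes>\<^bsub>A\<^esub> ext \<phi> A h"
      using ee[OF fh(1) x] ee[OF fh(2) y] ee[OF mult_closed[OF fh], of "x \<otimes> y"] x y by simp
  qed (rule cl)
  moreover have "openin (topo Gh) (kernel Gh A (ext \<phi> A))"
    unfolding 3 openin_Gh using K by auto
  moreover have "ext \<phi> A (act Gh f) = act A (ext \<phi> A f)" if f: "f \<in> carrier Gh" for f
  proof -
    obtain x where x: "x \<in> carrier G" "f ?K = ?K #> x" using mem_rep f K by blast
    have "act Gh f ?K = ?K #> act G x" using x K act_coset[OF JD(2)] by (simp add: act_at)
    thus ?thesis using ee[OF f x] ee[OF act_closed'[OF f], of "act G x"] x \<phi> by (simp add: ghom_def)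
  qed
  ultimately show "ext \<phi> A \<in> ghom Gh A" by (simp add: ghom_def)
qed

text \<open>An open kernel contains a basic neighbourhood of the identity, and such a neighbourhood
  is cut out by a single coordinate.\<close>

lemma hom_factor:
  assumes "\<theta> \<in> hom Gh B" "group B" "openin (topo Gh) (kernel Gh B \<theta>)"
  obtains L where "L \<in> J" "\<And>f h. \<lbrakk>f \<in> carrier Gh; h \<in> carrier Gh; f L = h L\<rbrakk> \<Longrightarrow> \<theta> f = \<theta> h"
proof -
  interpret Gh: group Gh by (rule Gh_group)
  interpret \<theta>: group_hom Gh B \<theta> using assms Gh_group by (simp add: group_hom_iff)
  have "\<one>\<^bsub>Gh\<^esub> \<in> kernel Gh B \<theta>" by (simp add: kernel_def)
  then obtain L where L: "L \<in> J" "{h\<in>carrier Gh. h L = \<one>\<^bsub>Gh\<^esub> L} \<subseteq> kernel Gh B \<theta>"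
    using assms(3) openin_Gh by blast
  have "\<theta> f = \<theta> h" if fh: "f \<in> carrier Gh" "h \<in> carrier Gh" "f L = h L" for f h
  proof -
    have "(f \<otimes>\<^bsub>Gh\<^esub> inv\<^bsub>Gh\<^esub> h) L = (h \<otimes>\<^bsub>Gh\<^esub> inv\<^bsub>Gh\<^esub> h) L" unfolding mult_at[OF L(1)] using fh by simp
    also have "h \<otimes>\<^bsub>Gh\<^esub> inv\<^bsub>Gh\<^esub> h = \<one>\<^bsub>Gh\<^esub>" using fh by simp
    finally have "f \<otimes>\<^bsub>Gh\<^esub> inv\<^bsub>Gh\<^esub> h \<in> kernel Gh B \<theta>" using L(2) fh by auto
    hence "\<theta> f \<otimes>\<^bsub>B\<^esub> inv\<^bsub>B\<^esub> \<theta> h = \<one>\<^bsub>B\<^esub>" using fh by (simp add: kernel_def)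
    thus ?thesis using fh by (metis \<theta>.H.inv_closed \<theta>.H.inv_equality \<theta>.H.inv_inv \<theta>.hom_closed)
  qed
  thus ?thesis using that L(1) by blast
qed

text \<open>Finiteness of the completion means that the directed family \<open>J\<close> has a least
  member. In the direction that starts from an isomorphism, its composite \<open>\<psi>\<close> with
  \<open>\<iota>\<close> has kernel the intersection of \<open>J\<close>. Every member of
  \<open>J\<close> is therefore a union of fibres of \<open>\<psi>\<close> and is determined by its
  image in \<open>H\<close>, so \<open>J\<close> is finite; being directed, it has a least
  member.\<close>

theorem completion_iso_iff:
  assumes H: "finite_gamma_group H"
  shows "Gh \<cong>\<^sub>\<Gamma> H \<longleftrightarrow> (\<exists>\<phi>\<in>gsurj G H. kernel G H \<phi> \<in> J \<and> (\<forall>N\<in>J. kernel G H \<phi> \<subseteq> N))"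
proof
  note H' = finite_gammaD[OF H]
  interpret H: tg H by (rule H'(6))
  interpret Gh: tg Gh by (rule Gh_tg)
  {
    assume "\<exists>\<phi>\<in>gsurj G H. kernel G H \<phi> \<in> J \<and> (\<forall>N\<in>J. kernel G H \<phi> \<subseteq> N)"
    then obtain \<phi> where p: "\<phi> \<in> gsurj G H" "kernel G H \<phi> \<in> J" "\<And>N. N \<in> J \<Longrightarrow> kernel G H \<phi> \<subseteq> N" by blast
    let ?K = "kernel G H \<phi>"
    have ph: "\<phi> \<in> ghom G H" using p by (simp add: gsurj_def)
    note e = ext_ghom[OF ph H'(6) p(2)]
    interpret e: group_hom Gh H "ext \<phi> H" by (rule Gh.ghom_kernel(5)[OF e(1) H'(6)])
    have eqK: "f = h" if "f \<in> carrier Gh" "h \<in> carrier Gh" "f ?K = h ?K" for f h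
      using that mem_agree_up[OF that(1,2) p(2)] p(3) by (intro mem_eqI) auto
    have "kernel Gh H (ext \<phi> H) = {\<one>\<^bsub>Gh\<^esub>}"
      unfolding e(4) using eqK[OF _ one_closed'] p(2) by (auto simp: one_closed'[unfolded Gh_simps(3)] Gh_simps(3))
    hence bij: "bij_betw (ext \<phi> H) (carrier Gh) (carrier H)"
      unfolding bij_betw_def using e.inj_iff_trivial_ker e(3) p(1) by (simp add: gsurj_def)
    have "topo Gh = discrete_topology (carrier Gh)"
      unfolding topology_eq openin_Gh openin_discrete_topology using eqK p(2) by blast
    hence "homeomorphic_map (topo Gh) (topo H) (ext \<phi> H)" using homeo_discrete[OF bij] H'(3) by simp
    thus "Gh \<cong>\<^sub>\<Gamma> H" unfolding gamma_iso_def using bij e(1) by (intro bexI[of _ "ext \<phi> H"]) (auto simp: iso_def ghom_def)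
  }
  assume "Gh \<cong>\<^sub>\<Gamma> H"
  then obtain h where h: "\<And>x. x \<in> carrier Gh \<Longrightarrow> h (act Gh x) = act H (h x)" "bij_betw h (carrier Gh) (carrier H)" "h \<in> hom Gh H"
    unfolding gamma_iso_def iso_def by blast
  define \<psi> where "\<psi> = h \<circ> \<iota>"
  have hom: "\<psi> \<in> hom G H"
    by (rule homI) (use hom_mult[OF iota_hom] hom_mult[OF h(3)] hom_in_carrier[OF h(3)] iota_closed in \<open>auto simp: \<psi>_def\<close>)
  interpret \<psi>: group_hom G H \<psi> using hom by (simp add: group_hom_iff is_group H.is_group)
  have h1: "h f = \<one>\<^bsub>H\<^esub> \<longleftrightarrow> f = \<one>\<^bsub>Gh\<^esub>" if "f \<in> carrier Gh" for f
    using hom_one[OF h(3) Gh.is_group H.is_group] h(2) that by (metis Gh.one_closed bij_betw_def inj_on_eq_iff)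
  have coset_one: "N #> g = N \<longleftrightarrow> g \<in> N" if "N \<in> J" "g \<in> carrier G" for N g
    using coset_join1[OF _ that(2) JD(5)[OF that(1)]] coset_join2[OF that(2) JD(5)[OF that(1)]] JD(6)[OF that(1)] by blast
  have ker: "kernel G H \<psi> = {g \<in> carrier G. \<forall>N\<in>J. g \<in> N}"
  proof -
    have "\<iota> g = \<one>\<^bsub>Gh\<^esub> \<longleftrightarrow> (\<forall>N\<in>J. g \<in> N)" if "g \<in> carrier G" for g
      using that coset_one by (auto simp: completion_map_def Gh_simps(3) fun_eq_iff restrict_def)
    thus ?thesis using h1 iota_closed by (auto simp: kernel_def \<psi>_def)
  qed
  have sat: "g \<in> N" if "N \<in> J" "g \<in> carrier G" "n \<in> N" "\<psi> g = \<psi> n" for N g n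
  proof -
    have n: "n \<in> carrier G" using JD(6) that by blast
    have "g \<otimes> inv n \<in> kernel G H \<psi>" using that n by (simp add: kernel_def)
    hence "g \<otimes> inv n \<in> N" using ker that by blast
    hence "g \<otimes> inv n \<otimes> n \<in> N" using that JD(5) subgroup.m_closed by metis
    thus ?thesis using that n by (simp add: m_assoc)
  qed
  have "inj_on (\<lambda>N. \<psi> ` N) J"
  proof (rule inj_onI)
    have sub: "N \<subseteq> M" if "N \<in> J" "M \<in> J" "\<psi> ` N = \<psi> ` M" for N M
    proof
      fix g assume g: "g \<in> N"
      hence "\<psi> g \<in> \<psi> ` M" using that(3) by blast
      then obtain m where "m \<in> M" "\<psi> g = \<psi> m" by blast
      thus "g \<in> M" using sat[OF that(2)] g JD(6)[OF that(1)] by blast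
    qed
    fix N M assume "N \<in> J" "M \<in> J" "\<psi> ` N = \<psi> ` M"
    thus "N = M" using sub[of N M] sub[of M N] by blast
  qed
  moreover have "(\<lambda>N. \<psi> ` N) ` J \<subseteq> Pow (carrier H)" using JD(6) \<psi>.hom_closed by blast
  ultimately have "finite J" using H'(2) by (meson finite_Pow_iff finite_imageD finite_subset)
  then obtain L where L: "L \<in> J" "\<forall>N\<in>J. L \<subseteq> N" using J_Inter by blast
  have kL: "kernel G H \<psi> = L" using L JD(6)[OF L(1)] ker by blast
  have eqv: "\<psi> (act G x) = act H (\<psi> x)" if "x \<in> carrier G" for x
    using that h(1)[OF iota_closed[OF that]] by (simp add: \<psi>_def iota_act)
  have "carrier H \<subseteq> \<psi> ` carrier G"
  proof
    fix y assume "y \<in> carrier H"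
    then obtain f where f: "f \<in> carrier Gh" "y = h f" using h(2) by (auto simp: bij_betw_def)
    obtain g where g: "g \<in> carrier G" "f L = L #> g" using mem_rep f L by blast
    have "f = \<iota> g" using mem_up[OF f(1) L(1) _ _ g] L(2) g iota_closed by (intro mem_eqI) (auto simp: f iota_at)
    thus "y \<in> \<psi> ` carrier G" using g f by (auto simp: \<psi>_def)
  qed
  hence "\<psi> \<in> gsurj G H" using hom eqv kL JD(3)[OF L(1)] \<psi>.hom_closed by (auto simp: gsurj_def ghom_def)
  thus "\<exists>\<phi>\<in>gsurj G H. kernel G H \<phi> \<in> J \<and> (\<forall>N\<in>J. kernel G H \<phi> \<subseteq> N)" using kL L by blast
qed

end

section \<open>Universal properties of free groups\<close>

lemma word_eq_append: "word_eq v w \<Longrightarrow> word_eq (a @ v @ b) (a @ w @ b)"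
proof (induction rule: word_eq.induct)
  case (cancel v x c w)
  show ?case using word_eq.cancel[of "a @ v" x c "w @ b"] by simp
qed (auto intro: word_eq.intros)

lemma word_eq_append2: "word_eq a a' \<Longrightarrow> word_eq b b' \<Longrightarrow> word_eq (a @ b) (a' @ b')"
  using word_eq_append[of a a' "[]" b] word_eq_append[of b b' a' "[]"] by (auto intro: word_eq.trans)

definition word_inv :: "('x \<times> bool) list \<Rightarrow> ('x \<times> bool) list" where
  "word_inv w = rev (map (apsnd Not) w)"

lemma word_inv_left: "word_eq (word_inv w @ w) []"
proof (induction w)
  case (Cons a w)
  obtain x b where a: "a = (x, b)" by (cases a)
  have "word_eq (word_inv w @ [(x, \<not> b), (x, \<not> \<not> b)] @ w) (word_inv w @ w)" by (rule word_eq.cancel)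
  thus ?case using Cons a by (auto simp: word_inv_def intro: word_eq.trans)
qed (auto simp: word_inv_def intro: word_eq.refl)

lemma word_eq_map: "word_eq v w \<Longrightarrow> word_eq (map (apfst s) v) (map (apfst s) w)"
proof (induction rule: word_eq.induct)
  case (cancel v x b w)
  show ?case using word_eq.cancel[of "map (apfst s) v" "s x" b "map (apfst s) w"] by simp
qed (auto intro: word_eq.intros)

locale free_words =
  fixes X :: "'x set" and s :: "'x \<Rightarrow> 'x"
  assumes sX: "\<And>x. x \<in> X \<Longrightarrow> s x \<in> X" and ss: "\<And>x. s (s x) = x"
begin

definition W :: "('x \<times> bool) list set" where "W = lists (X \<times> UNIV)"

lemma W_simps[simp]: "[] \<in> W" "v @ w \<in> W \<longleftrightarrow> v \<in> W \<and> w \<in> W" "a # w \<in> W \<longleftrightarrow> fst a \<in> X \<and> w \<in> W"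
  by (auto simp: W_def mem_Times_iff)

abbreviation "FG \<equiv> free_gamma_group X s"
definition cls :: "('x \<times> bool) list \<Rightarrow> ('x \<times> bool) list set" where "cls w = word_rel X `` {w}"

lemma cls_iff: "v \<in> W \<Longrightarrow> z \<in> cls v \<longleftrightarrow> z \<in> W \<and> word_eq v z"
  by (auto simp: cls_def word_rel_def W_def)

lemma cls_eq: assumes "v \<in> W" "w \<in> W" shows "cls v = cls w \<longleftrightarrow> word_eq v w"
proof
  assume "cls v = cls w"
  moreover have "v \<in> cls v" unfolding cls_iff[OF assms(1)] using assms(1) by (auto intro: word_eq.refl)
  ultimately show "word_eq v w" using cls_iff[OF assms(2), of v] by (auto intro: word_eq.sym)
next
  assume "word_eq v w"
  thus "cls v = cls w" unfolding set_eq_iff cls_iff[OF assms(1)] cls_iff[OF assms(2)]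
    by (auto intro: word_eq.sym word_eq.trans)
qed

lemma carrier_FG: "carrier FG = cls ` W"
  unfolding free_gamma_group_def by (auto simp: quotient_def cls_def W_def)

lemma mapW: "w \<in> W \<Longrightarrow> map (apfst s) w \<in> W" using sX by (induction w) auto

lemma s_map_map: "map (apfst s) (map (apfst s) w) = w"
  by (induction w) (auto simp: ss)

lemma mult_cls: assumes "v \<in> W" "w \<in> W" shows "cls v \<otimes>\<^bsub>FG\<^esub> cls w = cls (v @ w)"
proof -
  have vw: "v @ w \<in> W" using assms by simp
  have "cls v \<otimes>\<^bsub>FG\<^esub> cls w = word_rel X `` {a @ b | a b. a \<in> cls v \<and> b \<in> cls w}"
    by (simp add: free_gamma_group_def)
  also have "\<dots> = cls (v @ w)"
  proof (intro equalityI subsetI)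
    fix z assume "z \<in> word_rel X `` {a @ b | a b. a \<in> cls v \<and> b \<in> cls w}"
    then obtain a b where ab: "word_eq v a" "word_eq w b" "z \<in> W" "word_eq (a @ b) z"
      using assms by (auto simp: cls_iff) (auto simp: word_rel_def W_def)
    thus "z \<in> cls (v @ w)" unfolding cls_iff[OF vw] using word_eq_append2[OF ab(1,2)] by (auto intro: word_eq.trans)
  next
    fix z assume z: "z \<in> cls (v @ w)"
    have "v \<in> cls v" "w \<in> cls w" using assms by (auto simp: cls_iff intro: word_eq.refl)
    moreover have "(v @ w, z) \<in> word_rel X" using z vw by (simp add: cls_def)
    ultimately show "z \<in> word_rel X `` {a @ b | a b. a \<in> cls v \<and> b \<in> cls w}" by blast
  qed
  finally show ?thesis .
qed

lemma one_FG: "\<one>\<^bsub>FG\<^esub> = cls []" by (simp add: free_gamma_group_def cls_def)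

lemma act_cls: assumes "w \<in> W" shows "act FG (cls w) = cls (map (apfst s) w)"
proof (intro equalityI subsetI)
  fix z assume "z \<in> act FG (cls w)"
  then obtain a where "a \<in> cls w" "z = map (apfst s) a" by (auto simp: free_gamma_group_def)
  thus "z \<in> cls (map (apfst s) w)" using assms mapW word_eq_map unfolding cls_iff[OF assms] cls_iff[OF mapW[OF assms]] by blast
next
  fix z assume z: "z \<in> cls (map (apfst s) w)"
  hence "map (apfst s) z \<in> cls w"
    using word_eq_map[of "map (apfst s) w" z s] mapW unfolding cls_iff[OF assms] cls_iff[OF mapW[OF assms]]
    by (auto simp: s_map_map simp del: List.map_map)
  moreover have "z = map (apfst s) (map (apfst s) z)" by (simp only: s_map_map)
  ultimately show "z \<in> act FG (cls w)" by (auto simp: free_gamma_group_def simp del: List.map_map)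
qed

lemma FG_group: "group FG"
proof (rule groupI)
  fix x assume "x \<in> carrier FG"
  then obtain w where w: "w \<in> W" "x = cls w" by (auto simp: carrier_FG)
  have wi: "word_inv w \<in> W" using w(1) by (induction w) (auto simp: word_inv_def)
  show "\<one>\<^bsub>FG\<^esub> \<otimes>\<^bsub>FG\<^esub> x = x" using w mult_cls[of "[]" w] by (simp add: one_FG)
  have "cls (word_inv w) \<otimes>\<^bsub>FG\<^esub> x = \<one>\<^bsub>FG\<^esub>"
    using w wi cls_eq[of "word_inv w @ w" "[]"] word_inv_left[of w] by (simp add: mult_cls one_FG)
  thus "\<exists>y\<in>carrier FG. y \<otimes>\<^bsub>FG\<^esub> x = \<one>\<^bsub>FG\<^esub>" using wi carrier_FG by blast
qed (auto simp: carrier_FG mult_cls one_FG)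

lemma FG_tg: "tg FG"
proof -
  interpret group FG by (rule FG_group)
  have t: "topo FG = discrete_topology (carrier FG)" by (simp add: free_gamma_group_def)
  have ac: "x \<in> carrier FG \<Longrightarrow> act FG x \<in> carrier FG" for x using mapW by (auto simp: carrier_FG act_cls)
  show ?thesis
  proof
    show "act FG \<in> hom FG FG"
      using ac mapW by (auto simp: hom_def carrier_FG mult_cls act_cls)
    show "act FG (act FG x) = x" if "x \<in> carrier FG" for x
      using that mapW by (auto simp: carrier_FG act_cls s_map_map simp del: List.map_map)
  qed (use ac l_coset_subset_G r_coset_subset_G in \<open>auto simp: t\<close>)
qed

lemma free_gen_cls: "free_gen X x = cls [(x, True)]" by (simp add: free_gen_def cls_def)

lemma free_gen_closed: "x \<in> X \<Longrightarrow> free_gen X x \<in> carrier FG"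
  unfolding free_gen_cls carrier_FG by auto

lemma free_gen_induct:
  assumes K: "subgroup K FG" and gen: "\<And>x. x \<in> X \<Longrightarrow> free_gen X x \<in> K" and g: "g \<in> carrier FG"
  shows "g \<in> K"
proof -
  interpret group FG by (rule FG_group)
  obtain w where w: "w \<in> W" "g = cls w" using g by (auto simp: carrier_FG)
  have "w \<in> W \<Longrightarrow> cls w \<in> K" for w
  proof (induction w)
    case Nil thus ?case using subgroup.one_closed[OF K] by (simp add: one_FG)
  next
    case (Cons a w)
    obtain x b where a: "a = (x, b)" by (cases a)
    have x: "x \<in> X" and wW: "w \<in> W" using Cons.prems a by auto
    have l: "cls [(x, True)] \<in> K" using gen[OF x] by (simp add: free_gen_cls)
    have cx: "[(x, c)] \<in> W" for c using x by simp
    have "cls [(x, False)] \<otimes>\<^bsub>FG\<^esub> cls [(x, True)] = \<one>\<^bsub>FG\<^esub>"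
      unfolding mult_cls[OF cx cx] one_FG using cls_eq[of "[(x, False), (x, True)]" "[]"] x word_eq.cancel[of "[]" x False "[]"] by simp
    hence "inv\<^bsub>FG\<^esub> cls [(x, True)] = cls [(x, False)]"
      by (rule inv_equality) (use cx carrier_FG in auto)
    hence "cls [(x, b)] \<in> K" using l subgroup.m_inv_closed[OF K l] by (cases b) auto
    moreover have "cls (a # w) = cls [(x, b)] \<otimes>\<^bsub>FG\<^esub> cls w" using mult_cls[OF cx wW] a by simp
    ultimately show ?case using subgroup.m_closed[OF K] Cons.IH[OF wW] by metis
  qed
  thus ?thesis using w by simp
qed

end

fun word_eval :: "('b, 'm) monoid_scheme \<Rightarrow> ('x \<Rightarrow> 'b) \<Rightarrow> ('x \<times> bool) list \<Rightarrow> 'b" where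
  "word_eval A a [] = \<one>\<^bsub>A\<^esub>"
| "word_eval A a (l # w) = (if snd l then a (fst l) else inv\<^bsub>A\<^esub> a (fst l)) \<otimes>\<^bsub>A\<^esub> word_eval A a w"

lemma (in group) word_eval_closed:
  assumes "\<And>x. a x \<in> carrier G" shows "word_eval G a w \<in> carrier G"
  using assms by (induction w) auto

lemma (in group) word_eval_append:
  assumes "\<And>x. a x \<in> carrier G" shows "word_eval G a (v @ w) = word_eval G a v \<otimes> word_eval G a w"
  using assms word_eval_closed[of a, OF assms] by (induction v) (auto simp: m_assoc)

lemma (in group) word_eval_cong:
  assumes "word_eq v w" "\<And>x. a x \<in> carrier G" shows "word_eval G a v = word_eval G a w"
  using assms(1)
proof (induction rule: word_eq.induct)
  case (cancel v x b w)
  have c: "word_eval G a w \<in> carrier G" by (rule word_eval_closed[OF assms(2)])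
  have "word_eval G a ([(x, b), (x, \<not> b)] @ w) = word_eval G a w"
    using assms(2)[of x] c by (cases b) (simp_all add: m_assoc[symmetric])
  thus ?case by (simp only: word_eval_append[OF assms(2)])
qed auto

lemma (in free_words) free_univ:
  assumes A: "tg A" and a: "\<And>x. x \<in> X \<Longrightarrow> a x \<in> carrier A" "\<And>x. x \<in> X \<Longrightarrow> a (s x) = act A (a x)"
  shows "\<exists>\<phi>\<in>ghom FG A. \<forall>x\<in>X. \<phi> (free_gen X x) = a x"
proof -
  interpret A: tg A by fact
  \<comment> \<open>The default \<open>\<one>\<close> outside \<open>X\<close> makes
    \<open>b\<close> a total function into \<open>A\<close>, as the evaluation lemmas require, and
    it keeps \<open>b\<close> equivariant because \<open>s\<close> preserves the complement of
    \<open>X\<close>.\<close>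
  define b where "b x = (if x \<in> X then a x else \<one>\<^bsub>A\<^esub>)" for x
  have b: "\<And>x. b x \<in> carrier A" using a by (simp add: b_def)
  have "s x \<in> X \<longleftrightarrow> x \<in> X" for x using sX ss by metis
  hence bs: "b (s x) = act A (b x)" for x using a by (auto simp: b_def)
  \<comment> \<open>Any representative gives the same value, since evaluation does not change under
    cancellation.\<close>
  define \<phi> where "\<phi> c = word_eval A b (SOME w. w \<in> c)" for c
  have \<phi>: "\<phi> (cls w) = word_eval A b w" if "w \<in> W" for w
  proof -
    have "w \<in> cls w" using that by (simp add: cls_iff word_eq.refl)
    hence "(SOME v. v \<in> cls w) \<in> cls w" by (rule someI)
    hence "word_eq w (SOME v. v \<in> cls w)" using cls_iff[OF that] by blast
    thus ?thesis unfolding \<phi>_def using A.word_eval_cong b by metis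
  qed
  have ev_act: "word_eval A b (map (apfst s) w) = act A (word_eval A b w)" for w
  proof (induction w)
    case (Cons l w)
    have "word_eval A b w \<in> carrier A" by (rule A.word_eval_closed[OF b])
    thus ?case using Cons b by (auto simp: bs A.act_mult A.act_inv)
  qed simp
  have "\<phi> \<in> hom FG A"
    by (auto simp: hom_def carrier_FG mult_cls \<phi> A.word_eval_closed[of b, OF b] A.word_eval_append[of b, OF b])
  moreover have "\<phi> (act FG g) = act A (\<phi> g)" if "g \<in> carrier FG" for g
    using that ev_act mapW by (auto simp: carrier_FG act_cls \<phi>)
  moreover have "openin (topo FG) (kernel FG A \<phi>)"
    by (auto simp: free_gamma_group_def kernel_def)
  moreover have "\<phi> (free_gen X x) = a x" if "x \<in> X" for x
    using that \<phi>[of "[(x, True)]"] b[of x] by (simp add: free_gen_cls) (simp add: b_def)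
  ultimately show ?thesis by (auto simp: ghom_def)
qed

section \<open>Odd and p-power indices, and roots of inverted elements\<close>

lemma (in tg) rcosets_kernel_dvd:
  assumes "finite_gamma_group A" "\<phi> \<in> ghom G A"
  shows "finite (rcosets (kernel G A \<phi>))" "card (rcosets (kernel G A \<phi>)) dvd order A"
proof -
  note i = image_restrict[OF tg_axioms assms]
  note f = finite_gammaD[OF i(2)]
  interpret A: tg A by (rule finite_gammaD(6)[OF assms(1)])
  have iso: "gamma_quotient G (kernel G A \<phi>) \<cong>\<^sub>\<Gamma> gamma_restrict A (\<phi> ` carrier G)"
    using quotient_iso[OF i(3) f(1,3,6)] i(4) by simp
  then obtain h where "bij_betw h (rcosets (kernel G A \<phi>)) (\<phi> ` carrier G)"
    by (rule gamma_isoD) (simp add: gamma_restrict_def)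
  moreover have "finite (\<phi> ` carrier G)" using f(2) by (simp add: gamma_restrict_def)
  ultimately show "finite (rcosets (kernel G A \<phi>))" using bij_betw_finite by blast
  have "subgroup (\<phi> ` carrier G) A" using i(1) by (simp add: gamma_subgroup_def)
  hence "card (\<phi> ` carrier G) dvd order A" using A.lagrange by (metis dvd_triv_right)
  moreover have "card (rcosets (kernel G A \<phi>)) = card (\<phi> ` carrier G)"
    using gamma_iso_order[OF iso] by (simp add: order_def gamma_restrict_def)
  ultimately show "card (rcosets (kernel G A \<phi>)) dvd order A" by simp
qed

lemma odd_gamma_groups_eq: "odd_gamma_groups = fin_class odd"
  by (auto simp: odd_gamma_groups_def fin_class_def)

lemma p_gamma_groups_eq: "p_gamma_groups p = fin_class (\<lambda>m. \<exists>k. m = p ^ k)"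
  by (auto simp: p_gamma_groups_def fin_class_def finite_p_gamma_group_def)

lemma (in tg) index_odd:
  "completion_index odd_gamma_groups G =
    {N. N \<lhd> G \<and> gamma_subgroup G N \<and> openin (topo G) N \<and> finite (rcosets N) \<and> odd (card (rcosets N))}"
  unfolding odd_gamma_groups_eq by (rule completion_index_fin_class) auto

lemma (in tg) index_p:
  assumes "prime p"
  shows "p_index p G =
    {N. N \<lhd> G \<and> gamma_subgroup G N \<and> openin (topo G) N \<and> finite (rcosets N) \<and> (\<exists>k. card (rcosets N) = p ^ k)}"
  unfolding p_gamma_groups_eq
proof (rule completion_index_fin_class)
  show "\<exists>k. (1::nat) = p ^ k" by (rule exI[of _ 0]) simp
  show "\<And>a b. \<exists>k. b = p ^ k \<Longrightarrow> a dvd b \<Longrightarrow> \<exists>k. a = p ^ k"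
    using divides_primepow_nat[OF assms] by blast
  show "\<And>a b. \<exists>k. a = p ^ k \<Longrightarrow> \<exists>k. b = p ^ k \<Longrightarrow> \<exists>k. a * b = p ^ k"
    by (metis power_add)
qed

lemma (in tg) odd_completed: "completed G odd_gamma_groups"
  by unfold_locales (auto simp: odd_gamma_groups_def)

lemma (in tg) kernel_p_index:
  assumes "prime p" "finite_gamma_group A" "order A = p ^ h" "\<phi> \<in> ghom G A"
  shows "kernel G A \<phi> \<in> p_index p G"
  unfolding index_p[OF assms(1)] using ghom_kernel[OF assms(4) finite_gammaD(6)[OF assms(2)]]
    rcosets_kernel_dvd[OF assms(2,4)] assms(3) divides_primepow_nat[OF assms(1)] by auto

lemma (in tg) p_completed: "completed G (p_gamma_groups p)"
  by unfold_locales (auto simp: p_gamma_groups_def finite_p_gamma_group_def)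

lemma (in tg) act_pow: "x \<in> carrier G \<Longrightarrow> act G (x [^] (k::nat)) = act G x [^] k"
  by (induction k) (auto simp: act_mult)

text \<open>In a group of order 2t+1 the power \<open>e\<close> of \<open>c\<close> with exponent
  t+1 is a square root of \<open>c\<close>. It is inverted by the involution along with
  \<open>c\<close>, so \<open>Y(inv e) = e e = c\<close>.\<close>

lemma Y_root:
  assumes A: "finite_gamma_group A" "odd (order A)" and c: "c \<in> carrier A" "act A c = inv\<^bsub>A\<^esub> c"
  shows "\<exists>d\<in>carrier A. Y A d = c"
proof -
  interpret tg A by (rule finite_gammaD(6)[OF A(1)])
  obtain t where t: "order A = 2 * t + 1" using A(2) by (metis oddE)
  define e where "e = c [^]\<^bsub>A\<^esub> (t + 1 :: nat)"
  have e: "e \<in> carrier A" using c by (simp add: e_def)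
  have "e \<otimes>\<^bsub>A\<^esub> e = c [^]\<^bsub>A\<^esub> (order A + 1)"
  proof -
    have "(t + 1) + (t + 1) = order A + 1" using t by simp
    thus ?thesis unfolding e_def nat_pow_mult[OF c(1)] by (simp only:)
  qed
  also have "\<dots> = c" using c(1) pow_order_eq_1 by simp
  finally have ee: "e \<otimes>\<^bsub>A\<^esub> e = c" .
  have "act A e = inv\<^bsub>A\<^esub> e" unfolding e_def act_pow[OF c(1)] c(2) by (rule nat_pow_inv[OF c(1)])
  hence "Y A (inv\<^bsub>A\<^esub> e) = c" using e ee by (simp add: Y_def act_inv)
  thus ?thesis using e by blast
qed

lemma (in tg) closed_gamma_gen_props:
  assumes "S \<subseteq> carrier G"
  shows "gamma_subgroup G (closed_gamma_gen G S)" "closedin (topo G) (closed_gamma_gen G S)"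
    "S \<subseteq> closed_gamma_gen G S"
    "\<And>K. \<lbrakk>gamma_subgroup G K; closedin (topo G) K; S \<subseteq> K\<rbrakk> \<Longrightarrow> closed_gamma_gen G S \<subseteq> K"
proof -
  let ?F = "{K. (gamma_subgroup G K \<and> closedin (topo G) K) \<and> S \<subseteq> K}"
  have c: "carrier G \<in> ?F"
    using assms subgroup_self topspace_eq by (auto simp: gamma_subgroup_def) (metis closedin_topspace)
  have eq: "closed_gamma_gen G S = \<Inter>?F" by (simp add: closed_gamma_gen_def hull_def)
  have "subgroup (\<Inter>?F) G" using c by (intro subgroups_Inter) (auto simp: gamma_subgroup_def)
  thus "gamma_subgroup G (closed_gamma_gen G S)" unfolding eq by (auto simp: gamma_subgroup_def)
  show "closedin (topo G) (closed_gamma_gen G S)" unfolding eq using c by (intro closedin_Inter) auto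
  show "S \<subseteq> closed_gamma_gen G S" unfolding eq by auto
  show "\<And>K. \<lbrakk>gamma_subgroup G K; closedin (topo G) K; S \<subseteq> K\<rbrakk> \<Longrightarrow> closed_gamma_gen G S \<subseteq> K"
    unfolding eq by auto
qed

lemma gamma_restrict_simps[simp]:
  "carrier (gamma_restrict G K) = K" "mult (gamma_restrict G K) = mult G" "one (gamma_restrict G K) = one G"
  "act (gamma_restrict G K) = act G" "topo (gamma_restrict G K) = subtopology (topo G) K"
  by (simp_all add: gamma_restrict_def)

lemma (in tg) restrict_tg:
  assumes "gamma_subgroup G K"
  shows "tg (gamma_restrict G K)" "\<And>x. x \<in> K \<Longrightarrow> inv\<^bsub>gamma_restrict G K\<^esub> x = inv x"
proof -
  let ?R = "gamma_restrict G K"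
  have s: "subgroup K G" using assms by (simp add: gamma_subgroup_def)
  interpret K: subgroup K G by fact
  have "group (G\<lparr>carrier := K\<rparr>)" using K.subgroup_is_group[OF is_group] .
  hence g: "group ?R" using group_cong_gamma(1)[of "G\<lparr>carrier := K\<rparr>" ?R] by simp
  interpret R: group ?R by (rule g)
  show inv: "\<And>x. x \<in> K \<Longrightarrow> inv\<^bsub>?R\<^esub> x = inv x"
    by (rule R.inv_equality) (auto simp: K.m_inv_closed)
  have aK: "act G x \<in> K" if "x \<in> K" for x using assms that by (auto simp: gamma_subgroup_def)
  show "tg ?R"
  proof
    show "topspace (topo ?R) = carrier ?R" using K.subset topspace_eq by auto
  next
    fix a U assume a: "a \<in> carrier ?R" and U: "openin (topo ?R) U"
    then obtain T where T: "openin (topo G) T" "U = T \<inter> K" by (auto simp: openin_subtopology)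
    have ac: "a \<in> K" "a \<in> carrier G" using a by auto
    have "l_coset ?R a U = l_coset G a T \<inter> K"
    proof (intro equalityI subsetI)
      fix x assume "x \<in> l_coset G a T \<inter> K"
      then obtain t where t: "t \<in> T" "x = a \<otimes> t" "x \<in> K" by (auto simp: l_coset_def)
      have "t = inv a \<otimes> x" using t ac open_sub[OF T(1)] by (auto simp: m_assoc[symmetric])
      moreover have "inv a \<otimes> x \<in> K" using t(3) ac by blast
      ultimately have "t \<in> K" by simp
      thus "x \<in> l_coset ?R a U" using t T by (auto simp: l_coset_def)
    qed (use T ac in \<open>auto simp: l_coset_def\<close>)
    thus "openin (topo ?R) (l_coset ?R a U)" using ltrans_open[OF ac(2) T(1)] by (auto simp: openin_subtopology)
    have "U #>\<^bsub>?R\<^esub> a = (T #> a) \<inter> K"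
    proof (intro equalityI subsetI)
      fix x assume "x \<in> (T #> a) \<inter> K"
      then obtain t where t: "t \<in> T" "x = t \<otimes> a" "x \<in> K" by (auto simp: r_coset_def)
      have "t = x \<otimes> inv a" using t ac open_sub[OF T(1)] by (auto simp: m_assoc)
      moreover have "x \<otimes> inv a \<in> K" using t(3) ac by blast
      ultimately have "t \<in> K" by simp
      thus "x \<in> U #>\<^bsub>?R\<^esub> a" using t T by (auto simp: r_coset_def)
    qed (use T ac in \<open>auto simp: r_coset_def\<close>)
    thus "openin (topo ?R) (U #>\<^bsub>?R\<^esub> a)" using rtrans_open[OF ac(2) T(1)] by (auto simp: openin_subtopology)
  next
    fix U assume U: "openin (topo ?R) U"
    then obtain T where T: "openin (topo G) T" "U = T \<inter> K" by (auto simp: openin_subtopology)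
    have "act ?R ` U = act G ` T \<inter> K"
    proof (intro equalityI subsetI)
      fix x assume "x \<in> act G ` T \<inter> K"
      then obtain t where t: "t \<in> T" "x = act G t" "x \<in> K" by auto
      have "t = act G x" using t open_sub[OF T(1)] act_act by auto
      moreover have "act G x \<in> K" using aK t(3) by blast
      ultimately have "t \<in> U" using t T by simp
      thus "x \<in> act ?R ` U" using t by simp
    qed (use T aK in auto)
    thus "openin (topo ?R) (act ?R ` U)" using act_open[OF T(1)] by (auto simp: openin_subtopology)
  next
    show "act ?R \<in> hom ?R ?R" using aK K.mem_carrier by (auto simp: hom_def act_mult)
  qed (use act_act in auto)
qed

text \<open>What \<open>\<F> n\<close> and the free pro-p group have in common, so that one
  character count serves both. Topological generation is phrased through open subgroups, and the
  targets of the universal property carry no involution. Freeness is assumed for targets on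
  \<open>nat\<close>, as a locale assumption cannot quantify over types; \<open>univ\<close>
  transports it to all finite p-groups.\<close>

locale pfree = tg F for F :: "'a gstruct" (structure) +
  fixes p :: nat and I :: "'i set" and y :: "'i \<Rightarrow> 'a"
  assumes prime: "prime p" and finI: "finite I" and y_closed: "\<And>i. i \<in> I \<Longrightarrow> y i \<in> carrier F"
    and generated: "\<lbrakk>subgroup K F; openin (topo F) K; \<And>i. i \<in> I \<Longrightarrow> y i \<in> K\<rbrakk> \<Longrightarrow> K = carrier F"
    and univ_nat: "\<And>(A::nat monoid) a. \<lbrakk>group A; finite (carrier A); \<exists>k. order A = p ^ k; \<And>i. i \<in> I \<Longrightarrow> a i \<in> carrier A\<rbrakk>
      \<Longrightarrow> \<exists>\<phi>\<in>hom F A. openin (topo F) (kernel F A \<phi>) \<and> (\<forall>i\<in>I. \<phi> (y i) = a i)"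

text \<open>The condition \<open>act_y\<close> is all that ties freeness to the involution; the
  equivariant universal property is derived from it in \<open>guniv\<close>.\<close>

locale gfree = pfree +
  assumes act_y: "\<And>i. i \<in> I \<Longrightarrow> act F (y i) = inv (y i)" and odd_p: "odd p"

text \<open>The universal property is required for targets without involution, whereas
  \<open>\<F> n\<close> is cut out of a free group with involution. The swap on
  \<open>A \<times> A\<close> bridges the gap: an equivariant map into it, restricted to
  \<open>\<F> n\<close> and projected to the first factor, realises arbitrary prescribed values in
  \<open>A\<close>.\<close>

lemma gfree_Fn:
  assumes p: "prime p" "odd p"
  shows "gfree (\<F> n) p {1..n} (\<lambda>i. Y (free_pro_odd n) (x_gen n i))"
proof -
  let ?X = "gen_index n" and ?s = "map_prod id Not" and ?P = "free_pro_odd n"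
  interpret fw: free_words ?X ?s by unfold_locales (auto simp: gen_index_def)
  interpret D: tg "free_discrete n" by (rule fw.FG_tg)
  interpret c: completed "free_discrete n" odd_gamma_groups by (rule D.odd_completed)
  have P: "?P = c.Gh" by (simp add: free_pro_odd_def)
  interpret P: tg ?P unfolding P by (rule c.Gh_tg)
  let ?y = "\<lambda>i. Y ?P (x_gen n i)"
  have gX: "i \<in> {1..n} \<Longrightarrow> (i, b) \<in> ?X" for i b by (simp add: gen_index_def)
  have xc: "x_gen n i \<in> carrier ?P" if "i \<in> {1..n}" for i
    unfolding x_gen_def P using c.iota_closed fw.free_gen_closed gX[OF that] by blast
  have yc: "?y ` {1..n} \<subseteq> carrier ?P" using xc by auto
  let ?K = "closed_gamma_gen ?P (?y ` {1..n})"
  have F: "\<F> n = gamma_restrict ?P ?K" by (simp add: \<F>_def)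
  note K = P.closed_gamma_gen_props[OF yc]
  have sK: "subgroup ?K ?P" using K(1) by (simp add: gamma_subgroup_def)
  interpret F: tg "\<F> n" unfolding F by (rule P.restrict_tg(1)[OF K(1)])
  have yK: "?y i \<in> ?K" if "i \<in> {1..n}" for i using K(3) that by blast
  show ?thesis
  proof
    fix L assume L: "subgroup L (\<F> n)" "openin (topo (\<F> n)) L" "\<And>i. i \<in> {1..n} \<Longrightarrow> ?y i \<in> L"
    have LK: "L \<subseteq> ?K" using subgroup.subset[OF L(1)] F by simp
    have "closedin (topo (\<F> n)) L" using F.open_subgroup_closed L by blast
    hence cl: "closedin (topo ?P) L" using K(2) F closedin_trans_full by (metis gamma_restrict_simps(5))
    have Linv: "inv\<^bsub>?P\<^esub> x \<in> L" if "x \<in> L" for x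
    proof -
      have "x \<in> ?K" using LK that by blast
      from P.restrict_tg(2)[OF K(1) this] show ?thesis
        using subgroup.m_inv_closed[OF L(1) that] unfolding F by simp
    qed
    have Lmult: "x \<otimes>\<^bsub>?P\<^esub> z \<in> L" if "x \<in> L" "z \<in> L" for x z
      using subgroup.m_closed[OF L(1) that] F by simp
    have L1: "\<one>\<^bsub>?P\<^esub> \<in> L" using subgroup.one_closed[OF L(1)] F by simp
    have LP: "L \<subseteq> carrier ?P" using LK subgroup.subset[OF sK] by blast
    \<comment> \<open>An open subgroup of \<open>\<F> n\<close> need not be stable under the
      involution, but its intersection with its image under the involution is. The generators are
      inverted, so they survive in the intersection, and minimality of \<open>?K\<close> applies to
      it.\<close>
    let ?M = "L \<inter> {x \<in> carrier ?P. act ?P x \<in> L}"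
    have "gamma_subgroup ?P ?M"
      unfolding gamma_subgroup_def
    proof
      show "subgroup ?M ?P"
        using LP L1 Linv Lmult by (intro P.subgroupI) (auto simp: P.act_inv P.act_mult subset_iff)
      show "act ?P ` ?M \<subseteq> ?M" using P.act_act LP by auto
    qed
    moreover have "closedin (topo ?P) ?M"
    proof -
      have "openin (topo ?P) (act ?P ` (carrier ?P - L))" using P.act_open cl P.topspace_eq by (metis closedin_def)
      moreover have "act ?P ` (carrier ?P - L) = carrier ?P - {x \<in> carrier ?P. act ?P x \<in> L}"
      proof (intro equalityI subsetI)
        fix x assume "x \<in> carrier ?P - {x \<in> carrier ?P. act ?P x \<in> L}"
        hence "act ?P x \<in> carrier ?P - L" "x = act ?P (act ?P x)" by (auto simp: P.act_act)
        thus "x \<in> act ?P ` (carrier ?P - L)" by blast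
      qed (auto simp: P.act_act)
      ultimately have "closedin (topo ?P) {x \<in> carrier ?P. act ?P x \<in> L}"
        using P.topspace_eq by (auto simp: closedin_def)
      thus ?thesis using cl by blast
    qed
    moreover have "?y ` {1..n} \<subseteq> ?M"
      using L(3) yc Linv xc by (auto simp: P.act_Y)
    ultimately have "?K \<subseteq> ?M" using K(4) by blast
    thus "L = carrier (\<F> n)" using LK F by auto
  next
    fix A :: "nat monoid" and a
    assume A: "group A" "finite (carrier A)" "\<exists>k. order A = p ^ k" and a: "\<And>i. i \<in> {1..n} \<Longrightarrow> a i \<in> carrier A"
    interpret A: group A by fact
    \<comment> \<open>With the swap on \<open>A \<times> A\<close> every pair \<open>(a, a\<^sup>-\<^sup>1)\<close> is inverted by \<open>\<sigma>\<close>, hence a value of \<open>Y\<close>.\<close>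
    define B where "B = monoid.extend (A \<times>\<times> A) (gstruct.fields (discrete_topology (carrier A \<times> carrier A)) (\<lambda>(x, y). (y, x)))"
    have Bs: "carrier B = carrier A \<times> carrier A" "mult B = mult (A \<times>\<times> A)" "one B = one (A \<times>\<times> A)" "act B = (\<lambda>(x, y). (y, x))"
      "topo B = discrete_topology (carrier A \<times> carrier A)"
      by (simp_all add: B_def)
    have gB: "group B" using DirProd_group[OF A(1) A(1)] group_cong_gamma(1)[of "A \<times>\<times> A" B] by (simp add: Bs)
    have B: "finite_gamma_group B"
      by (rule finite_gammaI[OF gB]) (auto simp: Bs A(2) hom_def)
    have oB: "odd (order B)" using A(3) p(2) by (auto simp: order_def Bs card_cartesian_product)
    interpret B: tg B by (rule finite_gammaD(6)[OF B])
    have invB: "inv\<^bsub>B\<^esub> (u, v) = (inv\<^bsub>A\<^esub> u, inv\<^bsub>A\<^esub> v)" if "u \<in> carrier A" "v \<in> carrier A" for u v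
      using that by (intro B.inv_equality) (auto simp: Bs)
    have "\<exists>d\<in>carrier B. Y B d = (a i, inv\<^bsub>A\<^esub> a i)" if "i \<in> {1..n}" for i
      using a[OF that] by (intro Y_root[OF B oB]) (auto simp: Bs(1,4) invB)
    then obtain d where d: "\<And>i. i \<in> {1..n} \<Longrightarrow> d i \<in> carrier B" "\<And>i. i \<in> {1..n} \<Longrightarrow> Y B (d i) = (a i, inv\<^bsub>A\<^esub> a i)" by metis
    obtain \<theta> where \<theta>: "\<theta> \<in> ghom (free_discrete n) B" "\<forall>x\<in>?X. \<theta> (free_gen ?X x) = (if snd x then act B (d (fst x)) else d (fst x))"
    proof -
      let ?a = "\<lambda>x. if snd x then act B (d (fst x)) else d (fst x)"
      have dX: "d (fst x) \<in> carrier B" if "x \<in> ?X" for x using d(1) that by (auto simp: gen_index_def)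
      have "\<exists>\<phi>\<in>ghom (free_discrete n) B. \<forall>x\<in>?X. \<phi> (free_gen ?X x) = ?a x"
        by (rule fw.free_univ[OF B.tg_axioms]) (use dX B.act_act in \<open>auto simp: map_prod_def case_prod_beta\<close>)
      thus thesis using that by blast
    qed
    note kd = D.rcosets_kernel_dvd[OF B \<theta>(1)]
    have KJ: "kernel (free_discrete n) B \<theta> \<in> c.J"
      unfolding D.index_odd using D.ghom_kernel[OF \<theta>(1) B.tg_axioms] kd oB dvd_trans by (auto intro: dvd_trans)
    note e = c.ext_ghom[OF \<theta>(1) B.tg_axioms KJ, folded P]
    interpret e: group_hom ?P B "c.ext \<theta> B" by (rule P.ghom_kernel(5)[OF e(1) B.tg_axioms])
    have ex: "c.ext \<theta> B (x_gen n i) = d i" if "i \<in> {1..n}" for i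
      unfolding x_gen_def using e(2)[OF fw.free_gen_closed[OF gX[OF that]]] \<theta>(2) gX[OF that, of False] by simp
    have ey: "c.ext \<theta> B (?y i) = (a i, inv\<^bsub>A\<^esub> a i)" if "i \<in> {1..n}" for i
    proof -
      have "c.ext \<theta> B (?y i) = Y B (c.ext \<theta> B (x_gen n i))"
        using xc[OF that] e(1) by (simp add: Y_def ghom_def)
      thus ?thesis using ex d that by simp
    qed
    let ?\<phi> = "\<lambda>x. fst (c.ext \<theta> B x)"
    have KP: "x \<in> ?K \<Longrightarrow> x \<in> carrier ?P" for x using subgroup.subset[OF sK] by blast
    have ec: "c.ext \<theta> B x \<in> carrier A \<times> carrier A" if "x \<in> ?K" for x
      using e.hom_closed[OF KP[OF that]] by (simp add: Bs)
    have hom: "?\<phi> \<in> hom (\<F> n) A"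
    proof (rule homI)
      fix x z assume "x \<in> carrier (\<F> n)" "z \<in> carrier (\<F> n)"
      hence xz: "x \<in> ?K" "z \<in> ?K" by (auto simp: F)
      thus "?\<phi> (x \<otimes>\<^bsub>\<F> n\<^esub> z) = ?\<phi> x \<otimes>\<^bsub>A\<^esub> ?\<phi> z"
        using ec[OF xz(1)] ec[OF xz(2)] e.hom_mult[OF KP KP, of x z] by (auto simp: F Bs mult_DirProd')
    qed (use ec in \<open>auto simp: F mem_Times_iff\<close>)
    have sk: "subgroup (kernel (\<F> n) A ?\<phi>) (\<F> n)"
      using group_hom.subgroup_kernel[of "\<F> n" A ?\<phi>] hom F.is_group A(1) by (simp add: group_hom_iff)
    have "openin (topo ?P) (kernel ?P B (c.ext \<theta> B))" using e(1) by (simp add: ghom_def)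
    hence o: "openin (topo (\<F> n)) (kernel ?P B (c.ext \<theta> B) \<inter> ?K)" by (auto simp: F openin_subtopology)
    have "openin (topo (\<F> n)) (kernel (\<F> n) A ?\<phi>)"
      by (rule F.open_superset[OF sk o]) (use subgroup.one_closed[OF sK] in \<open>auto simp: kernel_def F Bs\<close>)
    thus "\<exists>\<phi>\<in>hom (\<F> n) A. openin (topo (\<F> n)) (kernel (\<F> n) A \<phi>) \<and> (\<forall>i\<in>{1..n}. \<phi> (?y i) = a i)"
      using hom ey by (intro bexI[of _ ?\<phi>]) auto
  next
    fix i assume i: "i \<in> {1..n}"
    show "?y i \<in> carrier (\<F> n)" using yK[OF i] by (simp add: F)
    show "act (\<F> n) (?y i) = inv\<^bsub>\<F> n\<^esub> (?y i)"
      using P.restrict_tg(2)[OF K(1) yK[OF i]] P.act_Y[OF xc[OF i]] by (simp add: F)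
  qed (use p in auto)
qed

text \<open>For generation: an open subgroup containing the generators contains the image of the
  whole discrete free group. That image is dense, so it meets every coset of a basic neighbourhood
  of the identity.\<close>

lemma pfree_free_pro_p:
  assumes p: "prime p"
  shows "pfree (free_pro_p p d) p {..<d} (\<lambda>i. completion_map (p_gamma_groups p) (free_gamma_group {..<d} id) (free_gen {..<d} i))"
    "\<And>x. x \<in> carrier (free_pro_p p d) \<Longrightarrow> act (free_pro_p p d) x = x"
proof -
  let ?D = "free_gamma_group {..<d} id"
  interpret fw: free_words "{..<d}" id by unfold_locales auto
  interpret D: tg ?D by (rule fw.FG_tg)
  interpret c: completed ?D "p_gamma_groups p" by (rule D.p_completed)
  have P: "free_pro_p p d = c.Gh" by (simp add: free_pro_p_def)
  interpret P: tg "free_pro_p p d" unfolding P by (rule c.Gh_tg)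
  show actP: "act (free_pro_p p d) x = x" if "x \<in> carrier (free_pro_p p d)" for x
  proof -
    have "act ?D g = g" for g by (simp add: free_gamma_group_def apfst_def prod.map_id0 list.map_id0)
    hence "act ?D = (\<lambda>g. g)" by auto
    thus ?thesis using that unfolding P by (intro c.mem_eqI c.act_closed') (auto simp: c.act_at)
  qed
  show "pfree (free_pro_p p d) p {..<d} (\<lambda>i. c.\<iota> (free_gen {..<d} i))"
  proof
    fix K assume K: "subgroup K (free_pro_p p d)" "openin (topo (free_pro_p p d)) K" "\<And>i. i \<in> {..<d} \<Longrightarrow> c.\<iota> (free_gen {..<d} i) \<in> K"
    interpret i: group_hom ?D c.Gh c.\<iota> using c.iota_hom D.is_group c.Gh_group by (simp add: group_hom_iff)
    have Ks: "subgroup K c.Gh" using K P by simp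
    obtain L where L: "L \<in> c.J" "{h\<in>carrier c.Gh. h L = \<one>\<^bsub>c.Gh\<^esub> L} \<subseteq> K"
      using K(2) subgroup.one_closed[OF Ks] unfolding P c.openin_Gh by blast
    have sub: "subgroup {g \<in> carrier ?D. c.\<iota> g \<in> K} ?D"
      by (intro D.subgroupI) (use subgroup.one_closed[OF Ks] subgroup.m_closed[OF Ks] subgroup.m_inv_closed[OF Ks] in auto)
    have iK: "c.\<iota> g \<in> K" if "g \<in> carrier ?D" for g
      using fw.free_gen_induct[OF sub _ that] K(3) fw.free_gen_closed by auto
    have "f \<in> K" if f: "f \<in> carrier c.Gh" for f
    proof -
      obtain g where g: "g \<in> carrier ?D" "f L = L #>\<^bsub>?D\<^esub> g" using c.mem_rep[OF f L(1)] .
      let ?k = "inv\<^bsub>c.Gh\<^esub> (c.\<iota> g)"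
      have "(?k \<otimes>\<^bsub>c.Gh\<^esub> f) L = (?k \<otimes>\<^bsub>c.Gh\<^esub> c.\<iota> g) L" unfolding c.mult_at[OF L(1)] using g c.iota_at[OF L(1)] by simp
      also have "?k \<otimes>\<^bsub>c.Gh\<^esub> c.\<iota> g = \<one>\<^bsub>c.Gh\<^esub>" using g(1) by simp
      finally have "(?k \<otimes>\<^bsub>c.Gh\<^esub> f) L = \<one>\<^bsub>c.Gh\<^esub> L" .
      moreover have "?k \<otimes>\<^bsub>c.Gh\<^esub> f \<in> carrier c.Gh"
        by (intro i.H.m_closed i.H.inv_closed c.iota_closed g f)
      ultimately have "?k \<otimes>\<^bsub>c.Gh\<^esub> f \<in> K" using L(2) by blast
      hence "c.\<iota> g \<otimes>\<^bsub>c.Gh\<^esub> (?k \<otimes>\<^bsub>c.Gh\<^esub> f) \<in> K" using subgroup.m_closed[OF Ks iK[OF g(1)]] by blast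
      thus ?thesis using f g(1) by (simp add: i.H.m_assoc[symmetric])
    qed
    thus "K = carrier (free_pro_p p d)" using subgroup.subset[OF K(1)] P by auto
  next
    fix A :: "nat monoid" and a
    assume A: "group A" "finite (carrier A)" "\<exists>k. order A = p ^ k" and a: "\<And>i. i \<in> {..<d} \<Longrightarrow> a i \<in> carrier A"
    define B where "B = monoid.extend A (gstruct.fields (discrete_topology (carrier A)) (\<lambda>x. x))"
    have Bs: "carrier B = carrier A" "mult B = mult A" "one B = one A" "act B = (\<lambda>x. x)" "topo B = discrete_topology (carrier A)"
      by (simp_all add: B_def)
    have B: "finite_gamma_group B"
      using A group_cong_gamma(1)[of A B] by (intro finite_gammaI) (auto simp: Bs hom_def)
    interpret B: tg B by (rule finite_gammaD(6)[OF B])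
    obtain \<theta> where \<theta>: "\<theta> \<in> ghom ?D B" "\<forall>x\<in>{..<d}. \<theta> (free_gen {..<d} x) = a x"
      using fw.free_univ[OF B.tg_axioms, of a] a by (auto simp: Bs)
    note kd = D.rcosets_kernel_dvd[OF B \<theta>(1)]
    have "\<exists>k. card (rcosets\<^bsub>?D\<^esub> (kernel ?D B \<theta>)) = p ^ k"
      using kd(2) A(3) divides_primepow_nat[OF p] by (auto simp: order_def Bs)
    hence KJ: "kernel ?D B \<theta> \<in> c.J"
      unfolding D.index_p[OF p] using D.ghom_kernel[OF \<theta>(1) B.tg_axioms] kd by auto
    note e = c.ext_ghom[OF \<theta>(1) B.tg_axioms KJ, folded P]
    have "hom (free_pro_p p d) B = hom (free_pro_p p d) A" by (rule group_cong_gamma(3)) (simp_all add: Bs)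
    hence "c.ext \<theta> B \<in> hom (free_pro_p p d) A" using e(1) by (simp add: ghom_def)
    moreover have "openin (topo (free_pro_p p d)) (kernel (free_pro_p p d) A (c.ext \<theta> B))"
      using e(1) by (simp add: ghom_def kernel_def Bs)
    moreover have "\<forall>i\<in>{..<d}. c.ext \<theta> B (c.\<iota> (free_gen {..<d} i)) = a i"
      using e(2) fw.free_gen_closed \<theta>(2) by auto
    ultimately show "\<exists>\<phi>\<in>hom (free_pro_p p d) A. openin (topo (free_pro_p p d)) (kernel (free_pro_p p d) A \<phi>) \<and> (\<forall>i\<in>{..<d}. \<phi> (c.\<iota> (free_gen {..<d} i)) = a i)"
      by blast
  next
    fix i assume i: "i \<in> {..<d}"
    show "c.\<iota> (free_gen {..<d} i) \<in> carrier (free_pro_p p d)"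
      unfolding P using c.iota_closed fw.free_gen_closed[OF i] by blast
  qed (use p in auto)
qed

lemma (in group) cancel_simps[simp]:
  assumes "x \<in> carrier G" "z \<in> carrier G"
  shows "x \<otimes> (inv x \<otimes> z) = z" "inv x \<otimes> (x \<otimes> z) = z"
  using assms by (simp_all add: m_assoc[symmetric])

context pfree begin

lemma univ:
  fixes A :: "('b, 'm) monoid_scheme"
  assumes A: "group A" "finite (carrier A)" "\<exists>k. order A = p ^ k" and a: "\<And>i. i \<in> I \<Longrightarrow> a i \<in> carrier A"
  shows "\<exists>\<phi>\<in>hom F A. openin (topo F) (kernel F A \<phi>) \<and> (\<forall>i\<in>I. \<phi> (y i) = a i)"
proof -
  define A' where "A' = \<lparr>carrier = carrier A, mult = mult A, one = one A, topo = discrete_topology (carrier A), act = (\<lambda>x. x)\<rparr>"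
  have "finite_gamma_group A'"
    using A group_cong_gamma(1)[of A' A] by (intro finite_gammaI) (auto simp: A'_def hom_def)
  then obtain B :: "nat gstruct" where B: "finite_gamma_group B" "A' \<cong>\<^sub>\<Gamma> B" using canonical_copy by metis
  note B' = finite_gammaD[OF B(1)]
  obtain h where h: "h \<in> iso A' B" using B(2) by (auto simp: gamma_iso_def)
  interpret A: group A by fact
  interpret B: group B by (rule B'(1))
  have gA': "group A'" using A group_cong_gamma(1)[of A' A] by (simp add: A'_def)
  let ?k = "inv_into (carrier A) h"
  have k: "?k \<in> hom B A" "bij_betw ?k (carrier B) (carrier A)"
  proof -
    have "?k \<in> iso B A'" using group.iso_set_sym[OF gA' h] by (simp add: A'_def)
    thus "?k \<in> hom B A" "bij_betw ?k (carrier B) (carrier A)" by (auto simp: iso_def A'_def hom_def)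
  qed
  have hb: "bij_betw h (carrier A) (carrier B)" using h by (simp add: iso_def A'_def)
  define B0 where "B0 = \<lparr>carrier = carrier B, mult = mult B, one = one B\<rparr>"
  have "group B0" using B.is_group group_cong_gamma(1)[of B0 B] by (simp add: B0_def)
  moreover have "finite (carrier B0)" using B' by (simp add: B0_def)
  moreover have "\<exists>k. order B0 = p ^ k"
    using A(3) bij_betw_same_card[OF hb] by (simp add: order_def B0_def)
  moreover have "h (a i) \<in> carrier B0" if "i \<in> I" for i using a[OF that] hb by (auto simp: bij_betw_def B0_def)
  ultimately obtain \<phi> where \<phi>: "\<phi> \<in> hom F B0" "openin (topo F) (kernel F B0 \<phi>)" "\<forall>i\<in>I. \<phi> (y i) = h (a i)"
    using univ_nat[of B0 "\<lambda>i. h (a i)"] by blast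
  have k1: "?k x = \<one>\<^bsub>A\<^esub> \<longleftrightarrow> x = \<one>\<^bsub>B\<^esub>" if "x \<in> carrier B" for x
    using hom_one[OF k(1) B.is_group A.is_group] k(2) that by (metis B.one_closed bij_betw_def inj_on_eq_iff)
  have "(\<lambda>x. ?k (\<phi> x)) \<in> hom F A"
    by (rule homI) (use hom_mult[OF \<phi>(1)] hom_mult[OF k(1)] hom_in_carrier[OF k(1)] hom_in_carrier[OF \<phi>(1)] in \<open>auto simp: B0_def\<close>)
  moreover have "kernel F A (\<lambda>x. ?k (\<phi> x)) = kernel F B0 \<phi>"
    using k1 hom_in_carrier[OF \<phi>(1)] by (auto simp: kernel_def B0_def)
  moreover have "?k (\<phi> (y i)) = a i" if "i \<in> I" for i
    using \<phi>(3) that a bij_betw_inv_into_left[OF hb] by simp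
  ultimately show ?thesis using \<phi>(2) by (intro bexI[of _ "\<lambda>x. ?k (\<phi> x)"]) auto
qed

lemma image_in:
  assumes "\<phi> \<in> hom F A" "group A" "openin (topo F) (kernel F A \<phi>)" "subgroup K A" "\<And>i. i \<in> I \<Longrightarrow> \<phi> (y i) \<in> K"
    "x \<in> carrier F"
  shows "\<phi> x \<in> K"
proof -
  interpret h: group_hom F A \<phi> using assms is_group by (simp add: group_hom_iff)
  let ?S = "{x \<in> carrier F. \<phi> x \<in> K}"
  have "subgroup ?S F"
    using subgroup.one_closed[OF assms(4)] subgroup.m_closed[OF assms(4)] subgroup.m_inv_closed[OF assms(4)]
    by (intro subgroupI) auto
  moreover have "openin (topo F) ?S" by (rule fibre_open[OF assms(1-3)])
  ultimately have "?S = carrier F" using assms(5) y_closed by (intro generated) auto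
  thus ?thesis using assms(6) by blast
qed

text \<open>The equaliser contains the intersection of the two open kernels, so it is an open
  subgroup containing the generators.\<close>

lemma hom_unique:
  assumes "\<phi> \<in> hom F A" "\<psi> \<in> hom F A" "group A" "openin (topo F) (kernel F A \<phi>)" "openin (topo F) (kernel F A \<psi>)"
    "\<And>i. i \<in> I \<Longrightarrow> \<phi> (y i) = \<psi> (y i)" "x \<in> carrier F"
  shows "\<phi> x = \<psi> x"
proof -
  interpret h: group_hom F A \<phi> using assms is_group by (simp add: group_hom_iff)
  interpret k: group_hom F A \<psi> using assms is_group by (simp add: group_hom_iff)
  let ?S = "{x \<in> carrier F. \<phi> x = \<psi> x}"
  have s: "subgroup ?S F" by (intro subgroupI) auto
  have "openin (topo F) (kernel F A \<phi> \<inter> kernel F A \<psi>)" using assms by blast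
  hence "openin (topo F) ?S" by (rule open_superset[OF s]) (auto simp: kernel_def)
  with s have "?S = carrier F" using assms(6) y_closed by (intro generated) auto
  thus ?thesis using assms(7) by blast
qed

end

text \<open>Take the map \<open>\<phi>\<close> given by plain freeness and conjugate it by the two
  involutions. Both maps send \<open>y i\<close> to \<open>a i\<close>, because \<open>y i\<close>
  and \<open>a i\<close> are both inverted; uniqueness makes them equal, which is
  equivariance.\<close>

lemma (in gfree) guniv:
  assumes A: "finite_gamma_group A" "\<exists>k. order A = p ^ k"
    and a: "\<And>i. i \<in> I \<Longrightarrow> a i \<in> carrier A" "\<And>i. i \<in> I \<Longrightarrow> act A (a i) = inv\<^bsub>A\<^esub> (a i)"
  shows "\<exists>\<phi>\<in>ghom F A. \<forall>i\<in>I. \<phi> (y i) = a i"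
proof -
  note A' = finite_gammaD[OF A(1)]
  interpret A: tg A by (rule A'(6))
  obtain \<phi> where \<phi>: "\<phi> \<in> hom F A" "openin (topo F) (kernel F A \<phi>)" "\<forall>i\<in>I. \<phi> (y i) = a i"
    using univ[OF A'(1,2) A(2), of a] a by blast
  interpret h: group_hom F A \<phi> using \<phi> is_group A'(1) by (simp add: group_hom_iff)
  let ?\<psi> = "\<lambda>x. act A (\<phi> (act F x))"
  have psi: "?\<psi> \<in> hom F A" by (rule homI) (auto simp: act_mult A.act_mult)
  have "kernel F A ?\<psi> = act F ` kernel F A \<phi>"
  proof (intro equalityI subsetI)
    fix x assume x: "x \<in> kernel F A ?\<psi>"
    hence "act F x \<in> kernel F A \<phi>" using A.act_act[of "\<phi> (act F x)"] by (auto simp: kernel_def)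
    moreover have "x = act F (act F x)" using x by (simp add: kernel_def act_act)
    ultimately show "x \<in> act F ` kernel F A \<phi>" by blast
  qed (auto simp: kernel_def act_act)
  hence o: "openin (topo F) (kernel F A ?\<psi>)" using act_open[OF \<phi>(2)] by simp
  have "?\<psi> x = \<phi> x" if "x \<in> carrier F" for x
    by (rule hom_unique[OF psi \<phi>(1) A'(1) o \<phi>(2) _ that])
      (use \<phi>(3) a y_closed in \<open>simp add: act_y A.act_inv\<close>)
  hence "\<phi> (act F x) = act A (\<phi> x)" if "x \<in> carrier F" for x
    using that by (metis A.act_act act_closed h.hom_closed)
  thus ?thesis using \<phi> by (intro bexI[of _ \<phi>]) (simp_all add: ghom_def)
qed

section \<open>Central characters and cocycles\<close>

text \<open>The complex \<open>p\<close>-th roots of unity play the role of \<open>\<int>/p\<close>.\<close>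

definition mu :: "nat \<Rightarrow> complex set" where "mu p = {z. z ^ p = 1}"

lemma mu_simps[simp]:
  "1 \<in> mu p" "x \<in> mu p \<Longrightarrow> z \<in> mu p \<Longrightarrow> x * z \<in> mu p" "x \<in> mu p \<Longrightarrow> inverse x \<in> mu p"
  "x \<in> mu p \<Longrightarrow> z \<in> mu p \<Longrightarrow> x / z \<in> mu p" "x \<in> mu p \<Longrightarrow> x ^ k \<in> mu p"
  by (auto simp: mu_def power_mult_distrib power_inverse power_divide) (metis power_mult mult.commute power_one)

lemma mu_nz: "p > 0 \<Longrightarrow> x \<in> mu p \<Longrightarrow> x \<noteq> 0" by (auto simp: mu_def power_0_left)

lemma card_mu: "p > 0 \<Longrightarrow> card (mu p) = p" "p > 0 \<Longrightarrow> finite (mu p)"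
  unfolding mu_def using card_roots_unity_eq[of p] finite_roots_unity[of p] by auto

definition omega :: "nat \<Rightarrow> complex" where "omega p = cis (2 * pi / real p)"

lemma omega_mu: "p > 0 \<Longrightarrow> omega p \<in> mu p"
  by (simp add: omega_def mu_def Complex.DeMoivre)

lemma omega_powers:
  assumes "p > 0"
  shows "inj_on (\<lambda>k. omega p ^ k) {..<p}" "(\<lambda>k. omega p ^ k) ` {..<p} = mu p"
proof -
  have "bij_betw (\<lambda>k. cis (2 * pi * real k / real p)) {..<p} {z. z ^ p = 1}"
    by (rule Complex.bij_betw_roots_unity[OF assms])
  moreover have "cis (2 * pi * real k / real p) = omega p ^ k" for k
    by (simp add: omega_def Complex.DeMoivre mult_ac)
  ultimately have "bij_betw (\<lambda>k. omega p ^ k) {..<p} (mu p)" by (simp add: mu_def)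
  thus "inj_on (\<lambda>k. omega p ^ k) {..<p}" "(\<lambda>k. omega p ^ k) ` {..<p} = mu p" by (auto simp: bij_betw_def)
qed

text \<open>Normalised 2-cocycles for the trivial action. The normalisation makes the pair of
  identities the unit of the associated extension, and makes a trivialisation of the inflated
  cocycle multiplicative on the kernel.\<close>

definition cocycles :: "nat \<Rightarrow> ('h, 'm) monoid_scheme \<Rightarrow> ('h \<times> 'h \<Rightarrow> complex) set" where
  "cocycles p H = {c \<in> (carrier H \<times> carrier H) \<rightarrow>\<^sub>E mu p.
     (\<forall>h\<in>carrier H. c (\<one>\<^bsub>H\<^esub>, h) = 1 \<and> c (h, \<one>\<^bsub>H\<^esub>) = 1) \<and>
     (\<forall>a\<in>carrier H. \<forall>b\<in>carrier H. \<forall>d\<in>carrier H. c (a, b) * c (a \<otimes>\<^bsub>H\<^esub> b, d) = c (b, d) * c (a, b \<otimes>\<^bsub>H\<^esub> d))}"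

text \<open>The \<open>F\<close>-invariant continuous homomorphisms from \<open>N\<close> to the
  p-th roots of unity, in other words the dual of \<open>N/N^p[N,F]\<close>. The functions are
  extensional on \<open>N\<close>, so that they can be counted.\<close>

definition central_chars :: "nat \<Rightarrow> 'a gstruct \<Rightarrow> 'a set \<Rightarrow> ('a \<Rightarrow> complex) set" where
  "central_chars p F N = {c \<in> N \<rightarrow>\<^sub>E mu p.
     (\<forall>a\<in>N. \<forall>b\<in>N. c (a \<otimes>\<^bsub>F\<^esub> b) = c a * c b) \<and>
     (\<forall>g\<in>carrier F. \<forall>a\<in>N. c (g \<otimes>\<^bsub>F\<^esub> a \<otimes>\<^bsub>F\<^esub> inv\<^bsub>F\<^esub> g) = c a) \<and> openin (topo F) {a\<in>N. c a = 1}}"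

text \<open>The central extension of \<open>H\<close> by the p-th roots of unity with factor set
  \<open>c\<close>.\<close>

definition cocycle_ext :: "nat \<Rightarrow> ('h, 'm) monoid_scheme \<Rightarrow> ('h \<times> 'h \<Rightarrow> complex) \<Rightarrow> ('h \<times> complex) monoid" where
  "cocycle_ext p H c = \<lparr>carrier = carrier H \<times> mu p,
     mult = (\<lambda>(h, s) (k, t). (h \<otimes>\<^bsub>H\<^esub> k, s * t * c (h, k))), one = (\<one>\<^bsub>H\<^esub>, 1)\<rparr>"

lemma cocycle_ext_group:
  assumes "group H" "c \<in> cocycles p H" "p > 0"
  shows "group (cocycle_ext p H c)"
proof -
  interpret H: group H by fact
  have c: "\<And>a b. a \<in> carrier H \<Longrightarrow> b \<in> carrier H \<Longrightarrow> c (a, b) \<in> mu p"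
    "\<And>h. h \<in> carrier H \<Longrightarrow> c (\<one>\<^bsub>H\<^esub>, h) = 1" "\<And>h. h \<in> carrier H \<Longrightarrow> c (h, \<one>\<^bsub>H\<^esub>) = 1"
    "\<And>a b d. a \<in> carrier H \<Longrightarrow> b \<in> carrier H \<Longrightarrow> d \<in> carrier H \<Longrightarrow>
      c (a, b) * c (a \<otimes>\<^bsub>H\<^esub> b, d) = c (b, d) * c (a, b \<otimes>\<^bsub>H\<^esub> d)"
    using assms(2) by (auto simp: cocycles_def)
  show ?thesis
  proof (rule groupI)
    fix x z w assume "x \<in> carrier (cocycle_ext p H c)" "z \<in> carrier (cocycle_ext p H c)" "w \<in> carrier (cocycle_ext p H c)"
    then obtain h s k t l u where "x = (h, s)" "z = (k, t)" "w = (l, u)" and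
      *: "h \<in> carrier H" "k \<in> carrier H" "l \<in> carrier H" by (auto simp: cocycle_ext_def)
    moreover have "s * t * c (h, k) * u * c (h \<otimes>\<^bsub>H\<^esub> k, l) = s * t * u * (c (h, k) * c (h \<otimes>\<^bsub>H\<^esub> k, l))" by (simp add: mult_ac)
    moreover have "s * (t * u * c (k, l)) * c (h, k \<otimes>\<^bsub>H\<^esub> l) = s * t * u * (c (k, l) * c (h, k \<otimes>\<^bsub>H\<^esub> l))" by (simp add: mult_ac)
    ultimately show "x \<otimes>\<^bsub>cocycle_ext p H c\<^esub> z \<otimes>\<^bsub>cocycle_ext p H c\<^esub> w = x \<otimes>\<^bsub>cocycle_ext p H c\<^esub> (z \<otimes>\<^bsub>cocycle_ext p H c\<^esub> w)"
      using c(4)[OF *] by (simp add: cocycle_ext_def H.m_assoc)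
  next
    fix x assume "x \<in> carrier (cocycle_ext p H c)"
    then obtain h s where x: "x = (h, s)" "h \<in> carrier H" "s \<in> mu p" by (auto simp: cocycle_ext_def)
    show "\<one>\<^bsub>cocycle_ext p H c\<^esub> \<otimes>\<^bsub>cocycle_ext p H c\<^esub> x = x" using x c by (simp add: cocycle_ext_def)
    have "(inv\<^bsub>H\<^esub> h, inverse (s * c (inv\<^bsub>H\<^esub> h, h))) \<in> carrier (cocycle_ext p H c)"
      using x c by (simp add: cocycle_ext_def)
    moreover have "(inv\<^bsub>H\<^esub> h, inverse (s * c (inv\<^bsub>H\<^esub> h, h))) \<otimes>\<^bsub>cocycle_ext p H c\<^esub> x = \<one>\<^bsub>cocycle_ext p H c\<^esub>"
      using x mu_nz[OF assms(3) x(3)] mu_nz[OF assms(3) c(1)[of "inv\<^bsub>H\<^esub> h" h]] by (simp add: cocycle_ext_def field_simps)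
    ultimately show "\<exists>z\<in>carrier (cocycle_ext p H c). z \<otimes>\<^bsub>cocycle_ext p H c\<^esub> x = \<one>\<^bsub>cocycle_ext p H c\<^esub>" by blast
  qed (use c in \<open>auto simp: cocycle_ext_def\<close>)
qed

context pfree begin

context
  fixes H :: "('h, 'm) monoid_scheme" and \<phi> N
  assumes H: "group H" "finite (carrier H)" "\<exists>k. order H = p ^ k"
    and \<phi>: "\<phi> \<in> hom F H" "\<phi> ` carrier F = carrier H" "openin (topo F) (kernel F H \<phi>)"
    and N_def: "N = kernel F H \<phi>"
begin

interpretation H: group H by (rule H(1))
interpretation \<phi>: group_hom F H \<phi> using \<phi> is_group H by (simp add: group_hom_iff)

lemma p_pos: "p > 0" using prime prime_gt_0_nat by blast

text \<open>The functions \<open>\<xi>\<close> trivialising the inflation of a cocycle \<open>c\<close> are determined by \<open>c\<close> and their values on the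
  generators, and also by \<open>c\<close>, a central character of \<open>N\<close> and their values on coset representatives.\<close>

definition twisted :: "(('h \<times> 'h \<Rightarrow> complex) \<times> ('a \<Rightarrow> complex)) set" where
  "twisted = {(c, \<xi>). c \<in> cocycles p H \<and> \<xi> \<in> carrier F \<rightarrow>\<^sub>E mu p \<and> openin (topo F) {a\<in>N. \<xi> a = 1} \<and>
     (\<forall>a\<in>carrier F. \<forall>b\<in>carrier F. \<xi> (a \<otimes> b) = \<xi> a * \<xi> b * c (\<phi> a, \<phi> b))}"

lemma twistedD:
  assumes "(c, \<xi>) \<in> twisted"
  shows "c \<in> cocycles p H" "\<And>a. a \<in> carrier F \<Longrightarrow> \<xi> a \<in> mu p" "\<And>a. a \<in> carrier F \<Longrightarrow> \<xi> a \<noteq> 0" "\<xi> \<in> extensional (carrier F)"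
    "openin (topo F) {a\<in>N. \<xi> a = 1}"
    "\<And>a b. a \<in> carrier F \<Longrightarrow> b \<in> carrier F \<Longrightarrow> \<xi> (a \<otimes> b) = \<xi> a * \<xi> b * c (\<phi> a, \<phi> b)"
    "\<xi> \<one> = 1" "\<And>h. h \<in> carrier H \<Longrightarrow> c (\<one>\<^bsub>H\<^esub>, h) = 1" "\<And>h. h \<in> carrier H \<Longrightarrow> c (h, \<one>\<^bsub>H\<^esub>) = 1"
    "\<And>a b. a \<in> carrier H \<Longrightarrow> b \<in> carrier H \<Longrightarrow> c (a, b) \<in> mu p"
    "\<And>a b. a \<in> carrier H \<Longrightarrow> b \<in> carrier H \<Longrightarrow> c (a, b) \<noteq> 0"
proof -
  show 1: "c \<in> cocycles p H" "\<And>a. a \<in> carrier F \<Longrightarrow> \<xi> a \<in> mu p" "\<xi> \<in> extensional (carrier F)"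
    "openin (topo F) {a\<in>N. \<xi> a = 1}"
    "\<And>a b. a \<in> carrier F \<Longrightarrow> b \<in> carrier F \<Longrightarrow> \<xi> (a \<otimes> b) = \<xi> a * \<xi> b * c (\<phi> a, \<phi> b)"
    using assms by (auto simp: twisted_def PiE_def)
  show 2: "\<And>a. a \<in> carrier F \<Longrightarrow> \<xi> a \<noteq> 0" using 1(2) mu_nz[OF p_pos] by blast
  show 3: "\<And>h. h \<in> carrier H \<Longrightarrow> c (\<one>\<^bsub>H\<^esub>, h) = 1" "\<And>h. h \<in> carrier H \<Longrightarrow> c (h, \<one>\<^bsub>H\<^esub>) = 1"
    "\<And>a b. a \<in> carrier H \<Longrightarrow> b \<in> carrier H \<Longrightarrow> c (a, b) \<in> mu p"
    using 1(1) by (auto simp: cocycles_def)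
  thus "\<And>a b. a \<in> carrier H \<Longrightarrow> b \<in> carrier H \<Longrightarrow> c (a, b) \<noteq> 0" using mu_nz[OF p_pos] by blast
  show "\<xi> \<one> = 1" using 1(5)[of \<one> \<one>] 2[of \<one>] 3(1)[of "\<one>\<^bsub>H\<^esub>"] by simp
qed

text \<open>For fixed \<open>c\<close>, a trivialisation \<open>\<xi>\<close> is the same as a lift
  of \<open>\<phi>\<close> to the central extension, namely
  \<open>x \<mapsto> (\<phi> x, \<xi> x)\<close>. Freeness lets the second coordinates at the
  generators be prescribed arbitrarily, and generation makes them determine the lift.\<close>

lemma twisted_count1: "card twisted = card (cocycles p H) * p ^ card I"
proof -
  let ?f = "\<lambda>(c, \<xi>). (c, \<lambda>i\<in>I. \<xi> (y i))"
  have "bij_betw ?f twisted (cocycles p H \<times> (I \<rightarrow>\<^sub>E mu p))"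
    unfolding bij_betw_def
  proof
    show "inj_on ?f twisted"
    proof (rule inj_onI)
      fix u u' assume u: "u \<in> twisted" "u' \<in> twisted" "?f u = ?f u'"
      obtain c \<xi> c' \<xi>' where uu: "u = (c, \<xi>)" "u' = (c', \<xi>')" by (cases u, cases u') auto
      have *: "(c, \<xi>) \<in> twisted" "(c', \<xi>') \<in> twisted" "(c, \<lambda>i\<in>I. \<xi> (y i)) = (c', \<lambda>i\<in>I. \<xi>' (y i))"
        using u uu by auto
      have cc: "c' = c" and yy: "\<And>i. i \<in> I \<Longrightarrow> \<xi> (y i) = \<xi>' (y i)"
      proof -
        show "c' = c" using *(3) by simp
        fix i assume "i \<in> I"
        have "(\<lambda>i\<in>I. \<xi> (y i)) = (\<lambda>i\<in>I. \<xi>' (y i))" using *(3) by simp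
        from fun_cong[OF this, of i] \<open>i \<in> I\<close> show "\<xi> (y i) = \<xi>' (y i)" by simp
      qed
      note t = twistedD[OF *(1)] and t' = twistedD[OF *(2)[unfolded cc]]
      let ?S = "{x \<in> carrier F. \<xi> x = \<xi>' x}"
      have s: "subgroup ?S F"
      proof (intro subgroupI)
        fix a assume a: "a \<in> ?S"
        have "\<xi> a * \<xi> (inv a) * c (\<phi> a, \<phi> (inv a)) = \<xi>' a * \<xi>' (inv a) * c (\<phi> a, \<phi> (inv a))"
          using t(6)[of a "inv a"] t'(6)[of a "inv a"] a t(7) t'(7) by simp
        moreover have "\<xi> a \<noteq> 0" "c (\<phi> a, \<phi> (inv a)) \<noteq> 0" using a t(3) t(11)[of "\<phi> a" "\<phi> (inv a)"] by auto
        ultimately show "inv a \<in> ?S" using a by simp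
      qed (use t(6,7) t'(6,7) in auto)
      have "openin (topo F) ({a\<in>N. \<xi> a = 1} \<inter> {a\<in>N. \<xi>' a = 1})" using t(5) t'(5) by blast
      hence "openin (topo F) ?S"
        by (rule open_superset[OF s]) (use t(7) t'(7) in \<open>auto simp: N_def kernel_def\<close>)
      with s have "?S = carrier F" using yy y_closed by (intro generated) auto
      hence "\<xi> = \<xi>'" using t(4) t'(4) by (intro extensionalityI) auto
      thus "u = u'" using cc uu by simp
    qed
    show "?f ` twisted = cocycles p H \<times> (I \<rightarrow>\<^sub>E mu p)"
    proof (intro equalityI subsetI)
      fix z assume "z \<in> ?f ` twisted"
      thus "z \<in> cocycles p H \<times> (I \<rightarrow>\<^sub>E mu p)" using twistedD(1,2) y_closed by auto
    next
      fix z assume "z \<in> cocycles p H \<times> (I \<rightarrow>\<^sub>E mu p)"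
      then obtain c t where z: "z = (c, t)" and c: "c \<in> cocycles p H" and t: "t \<in> I \<rightarrow>\<^sub>E mu p" by auto
      let ?E = "cocycle_ext p H c"
      interpret E: group ?E by (rule cocycle_ext_group[OF H(1) c p_pos])
      have "\<exists>k. order ?E = p ^ k"
        using H(3) card_mu[OF p_pos]
        by (auto simp: order_def cocycle_ext_def card_cartesian_product) (metis power_Suc2)
      moreover have "finite (carrier ?E)" using H(2) card_mu[OF p_pos] by (simp add: cocycle_ext_def)
      moreover have "(\<phi> (y i), t i) \<in> carrier ?E" if "i \<in> I" for i using that t y_closed by (auto simp: cocycle_ext_def)
      ultimately obtain \<theta> where \<theta>: "\<theta> \<in> hom F ?E" "openin (topo F) (kernel F ?E \<theta>)" "\<forall>i\<in>I. \<theta> (y i) = (\<phi> (y i), t i)"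
        using univ[OF E.is_group, of "\<lambda>i. (\<phi> (y i), t i)"] by blast
      have tc: "\<theta> x \<in> carrier H \<times> mu p" if "x \<in> carrier F" for x
        using hom_in_carrier[OF \<theta>(1) that] by (simp add: cocycle_ext_def)
      have tm: "\<theta> (a \<otimes> b) = (fst (\<theta> a) \<otimes>\<^bsub>H\<^esub> fst (\<theta> b), snd (\<theta> a) * snd (\<theta> b) * c (fst (\<theta> a), fst (\<theta> b)))"
        if "a \<in> carrier F" "b \<in> carrier F" for a b
        using hom_mult[OF \<theta>(1) that] by (simp add: cocycle_ext_def case_prod_beta)
      have fh: "(\<lambda>x. fst (\<theta> x)) \<in> hom F H" by (rule homI) (use tc tm in \<open>auto simp: mem_Times_iff\<close>)
      have "subgroup (kernel F H (\<lambda>x. fst (\<theta> x))) F"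
        using group_hom.subgroup_kernel[of F H] fh is_group H(1) by (simp add: group_hom_iff)
      hence fo: "openin (topo F) (kernel F H (\<lambda>x. fst (\<theta> x)))"
        by (rule open_superset[OF _ \<theta>(2)]) (use hom_one[OF \<theta>(1) is_group E.is_group] in \<open>auto simp: kernel_def cocycle_ext_def\<close>)
      have ft: "fst (\<theta> x) = \<phi> x" if "x \<in> carrier F" for x
        by (rule hom_unique[OF fh \<phi>(1) H(1) fo \<phi>(3) _ that]) (use \<theta>(3) in simp)
      define \<xi> where "\<xi> = (\<lambda>x\<in>carrier F. snd (\<theta> x))"
      have "{a\<in>N. \<xi> a = 1} = kernel F ?E \<theta>"
        using ft by (auto simp: N_def kernel_def \<xi>_def cocycle_ext_def prod_eq_iff)
      hence "(c, \<xi>) \<in> twisted"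
        unfolding twisted_def using c tc tm \<theta>(2) ft by (auto simp: \<xi>_def mem_Times_iff)
      moreover have "?f (c, \<xi>) = z"
      proof -
        have "(\<lambda>i\<in>I. \<xi> (y i)) = t"
          using t \<theta>(3) y_closed by (intro extensionalityI[of _ I]) (auto simp: \<xi>_def PiE_def)
        thus ?thesis using z by simp
      qed
      ultimately show "z \<in> ?f ` twisted"
        using imageI[of "(c, \<xi>)" twisted ?f] back_subst[where P = "\<lambda>x. x \<in> ?f ` twisted"] by (metis (no_types))
    qed
  qed
  thus ?thesis using bij_betw_same_card card_mu[OF p_pos] finI
    by (simp add: card_cartesian_product card_PiE bij_betw_same_card)
qed

text \<open>Every \<open>g\<close> is \<open>?\<nu> g\<close> times its coset representative, with
  \<open>?\<nu> g\<close> in \<open>N\<close>. So \<open>\<xi>\<close> is determined by a central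
  character of \<open>N\<close> together with its values at the representatives of the nontrivial
  cosets. Both can be prescribed freely, and \<open>c\<close> is then forced.\<close>

lemma twisted_count2: "card twisted = card (central_chars p F N) * p ^ (order H - 1)"
proof -
  have "\<forall>h\<in>carrier H. \<exists>x. x \<in> carrier F \<and> \<phi> x = h"
  proof
    fix h assume "h \<in> carrier H"
    hence "h \<in> \<phi> ` carrier F" using \<phi>(2) by simp
    thus "\<exists>x. x \<in> carrier F \<and> \<phi> x = h" by auto
  qed
  then obtain sel where sel: "\<And>h. h \<in> carrier H \<Longrightarrow> sel h \<in> carrier F \<and> \<phi> (sel h) = h" by metis
  \<comment> \<open>The identity is its own representative. Its value is therefore forced to be 1,
    which accounts for the exponent \<open>order H - 1\<close>, and the cocycle constructed below
    comes out normalised.\<close>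
  define s where "s h = (if h = \<one>\<^bsub>H\<^esub> then \<one> else sel h)" for h
  have s: "s h \<in> carrier F \<and> \<phi> (s h) = h" if "h \<in> carrier H" for h
    using sel[OF that] by (simp add: s_def)
  have s1: "s \<one>\<^bsub>H\<^esub> = \<one>" by (simp add: s_def)
  have NI: "x \<in> N \<longleftrightarrow> x \<in> carrier F \<and> \<phi> x = \<one>\<^bsub>H\<^esub>" for x by (auto simp: N_def kernel_def)
  have Nn: "g \<otimes> a \<otimes> inv g \<in> N" if "g \<in> carrier F" "a \<in> N" for g a using that by (simp add: NI)
  let ?\<nu> = "\<lambda>g. g \<otimes> inv (s (\<phi> g))"
  have \<nu>: "?\<nu> g \<in> N" if "g \<in> carrier F" for g using that s[of "\<phi> g"] by (simp add: NI)
  let ?f = "\<lambda>(c, \<xi>). (restrict \<xi> N, \<lambda>h\<in>carrier H - {\<one>\<^bsub>H\<^esub>}. \<xi> (s h))"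
  have "bij_betw ?f twisted (central_chars p F N \<times> ((carrier H - {\<one>\<^bsub>H\<^esub>}) \<rightarrow>\<^sub>E mu p))"
    unfolding bij_betw_def
  proof
    show "inj_on ?f twisted"
    proof (rule inj_onI)
      fix u u' assume u: "u \<in> twisted" "u' \<in> twisted" "?f u = ?f u'"
      obtain c \<xi> c' \<xi>' where uu: "u = (c, \<xi>)" "u' = (c', \<xi>')" by (cases u, cases u') auto
      have *: "(c, \<xi>) \<in> twisted" "(c', \<xi>') \<in> twisted"
        "restrict \<xi> N = restrict \<xi>' N" "(\<lambda>h\<in>carrier H - {\<one>\<^bsub>H\<^esub>}. \<xi> (s h)) = (\<lambda>h\<in>carrier H - {\<one>\<^bsub>H\<^esub>}. \<xi>' (s h))"
        using u unfolding uu by simp_all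
      note t = twistedD[OF *(1)] and t' = twistedD[OF *(2)]
      have eN: "\<xi> a = \<xi>' a" if "a \<in> N" for a using fun_cong[OF *(3), of a] that by simp
      have eH: "\<xi> (s h) = \<xi>' (s h)" if "h \<in> carrier H" for h
        using fun_cong[OF *(4), of h] that s1 t(7) t'(7) by (cases "h = \<one>\<^bsub>H\<^esub>") auto
      have dec: "\<zeta> g = \<zeta> (?\<nu> g) * \<zeta> (s (\<phi> g))" if "(d, \<zeta>) \<in> twisted" "g \<in> carrier F" for d \<zeta> g
      proof -
        note u = twistedD[OF that(1)]
        have "g = ?\<nu> g \<otimes> s (\<phi> g)" using that s[of "\<phi> g"] by (simp add: m_assoc)
        hence "\<zeta> g = \<zeta> (?\<nu> g \<otimes> s (\<phi> g))" by simp
        also have "\<dots> = \<zeta> (?\<nu> g) * \<zeta> (s (\<phi> g)) * d (\<phi> (?\<nu> g), \<phi> (s (\<phi> g)))"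
          using that s[of "\<phi> g"] by (intro u(6)) auto
        also have "d (\<phi> (?\<nu> g), \<phi> (s (\<phi> g))) = 1"
          using \<nu>[OF that(2)] that s[of "\<phi> g"] u(8) unfolding NI by (simp del: \<phi>.hom_mult)
        finally show ?thesis by simp
      qed
      have eF: "\<xi> g = \<xi>' g" if "g \<in> carrier F" for g
        using dec[OF *(1) that] dec[OF *(2) that] eN[OF \<nu>[OF that]] eH[of "\<phi> g"] that by simp
      have "\<xi> = \<xi>'" using t(4) t'(4) eF by (intro extensionalityI) auto
      moreover have "c x = c' x" if x: "x \<in> carrier H \<times> carrier H" for x
      proof -
        obtain h k where hk: "x = (h, k)" "h \<in> carrier H" "k \<in> carrier H" using x by auto
        note sh = s[OF hk(2)] and sk = s[OF hk(3)]
        have "\<xi> (s h) * \<xi> (s k) * c (h, k) = \<xi> (s h) * \<xi> (s k) * c' (h, k)"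
          using t(6)[of "s h" "s k"] t'(6)[of "s h" "s k"] sh sk unfolding \<open>\<xi> = \<xi>'\<close> by (metis (no_types))
        moreover have "\<xi> (s h) \<noteq> 0" "\<xi> (s k) \<noteq> 0" using t(3) sh sk by auto
        ultimately show ?thesis using hk by simp
      qed
      moreover have "c \<in> extensional (carrier H \<times> carrier H)" "c' \<in> extensional (carrier H \<times> carrier H)"
        using t(1) t'(1) by (auto simp: cocycles_def PiE_def)
      ultimately show "u = u'" unfolding uu by (auto intro: extensionalityI)
    qed
    show "?f ` twisted = central_chars p F N \<times> ((carrier H - {\<one>\<^bsub>H\<^esub>}) \<rightarrow>\<^sub>E mu p)"
    proof (intro equalityI subsetI)
      fix z assume "z \<in> ?f ` twisted"
      then obtain c \<xi> where z: "(c, \<xi>) \<in> twisted" "z = ?f (c, \<xi>)" by auto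
      note t = twistedD[OF z(1)]
      have "\<xi> (g \<otimes> a \<otimes> inv g) = \<xi> a" if g: "g \<in> carrier F" and a: "a \<in> N" for g a
      proof -
        have a': "a \<in> carrier F" "\<phi> a = \<one>\<^bsub>H\<^esub>" using a NI by auto
        have "\<xi> (g \<otimes> a \<otimes> inv g) * \<xi> g = \<xi> (g \<otimes> a \<otimes> inv g \<otimes> g)"
          using t(6)[of "g \<otimes> a \<otimes> inv g" g] g a' t(8) by simp
        also have "g \<otimes> a \<otimes> inv g \<otimes> g = g \<otimes> a" using g a' by (simp add: m_assoc)
        also have "\<xi> (g \<otimes> a) = \<xi> g * \<xi> a" using t(6)[of g a] g a' t(9) by simp
        finally show ?thesis using t(3)[OF g] by simp
      qed
      moreover have "\<xi> (a \<otimes> b) = \<xi> a * \<xi> b" "a \<otimes> b \<in> N" if "a \<in> N" "b \<in> N" for a b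
        using that t(6)[of a b] t(8) by (auto simp: NI)
      moreover have "{a \<in> N. restrict \<xi> N a = 1} = {a \<in> N. \<xi> a = 1}" by auto
      ultimately have "restrict \<xi> N \<in> central_chars p F N"
        unfolding central_chars_def using t(2,5) Nn by (auto simp: NI)
      thus "z \<in> central_chars p F N \<times> ((carrier H - {\<one>\<^bsub>H\<^esub>}) \<rightarrow>\<^sub>E mu p)"
        using z(2) t(2) s by auto
    next
      fix z assume "z \<in> central_chars p F N \<times> ((carrier H - {\<one>\<^bsub>H\<^esub>}) \<rightarrow>\<^sub>E mu p)"
      then obtain \<kappa> v where z: "z = (\<kappa>, v)" and \<kappa>: "\<kappa> \<in> central_chars p F N" and v: "v \<in> (carrier H - {\<one>\<^bsub>H\<^esub>}) \<rightarrow>\<^sub>E mu p" by auto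
      have k: "\<And>a. a \<in> N \<Longrightarrow> \<kappa> a \<in> mu p" "\<kappa> \<in> extensional N" "\<And>a b. a \<in> N \<Longrightarrow> b \<in> N \<Longrightarrow> \<kappa> (a \<otimes> b) = \<kappa> a * \<kappa> b"
        "\<And>g a. g \<in> carrier F \<Longrightarrow> a \<in> N \<Longrightarrow> \<kappa> (g \<otimes> a \<otimes> inv g) = \<kappa> a" "openin (topo F) {a\<in>N. \<kappa> a = 1}"
        using \<kappa> by (auto simp: central_chars_def PiE_def)
      have knz: "\<And>a. a \<in> N \<Longrightarrow> \<kappa> a \<noteq> 0" using k(1) mu_nz[OF p_pos] by blast
      have k1: "\<kappa> \<one> = 1" using k(3)[of \<one> \<one>] knz[of \<one>] by (simp add: NI)
      define v' where "v' h = (if h = \<one>\<^bsub>H\<^esub> then 1 else v h)" for h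
      have v': "v' h \<in> mu p" if "h \<in> carrier H" for h using v that by (auto simp: v'_def)
      have vnz: "v' h \<noteq> 0" if "h \<in> carrier H" for h using v' mu_nz[OF p_pos] that by blast
      let ?d = "\<lambda>h k. s h \<otimes> s k \<otimes> inv (s (h \<otimes>\<^bsub>H\<^esub> k))"
      \<comment> \<open>Solved from the defining relation of \<open>twisted\<close> at pairs of
        representatives; their defect \<open>?d h k\<close> lies in \<open>N\<close>, where
        \<open>\<kappa>\<close> is available.\<close>
      define c where "c = (\<lambda>(h, k)\<in>carrier H \<times> carrier H. \<kappa> (?d h k) * v' (h \<otimes>\<^bsub>H\<^esub> k) / (v' h * v' k))"
      define \<xi> where "\<xi> = (\<lambda>g\<in>carrier F. \<kappa> (?\<nu> g) * v' (\<phi> g))"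
      have d: "?d h k \<in> N" if "h \<in> carrier H" "k \<in> carrier H" for h k
        using s[OF that(1)] s[OF that(2)] s[of "h \<otimes>\<^bsub>H\<^esub> k"] that by (simp add: NI)
      have R: "\<xi> (a \<otimes> b) = \<xi> a * \<xi> b * c (\<phi> a, \<phi> b)" if ab: "a \<in> carrier F" "b \<in> carrier F" for a b
      proof -
        have S: "s (\<phi> a) \<in> carrier F" "s (\<phi> b) \<in> carrier F" "s (\<phi> a \<otimes>\<^bsub>H\<^esub> \<phi> b) \<in> carrier F" using s ab by auto
        \<comment> \<open>Moving the \<open>N\<close>-part of \<open>b\<close> past the
          representative of \<open>a\<close> conjugates it, and an invariant character does not
          notice.\<close>
        have "?\<nu> (a \<otimes> b) = ?\<nu> a \<otimes> (s (\<phi> a) \<otimes> ?\<nu> b \<otimes> inv (s (\<phi> a))) \<otimes> ?d (\<phi> a) (\<phi> b)"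
          using ab S by (simp add: m_assoc)
        hence "\<kappa> (?\<nu> (a \<otimes> b)) = \<kappa> (?\<nu> a \<otimes> (s (\<phi> a) \<otimes> ?\<nu> b \<otimes> inv (s (\<phi> a))) \<otimes> ?d (\<phi> a) (\<phi> b))" by simp
        also have "\<dots> = \<kappa> (?\<nu> a \<otimes> (s (\<phi> a) \<otimes> ?\<nu> b \<otimes> inv (s (\<phi> a)))) * \<kappa> (?d (\<phi> a) (\<phi> b))"
          using \<nu>[OF ab(1)] Nn[OF S(1) \<nu>[OF ab(2)]] d[of "\<phi> a" "\<phi> b"] ab
          by (intro k(3)) (auto simp: NI)
        also have "\<kappa> (?\<nu> a \<otimes> (s (\<phi> a) \<otimes> ?\<nu> b \<otimes> inv (s (\<phi> a)))) = \<kappa> (?\<nu> a) * \<kappa> (?\<nu> b)"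
          using k(3)[OF \<nu>[OF ab(1)] Nn[OF S(1) \<nu>[OF ab(2)]]] k(4)[OF S(1) \<nu>[OF ab(2)]] by simp
        finally have 1: "\<kappa> (?\<nu> (a \<otimes> b)) = \<kappa> (?\<nu> a) * \<kappa> (?\<nu> b) * \<kappa> (?d (\<phi> a) (\<phi> b))" .
        show ?thesis
          unfolding \<xi>_def c_def using ab 1 vnz[of "\<phi> a"] vnz[of "\<phi> b"] by (simp del: cancel_simps)
      qed
      have xmu: "\<xi> a \<in> mu p" if "a \<in> carrier F" for a using that k(1)[OF \<nu>[OF that]] v' by (simp add: \<xi>_def)
      have xnz: "\<xi> a \<noteq> 0" if "a \<in> carrier F" for a using xmu[OF that] mu_nz[OF p_pos] by blast
      have xs: "\<xi> (s h) = v' h" if "h \<in> carrier H" for h using s[OF that] k1 by (simp add: \<xi>_def)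
      have xN: "\<xi> a = \<kappa> a" if "a \<in> N" for a using that s1 by (simp add: \<xi>_def NI v'_def)
      have x1: "\<xi> \<one> = 1" using xN[of \<one>] k1 by (simp add: NI)
      have "c \<in> cocycles p H"
        unfolding cocycles_def
      proof (intro CollectI conjI ballI)
        show "c \<in> carrier H \<times> carrier H \<rightarrow>\<^sub>E mu p" using d k(1) v' by (auto simp: c_def)
        fix h assume h: "h \<in> carrier H"
        show "c (\<one>\<^bsub>H\<^esub>, h) = 1" using R[of \<one> "s h"] s[OF h] x1 xnz[of "s h"] by simp
        show "c (h, \<one>\<^bsub>H\<^esub>) = 1" using R[of "s h" \<one>] s[OF h] x1 xnz[of "s h"] by simp
      next
        fix a b e assume abe: "a \<in> carrier H" "b \<in> carrier H" "e \<in> carrier H"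
        note S = s[OF abe(1)] s[OF abe(2)] s[OF abe(3)]
        have "\<xi> (s a \<otimes> s b \<otimes> s e) = \<xi> (s a \<otimes> (s b \<otimes> s e))" using S by (simp add: m_assoc)
        hence "\<xi> (s a) * \<xi> (s b) * \<xi> (s e) * (c (a, b) * c (a \<otimes>\<^bsub>H\<^esub> b, e)) = \<xi> (s a) * \<xi> (s b) * \<xi> (s e) * (c (b, e) * c (a, b \<otimes>\<^bsub>H\<^esub> e))"
          using S R[of "s a" "s b"] R[of "s a \<otimes> s b" "s e"] R[of "s b" "s e"] R[of "s a" "s b \<otimes> s e"] by (simp add: mult_ac)
        thus "c (a, b) * c (a \<otimes>\<^bsub>H\<^esub> b, e) = c (b, e) * c (a, b \<otimes>\<^bsub>H\<^esub> e)" using xnz S by simp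
      qed
      moreover have "{a\<in>N. \<xi> a = 1} = {a\<in>N. \<kappa> a = 1}" using xN by auto
      ultimately have "(c, \<xi>) \<in> twisted"
        unfolding twisted_def using R xmu k(5) by (auto simp: \<xi>_def)
      moreover have "?f (c, \<xi>) = z"
      proof -
        have "restrict \<xi> N = \<kappa>" using xN k(2) by (intro extensionalityI[of _ N]) auto
        moreover have "(\<lambda>h\<in>carrier H - {\<one>\<^bsub>H\<^esub>}. \<xi> (s h)) = v"
          using xs v by (intro extensionalityI[of _ "carrier H - {\<one>\<^bsub>H\<^esub>}"]) (auto simp: v'_def PiE_def)
        ultimately show ?thesis using z by simp
      qed
      ultimately show "z \<in> ?f ` twisted"
        using imageI[of "(c, \<xi>)" twisted ?f] back_subst[where P = "\<lambda>x. x \<in> ?f ` twisted"] by (metis (no_types))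
    qed
  qed
  moreover have "card (carrier H - {\<one>\<^bsub>H\<^esub>}) = order H - 1" using H(2) by (simp add: order_def card_Diff_singleton)
  ultimately show ?thesis using card_mu[OF p_pos] H(2) by (simp add: bij_betw_same_card card_cartesian_product card_PiE)
qed

text \<open>Apart from \<open>card I\<close> and the number of central characters, everything in the
  formula depends on \<open>H\<close> alone. Two free groups of different ranks over the same
  \<open>H\<close> thus have character groups whose dimensions differ by the difference of the
  ranks.\<close>

theorem card_central_chars:
  "card (central_chars p F N) * p ^ (order H - 1) = card (cocycles p H) * p ^ card I"
  using twisted_count1 twisted_count2 by simp

end

end

lemma cocycles_finite:
  assumes "finite (carrier H)" "p > 0" "group H" shows "finite (cocycles p H)" "card (cocycles p H) > 0"
proof -
  interpret H: group H by fact
  have "finite (carrier H \<times> carrier H \<rightarrow>\<^sub>E mu p)" using assms card_mu by (intro finite_PiE) auto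
  thus fin: "finite (cocycles p H)" by (rule rev_finite_subset) (auto simp: cocycles_def)
  have "(\<lambda>x\<in>carrier H \<times> carrier H. 1) \<in> cocycles p H" by (auto simp: cocycles_def)
  thus "card (cocycles p H) > 0" using fin card_gt_0_iff by blast
qed

section \<open>Dual bases and kernels of characters\<close>

abbreviation sign_char :: "'a gstruct \<Rightarrow> 'a set \<Rightarrow> ('a \<Rightarrow> complex) \<Rightarrow> bool" where
  "sign_char G N c \<equiv> (\<forall>a\<in>N. c (act G a) = c a) \<or> (\<forall>a\<in>N. c (act G a) = inverse (c a))"

lemma (in normal) factor_coset:
  "x \<in> carrier G \<Longrightarrow> H #> x \<in> carrier (G Mod H)"
  "\<lbrakk>x \<in> carrier G; y \<in> carrier G\<rbrakk> \<Longrightarrow> H #> (x \<otimes> y) = (H #> x) \<otimes>\<^bsub>G Mod H\<^esub> (H #> y)"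
  "\<one>\<^bsub>G Mod H\<^esub> = H"
  "x \<in> carrier G \<Longrightarrow> H #> x = H \<longleftrightarrow> x \<in> H"
  "x \<in> carrier G \<Longrightarrow> H #> (x [^] (k::nat)) = (H #> x) [^]\<^bsub>G Mod H\<^esub> k"
proof -
  show 1: "x \<in> carrier G \<Longrightarrow> H #> x \<in> carrier (G Mod H)" for x by (simp add: FactGroup_def rcosetsI subset)
  show 2: "\<lbrakk>x \<in> carrier G; y \<in> carrier G\<rbrakk> \<Longrightarrow> H #> (x \<otimes> y) = (H #> x) \<otimes>\<^bsub>G Mod H\<^esub> (H #> y)" for x y
    by (simp add: FactGroup_def rcos_sum)
  show 3: "\<one>\<^bsub>G Mod H\<^esub> = H" by (simp add: FactGroup_def)
  show 4: "x \<in> carrier G \<Longrightarrow> H #> x = H \<longleftrightarrow> x \<in> H" for x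
    using coset_join1[OF _ _ is_subgroup] coset_join2[OF _ is_subgroup] subset by blast
  show "x \<in> carrier G \<Longrightarrow> H #> (x [^] (k::nat)) = (H #> x) [^]\<^bsub>G Mod H\<^esub> k"
    by (induction k) (use 2 3 4[of \<one>] in simp_all)
qed

text \<open>\<open>cs\<close> is a basis of the group \<open>X\<close> of characters of \<open>N\<close>, with dual elements \<open>ns\<close>; the last clause says that the
  basis has the same common kernel as \<open>X\<close>.\<close>

definition dual_pair :: "nat \<Rightarrow> 'a set \<Rightarrow> ('a \<Rightarrow> complex) set \<Rightarrow> nat \<Rightarrow> (nat \<Rightarrow> 'a \<Rightarrow> complex) \<Rightarrow> (nat \<Rightarrow> 'a) \<Rightarrow> bool" where
  "dual_pair p N X m cs ns \<longleftrightarrow> (\<forall>j<m. cs j \<in> X \<and> ns j \<in> N) \<and>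
     (\<forall>i<m. \<forall>j<m. cs i (ns j) = (if i = j then omega p else 1)) \<and>
     (\<forall>c\<in>X. (\<forall>j<m. c (ns j) = 1) \<longrightarrow> c = (\<lambda>a\<in>N. 1)) \<and> card X = p ^ m \<and>
     (\<forall>w\<in>N. (\<forall>j<m. cs j w = 1) \<longrightarrow> (\<forall>c\<in>X. c w = 1))"

text \<open>A nontrivial root of unity is \<open>omega p ^ k\<close> with \<open>k\<close> prime to
  \<open>p\<close>, and \<open>l\<close> is an inverse of \<open>k\<close> modulo
  \<open>p\<close>.\<close>

lemma mu_omega_power:
  assumes "prime p" "x \<in> mu p" "x \<noteq> 1"
  obtains l where "x ^ l = omega p"
proof -
  have p: "p > 0" using assms(1) prime_gt_0_nat by blast
  obtain k where k: "k < p" "x = omega p ^ k" using omega_powers(2)[OF p] assms(2) by (auto simp: image_iff)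
  have "k \<noteq> 0" using k assms(3) by (cases k) auto
  hence "coprime k p" using k(1) assms(1) by (metis coprime_commute dvd_imp_le not_less prime_imp_coprime_nat not_gr_zero)
  then obtain l where l: "[k * l = Suc 0] (mod p)" using cong_solve_coprime_nat by blast
  have pw: "omega p ^ i = 1" if "p dvd i" for i
    using that omega_mu[OF p] by (auto simp: mu_def power_mult elim!: dvdE)
  have "x ^ l = omega p ^ (k * l)" by (simp add: k power_mult)
  also have "\<dots> = omega p ^ (p * (k * l div p) + k * l mod p)" by simp
  also have "\<dots> = omega p ^ (p * (k * l div p)) * omega p ^ (k * l mod p)" by (rule power_add)
  also have "\<dots> = omega p ^ (k * l mod p)" unfolding pw[OF dvd_triv_left] by simp
  also have "k * l mod p = 1" using l prime_gt_1_nat[OF assms(1)] by (simp add: cong_def)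
  finally show ?thesis using that by simp
qed

text \<open>Induction on the size of \<open>X\<close>. Some nontrivial \<open>c\<close> takes the
  value \<open>omega p\<close> at an element \<open>n\<close>; the characters trivial at
  \<open>n\<close> form a smaller group complementary to the powers of \<open>c\<close>. Its dual
  elements are multiplied by powers of \<open>n\<close> so that \<open>c\<close> becomes 1 on them,
  a change which characters trivial at \<open>n\<close> do not see.\<close>

lemma dual_basis:
  fixes G (structure)
  assumes G: "group G" "subgroup N G" and p: "prime p"
  shows "\<lbrakk>finite X; \<And>c. c \<in> X \<Longrightarrow> c \<in> N \<rightarrow>\<^sub>E mu p; \<And>c a b. c \<in> X \<Longrightarrow> a \<in> N \<Longrightarrow> b \<in> N \<Longrightarrow> c (a \<otimes> b) = c a * c b;
    (\<lambda>a\<in>N. 1) \<in> X; \<And>c d. c \<in> X \<Longrightarrow> d \<in> X \<Longrightarrow> (\<lambda>a\<in>N. c a * d a) \<in> X\<rbrakk>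
    \<Longrightarrow> \<exists>m cs ns. dual_pair p N X m cs ns"
proof (induction "card X" arbitrary: X rule: less_induct)
  case less
  note X = less.prems
  interpret group G by fact
  interpret N: subgroup N G by fact
  have pp: "p > 0" using p prime_gt_0_nat by blast
  have pw: "(\<lambda>a\<in>N. c a ^ k) \<in> X" if "c \<in> X" for c k
  proof (induction k)
    case (Suc k)
    have "(\<lambda>a\<in>N. c a ^ Suc k) = (\<lambda>a\<in>N. c a * (\<lambda>a\<in>N. c a ^ k) a)" by auto
    thus ?case using X(5)[OF that Suc] by (simp only:)
  qed (use X(4) in \<open>simp only: power_0\<close>)
  have cpow: "c (a [^] (k::nat)) = c a ^ k \<and> a [^] k \<in> N" if "c \<in> X" "a \<in> N" for c a k
  proof (induction k)
    case 0
    have "c \<one> = c \<one> * c \<one>" using X(3)[OF that(1), of \<one> \<one>] by simp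
    moreover have "c \<one> \<noteq> 0" using X(2)[OF that(1)] mu_nz[OF pp] by (auto simp: PiE_iff)
    ultimately show ?case by simp
  next
    case (Suc k) thus ?case using X(3)[OF that(1), of "a [^] k" a] that by (simp add: mult.commute)
  qed
  show ?case
  proof (cases "X = {\<lambda>a\<in>N. 1}")
    case True
    hence "dual_pair p N X 0 (\<lambda>_ _. 1) (\<lambda>_. \<one>)" unfolding dual_pair_def by simp
    thus ?thesis by blast
  next
    case False
    then obtain c where c: "c \<in> X" "c \<noteq> (\<lambda>a\<in>N. 1)" using X(4) by blast
    have "\<exists>a\<in>N. c a \<noteq> 1"
    proof (rule ccontr)
      assume "\<not> (\<exists>a\<in>N. c a \<noteq> 1)"
      hence "c = (\<lambda>a\<in>N. 1)" using X(2)[OF c(1)] by (intro extensionalityI[of _ N]) (auto simp: PiE_def)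
      thus False using c by simp
    qed
    then obtain a where a: "a \<in> N" "c a \<noteq> 1" by blast
    have cm: "d x \<in> mu p" if "d \<in> X" "x \<in> N" for d x using X(2)[OF that(1)] that(2) by auto
    obtain l where l: "c a ^ l = omega p" using mu_omega_power[OF p cm[OF c(1) a(1)] a(2)] .
    define n where "n = a [^] l"
    have n: "n \<in> N" "c n = omega p" using cpow[OF c(1) a(1), of l] l by (auto simp: n_def)
    have om1: "omega p \<noteq> 1" using l a(2) by (metis inj_onD lessThan_iff omega_powers(1)[OF pp] p power_0 power_one_right prime_gt_1_nat pp zero_neq_one)
    define X' where "X' = {d \<in> X. d n = 1}"
    have "c \<notin> X'" using n om1 by (simp add: X'_def)
    hence "X' \<subset> X" using c by (auto simp: X'_def)
    hence "card X' < card X" using X(1) psubset_card_mono by blast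
    then obtain m cs ns where IH: "dual_pair p N X' m cs ns"
      using less.hyps[of X'] X n by (auto simp: X'_def)
    have ih: "\<And>j. j < m \<Longrightarrow> cs j \<in> X'" "\<And>j. j < m \<Longrightarrow> ns j \<in> N"
      "\<And>i j. i < m \<Longrightarrow> j < m \<Longrightarrow> cs i (ns j) = (if i = j then omega p else 1)"
      "\<And>d. d \<in> X' \<Longrightarrow> (\<And>j. j < m \<Longrightarrow> d (ns j) = 1) \<Longrightarrow> d = (\<lambda>a\<in>N. 1)" "card X' = p ^ m"
      "\<And>w d. w \<in> N \<Longrightarrow> (\<And>j. j < m \<Longrightarrow> cs j w = 1) \<Longrightarrow> d \<in> X' \<Longrightarrow> d w = 1"
      using IH by (auto simp: dual_pair_def)
    have "\<exists>e. c (ns j) * omega p ^ e = 1" if "j < m" for j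
    proof -
      have "c (ns j) \<in> mu p" using cm[OF c(1) ih(2)[OF that]] .
      then obtain k where k: "k < p" "c (ns j) = omega p ^ k"
        using omega_powers(2)[OF pp] by (auto simp: image_iff)
      have "c (ns j) * omega p ^ (p - k) = 1" using k omega_mu[OF pp] by (simp add: mu_def flip: power_add)
      thus ?thesis by blast
    qed
    then obtain e where e: "\<And>j. j < m \<Longrightarrow> c (ns j) * omega p ^ e j = 1" by metis
    define cs' where "cs' j = (if j = m then c else cs j)" for j
    define ns' where "ns' j = (if j = m then n else ns j \<otimes> n [^] e j)" for j
    have ev: "d (ns j \<otimes> n [^] e j) = d (ns j) * d n ^ e j" if "d \<in> X" "j < m" for d j
      using X(3)[OF that(1) ih(2)[OF that(2)]] cpow[OF that(1) n(1), of "e j"] by simp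
    have dec: "\<exists>d\<in>X'. \<exists>k<p. z = (\<lambda>a\<in>N. d a * c a ^ k)" if z: "z \<in> X" for z
    proof -
      obtain k where k: "k < p" "z n = omega p ^ k"
        using omega_powers(2)[OF pp] cm[OF z n(1)] by (auto simp: image_iff)
      define d where "d = (\<lambda>a\<in>N. z a * (\<lambda>a\<in>N. c a ^ (p - k)) a)"
      have dX: "d \<in> X" unfolding d_def by (rule X(5)[OF z pw[OF c(1)]])
      have "d n = 1" using n k omega_mu[OF pp] by (simp add: d_def mu_def flip: power_add)
      hence "d \<in> X'" using dX by (simp add: X'_def)
      moreover have "z = (\<lambda>a\<in>N. d a * c a ^ k)"
      proof -
        have "c x ^ (p - k) * c x ^ k = 1" if "x \<in> N" for x
          using cm[OF c(1) that] k by (simp add: mu_def flip: power_add)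
        thus ?thesis
          using X(2)[OF z] by (intro extensionalityI[of _ N]) (auto simp: d_def PiE_def mult.assoc)
      qed
      ultimately show ?thesis using k(1) by blast
    qed
    have "card X = p ^ Suc m"
    proof -
      let ?g = "\<lambda>(d, k). (\<lambda>a\<in>N. d a * c a ^ k)"
      have inj: "inj_on ?g (X' \<times> {..<p})"
      proof (rule inj_onI)
        fix u v assume u: "u \<in> X' \<times> {..<p}" "v \<in> X' \<times> {..<p}" "?g u = ?g v"
        obtain d k d' k' where uv: "u = (d, k)" "v = (d', k')" by (cases u, cases v) auto
        have eq: "(\<lambda>a\<in>N. d a * c a ^ k) = (\<lambda>a\<in>N. d' a * c a ^ k')" using u(3) uv by simp
        have dX: "d \<in> X'" "d' \<in> X'" "k < p" "k' < p" using u uv by auto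
        have "omega p ^ k = omega p ^ k'" using fun_cong[OF eq, of n] n dX by (simp add: X'_def)
        hence kk: "k = k'" using omega_powers(1)[OF pp] dX by (auto dest: inj_onD)
        have "d x = d' x" if "x \<in> N" for x
          using fun_cong[OF eq, of x] that kk mu_nz[OF pp cm[OF c(1) that]] by simp
        hence "d = d'" using dX X(2) by (intro extensionalityI[of _ N]) (auto simp: X'_def PiE_def)
        thus "u = v" using kk uv by simp
      qed
      have "?g ` (X' \<times> {..<p}) = X"
      proof (intro equalityI subsetI)
        fix z assume "z \<in> ?g ` (X' \<times> {..<p})"
        then obtain d k where z: "z = (\<lambda>a\<in>N. d a * c a ^ k)" "d \<in> X'" by auto
        have "z = (\<lambda>a\<in>N. d a * (\<lambda>a\<in>N. c a ^ k) a)" using z by auto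
        thus "z \<in> X" using X(5)[OF _ pw[OF c(1)]] z by (simp add: X'_def)
      next
        fix z assume "z \<in> X"
        then obtain d k where "d \<in> X'" "k < p" "z = (\<lambda>a\<in>N. d a * c a ^ k)" using dec by blast
        thus "z \<in> ?g ` (X' \<times> {..<p})" by (intro image_eqI[of z ?g "(d, k)"]) auto
      qed
      hence "card X = card (X' \<times> {..<p})" using card_image[OF inj] by simp
      thus ?thesis using ih(5) by (simp add: card_cartesian_product mult.commute)
    qed
    moreover have "cs' j \<in> X \<and> ns' j \<in> N" if "j < Suc m" for j
      using that c n ih(1,2) cpow[OF c(1) n(1)] by (auto simp: cs'_def ns'_def X'_def less_Suc_eq)
    moreover have "cs' i (ns' j) = (if i = j then omega p else 1)" if "i < Suc m" "j < Suc m" for i j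
    proof (cases "i = m"; cases "j = m")
      assume *: "i = m" "j \<noteq> m"
      have "j < m" using that * by simp
      thus ?thesis using * ev[OF c(1), of j] e[of j] n(2) by (simp add: cs'_def ns'_def)
    next
      assume *: "i \<noteq> m" "j = m"
      have "i < m" using that * by simp
      thus ?thesis using * ih(1)[of i] by (simp add: cs'_def ns'_def X'_def)
    next
      assume *: "i \<noteq> m" "j \<noteq> m"
      have ij: "i < m" "j < m" using that * by auto
      have "cs i \<in> X" "cs i n = 1" using ih(1)[OF ij(1)] by (auto simp: X'_def)
      thus ?thesis using * ev[of "cs i" j] ij ih(3)[OF ij] by (simp add: cs'_def ns'_def)
    qed (use n in \<open>simp add: cs'_def ns'_def\<close>)
    moreover have "d = (\<lambda>a\<in>N. 1)" if d: "d \<in> X" "\<forall>j<Suc m. d (ns' j) = 1" for d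
    proof -
      have dn: "d n = 1" using d(2)[rule_format, of m] by (simp add: ns'_def)
      have "d (ns j) = 1" if "j < m" for j
        using d(2)[rule_format, of j] that ev[OF d(1) that] dn by (simp add: ns'_def)
      thus ?thesis using ih(4)[of d] d dn by (simp add: X'_def)
    qed
    moreover have "d w = 1" if w: "w \<in> N" "\<forall>j<Suc m. cs' j w = 1" "d \<in> X" for d w
    proof -
      obtain d' k where d': "d' \<in> X'" "d = (\<lambda>a\<in>N. d' a * c a ^ k)" using dec[OF w(3)] by blast
      have "cs j w = 1" if "j < m" for j using w(2)[rule_format, of j] that by (simp add: cs'_def)
      hence "d' w = 1" using ih(6)[OF w(1) _ d'(1)] by blast
      moreover have "c w = 1" using w(2)[rule_format, of m] by (simp add: cs'_def)
      ultimately show ?thesis using d'(2) w(1) by simp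
    qed
    ultimately have "dual_pair p N X (Suc m) cs' ns'" by (simp add: dual_pair_def)
    thus ?thesis by blast
  qed
qed

text \<open>Multiplying by a power of \<open>ns k\<close> adjusts the value of \<open>cs k\<close>
  to any root of unity and leaves the other coordinates alone, so the prescribed values can be
  reached one at a time.\<close>

lemma dual_surj:
  fixes G (structure)
  assumes G: "group G" "subgroup N G" "p > 0" and X: "\<And>c a b. c \<in> X \<Longrightarrow> a \<in> N \<Longrightarrow> b \<in> N \<Longrightarrow> c (a \<otimes> b) = c a * c b"
    "\<And>c. c \<in> X \<Longrightarrow> c \<one> = 1" and d: "dual_pair p N X m cs ns" and t: "\<And>j. j < m \<Longrightarrow> t j \<in> mu p"
  shows "\<exists>n\<in>N. \<forall>j<m. cs j n = t j"
proof -
  interpret group G by fact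
  interpret N: subgroup N G by fact
  have D: "\<And>j. j < m \<Longrightarrow> cs j \<in> X" "\<And>j. j < m \<Longrightarrow> ns j \<in> N"
      "\<And>i j. i < m \<Longrightarrow> j < m \<Longrightarrow> cs i (ns j) = (if i = j then omega p else 1)"
    using d by (auto simp: dual_pair_def)
  have cpow: "c (a [^] (k::nat)) = c a ^ k \<and> a [^] k \<in> N" if "c \<in> X" "a \<in> N" for c a k
  proof (induction k)
    case (Suc k) thus ?case using X(1)[OF that(1), of "a [^] k" a] that by (simp add: mult.commute)
  qed (use X(2)[OF that(1)] in simp)
  have "m' \<le> m \<Longrightarrow> \<exists>n\<in>N. \<forall>j<m. cs j n = (if j < m' then t j else 1)" for m'
  proof (induction m')
    case 0 thus ?case using X(2) D(1) by (intro bexI[of _ \<one>]) auto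
  next
    case (Suc k)
    then obtain n where n: "n \<in> N" "\<forall>j<m. cs j n = (if j < k then t j else 1)" by auto
    have km: "k < m" using Suc by simp
    obtain i where i: "t k = omega p ^ i" using omega_powers(2)[OF G(3)] t[OF km] by (auto simp: image_iff)
    have "cs j (n \<otimes> ns k [^] i) = (if j < Suc k then t j else 1)" if "j < m" for j
      using X(1)[OF D(1)[OF that] n(1), of "ns k [^] i"] cpow[OF D(1)[OF that] D(2)[OF km], of i] n(2) that D(3)[OF that km] i
      by (auto simp: less_Suc_eq)
    thus ?case using n(1) cpow[OF D(1)[OF km] D(2)[OF km], of i] by (intro bexI[of _ "n \<otimes> ns k [^] i"]) auto
  qed
  from this[of m] show ?thesis by auto
qed

context tg begin

lemma central_charsD:
  assumes "c \<in> central_chars p G N" "N \<lhd> G" "p > 0"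
  shows "\<And>a. a \<in> N \<Longrightarrow> c a \<in> mu p" "\<And>a. a \<in> N \<Longrightarrow> c a \<noteq> 0" "\<And>a b. a \<in> N \<Longrightarrow> b \<in> N \<Longrightarrow> c (a \<otimes> b) = c a * c b"
    "\<And>g a. g \<in> carrier G \<Longrightarrow> a \<in> N \<Longrightarrow> c (g \<otimes> a \<otimes> inv g) = c a" "openin (topo G) {a\<in>N. c a = 1}"
    "c \<in> extensional N" "c \<one> = 1" "\<And>a. a \<in> N \<Longrightarrow> c (inv a) = inverse (c a)"
    "\<And>g a. g \<in> carrier G \<Longrightarrow> a \<in> N \<Longrightarrow> c (inv g \<otimes> a \<otimes> g) = c a" "c \<in> N \<rightarrow>\<^sub>E mu p"
proof -
  interpret normal N G by fact
  show 1: "\<And>a. a \<in> N \<Longrightarrow> c a \<in> mu p" "\<And>a b. a \<in> N \<Longrightarrow> b \<in> N \<Longrightarrow> c (a \<otimes> b) = c a * c b"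
    "\<And>g a. g \<in> carrier G \<Longrightarrow> a \<in> N \<Longrightarrow> c (g \<otimes> a \<otimes> inv g) = c a" "openin (topo G) {a\<in>N. c a = 1}"
    "c \<in> extensional N" "c \<in> N \<rightarrow>\<^sub>E mu p"
    using assms(1) by (auto simp: central_chars_def PiE_def)
  show 2: "\<And>a. a \<in> N \<Longrightarrow> c a \<noteq> 0" using 1(1) mu_nz[OF assms(3)] by blast
  show 3: "c \<one> = 1" using 1(2)[of \<one> \<one>] 2[of \<one>] by simp
  show "c (inv a) = inverse (c a)" if "a \<in> N" for a
    using 1(2)[OF that, of "inv a"] that 3 2[OF that] by (simp add: field_simps)
  show "c (inv g \<otimes> a \<otimes> g) = c a" if "g \<in> carrier G" "a \<in> N" for g a
    using 1(3)[of "inv g" a] that by simp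
qed

lemma central_char_kernel:
  assumes "c \<in> central_chars p G N" "N \<lhd> G" "p > 0"
  shows "{a\<in>N. c a = 1} \<lhd> G"
proof -
  interpret normal N G by fact
  note D = central_charsD[OF assms]
  have "subgroup {a\<in>N. c a = 1} G" by (intro subgroupI) (use D subset in auto)
  thus ?thesis unfolding normal_inv_iff using D(4) inv_op_closed2 by auto
qed

lemma central_chars_closed:
  assumes N: "N \<lhd> G" "openin (topo G) N" "p > 0"
  shows "(\<lambda>a\<in>N. 1) \<in> central_chars p G N"
    "\<And>c d. c \<in> central_chars p G N \<Longrightarrow> d \<in> central_chars p G N \<Longrightarrow> (\<lambda>a\<in>N. c a * d a) \<in> central_chars p G N"
    "\<And>c. c \<in> central_chars p G N \<Longrightarrow> gamma_subgroup G N \<Longrightarrow> (\<lambda>a\<in>N. c (act G a)) \<in> central_chars p G N"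
proof -
  interpret normal N G by fact
  have nc: "g \<otimes> a \<otimes> inv g \<in> N" if "g \<in> carrier G" "a \<in> N" for g a using inv_op_closed2 that by blast
  have "{a\<in>N. (\<lambda>a\<in>N. 1::complex) a = 1} = N" by auto
  thus "(\<lambda>a\<in>N. 1) \<in> central_chars p G N"
    using N nc by (auto simp: central_chars_def)
  fix c assume c: "c \<in> central_chars p G N"
  note C = central_charsD[OF c N(1,3)]
  {
    fix d assume d: "d \<in> central_chars p G N"
    note D = central_charsD[OF d N(1,3)]
    let ?e = "\<lambda>a\<in>N. c a * d a"
    have "subgroup {a\<in>N. ?e a = 1} G"
    proof (rule subgroupI)
      fix a assume a: "a \<in> {a\<in>N. ?e a = 1}"
      have "c a * d a = 1" using a by (auto split: if_splits)
      hence "inverse (c a) * inverse (d a) = 1" unfolding inverse_mult_distrib[symmetric] by simp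
      thus "inv a \<in> {a\<in>N. ?e a = 1}" using a C(8)[of a] D(8)[of a] by simp
      fix b assume b: "b \<in> {a\<in>N. ?e a = 1}"
      have "c a * c b * (d a * d b) = (c a * d a) * (c b * d b)" by (simp only: mult_ac)
      also have "\<dots> = 1" using a b by (auto split: if_splits)
      finally show "a \<otimes> b \<in> {a\<in>N. ?e a = 1}" using a b C(3)[of a b] D(3)[of a b] by simp
    next
      have "\<one> \<in> {a\<in>N. ?e a = 1}" using C(7) D(7) subgroup.one_closed[OF is_subgroup] by simp
      thus "{a\<in>N. ?e a = 1} \<noteq> {}" by blast
    qed (use subset in auto)
    moreover have "openin (topo G) ({a\<in>N. c a = 1} \<inter> {a\<in>N. d a = 1})" using C D by blast
    ultimately have "openin (topo G) {a\<in>N. ?e a = 1}"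
      by (rule open_superset) (use C D in auto)
    thus "?e \<in> central_chars p G N"
      using C D nc by (auto simp: central_chars_def)
  }
  assume g: "gamma_subgroup G N"
  have aN: "act G a \<in> N" if "a \<in> N" for a using g that by (auto simp: gamma_subgroup_def)
  have "{a\<in>N. (\<lambda>a\<in>N. c (act G a)) a = 1} = act G ` {a\<in>N. c a = 1}"
  proof (intro equalityI subsetI)
    fix x assume "x \<in> {a\<in>N. (\<lambda>a\<in>N. c (act G a)) a = 1}"
    hence x: "x \<in> N" "c (act G x) = 1" by (auto split: if_splits)
    have "act G x \<in> {a\<in>N. c a = 1}" using aN[OF x(1)] x(2) by simp
    moreover have "x = act G (act G x)" using act_act[OF mem_carrier[OF x(1)]] by simp
    ultimately show "x \<in> act G ` {a\<in>N. c a = 1}" by blast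
  next
    fix x assume "x \<in> act G ` {a\<in>N. c a = 1}"
    then obtain a where a: "a \<in> N" "c a = 1" "x = act G a" by auto
    thus "x \<in> {a\<in>N. (\<lambda>a\<in>N. c (act G a)) a = 1}" using aN[OF a(1)] act_act[OF mem_carrier[OF a(1)]] by simp
  qed
  hence "openin (topo G) {a\<in>N. (\<lambda>a\<in>N. c (act G a)) a = 1}" using act_open[OF C(5)] by simp
  thus "(\<lambda>a\<in>N. c (act G a)) \<in> central_chars p G N"
    unfolding central_chars_def
  proof (intro CollectI conjI ballI)
    show "(\<lambda>a\<in>N. c (act G a)) \<in> N \<rightarrow>\<^sub>E mu p" using C(1)[OF aN] by simp
    fix a b assume ab: "a \<in> N" "b \<in> N"
    show "(\<lambda>a\<in>N. c (act G a)) (a \<otimes> b) = (\<lambda>a\<in>N. c (act G a)) a * (\<lambda>a\<in>N. c (act G a)) b"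
      using C(3)[OF aN[OF ab(1)] aN[OF ab(2)]] ab act_mult[OF mem_carrier[OF ab(1)] mem_carrier[OF ab(2)]] by simp
  next
    fix g a assume ga: "g \<in> carrier G" "a \<in> N"
    have "act G (g \<otimes> a \<otimes> inv g) = act G g \<otimes> act G a \<otimes> inv (act G g)"
      using ga mem_carrier[OF ga(2)] by (simp add: act_mult act_inv)
    thus "(\<lambda>a\<in>N. c (act G a)) (g \<otimes> a \<otimes> inv g) = (\<lambda>a\<in>N. c (act G a)) a"
      using C(4)[OF act_closed[OF ga(1)] aN[OF ga(2)]] nc[OF ga] ga by simp
  qed
qed

lemma char_nontrivial:
  assumes "c \<in> central_chars p G N" "c \<noteq> (\<lambda>a\<in>N. 1)" "N \<lhd> G" "p > 0"
  shows "\<exists>a\<in>N. c a \<noteq> 1"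
proof (rule ccontr)
  assume "\<not> (\<exists>a\<in>N. c a \<noteq> 1)"
  hence "c = (\<lambda>a\<in>N. 1)" using central_charsD(6)[OF assms(1,3,4)] by (intro extensionalityI[of _ N]) auto
  thus False using assms(2) by simp
qed

lemma char_image:
  assumes c: "c \<in> central_chars p G N" "c \<noteq> (\<lambda>a\<in>N. 1)" and N: "N \<lhd> G" and p: "prime p"
  shows "c ` N = mu p"
proof -
  interpret normal N G by fact
  have pp: "p > 0" using p prime_gt_0_nat by blast
  note C = central_charsD[OF c(1) N pp]
  obtain a where a: "a \<in> N" "c a \<noteq> 1" using char_nontrivial[OF c N pp] by blast
  have cpow: "c (a [^] (k::nat)) = c a ^ k \<and> a [^] k \<in> N" for k
  proof (induction k)
    case (Suc k) thus ?case using C(3)[of "a [^] k" a] a by (simp add: mult.commute)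
  qed (use C(7) in simp)
  obtain l where l: "c a ^ l = omega p" using mu_omega_power[OF p C(1)[OF a(1)] a(2)] .
  have "mu p \<subseteq> c ` N"
  proof
    fix z assume "z \<in> mu p"
    then obtain k where "z = omega p ^ k" using omega_powers(2)[OF pp] by (auto simp: image_iff)
    hence "z = c (a [^] (l * k))" using cpow[of "l * k"] l by (simp add: power_mult)
    thus "z \<in> c ` N" using cpow by blast
  qed
  thus ?thesis using C(1) by blast
qed

text \<open>A coset of the kernel of \<open>c\<close> is determined by its image in \<open>H\<close>
  and by the value of \<open>c\<close> at the displacement from a chosen representative of that
  image. All pairs occur because a nontrivial \<open>c\<close> is onto the p-th roots of
  unity.\<close>

lemma card_rcosets_char_kernel:
  assumes \<phi>: "\<phi> \<in> hom G H" "\<phi> ` carrier G = carrier H" and H: "group H" "finite (carrier H)" and N: "N = kernel G H \<phi>"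
    and c: "c \<in> central_chars p G N" "c \<noteq> (\<lambda>a\<in>N. 1)" and p: "prime p"
  shows "finite (rcosets {a\<in>N. c a = 1})" "card (rcosets {a\<in>N. c a = 1}) = order H * p"
proof -
  interpret \<phi>: group_hom G H \<phi> using \<phi> is_group H by (simp add: group_hom_iff)
  have Nn: "N \<lhd> G" using \<phi>.normal_kernel N by simp
  have pp: "p > 0" using p prime_gt_0_nat by blast
  note C = central_charsD[OF c(1) Nn pp]
  let ?K = "{a\<in>N. c a = 1}"
  have K: "?K \<lhd> G" by (rule central_char_kernel[OF c(1) Nn pp])
  have NI: "x \<in> N \<longleftrightarrow> x \<in> carrier G \<and> \<phi> x = \<one>\<^bsub>H\<^esub>" for x by (auto simp: N kernel_def)
  define s where "s h = (SOME x. x \<in> carrier G \<and> \<phi> x = h)" for h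
  have s: "s h \<in> carrier G \<and> \<phi> (s h) = h" if "h \<in> carrier H" for h
  proof -
    have "h \<in> \<phi> ` carrier G" using that \<phi>(2) by simp
    hence "\<exists>x. x \<in> carrier G \<and> \<phi> x = h" by auto
    from someI_ex[OF this] show ?thesis unfolding s_def .
  qed
  let ?g = "\<lambda>(h, z). {x \<in> carrier G. \<phi> x = h \<and> c (x \<otimes> inv (s h)) = z}"
  have nu: "x \<otimes> inv (s (\<phi> x)) \<in> N" if "x \<in> carrier G" for x using that s[of "\<phi> x"] by (simp add: NI)
  have coset: "?K #> x = ?g (\<phi> x, c (x \<otimes> inv (s (\<phi> x))))" if x: "x \<in> carrier G" for x
  proof (intro equalityI subsetI)
    fix w assume "w \<in> ?K #> x"
    then obtain k where k: "k \<in> N" "c k = 1" "w = k \<otimes> x" by (auto simp: r_coset_def)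
    have kc: "k \<in> carrier G" "\<phi> k = \<one>\<^bsub>H\<^esub>" using k NI by auto
    have "w \<otimes> inv (s (\<phi> x)) = k \<otimes> (x \<otimes> inv (s (\<phi> x)))" using k kc x s[of "\<phi> x"] by (simp add: m_assoc)
    thus "w \<in> ?g (\<phi> x, c (x \<otimes> inv (s (\<phi> x))))" using k kc x C(3)[OF k(1) nu[OF x]] by simp
  next
    fix w assume "w \<in> ?g (\<phi> x, c (x \<otimes> inv (s (\<phi> x))))"
    hence w: "w \<in> carrier G" "\<phi> w = \<phi> x" "c (w \<otimes> inv (s (\<phi> x))) = c (x \<otimes> inv (s (\<phi> x)))" by auto
    have "w \<otimes> inv x = (w \<otimes> inv (s (\<phi> x))) \<otimes> inv (x \<otimes> inv (s (\<phi> x)))"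
      using w x s[of "\<phi> x"] by (simp add: m_assoc inv_mult_group)
    hence "c (w \<otimes> inv x) = c (w \<otimes> inv (s (\<phi> x))) * c (inv (x \<otimes> inv (s (\<phi> x))))"
      using C(3)[of "w \<otimes> inv (s (\<phi> x))" "inv (x \<otimes> inv (s (\<phi> x)))"] nu[OF w(1)] nu[OF x] w(2)
        subgroup.m_inv_closed[OF normal_imp_subgroup[OF Nn]] by simp
    hence "c (w \<otimes> inv x) = 1" using C(8)[OF nu[OF x]] w(3) C(2)[OF nu[OF x]] by simp
    moreover have "w \<otimes> inv x \<in> N" using w x by (simp add: NI)
    ultimately have "w \<otimes> inv x \<in> ?K" by simp
    moreover have "w = (w \<otimes> inv x) \<otimes> x" using w x by (simp add: m_assoc)
    ultimately show "w \<in> ?K #> x" by (auto simp: r_coset_def)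
  qed
  have im: "?g ` (carrier H \<times> mu p) = rcosets ?K"
  proof (intro equalityI subsetI)
    fix D assume "D \<in> ?g ` (carrier H \<times> mu p)"
    then obtain h z where hz: "h \<in> carrier H" "z \<in> mu p" "D = ?g (h, z)" by auto
    obtain n where n: "n \<in> N" "c n = z" using char_image[OF c Nn p] hz by (metis imageE)
    have nc: "n \<in> carrier G" "\<phi> n = \<one>\<^bsub>H\<^esub>" using n NI by auto
    have "D = ?K #> (n \<otimes> s h)"
      using coset[of "n \<otimes> s h"] nc s[OF hz(1)] hz n by (simp add: m_assoc)
    thus "D \<in> rcosets ?K" using nc s[OF hz(1)] by (auto simp: RCOSETS_def)
  next
    fix D assume "D \<in> rcosets ?K"
    then obtain x where x: "x \<in> carrier G" "D = ?K #> x" by (auto simp: RCOSETS_def)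
    thus "D \<in> ?g ` (carrier H \<times> mu p)"
      using coset[OF x(1)] C(1)[OF nu[OF x(1)]] by (intro image_eqI[of D ?g "(\<phi> x, c (x \<otimes> inv (s (\<phi> x))))"]) auto
  qed
  have inj: "inj_on ?g (carrier H \<times> mu p)"
  proof (rule inj_onI)
    fix u v assume uv: "u \<in> carrier H \<times> mu p" "v \<in> carrier H \<times> mu p" "?g u = ?g v"
    have "?g u \<in> rcosets ?K" using im uv(1) by blast
    then obtain x where x: "x \<in> carrier G" "?g u = ?K #> x" by (auto simp: RCOSETS_def)
    have xu: "x \<in> ?g u" using rcos_self[OF x(1) normal_imp_subgroup[OF K]] unfolding x(2) .
    hence xv: "x \<in> ?g v" unfolding uv(3) .
    show "u = v" using xu xv by (cases u, cases v) simp
  qed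
  show "finite (rcosets ?K)" unfolding im[symmetric] using H(2) card_mu[OF pp] by simp
  show "card (rcosets ?K) = order H * p"
    unfolding im[symmetric] card_image[OF inj] using card_mu[OF pp] by (simp add: card_cartesian_product order_def)
qed

end

section \<open>Central elements of finite p-groups\<close>

lemma prime_dvd_of_dvd_power:
  fixes n :: nat assumes "prime p" "n \<noteq> 1" "n dvd p ^ k" shows "p dvd n"
  using assms divides_primepow_nat[OF assms(1)] by (metis dvd_power not_gr_zero power_0)

text \<open>The class equation inside \<open>K\<close>: if no nontrivial element of \<open>K\<close>
  were central, every conjugation orbit in \<open>K\<close> other than that of the identity would
  have size divisible by \<open>p\<close>. Since \<open>p\<close> divides the order of
  \<open>K\<close>, it would divide 1.\<close>

lemma p_group_central:
  fixes G (structure)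
  assumes G: "group G" "finite (carrier G)" "order G = p ^ k" and p: "prime p" and K: "K \<lhd> G" "K \<noteq> {\<one>}"
  shows "\<exists>z\<in>K. z \<noteq> \<one> \<and> (\<forall>g\<in>carrier G. g \<otimes> z = z \<otimes> g)"
proof (rule ccontr)
  assume no: "\<not> ?thesis"
  interpret group G by fact
  interpret K: normal K G by fact
  interpret A: group_action G "carrier G" "\<lambda>g. \<lambda>h\<in>carrier G. g \<otimes> h \<otimes> inv g" by (rule action_by_conjugation)
  let ?o = "\<lambda>x. orbit G (\<lambda>g. \<lambda>h\<in>carrier G. g \<otimes> h \<otimes> inv g) x"
  have orb: "?o x = {g \<otimes> x \<otimes> inv g | g. g \<in> carrier G}" if "x \<in> carrier G" for x
    using that by (auto simp: orbit_def)
  have oK: "?o x \<subseteq> K" if "x \<in> K" for x using that orb K.inv_op_closed2 K.mem_carrier by auto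
  have self: "x \<in> ?o x" if "x \<in> K" for x using A.orbit_refl that K.mem_carrier by blast
  have finK: "finite K" using G(2) K.subset finite_subset by blast
  have U: "(\<Union>x\<in>K. ?o x) = K" using oK self by blast
  have disj: "pairwise disjnt (?o ` K)"
  proof (rule pairwiseI)
    fix X Y assume XY: "X \<in> ?o ` K" "Y \<in> ?o ` K" "X \<noteq> Y"
    then obtain x y where xy: "x \<in> K" "y \<in> K" "X = ?o x" "Y = ?o y" by auto
    hence "X \<in> orbits G (carrier G) (\<lambda>g. \<lambda>h\<in>carrier G. g \<otimes> h \<otimes> inv g)" "Y \<in> orbits G (carrier G) (\<lambda>g. \<lambda>h\<in>carrier G. g \<otimes> h \<otimes> inv g)"
      using K.mem_carrier by (auto simp: orbits_def)
    thus "disjnt X Y" using A.disjoint_union XY(3) by (auto simp: disjnt_def)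
  qed
  have "card K = sum card (?o ` K)"
    using card_Union_disjoint[OF disj] finK oK finite_subset by (metis (no_types, lifting) U image_iff)
  also have "\<dots> = card (?o \<one>) + sum card (?o ` K - {?o \<one>})"
    using finK by (intro sum.remove) auto
  also have "card (?o \<one>) = 1"
  proof -
    have "?o \<one> = (\<lambda>g. g \<otimes> \<one> \<otimes> inv g) ` carrier G" unfolding orb[OF one_closed] by blast
    also have "\<dots> = (\<lambda>g. \<one>) ` carrier G" by (rule image_cong) simp_all
    also have "\<dots> = {\<one>}" using one_closed by blast
    finally show ?thesis by simp
  qed
  finally have cK: "card K = 1 + sum card (?o ` K - {?o \<one>})" .
  have "p dvd card X" if "X \<in> ?o ` K - {?o \<one>}" for X
  proof -
    obtain x where x: "x \<in> K" "X = ?o x" "?o x \<noteq> ?o \<one>" using \<open>X \<in> ?o ` K - {?o \<one>}\<close> by auto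
    have xc: "x \<in> carrier G" using x by auto
    have "x \<noteq> \<one>" using x by auto
    then obtain g where g: "g \<in> carrier G" "g \<otimes> x \<noteq> x \<otimes> g" using no x by blast
    have "g \<otimes> x \<otimes> inv g \<noteq> x"
    proof
      assume "g \<otimes> x \<otimes> inv g = x"
      hence "g \<otimes> x \<otimes> inv g \<otimes> g = x \<otimes> g" by simp
      thus False using g xc by (simp add: m_assoc)
    qed
    have "g \<otimes> x \<otimes> inv g \<in> ?o x" unfolding orb[OF xc] using g(1) by blast
    have "card (?o x) \<noteq> 1"
    proof
      assume "card (?o x) = 1"
      then obtain q where q: "?o x = {q}" by (rule card_1_singletonE)
      have "x \<in> {q}" "g \<otimes> x \<otimes> inv g \<in> {q}" using self[OF x(1)] \<open>g \<otimes> x \<otimes> inv g \<in> ?o x\<close> unfolding q .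
      thus False using \<open>g \<otimes> x \<otimes> inv g \<noteq> x\<close> by simp
    qed
    moreover have "card (?o x) dvd order G"
      by (rule dvdI[OF A.orbit_stabilizer_theorem[OF xc, symmetric]])
    ultimately show ?thesis unfolding x(2) G(3) by (intro prime_dvd_of_dvd_power[OF p])
  qed
  hence "p dvd sum card (?o ` K - {?o \<one>})" by (rule dvd_sum)
  moreover have "p dvd card K"
  proof -
    have "card K dvd p ^ k" using lagrange[OF K.is_subgroup] G(3) by (metis dvd_triv_right)
    moreover have "card K \<noteq> 1" using K(2) K.one_closed by (metis card_1_singletonE singletonD)
    ultimately show ?thesis using prime_dvd_of_dvd_power[OF p] by blast
  qed
  ultimately have "p dvd (1 + sum card (?o ` K - {?o \<one>})) - sum card (?o ` K - {?o \<one>})"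
    unfolding cK[symmetric] by (intro dvd_diff_nat)
  hence "p dvd 1" by simp
  thus False using p by (simp add: prime_nat_iff)
qed

text \<open>Let \<open>w\<close> be a central element of order \<open>p\<close> in \<open>K\<close>.
  If the product of \<open>w\<close> and its image under the involution is trivial, then
  \<open>w\<close> is inverted; otherwise that product is itself a nontrivial fixed central
  element.\<close>

lemma p_group_central_gamma:
  fixes G (structure)
  assumes G: "finite_gamma_group G" "order G = p ^ k" and p: "prime p" and K: "K \<lhd> G" "K \<noteq> {\<one>}" "act G ` K \<subseteq> K"
  shows "\<exists>z\<in>K. z \<noteq> \<one> \<and> z [^] p = \<one> \<and> (\<forall>g\<in>carrier G. g \<otimes> z = z \<otimes> g) \<and> (act G z = z \<or> act G z = inv z)"
proof -
  note G' = finite_gammaD[OF G(1)]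
  interpret tg G by (rule G'(6))
  interpret K: normal K G by fact
  obtain z where z: "z \<in> K" "z \<noteq> \<one>" "\<forall>g\<in>carrier G. g \<otimes> z = z \<otimes> g"
    using p_group_central[OF G'(1,2) G(2) p K(1,2)] by blast
  have zc: "z \<in> carrier G" using z by auto
  have powK: "x [^] (i::nat) \<in> K" if "x \<in> K" for x i using that by (induction i) auto
  have powc: "g \<otimes> x [^] (i::nat) = x [^] i \<otimes> g" if "x \<in> carrier G" "\<forall>g\<in>carrier G. g \<otimes> x = x \<otimes> g" "g \<in> carrier G" for x i g
  proof (induction i)
    case (Suc i)
    have xi: "x [^] i \<in> carrier G" using that(1) by simp
    have "g \<otimes> (x [^] i \<otimes> x) = g \<otimes> x [^] i \<otimes> x" using m_assoc[OF that(3) xi that(1)] by simp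
    also have "\<dots> = x [^] i \<otimes> (g \<otimes> x)" using Suc m_assoc[OF xi that(3) that(1)] by simp
    also have "\<dots> = x [^] i \<otimes> (x \<otimes> g)" using that(2,3) by simp
    also have "\<dots> = x [^] i \<otimes> x \<otimes> g" using m_assoc[OF xi that(1) that(3)] by simp
    finally show ?case by simp
  qed (use that in simp)
  have ex: "\<exists>j. z [^] (p ^ j) = \<one>" using pow_order_eq_1[OF zc] G(2) by auto
  \<comment> \<open>With \<open>j\<close> minimal, the power of \<open>z\<close> with exponent
    p^(j-1) is nontrivial and is killed by \<open>p\<close>.\<close>
  define j where "j = (LEAST j. z [^] (p ^ j) = \<one>)"
  have j: "z [^] (p ^ j) = \<one>" unfolding j_def by (rule LeastI_ex[OF ex])
  have "j \<noteq> 0" using j z(2) zc by (cases j) auto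
  then obtain i where i: "j = Suc i" by (cases j) auto
  define w where "w = z [^] (p ^ i)"
  have w: "w \<in> K" "w \<in> carrier G" "\<forall>g\<in>carrier G. g \<otimes> w = w \<otimes> g" using powK z powc[OF zc z(3)] zc by (auto simp: w_def)
  have w1: "w \<noteq> \<one>" unfolding w_def using not_less_Least[of i "\<lambda>j. z [^] (p ^ j) = \<one>"] i j_def by auto
  have wp: "w [^] p = \<one>" using j zc i by (simp add: w_def nat_pow_pow mult.commute)
  have aw: "act G w \<in> K" "act G w \<in> carrier G" using w K(3) by auto
  have awc: "g \<otimes> act G w = act G w \<otimes> g" if "g \<in> carrier G" for g
    using arg_cong[OF bspec[OF w(3), of "act G g"], of "act G"] that w(2) by (simp add: act_mult act_act)
  show ?thesis
  proof (cases "w \<otimes> act G w = \<one>")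
    case True
    hence "act G w = inv w" using w aw by (metis inv_equality inv_inv inv_closed)
    thus ?thesis using w w1 wp by blast
  next
    case False
    let ?v = "w \<otimes> act G w"
    have "act G ?v = ?v" using w aw awc[of w] by (simp add: act_mult act_act)
    moreover have "?v [^] p = \<one>"
    proof -
      have "?v [^] p = w [^] p \<otimes> act G w [^] p" using w aw by (intro pow_mult_distrib) auto
      also have "act G w [^] p = act G (w [^] p)" using w by (simp add: act_pow)
      finally show ?thesis using wp by simp
    qed
    moreover have "g \<otimes> ?v = ?v \<otimes> g" if g: "g \<in> carrier G" for g
    proof -
      have "g \<otimes> ?v = w \<otimes> g \<otimes> act G w" using w aw g by (simp add: m_assoc[symmetric])
      thus ?thesis using awc[OF g] w aw g by (simp add: m_assoc)
    qed
    moreover have "?v \<in> K" using w aw by auto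
    ultimately show ?thesis using False by blast
  qed
qed

section \<open>Generation of a kernel\<close>

lemma omega_power_eq_1:
  assumes "prime p" shows "omega p ^ k = 1 \<longleftrightarrow> p dvd k"
proof
  have p: "p > 0" using assms prime_gt_0_nat by blast
  have pw: "omega p ^ i = 1" if "p dvd i" for i
    using that omega_mu[OF p] by (auto simp: mu_def power_mult elim!: dvdE)
  thus "p dvd k \<Longrightarrow> omega p ^ k = 1" .
  assume "omega p ^ k = 1"
  have "omega p ^ k = omega p ^ (p * (k div p) + k mod p)" by simp
  also have "\<dots> = omega p ^ (p * (k div p)) * omega p ^ (k mod p)" by (rule power_add)
  also have "\<dots> = omega p ^ (k mod p)" unfolding pw[OF dvd_triv_left] by simp
  finally have "omega p ^ (k mod p) = omega p ^ 0" using \<open>omega p ^ k = 1\<close> by simp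
  moreover have "k mod p < p" using p by simp
  ultimately have "k mod p = 0" using inj_onD[OF omega_powers(1)[OF p], of "k mod p" 0] p by simp
  thus "p dvd k" by (simp add: dvd_eq_mod_eq_0)
qed

context tg begin

text \<open>By the hypotheses \<open>N/M\<close> is cyclic of order \<open>p\<close>, generated by
  the coset of \<open>a\<close>, and central in \<open>G/M\<close>. The coset of \<open>a\<close>
  has order exactly \<open>p\<close>, so sending the coset of \<open>a [^] k\<close> to
  \<open>omega p ^ k\<close> is well defined with kernel \<open>M\<close>; centrality gives
  invariance under conjugation.\<close>

lemma central_char_exists:
  assumes p: "prime p" and N: "N \<lhd> G" and M: "M \<lhd> G" "openin (topo G) M" "M \<subseteq> N"
    and a: "a \<in> N" "a \<notin> M" "a [^] p \<in> M"
    and gen: "\<And>x. x \<in> N \<Longrightarrow> \<exists>k::nat. M #> x = M #> a [^] k"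
    and cen: "\<And>g. g \<in> carrier G \<Longrightarrow> M #> (g \<otimes> a \<otimes> inv g) = M #> a"
  shows "\<exists>c\<in>central_chars p G N. (\<forall>x\<in>N. c x = 1 \<longleftrightarrow> x \<in> M) \<and>
    (\<forall>x\<in>N. \<forall>k::nat. M #> x = M #> a [^] k \<longrightarrow> c x = omega p ^ k)"
proof -
  interpret N: normal N G by fact
  interpret M: normal M G by fact
  have pp: "p > 0" using p prime_gt_0_nat by blast
  have ac: "a \<in> carrier G" using a by auto
  define Q where "Q = G Mod M"
  interpret Q: group Q unfolding Q_def by (rule M.factorgroup_is_group)
  let ?q = "\<lambda>x. M #> x"
  note Qm = M.factor_coset(1)[folded Q_def] and qm = M.factor_coset(2)[folded Q_def]
    and q1 = M.factor_coset(3)[folded Q_def] and qM = M.factor_coset(4)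
  let ?z = "?q a"
  have zc: "?z \<in> carrier Q" using Qm ac by blast
  note qpow = M.factor_coset(5)[OF ac, folded Q_def]
  have "Q.ord ?z dvd p" using Q.pow_eq_id[OF zc, of p] qpow[of p] qM[of "a [^] p"] a ac q1 by simp
  moreover have "Q.ord ?z \<noteq> 1" using Q.ord_eq_1[OF zc] qM[OF ac] a(2) q1 by simp
  ultimately have ordz: "Q.ord ?z = p" using p by (auto simp: prime_nat_iff)
  have z1: "?z [^]\<^bsub>Q\<^esub> (k::nat) = \<one>\<^bsub>Q\<^esub> \<longleftrightarrow> p dvd k" for k using Q.pow_eq_id[OF zc, of k] ordz by simp
  have wd: "omega p ^ i = omega p ^ j" if "?z [^]\<^bsub>Q\<^esub> i = ?z [^]\<^bsub>Q\<^esub> j" "i \<le> j" for i j :: nat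
  proof -
    have "?z [^]\<^bsub>Q\<^esub> i \<otimes>\<^bsub>Q\<^esub> ?z [^]\<^bsub>Q\<^esub> (j - i) = ?z [^]\<^bsub>Q\<^esub> i \<otimes>\<^bsub>Q\<^esub> \<one>\<^bsub>Q\<^esub>"
      using Q.nat_pow_mult[OF zc, of i "j - i"] that zc by simp
    hence "inv\<^bsub>Q\<^esub> (?z [^]\<^bsub>Q\<^esub> i) \<otimes>\<^bsub>Q\<^esub> (?z [^]\<^bsub>Q\<^esub> i \<otimes>\<^bsub>Q\<^esub> ?z [^]\<^bsub>Q\<^esub> (j - i)) = inv\<^bsub>Q\<^esub> (?z [^]\<^bsub>Q\<^esub> i) \<otimes>\<^bsub>Q\<^esub> (?z [^]\<^bsub>Q\<^esub> i \<otimes>\<^bsub>Q\<^esub> \<one>\<^bsub>Q\<^esub>)"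
      by (simp only:)
    hence "?z [^]\<^bsub>Q\<^esub> (j - i) = \<one>\<^bsub>Q\<^esub>" using zc by (simp only: Q.cancel_simps Q.nat_pow_closed Q.one_closed)
    hence "omega p ^ (j - i) = 1" using z1 omega_power_eq_1[OF p] by simp
    moreover have "omega p ^ j = omega p ^ i * omega p ^ (j - i)" using that(2) by (simp flip: power_add)
    ultimately show ?thesis by simp
  qed
  define kk where "kk x = (SOME k::nat. ?q x = ?q (a [^] k))" for x
  define c where "c = (\<lambda>x\<in>N. omega p ^ kk x)"
  have c: "c x = omega p ^ k" if "x \<in> N" "?q x = ?q (a [^] k)" for x and k :: nat
  proof -
    have "?q x = ?q (a [^] kk x)" unfolding kk_def using gen[OF that(1)] by (rule someI_ex)
    hence e: "?z [^]\<^bsub>Q\<^esub> kk x = ?z [^]\<^bsub>Q\<^esub> k" unfolding that(2) qpow by (rule HOL.sym)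
    have "omega p ^ kk x = omega p ^ k"
    proof (cases "kk x \<le> k")
      case True show ?thesis by (rule wd[OF e True])
    next
      case False
      hence "k \<le> kk x" by simp
      from wd[OF e[symmetric] this] show ?thesis by simp
    qed
    thus ?thesis using that(1) by (simp add: c_def)
  qed
  have cM: "c x = 1 \<longleftrightarrow> x \<in> M" if x: "x \<in> N" for x
  proof -
    obtain k :: nat where k: "?q x = ?q (a [^] k)" using gen[OF x] by blast
    have xc: "x \<in> carrier G" using x by auto
    have "c x = 1 \<longleftrightarrow> p dvd k" using c[OF x k] omega_power_eq_1[OF p] by simp
    also have "\<dots> \<longleftrightarrow> ?q x = M" using z1[of k] k qpow[of k] q1 by simp
    finally show ?thesis using qM[OF xc] by simp
  qed
  have "c \<in> central_chars p G N"
    unfolding central_chars_def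
  proof (intro CollectI conjI ballI)
    show "c \<in> N \<rightarrow>\<^sub>E mu p" using omega_mu[OF pp] by (auto simp: c_def)
    have "{x \<in> N. c x = 1} = M" using cM M(3) by blast
    thus "openin (topo G) {x \<in> N. c x = 1}" using M(2) by simp
    fix x y assume xy: "x \<in> N" "y \<in> N"
    obtain i :: nat where i: "?q x = ?q (a [^] i)" using gen[OF xy(1)] by blast
    obtain j :: nat where j: "?q y = ?q (a [^] j)" using gen[OF xy(2)] by blast
    have "?q (x \<otimes> y) = ?q (a [^] (i + j))"
      using qm[of x y] qm[of "a [^] i" "a [^] j"] xy i j ac by (simp add: nat_pow_mult)
    thus "c (x \<otimes> y) = c x * c y" using c[OF xy(1) i] c[OF xy(2) j] c[of "x \<otimes> y" "i + j"] xy by (simp add: power_add)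
  next
    fix g x assume g: "g \<in> carrier G" and x: "x \<in> N"
    obtain i :: nat where i: "?q x = ?q (a [^] i)" using gen[OF x] by blast
    have xc: "x \<in> carrier G" using x by auto
    have Qg: "?q g \<in> carrier Q" using Qm[OF g] .
    have "?q g \<otimes>\<^bsub>Q\<^esub> ?z \<otimes>\<^bsub>Q\<^esub> ?q (inv g) = ?z"
      using cen[OF g] qm g ac by simp
    hence "?q g \<otimes>\<^bsub>Q\<^esub> ?z \<otimes>\<^bsub>Q\<^esub> ?q (inv g) \<otimes>\<^bsub>Q\<^esub> ?q g = ?z \<otimes>\<^bsub>Q\<^esub> ?q g" by simp
    moreover have ig: "?q (inv g) \<otimes>\<^bsub>Q\<^esub> ?q g = \<one>\<^bsub>Q\<^esub>" using qm[of "inv g" g] g qM[of \<one>] q1 by simp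
    ultimately have com: "?q g \<otimes>\<^bsub>Q\<^esub> ?z = ?z \<otimes>\<^bsub>Q\<^esub> ?q g"
      using zc Qg Qm[of "inv g"] g by (simp add: Q.m_assoc)
    have comk: "?q g \<otimes>\<^bsub>Q\<^esub> ?z [^]\<^bsub>Q\<^esub> (k::nat) = ?z [^]\<^bsub>Q\<^esub> k \<otimes>\<^bsub>Q\<^esub> ?q g" for k
    proof (induction k)
      case (Suc k)
      have zk: "?z [^]\<^bsub>Q\<^esub> k \<in> carrier Q" using zc by simp
      have "?q g \<otimes>\<^bsub>Q\<^esub> (?z [^]\<^bsub>Q\<^esub> k \<otimes>\<^bsub>Q\<^esub> ?z) = ?z [^]\<^bsub>Q\<^esub> k \<otimes>\<^bsub>Q\<^esub> ?q g \<otimes>\<^bsub>Q\<^esub> ?z"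
        using Q.m_assoc[OF Qg zk zc] Suc by simp
      also have "\<dots> = ?z [^]\<^bsub>Q\<^esub> k \<otimes>\<^bsub>Q\<^esub> (?z \<otimes>\<^bsub>Q\<^esub> ?q g)" using Q.m_assoc[OF zk Qg zc] com by simp
      finally show ?case using Q.m_assoc[OF zk zc Qg] by simp
    qed (use Qg in simp)
    have "?q (g \<otimes> x \<otimes> inv g) = ?q g \<otimes>\<^bsub>Q\<^esub> ?z [^]\<^bsub>Q\<^esub> i \<otimes>\<^bsub>Q\<^esub> ?q (inv g)"
      using qm g xc i qpow[of i] by simp
    also have "\<dots> = ?z [^]\<^bsub>Q\<^esub> i \<otimes>\<^bsub>Q\<^esub> (?q g \<otimes>\<^bsub>Q\<^esub> ?q (inv g))"
      using comk[of i] Q.m_assoc[OF Q.nat_pow_closed[OF zc] Qg Qm[of "inv g"]] g by simp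
    also have "?q g \<otimes>\<^bsub>Q\<^esub> ?q (inv g) = \<one>\<^bsub>Q\<^esub>" using qm[of g "inv g"] g qM[of \<one>] q1 by simp
    finally have "?q (g \<otimes> x \<otimes> inv g) = ?q (a [^] i)" using qpow[of i] zc by simp
    thus "c (g \<otimes> x \<otimes> inv g) = c x" using c[OF x i] c[of "g \<otimes> x \<otimes> inv g" i] N.inv_op_closed2[OF g x] by simp
  qed
  thus ?thesis using cM c by blast
qed

text \<open>The projection from \<open>G/N\<close> to \<open>G/M\<close> is a surjection of finite
  groups, so the divisibility is Lagrange in \<open>G/N\<close>.\<close>

lemma index_dvd:
  assumes M: "M \<lhd> G" "gamma_subgroup G M" and N: "N \<lhd> G" "gamma_subgroup G N" "openin (topo G) N" "finite (rcosets N)"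
    and NM: "N \<subseteq> M"
  shows "finite (rcosets M)" "card (rcosets M) dvd card (rcosets N)" "openin (topo G) M"
proof -
  interpret M: normal M G by fact
  interpret N: normal N G by fact
  show o: "openin (topo G) M" by (rule open_superset[OF M.is_subgroup N(3) N.one_closed NM])
  let ?\<pi> = "\<lambda>X. M <#> X"
  have \<pi>: "?\<pi> (N #> x) = M #> x" if "x \<in> carrier G" for x
  proof -
    have "M <#> N = M"
    proof (intro equalityI subsetI)
      fix w assume "w \<in> M" thus "w \<in> M <#> N" unfolding set_mult_def using N.one_closed M.mem_carrier r_one by (metis (no_types, lifting) UN_iff singletonI)
    qed (use NM in \<open>auto simp: set_mult_def\<close>)
    thus ?thesis using setmult_rcos_assoc[OF M.subset N.subset that] by simp
  qed
  have im: "?\<pi> ` (rcosets N) = rcosets M"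
    using \<pi> by (auto simp: RCOSETS_def image_iff)
  show fin: "finite (rcosets M)" using N(4) im by (metis finite_imageI)
  let ?Q = "gamma_quotient G N" and ?R = "gamma_quotient G M"
  note fQ = quotient_finite[OF N]
  note fR = quotient_finite[OF M o fin]
  interpret Q: tg ?Q using finite_gammaD(6)[OF fQ(1)] .
  have "?\<pi> \<in> gsurj ?Q ?R"
    unfolding gsurj_def ghom_def
  proof (intro CollectI conjI ballI homI)
    fix X assume X: "X \<in> carrier ?Q"
    then obtain x where x: "x \<in> carrier G" "X = N #> x" by (auto simp: RCOSETS_def)
    show "?\<pi> X \<in> carrier ?R" using x \<pi> M.subset by (simp add: rcosetsI)
    show "?\<pi> (act ?Q X) = act ?R (?\<pi> X)" using x \<pi> act_coset[OF N(2)] act_coset[OF M(2)] by simp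
    fix Z assume "Z \<in> carrier ?Q"
    then obtain z where z: "z \<in> carrier G" "Z = N #> z" by (auto simp: RCOSETS_def)
    show "?\<pi> (X \<otimes>\<^bsub>?Q\<^esub> Z) = ?\<pi> X \<otimes>\<^bsub>?R\<^esub> ?\<pi> Z" using x z \<pi> N.rcos_sum M.rcos_sum by simp
  next
    show "openin (topo ?Q) (kernel ?Q ?R ?\<pi>)" using finite_gammaD(3)[OF fQ(1)] by (auto simp: kernel_def)
  qed (use im in simp)
  hence "gamma_quotient ?Q (kernel ?Q ?R ?\<pi>) \<cong>\<^sub>\<Gamma> ?R"
    using Q.quotient_iso finite_gammaD[OF fR(1)] by blast
  hence e: "card (rcosets\<^bsub>?Q\<^esub> (kernel ?Q ?R ?\<pi>)) = card (rcosets M)"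
    using gamma_iso_order by (fastforce simp: order_def)
  have "\<pi> \<in> ghom ?Q ?R \<Longrightarrow> subgroup (kernel ?Q ?R \<pi>) ?Q" for \<pi>
    using Q.ghom_kernel(1) finite_gammaD(6)[OF fR(1)] normal_imp_subgroup by blast
  hence "subgroup (kernel ?Q ?R ?\<pi>) ?Q" using \<open>?\<pi> \<in> gsurj ?Q ?R\<close> by (auto simp: gsurj_def)
  hence "card (rcosets\<^bsub>?Q\<^esub> (kernel ?Q ?R ?\<pi>)) dvd order ?Q" using Q.lagrange by (metis dvd_triv_left)
  thus "card (rcosets M) dvd card (rcosets N)" using e by (simp add: order_def)
qed

text \<open>Each overgroup of \<open>N\<close> is a union of cosets of \<open>N\<close>, and there
  are finitely many cosets.\<close>

lemma finite_overgroups: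
  assumes "subgroup N G" "finite (rcosets N)"
  shows "finite {M. subgroup M G \<and> N \<subseteq> M}"
proof -
  have "{M. subgroup M G \<and> N \<subseteq> M} \<subseteq> Union ` Pow (rcosets N)"
  proof
    fix M assume "M \<in> {M. subgroup M G \<and> N \<subseteq> M}"
    hence M: "subgroup M G" "N \<subseteq> M" by auto
    have "M = \<Union>((\<lambda>x. N #> x) ` M)"
    proof (intro equalityI subsetI)
      fix x assume "x \<in> M"
      hence "x \<in> N #> x" using rcos_self[OF _ assms(1)] subgroup.mem_carrier[OF M(1)] by simp
      thus "x \<in> \<Union>((\<lambda>x. N #> x) ` M)" using \<open>x \<in> M\<close> by (rule UN_I[rotated])
    next
      fix w assume "w \<in> \<Union>((\<lambda>x. N #> x) ` M)"
      thus "w \<in> M" using M subgroup.m_closed[OF M(1)] by (auto simp: r_coset_def)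
    qed
    moreover have "(\<lambda>x. N #> x) ` M \<subseteq> rcosets N"
      using subgroup.mem_carrier[OF M(1)] subgroup.subset[OF assms(1)] by (auto intro: rcosetsI)
    ultimately show "M \<in> Union ` Pow (rcosets N)" by blast
  qed
  thus ?thesis using assms(2) by (meson finite_Pow_iff finite_imageI finite_subset)
qed

text \<open>Let \<open>M\<close> be maximal among the \<open>\<Gamma>\<close>-stable normal
  subgroups that contain \<open>L\<close> and lie properly in \<open>N\<close>. In the p-group
  \<open>G/M\<close>, the normal subgroup \<open>N/M\<close> contains a central element
  \<open>z\<close> of order \<open>p\<close> on which the involution acts by a sign. The preimage of
  the group generated by \<open>z\<close> is stable and normal, so by maximality it is
  \<open>N\<close>; the character of the resulting cyclic quotient inherits the sign.\<close>

lemma chief_char: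
  assumes p: "prime p" and N: "N \<lhd> G" "gamma_subgroup G N"
    and L: "L \<lhd> G" "gamma_subgroup G L" "openin (topo G) L" "finite (rcosets L)" "card (rcosets L) = p ^ k"
    and LN: "L \<subseteq> N" "L \<noteq> N"
  shows "\<exists>c\<in>central_chars p G N. c \<noteq> (\<lambda>a\<in>N. 1) \<and> (\<forall>a\<in>L. c a = 1) \<and>
    sign_char G N c"
proof -
  interpret N: normal N G by fact
  interpret L: normal L G by fact
  have pp: "p > 0" using p prime_gt_0_nat by blast
  let ?S = "{M. M \<lhd> G \<and> gamma_subgroup G M \<and> L \<subseteq> M \<and> M \<subset> N}"
  have "?S \<subseteq> {M. subgroup M G \<and> L \<subseteq> M}" using normal_imp_subgroup by blast
  hence "finite ?S" using finite_overgroups[OF L.is_subgroup L(4)] finite_subset by blast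
  moreover have "L \<in> ?S" using L LN by blast
  hence "?S \<noteq> {}" by (metis empty_iff)
  ultimately have "\<exists>M\<in>?S. \<forall>M'\<in>?S. M \<subseteq> M' \<longrightarrow> M = M'" by (rule finite_has_maximal)
  then obtain M where MS: "M \<in> ?S" and max0: "\<forall>M'\<in>?S. M \<subseteq> M' \<longrightarrow> M = M'" by (elim bexE)
  have max: "M = M'" if "M' \<in> ?S" "M \<subseteq> M'" for M' using bspec[OF max0 that(1)] that(2) by (rule mp)
  from MS have M: "M \<lhd> G" "gamma_subgroup G M" "L \<subseteq> M" "M \<subset> N" by auto
  interpret M: normal M G by fact
  note iM = index_dvd[OF M(1,2) L(1,2,3,4) M(3)]
  obtain k' where k': "card (rcosets M) = p ^ k'" using iM(2) L(5) divides_primepow_nat[OF p] by auto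
  let ?Q = "gamma_quotient G M" and ?q = "\<lambda>x. M #> x"
  note fQ = quotient_finite[OF M(1,2) iM(3,1)]
  interpret Q: tg ?Q using finite_gammaD(6)[OF fQ(1)] .
  have qhom: "?q \<in> hom G ?Q" by (rule quotient_tg(4)[OF M(1,2)])
  interpret q: group_hom G ?Q ?q using qhom is_group Q.is_group by (simp add: group_hom_iff)
  have qsurj: "?q ` carrier G = carrier ?Q" using fQ(2) by (simp add: gsurj_def)
  have qM: "?q x = M \<longleftrightarrow> x \<in> M" if "x \<in> carrier G" for x
    using coset_join1[OF _ that M.is_subgroup] coset_join2[OF that M.is_subgroup] M.subset by blast
  let ?K = "?q ` N"
  have K: "?K \<lhd> ?Q" by (rule N.surj_hom_normal_subgroup[OF q.group_hom_axioms qsurj])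
  obtain b where b: "b \<in> N" "b \<notin> M" using M(4) by blast
  have "?q b \<noteq> M" using qM b by auto
  hence K1: "?K \<noteq> {\<one>\<^bsub>?Q\<^esub>}" using b by auto
  have Ka: "act ?Q ` ?K \<subseteq> ?K"
    using N(2) act_coset[OF M(2)] by (auto simp: gamma_subgroup_def)
  obtain z where z: "z \<in> ?K" "z \<noteq> \<one>\<^bsub>?Q\<^esub>" "z [^]\<^bsub>?Q\<^esub> p = \<one>\<^bsub>?Q\<^esub>" "\<forall>g\<in>carrier ?Q. g \<otimes>\<^bsub>?Q\<^esub> z = z \<otimes>\<^bsub>?Q\<^esub> g"
    "act ?Q z = z \<or> act ?Q z = inv\<^bsub>?Q\<^esub> z"
    using p_group_central_gamma[OF fQ(1) _ p K K1 Ka, of k'] k' by (auto simp: order_def)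
  obtain a where a: "a \<in> N" "z = ?q a" using z(1) by blast
  have ac: "a \<in> carrier G" and zc: "z \<in> carrier ?Q" using a M.subset by (auto simp: rcosetsI)
  have qpow: "?q (a [^] (i::nat)) = z [^]\<^bsub>?Q\<^esub> i" for i
    using q.hom_nat_pow[OF ac, of i] a by simp
  have comk: "g \<otimes>\<^bsub>?Q\<^esub> z [^]\<^bsub>?Q\<^esub> (i::nat) = z [^]\<^bsub>?Q\<^esub> i \<otimes>\<^bsub>?Q\<^esub> g" if g: "g \<in> carrier ?Q" for g i
  proof (induction i)
    case (Suc i)
    have zk: "z [^]\<^bsub>?Q\<^esub> i \<in> carrier ?Q" using zc by (rule Q.nat_pow_closed)
    have "g \<otimes>\<^bsub>?Q\<^esub> (z [^]\<^bsub>?Q\<^esub> i \<otimes>\<^bsub>?Q\<^esub> z) = z [^]\<^bsub>?Q\<^esub> i \<otimes>\<^bsub>?Q\<^esub> g \<otimes>\<^bsub>?Q\<^esub> z"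
      using Q.m_assoc[OF g zk zc] Suc by (simp only:)
    also have "\<dots> = z [^]\<^bsub>?Q\<^esub> i \<otimes>\<^bsub>?Q\<^esub> (z \<otimes>\<^bsub>?Q\<^esub> g)" using Q.m_assoc[OF zk g zc] z(4) g by (simp only:)
    finally show ?case using Q.m_assoc[OF zk zc g] by (simp only: Q.nat_pow_Suc)
  qed (use Q.l_one[OF g] Q.r_one[OF g] in \<open>simp only: Q.nat_pow_0\<close>)
  have conj: "?q (g \<otimes> a [^] (i::nat) \<otimes> inv g) = z [^]\<^bsub>?Q\<^esub> i" if g: "g \<in> carrier G" for g i
  proof -
    have gc: "?q g \<in> carrier ?Q" using q.hom_closed[OF g] .
    have "?q (g \<otimes> a [^] i \<otimes> inv g) = ?q g \<otimes>\<^bsub>?Q\<^esub> z [^]\<^bsub>?Q\<^esub> i \<otimes>\<^bsub>?Q\<^esub> inv\<^bsub>?Q\<^esub> ?q g"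
      using q.hom_mult[of "g \<otimes> a [^] i" "inv g"] q.hom_mult[of g "a [^] i"] q.hom_inv[OF g] qpow[of i] g ac by (simp del: gamma_quotient_simps)
    also have "\<dots> = z [^]\<^bsub>?Q\<^esub> i \<otimes>\<^bsub>?Q\<^esub> (?q g \<otimes>\<^bsub>?Q\<^esub> inv\<^bsub>?Q\<^esub> ?q g)"
      using comk[OF gc, of i] Q.m_assoc[OF Q.nat_pow_closed[OF zc] gc Q.inv_closed[OF gc]] by (simp only:)
    finally show ?thesis using Q.r_inv[OF gc] Q.r_one[OF Q.nat_pow_closed[OF zc]] by (simp only:)
  qed
  let ?N' = "{x \<in> N. \<exists>i::nat. ?q x = z [^]\<^bsub>?Q\<^esub> i}"
  \<comment> \<open>As \<open>z\<close> has exponent \<open>p\<close>, the exponent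
    \<open>p - 1\<close> serves as -1 and all exponents remain natural numbers.\<close>
  have zinv: "inv\<^bsub>?Q\<^esub> z [^]\<^bsub>?Q\<^esub> (i::nat) = z [^]\<^bsub>?Q\<^esub> ((p - 1) * i)" for i
  proof -
    have "z [^]\<^bsub>?Q\<^esub> (p - 1) \<otimes>\<^bsub>?Q\<^esub> z = \<one>\<^bsub>?Q\<^esub>"
      using z(3) pp by (metis Q.nat_pow_Suc Suc_pred' )
    hence "inv\<^bsub>?Q\<^esub> z = z [^]\<^bsub>?Q\<^esub> (p - 1)" using zc by (intro Q.inv_equality Q.nat_pow_closed)
    thus ?thesis using Q.nat_pow_pow[OF zc] by simp
  qed
  have sN': "subgroup ?N' G"
  proof (rule subgroupI)
    fix x assume "x \<in> ?N'"
    then obtain i :: nat where i: "x \<in> N" "?q x = z [^]\<^bsub>?Q\<^esub> i" by blast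
    have "?q (inv x) = inv\<^bsub>?Q\<^esub> (z [^]\<^bsub>?Q\<^esub> i)" using q.hom_inv[of x] i by (simp del: gamma_quotient_simps)
    also have "\<dots> = inv\<^bsub>?Q\<^esub> z [^]\<^bsub>?Q\<^esub> i" using Q.nat_pow_inv[OF zc] by simp
    finally show "inv x \<in> ?N'" using zinv[of i] i by auto
    fix y assume "y \<in> ?N'"
    then obtain j :: nat where j: "y \<in> N" "?q y = z [^]\<^bsub>?Q\<^esub> j" by blast
    have "?q (x \<otimes> y) = z [^]\<^bsub>?Q\<^esub> (i + j)"
      using q.hom_mult[of x y] i j Q.nat_pow_mult[OF zc, of i j] by (simp del: gamma_quotient_simps)
    thus "x \<otimes> y \<in> ?N'" using i j by auto
  next
    have "?q \<one> = z [^]\<^bsub>?Q\<^esub> (0::nat)" using q.hom_one by (simp only: Q.nat_pow_0)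
    thus "?N' \<noteq> {}" using N.one_closed by blast
  qed (use N.subset in blast)
  have nN': "?N' \<lhd> G"
    unfolding normal_inv_iff
  proof (intro conjI ballI sN')
    fix g x assume g: "g \<in> carrier G" and "x \<in> ?N'"
    then obtain i :: nat where i: "x \<in> N" "?q x = z [^]\<^bsub>?Q\<^esub> i" by blast
    have "?q (g \<otimes> x \<otimes> inv g) = ?q g \<otimes>\<^bsub>?Q\<^esub> ?q x \<otimes>\<^bsub>?Q\<^esub> ?q (inv g)"
      using q.hom_mult[of "g \<otimes> x" "inv g"] q.hom_mult[of g x] g i by (simp del: gamma_quotient_simps)
    also have "\<dots> = ?q (g \<otimes> a [^] i \<otimes> inv g)"
      using q.hom_mult[of "g \<otimes> a [^] i" "inv g"] q.hom_mult[of g "a [^] i"] g ac i qpow[of i] by (simp del: gamma_quotient_simps)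
    finally show "g \<otimes> x \<otimes> inv g \<in> ?N'" using conj[OF g, of i] N.inv_op_closed2[OF g i(1)] by auto
  qed
  have actz: "act ?Q (z [^]\<^bsub>?Q\<^esub> i) = z [^]\<^bsub>?Q\<^esub> i \<or> act ?Q (z [^]\<^bsub>?Q\<^esub> i) = z [^]\<^bsub>?Q\<^esub> ((p - 1) * i)" for i :: nat
    using z(5) Q.act_pow[OF zc, of i] zinv[of i] by (simp del: gamma_quotient_simps) (metis)
  have aq: "?q (act G x) = act ?Q (?q x)" if "x \<in> carrier G" for x using act_coset[OF M(2) that] by simp
  have gN': "gamma_subgroup G ?N'"
    unfolding gamma_subgroup_def
  proof (intro conjI sN' subsetI)
    fix w assume "w \<in> act G ` ?N'"
    then obtain x and i :: nat where x: "w = act G x" "x \<in> N" "?q x = z [^]\<^bsub>?Q\<^esub> i" by blast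
    have "?q w = act ?Q (z [^]\<^bsub>?Q\<^esub> i)" using aq[of x] x by (simp del: gamma_quotient_simps)
    moreover have "w \<in> N" using x N(2) by (auto simp: gamma_subgroup_def)
    ultimately show "w \<in> ?N'" using actz[of i] by (simp del: gamma_quotient_simps) metis
  qed
  have "?N' = N"
  proof (rule ccontr)
    assume ne: "?N' \<noteq> N"
    have MN': "M \<subseteq> ?N'"
    proof
      fix x assume x: "x \<in> M"
      have "?q x = z [^]\<^bsub>?Q\<^esub> (0::nat)" using qM[of x] x by simp
      thus "x \<in> ?N'" using x M(4) by blast
    qed
    hence "?N' \<in> ?S" using nN' gN' M(3) ne by blast
    hence "M = ?N'" by (rule max[OF _ MN'])
    have "?q a = z [^]\<^bsub>?Q\<^esub> (1::nat)" using a(2) Q.nat_pow_eone[OF zc] by (simp only:)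
    hence "a \<in> ?N'" using a(1) by blast
    moreover note \<open>M = ?N'\<close>
    ultimately have "a \<in> M" by blast
    thus False using z(2) a qM[OF ac] by simp
  qed
  hence gen: "\<exists>i::nat. ?q x = ?q (a [^] i)" if "x \<in> N" for x using qpow that by auto
  have aM: "a \<notin> M" using z(2) a qM[OF ac] by simp
  have apM: "a [^] p \<in> M" using z(3) qpow[of p] qM[of "a [^] p"] ac by simp
  have cen: "?q (g \<otimes> a \<otimes> inv g) = ?q a" if "g \<in> carrier G" for g
    using conj[OF that, of 1] Q.nat_pow_eone[OF zc] nat_pow_eone[OF ac] a(2) by (simp only:)
  have MN: "M \<subseteq> N" using M(4) by blast
  have "\<exists>c\<in>central_chars p G N. (\<forall>x\<in>N. c x = 1 \<longleftrightarrow> x \<in> M) \<and>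
    (\<forall>x\<in>N. \<forall>i::nat. ?q x = ?q (a [^] i) \<longrightarrow> c x = omega p ^ i)"
    by (rule central_char_exists[OF p N(1) M(1) iM(3) MN a(1) aM apM]) (erule gen, erule cen)
  then obtain c where c: "c \<in> central_chars p G N" "\<forall>x\<in>N. c x = 1 \<longleftrightarrow> x \<in> M" "\<forall>x\<in>N. \<forall>i::nat. ?q x = ?q (a [^] i) \<longrightarrow> c x = omega p ^ i"
    by (elim bexE conjE)
  have "c \<noteq> (\<lambda>a\<in>N. 1)"
  proof
    assume "c = (\<lambda>a\<in>N. 1)"
    hence "c a = 1" using a(1) by simp
    thus False using bspec[OF c(2) a(1)] aM by simp
  qed
  moreover have "\<forall>a\<in>L. c a = 1"
  proof
    fix x assume "x \<in> L"
    hence "x \<in> M" "x \<in> N" using M(3) LN(1) by auto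
    thus "c x = 1" using bspec[OF c(2), of x] by simp
  qed
  moreover have "(\<forall>x\<in>N. c (act G x) = c x) \<or> (\<forall>x\<in>N. c (act G x) = inverse (c x))"
  proof -
    have aN: "act G x \<in> N" if "x \<in> N" for x using N(2) that by (auto simp: gamma_subgroup_def)
    consider "act ?Q z = z" | "act ?Q z = inv\<^bsub>?Q\<^esub> z" using z(5) by blast
    thus ?thesis
    proof cases
      case 1
      have "c (act G x) = c x" if x: "x \<in> N" for x
      proof -
        obtain i :: nat where i: "?q x = ?q (a [^] i)" using gen[OF x] by blast
        have "?q (act G x) = act ?Q z [^]\<^bsub>?Q\<^esub> i" using aq[of x] x i qpow[of i] Q.act_pow[OF zc, of i] by (simp del: gamma_quotient_simps)
        hence "?q (act G x) = ?q (a [^] i)" using 1 qpow by simp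
        thus ?thesis using c(3) x aN[OF x] i by metis
      qed
      thus ?thesis by blast
    next
      case 2
      have "c (act G x) = inverse (c x)" if x: "x \<in> N" for x
      proof -
        obtain i :: nat where i: "?q x = ?q (a [^] i)" using gen[OF x] by blast
        have "?q (act G x) = act ?Q z [^]\<^bsub>?Q\<^esub> i" using aq[of x] x i qpow[of i] Q.act_pow[OF zc, of i] by (simp del: gamma_quotient_simps)
        hence "?q (act G x) = ?q (a [^] ((p - 1) * i))" using 2 qpow zinv[of i] by simp
        hence 3: "c (act G x) = omega p ^ ((p - 1) * i)" using c(3) aN[OF x] by blast
        have 4: "c x = omega p ^ i" using c(3) x i by blast
        have "omega p ^ ((p - 1) * i) * omega p ^ i = omega p ^ (p * i)"
          using pp by (simp add: diff_mult_distrib flip: power_add)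
        also have "\<dots> = 1" using omega_power_eq_1[OF p] by simp
        finally show ?thesis using 3 4 by (metis inverse_unique mult.commute)
      qed
      thus ?thesis by blast
    qed
  qed
  ultimately show ?thesis using c(1) by blast
qed

text \<open>The sign condition is what makes the kernel of \<open>c\<close> stable under the
  involution. Its index is \<open>p\<close> times that of \<open>N\<close>, hence the exponent
  \<open>h + 1\<close>.\<close>

lemma sign_char_kernel:
  assumes p: "prime p" and H: "finite_gamma_group H" "order H = p ^ h" and \<phi>: "\<phi> \<in> gsurj G H" and N: "N = kernel G H \<phi>"
    and c: "c \<in> central_chars p G N" "c \<noteq> (\<lambda>a\<in>N. 1)" "sign_char G N c"
  defines "K \<equiv> {a\<in>N. c a = 1}"
  shows "K \<lhd> G" "gamma_subgroup G K" "openin (topo G) K" "finite (rcosets K)" "card (rcosets K) = p ^ (h + 1)"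
proof -
  note H' = finite_gammaD[OF H(1)]
  have pp: "p > 0" using p prime_gt_0_nat by blast
  have s: "\<phi> \<in> ghom G H" "\<phi> \<in> hom G H" "\<phi> ` carrier G = carrier H" using \<phi> by (auto simp: gsurj_def ghom_def)
  note k = ghom_kernel[OF s(1) H'(6), folded N]
  show K: "K \<lhd> G" unfolding K_def by (rule central_char_kernel[OF c(1) k(1) pp])
  show "gamma_subgroup G K"
    using normal_imp_subgroup[OF K] c(3) k(2) by (auto simp: gamma_subgroup_def K_def)
  show "openin (topo G) K" unfolding K_def by (rule central_charsD(5)[OF c(1) k(1) pp])
  note r = card_rcosets_char_kernel[OF s(2,3) H'(1,2) N c(1,2) p, folded K_def]
  show "finite (rcosets K)" by (rule r(1))
  show "card (rcosets K) = p ^ (h + 1)" using r(2) H(2) by simp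
qed

text \<open>\<open>N \<inter> M\<close> is again a member of the index and is properly contained in
  \<open>N\<close>; a chief character between the two does the separation.\<close>

lemma sign_char_separating:
  assumes p: "prime p" and N: "N \<in> p_index p G" and M: "M \<in> p_index p G" "\<not> N \<subseteq> M"
  shows "\<exists>c\<in>central_chars p G N. c \<noteq> (\<lambda>a\<in>N. 1) \<and> (\<forall>a\<in>N \<inter> M. c a = 1) \<and> sign_char G N c"
proof -
  interpret c: completed G "p_gamma_groups p" by (rule p_completed)
  have "N \<inter> M \<in> p_index p G" by (rule completion_index_Int[OF c.Cfin N M(1)])
  then obtain j where L: "N \<inter> M \<lhd> G" "gamma_subgroup G (N \<inter> M)" "openin (topo G) (N \<inter> M)" "finite (rcosets (N \<inter> M))"
    "card (rcosets (N \<inter> M)) = p ^ j" unfolding index_p[OF p] by blast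
  show ?thesis by (rule chief_char[OF p c.JD(1,2)[OF N] L]) (use M(2) in auto)
qed

text \<open>For \<open>N\<close> in the index this says that \<open>G/N\<close> is the largest
  finite p-quotient of \<open>G/[Y(S)]\<close>, expressed without forming
  \<open>G/[Y(S)]\<close>.\<close>

definition generates_kernel :: "nat \<Rightarrow> 'a set \<Rightarrow> 'a set \<Rightarrow> bool" where
  "generates_kernel p N S \<longleftrightarrow> (\<forall>s\<in>S. Y G s \<in> N) \<and>
     (\<forall>M\<in>p_index p G. (\<forall>s\<in>S. Y G s \<in> M) \<longrightarrow> N \<subseteq> M)"

text \<open>The kernel of a nontrivial sign character is a member of the index not containing
  \<open>N\<close>, so it must miss some \<open>Y(s)\<close>. Conversely, a member of the index that
  contains \<open>Y(S)\<close> but not \<open>N\<close> is separated from \<open>N\<close> by a sign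
  character, and that character is trivial on \<open>Y(S)\<close>.\<close>

lemma generates_kernel_iff:
  assumes p: "prime p" and H: "finite_gamma_group H" "order H = p ^ h" and \<phi>: "\<phi> \<in> gsurj G H" and N: "N = kernel G H \<phi>"
  shows "generates_kernel p N S \<longleftrightarrow> (\<forall>s\<in>S. Y G s \<in> N) \<and>
    (\<forall>c\<in>central_chars p G N. c \<noteq> (\<lambda>a\<in>N. 1) \<and> sign_char G N c
      \<longrightarrow> (\<exists>s\<in>S. c (Y G s) \<noteq> 1))"
    (is "_ \<longleftrightarrow> ?R")
proof -
  note H' = finite_gammaD[OF H(1)]
  have pp: "p > 0" using p prime_gt_0_nat by blast
  have gh: "\<phi> \<in> ghom G H" using \<phi> by (simp add: gsurj_def)
  note k = ghom_kernel[OF gh H'(6), folded N]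
  interpret N: normal N G by (rule k(1))
  show ?thesis
  proof
    assume L: "generates_kernel p N S"
    show ?R
    proof (intro conjI ballI impI)
      fix c assume c: "c \<in> central_chars p G N"
        "c \<noteq> (\<lambda>a\<in>N. 1) \<and> sign_char G N c"
      let ?K = "{a\<in>N. c a = 1}"
      have c2: "c \<noteq> (\<lambda>a\<in>N. 1)" "sign_char G N c" using c(2) by blast+
      have KJ: "?K \<in> p_index p G"
        unfolding index_p[OF p] using sign_char_kernel[OF p H \<phi> N c(1) c2] by blast
      show "\<exists>s\<in>S. c (Y G s) \<noteq> 1"
      proof (rule ccontr)
        assume "\<not> ?thesis"
        hence "\<forall>s\<in>S. Y G s \<in> ?K" using L by (auto simp: generates_kernel_def)
        hence "N \<subseteq> ?K" using L KJ by (auto simp: generates_kernel_def)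
        thus False using char_nontrivial[OF c(1) c2(1) k(1) pp] by blast
      qed
    qed (use L in \<open>auto simp: generates_kernel_def\<close>)
  next
    assume R: ?R
    show "generates_kernel p N S"
      unfolding generates_kernel_def
    proof (intro conjI ballI impI)
      fix M assume M: "M \<in> p_index p G" "\<forall>s\<in>S. Y G s \<in> M"
      show "N \<subseteq> M"
      proof (rule ccontr)
        assume nm: "\<not> N \<subseteq> M"
        obtain c where c: "c\<in>central_chars p G N" "c \<noteq> (\<lambda>a\<in>N. 1)" "\<forall>a\<in>N \<inter> M. c a = 1" "sign_char G N c"
          using sign_char_separating[OF p kernel_p_index[OF p H gh, folded N] M(1) nm] by blast
        hence "\<exists>s\<in>S. c (Y G s) \<noteq> 1" using R by blast
        thus False using c(3) M(2) R by blast
      qed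
    qed (use R in blast)
  qed
qed

end

text \<open>The constant \<open>card\<close> is 0 on infinite sets, so positivity of the right-hand
  side of the counting formula already forces finiteness.\<close>

lemma (in pfree) central_chars_finite:
  assumes "group H" "finite (carrier H)" "\<exists>k. order H = p ^ k"
    "\<phi> \<in> hom F H" "\<phi> ` carrier F = carrier H" "openin (topo F) (kernel F H \<phi>)"
  shows "finite (central_chars p F (kernel F H \<phi>))"
proof -
  have pp: "p > 0" using prime prime_gt_0_nat by blast
  have "card (central_chars p F (kernel F H \<phi>)) * p ^ (order H - 1) > 0"
    using card_central_chars[OF assms HOL.refl] cocycles_finite[OF assms(2) pp assms(1)] pp by simp
  thus ?thesis using card_gt_0_iff by fastforce
qed

section \<open>The relation rank\<close>

text \<open>The topological input for recognising a closed subgroup by finite-order characters: a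
  point outside a closed set is separated from it modulo one open normal subgroup of finite index,
  here the kernel of a coordinate.\<close>

lemma (in completed) separate_closed:
  assumes D: "closedin (topo Gh) D" and a: "a \<in> carrier Gh" "a \<notin> D"
  shows "\<exists>L. L \<lhd> Gh \<and> openin (topo Gh) L \<and> finite (rcosets\<^bsub>Gh\<^esub> L) \<and> (\<forall>d\<in>D. a \<otimes>\<^bsub>Gh\<^esub> inv\<^bsub>Gh\<^esub> d \<notin> L)"
proof -
  interpret Gh: tg Gh by (rule Gh_tg)
  have "openin (topo Gh) (carrier Gh - D)" using D Gh.topspace_eq by (simp add: closedin_def)
  then obtain L where L: "L \<in> J" "{h\<in>carrier Gh. h L = a L} \<subseteq> carrier Gh - D"
    using a unfolding openin_Gh by blast
  let ?Q = "gamma_quotient G L"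
  note fQ = quotient_finite(1)[OF JD(1-4)[OF L(1)]]
  interpret Q: tg ?Q by (rule finite_gammaD(6)[OF fQ])
  let ?\<pi> = "\<lambda>f. f L"
  have ker: "kernel Gh ?Q ?\<pi> = {f\<in>carrier Gh. f L = L}" by (simp add: kernel_def)
  have gh: "?\<pi> \<in> ghom Gh ?Q"
    unfolding ghom_def
  proof (intro CollectI conjI ballI)
    show "?\<pi> \<in> hom Gh ?Q" using mem_rcosets[OF _ L(1)] mult_at[OF L(1)] by (auto simp: hom_def)
    show "openin (topo Gh) (kernel Gh ?Q ?\<pi>)" unfolding ker openin_Gh using L(1) by auto
  qed (simp add: act_at[OF L(1)])
  note k = Gh.ghom_kernel[OF gh Q.tg_axioms]
  have "a \<otimes>\<^bsub>Gh\<^esub> inv\<^bsub>Gh\<^esub> d \<notin> kernel Gh ?Q ?\<pi>" if d: "d \<in> D" for d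
  proof
    assume *: "a \<otimes>\<^bsub>Gh\<^esub> inv\<^bsub>Gh\<^esub> d \<in> kernel Gh ?Q ?\<pi>"
    have dc: "d \<in> carrier Gh" using d D closedin_subset Gh.topspace_eq by blast
    interpret \<pi>: group_hom Gh ?Q ?\<pi> by (rule k(5))
    have e: "?\<pi> (a \<otimes>\<^bsub>Gh\<^esub> inv\<^bsub>Gh\<^esub> d) = \<one>\<^bsub>?Q\<^esub>" using * by (simp only: kernel_def mem_Collect_eq)
    have "?\<pi> ((a \<otimes>\<^bsub>Gh\<^esub> inv\<^bsub>Gh\<^esub> d) \<otimes>\<^bsub>Gh\<^esub> d) = ?\<pi> (a \<otimes>\<^bsub>Gh\<^esub> inv\<^bsub>Gh\<^esub> d) \<otimes>\<^bsub>?Q\<^esub> ?\<pi> d"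
      by (rule \<pi>.hom_mult) (use a dc in simp_all)
    also have "\<dots> = \<one>\<^bsub>?Q\<^esub> \<otimes>\<^bsub>?Q\<^esub> ?\<pi> d" by (simp only: e)
    also have "\<one>\<^bsub>?Q\<^esub> \<otimes>\<^bsub>?Q\<^esub> ?\<pi> d = ?\<pi> d" by (rule Q.l_one[OF \<pi>.hom_closed[OF dc]])
    also have "(a \<otimes>\<^bsub>Gh\<^esub> inv\<^bsub>Gh\<^esub> d) \<otimes>\<^bsub>Gh\<^esub> d = a" using a dc by (simp add: Gh.m_assoc)
    finally show False using L(2) dc d by auto
  qed
  thus ?thesis using k Gh.rcosets_kernel_dvd(1)[OF fQ gh] by blast
qed

lemma (in group) finite_rcosets_Int:
  assumes "subgroup L G" "subgroup N G" "finite (rcosets L)" "finite (rcosets N)"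
  shows "finite (rcosets (L \<inter> N))"
proof -
  interpret L: subgroup L G by fact
  interpret N: subgroup N G by fact
  have "rcosets (L \<inter> N) \<subseteq> (\<lambda>(A, B). A \<inter> B) ` ((rcosets L) \<times> (rcosets N))"
  proof
    fix C assume "C \<in> rcosets (L \<inter> N)"
    then obtain x where x: "x \<in> carrier G" "C = (L \<inter> N) #> x" by (auto simp: RCOSETS_def)
    have "C = (L #> x) \<inter> (N #> x)"
      unfolding x(2) r_coset_def using x(1) by (auto simp: L.mem_carrier N.mem_carrier)
    thus "C \<in> (\<lambda>(A, B). A \<inter> B) ` ((rcosets L) \<times> (rcosets N))"
      using x(1) rcosetsI[OF L.subset x(1)] rcosetsI[OF N.subset x(1)]
      by (intro image_eqI[of C _ "(L #> x, N #> x)"]) auto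
  qed
  thus ?thesis using assms(3,4) by (meson finite_SigmaI finite_imageI finite_subset)
qed

context tg begin

lemma common_char_kernel:
  assumes N: "N \<lhd> G" and p: "p > 0"
  shows "{a\<in>N. \<forall>c\<in>central_chars p G N. c a = 1} \<lhd> G"
proof -
  interpret N: normal N G by fact
  let ?D = "{a\<in>N. \<forall>c\<in>central_chars p G N. c a = 1}"
  note C = central_charsD[OF _ N p]
  have "subgroup ?D G"
  proof (rule subgroupI)
    show "?D \<noteq> {}" using C(7) N.one_closed by blast
    fix a assume a: "a \<in> ?D"
    have "c (inv a) = 1" if "c \<in> central_chars p G N" for c using C(8)[OF that, of a] a that by simp
    thus "inv a \<in> ?D" using a by blast
    fix b assume b: "b \<in> ?D"
    have "c (a \<otimes> b) = 1" if c: "c \<in> central_chars p G N" for c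
    proof -
      have "a \<in> N" "b \<in> N" "c a = 1" "c b = 1" using a b c by blast+
      thus ?thesis using C(3)[OF c, of a b] by simp
    qed
    thus "a \<otimes> b \<in> ?D" using a b by blast
  qed (use N.subset in blast)
  moreover have "g \<otimes> a \<otimes> inv g \<in> ?D" if "g \<in> carrier G" "a \<in> ?D" for g a
  proof -
    have "c (g \<otimes> a \<otimes> inv g) = 1" if "c \<in> central_chars p G N" for c
      using C(4)[OF that \<open>g \<in> carrier G\<close>, of a] \<open>a \<in> ?D\<close> that by simp
    thus ?thesis using N.inv_op_closed2[OF that(1), of a] that(2) by blast
  qed
  ultimately show ?thesis unfolding normal_inv_iff by blast
qed

text \<open>Powers and commutators are killed by every central character, which gives one inclusion.
  For the other, an element \<open>a\<close> of \<open>N\<close> outside the closed subgroup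
  \<open>D\<close> is still outside modulo some open normal \<open>L\<close>. A subgroup
  \<open>M\<close> of \<open>N\<close> maximal among those containing \<open>D\<close> and
  \<open>L \<inter> N\<close> but not \<open>a\<close> has a cyclic quotient \<open>N/M\<close> of
  order \<open>p\<close>, generated by \<open>a\<close> and central. The character of this quotient
  detects \<open>a\<close>.\<close>

lemma p_commutator_eq:
  assumes p: "prime p" and N: "N \<lhd> G" "openin (topo G) N" "finite (rcosets N)"
    and triv: "\<And>x. x \<in> carrier G \<Longrightarrow> act G x = x" and fin: "finite (central_chars p G N)"
    and sep: "\<And>D a. \<lbrakk>closedin (topo G) D; a \<in> carrier G; a \<notin> D\<rbrakk> \<Longrightarrow>
      \<exists>L. L \<lhd> G \<and> openin (topo G) L \<and> finite (rcosets L) \<and> (\<forall>d\<in>D. a \<otimes> inv d \<notin> L)"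
  shows "p_commutator p G N = {a\<in>N. \<forall>c\<in>central_chars p G N. c a = 1}"
proof -
  interpret N: normal N G by fact
  have pp: "p > 0" using p prime_gt_0_nat by blast
  let ?X = "central_chars p G N" and ?M = "{a\<in>N. \<forall>c\<in>central_chars p G N. c a = 1}"
  let ?gens = "{n [^] p | n. n \<in> N} \<union> {n \<otimes> f \<otimes> inv n \<otimes> inv f | n f. n \<in> N \<and> f \<in> carrier G}"
  have gc: "?gens \<subseteq> carrier G" using N.mem_carrier by auto
  define D where "D = p_commutator p G N"
  have D_eq: "D = closed_gamma_gen G ?gens" by (simp add: D_def p_commutator_def)
  note Dp = closed_gamma_gen_props[OF gc, folded D_eq]
  have sD: "subgroup D G" using Dp(1) by (simp add: gamma_subgroup_def)
  interpret D: subgroup D G by (rule sD)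
  note C = central_charsD[OF _ N(1) pp]
  have M1: "(\<lambda>a\<in>N. 1) \<in> ?X" by (rule central_chars_closed(1)[OF N(1,2) pp])
  have sM: "subgroup ?M G" by (rule normal_imp_subgroup[OF common_char_kernel[OF N(1) pp]])
  have oM: "openin (topo G) ?M"
  proof -
    have "openin (topo G) (\<Inter>((\<lambda>c. {a\<in>N. c a = 1}) ` ?X))"
      using fin M1 C(5) by (intro openin_Inter) auto
    moreover have "(\<Inter>((\<lambda>c. {a\<in>N. c a = 1}) ` ?X)) = ?M" using M1 by blast
    ultimately show ?thesis by simp
  qed
  have gM: "?gens \<subseteq> ?M"
  proof
    fix x assume "x \<in> ?gens"
    then consider n where "n \<in> N" "x = n [^] p" | n f where "n \<in> N" "f \<in> carrier G" "x = n \<otimes> f \<otimes> inv n \<otimes> inv f" by blast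
    thus "x \<in> ?M"
    proof cases
      case 1
      have nk: "n [^] (k::nat) \<in> N \<and> (\<forall>c\<in>?X. c (n [^] k) = c n ^ k)" for k
      proof (induction k)
        case (Suc k)
        hence nk: "n [^] k \<in> N" "\<And>c. c \<in> ?X \<Longrightarrow> c (n [^] k) = c n ^ k" by auto
        have "c (n [^] k \<otimes> n) = c n ^ Suc k" if "c \<in> ?X" for c
          using C(3)[OF that nk(1) 1(1)] nk(2)[OF that] by simp
        thus ?case using nk(1) 1(1) by simp
      qed (use C(7) in simp)
      have "c (n [^] p) = 1" if c: "c \<in> ?X" for c
      proof -
        have "c (n [^] p) = c n ^ p" using nk[of p] c by blast
        thus ?thesis using C(1)[OF c 1(1)] by (simp add: mu_def)
      qed
      thus ?thesis using nk[of p] 1(2) by blast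
    next
      case 2
      have fi: "f \<otimes> inv n \<otimes> inv f \<in> N" using N.inv_op_closed2[OF 2(2), of "inv n"] 2 by simp
      have "x = n \<otimes> (f \<otimes> inv n \<otimes> inv f)" using 2 N.mem_carrier[OF 2(1)] by (simp add: m_assoc)
      moreover have "c (n \<otimes> (f \<otimes> inv n \<otimes> inv f)) = 1" if "c \<in> ?X" for c
        using C(3)[OF that 2(1) fi] C(4)[OF that 2(2), of "inv n"] C(8)[OF that 2(1)] C(2)[OF that 2(1)] 2(1) by simp
      ultimately show ?thesis using fi 2(1) by auto
    qed
  qed
  have "D \<subseteq> ?M"
  proof (rule Dp(4)[OF _ _ gM])
    show "gamma_subgroup G ?M" unfolding gamma_subgroup_def using sM triv N.subset by auto
    show "closedin (topo G) ?M" by (rule open_subgroup_closed[OF sM oM])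
  qed
  moreover have "?M \<subseteq> D"
  proof
    fix a assume a: "a \<in> ?M"
    have ac: "a \<in> carrier G" "a \<in> N" using a N.subset by auto
    show "a \<in> D"
    proof (rule ccontr)
      assume aD: "a \<notin> D"
      obtain L where L: "L \<lhd> G" "openin (topo G) L" "finite (rcosets L)" "\<forall>d\<in>D. a \<otimes> inv d \<notin> L"
        using sep[OF Dp(2) ac(1) aD] by blast
      interpret L: normal L G by (rule L(1))
      \<comment> \<open>The part of \<open>N\<close> lying in the product of \<open>L\<close> and
        \<open>D\<close>. It contains both \<open>D\<close> and \<open>L \<inter> N\<close> and, by
        the choice of \<open>L\<close>, misses \<open>a\<close>.\<close>
      define E where "E = {x\<in>N. \<exists>d\<in>D. x \<otimes> inv d \<in> L}"
      have DN: "D \<subseteq> N" using \<open>D \<subseteq> ?M\<close> by blast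
      have sE: "subgroup E G"
      proof (rule subgroupI)
        have "\<one> \<in> E" unfolding E_def using D.one_closed N.one_closed L.one_closed by (intro CollectI conjI bexI[of _ \<one>]) simp_all
        thus "E \<noteq> {}" by blast
        fix x assume "x \<in> E"
        then obtain d where d: "x \<in> N" "d \<in> D" "x \<otimes> inv d \<in> L" by (auto simp: E_def)
        have dx: "d \<in> carrier G" "x \<in> carrier G" using d by auto
        have "inv x \<otimes> inv (x \<otimes> inv d) \<otimes> inv (inv x) \<in> L" using d dx by (intro L.inv_op_closed2) auto
        moreover have "inv x \<otimes> inv (x \<otimes> inv d) \<otimes> inv (inv x) = inv x \<otimes> inv (inv d)"
          using dx by (simp add: inv_mult_group m_assoc)
        ultimately have "inv x \<otimes> inv (inv d) \<in> L" by (simp only:)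
        thus "inv x \<in> E" unfolding E_def using d(1) D.m_inv_closed[OF d(2)]
          by (intro CollectI conjI bexI[of _ "inv d"]) simp_all
        fix y assume "y \<in> E"
        then obtain e where e: "y \<in> N" "e \<in> D" "y \<otimes> inv e \<in> L" by (auto simp: E_def)
        have ey: "e \<in> carrier G" "y \<in> carrier G" using e by auto
        have "(x \<otimes> (y \<otimes> inv e) \<otimes> inv x) \<otimes> (x \<otimes> inv d) \<in> L"
          by (rule L.m_closed[OF L.inv_op_closed2[OF dx(2) e(3)] d(3)])
        moreover have "(x \<otimes> (y \<otimes> inv e) \<otimes> inv x) \<otimes> (x \<otimes> inv d) = x \<otimes> y \<otimes> inv (d \<otimes> e)"
          using dx ey by (simp add: inv_mult_group m_assoc)
        ultimately have "x \<otimes> y \<otimes> inv (d \<otimes> e) \<in> L" by (simp only:)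
        thus "x \<otimes> y \<in> E" unfolding E_def using d(1) e(1) D.m_closed[OF d(2) e(2)]
          by (intro CollectI conjI bexI[of _ "d \<otimes> e"]) simp_all
      qed (auto simp: E_def)
      have aE: "a \<notin> E" using L(4) by (auto simp: E_def)
      have DE: "D \<subseteq> E"
      proof
        fix d assume "d \<in> D"
        thus "d \<in> E" unfolding E_def using DN L.one_closed D.mem_carrier by (intro CollectI conjI bexI[of _ d]) auto
      qed
      have LE: "L \<inter> N \<subseteq> E"
      proof
        fix w assume "w \<in> L \<inter> N"
        thus "w \<in> E" unfolding E_def using D.one_closed by (intro CollectI conjI bexI[of _ \<one>]) simp_all
      qed
      \<comment> \<open>All members contain \<open>L \<inter> N\<close>, which has finite index, so
        \<open>S\<close> is finite and has maximal elements.\<close>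
      define S where "S = {M. subgroup M G \<and> E \<subseteq> M \<and> M \<subseteq> N \<and> a \<notin> M}"
      have "finite {M. subgroup M G \<and> L \<inter> N \<subseteq> M}"
        by (intro finite_overgroups finite_rcosets_Int subgroups_Inter_pair L.is_subgroup N.is_subgroup L(3) N(3))
      hence "finite S" by (rule rev_finite_subset) (use LE in \<open>auto simp: S_def\<close>)
      moreover have "E \<in> S" using sE aE by (auto simp: S_def E_def)
      hence "S \<noteq> {}" by blast
      ultimately have "\<exists>M\<in>S. \<forall>M'\<in>S. M \<subseteq> M' \<longrightarrow> M = M'" by (rule finite_has_maximal)
      then obtain M where MS: "M \<in> S" and max: "\<forall>M'\<in>S. M \<subseteq> M' \<longrightarrow> M = M'" by (elim bexE)
      have M: "subgroup M G" "E \<subseteq> M" "M \<subseteq> N" "a \<notin> M" using MS by (auto simp: S_def)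
      interpret M: subgroup M G by (rule M(1))
      have com: "g \<otimes> x \<otimes> inv g \<otimes> inv x \<in> M" if "g \<in> carrier G" "x \<in> N" for g x
      proof -
        have "x \<otimes> g \<otimes> inv x \<otimes> inv g \<in> D" using Dp(3) that by blast
        hence "inv (x \<otimes> g \<otimes> inv x \<otimes> inv g) \<in> M" using DE M(2) by (meson M.m_inv_closed subsetD)
        moreover have "inv (x \<otimes> g \<otimes> inv x \<otimes> inv g) = g \<otimes> x \<otimes> inv g \<otimes> inv x"
          using that N.mem_carrier[OF that(2)] by (simp add: inv_mult_group m_assoc)
        ultimately show ?thesis by simp
      qed
      have pw: "x [^] p \<in> M" if "x \<in> N" for x
      proof -
        have "x [^] p \<in> D" using Dp(3) that by blast
        thus ?thesis using DE M(2) by blast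
      qed
      have nM: "M \<lhd> G"
        unfolding normal_inv_iff
      proof (intro conjI ballI M(1))
        fix g x assume gx: "g \<in> carrier G" "x \<in> M"
        have "g \<otimes> x \<otimes> inv g \<otimes> inv x \<otimes> x \<in> M"
          by (rule M.m_closed[OF com[OF gx(1) subsetD[OF M(3) gx(2)]] gx(2)])
        thus "g \<otimes> x \<otimes> inv g \<in> M" using gx M.mem_carrier[OF gx(2)] by (simp add: m_assoc)
      qed
      have oM': "openin (topo G) M"
        by (rule open_superset[OF M(1), of "L \<inter> N"]) (use L(2) N(2) LE M(2) L.one_closed N.one_closed in auto)
      let ?q = "\<lambda>x. M #> x"
      interpret Mn: normal M G by (rule nM)
      define Q where "Q = G Mod M"
      interpret Q: group Q unfolding Q_def by (rule Mn.factorgroup_is_group)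
      note Qm = Mn.factor_coset(1)[folded Q_def] and qm = Mn.factor_coset(2)[folded Q_def]
        and q1 = Mn.factor_coset(3)[folded Q_def] and qM = Mn.factor_coset(4) and qpow = Mn.factor_coset(5)[folded Q_def]
      have qp: "?q x [^]\<^bsub>Q\<^esub> p = \<one>\<^bsub>Q\<^esub>" if "x \<in> N" for x
        using qpow[of x p] pw[OF that] qM[of "x [^] p"] that q1 by simp
      \<comment> \<open>If \<open>x\<close> is outside \<open>M\<close>, maximality puts
        \<open>a\<close> into the group generated by \<open>M\<close> and \<open>x\<close>. So
        \<open>a\<close> is a power of \<open>x\<close> modulo \<open>M\<close>, with exponent prime
        to \<open>p\<close> because \<open>a\<close> is not in \<open>M\<close>; inverting the
        exponent modulo \<open>p\<close> expresses \<open>x\<close> through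
        \<open>a\<close>.\<close>
      have gen: "\<exists>k::nat. ?q x = ?q (a [^] k)" if x: "x \<in> N" for x
      proof (cases "x \<in> M")
        case True
        hence "?q x = ?q (a [^] (0::nat))" using qM[of x] qM[of \<one>] N.mem_carrier[OF x] by simp
        thus ?thesis by blast
      next
        case False
        have xc: "x \<in> carrier G" "?q x \<in> carrier Q" using x Qm by auto
        define M' where "M' = {w\<in>N. \<exists>k::nat. ?q w = ?q x [^]\<^bsub>Q\<^esub> k}"
        have sM': "subgroup M' G"
        proof (rule subgroupI)
          have "?q \<one> = ?q x [^]\<^bsub>Q\<^esub> (0::nat)" using qM[of \<one>] q1 by simp
          thus "M' \<noteq> {}" unfolding M'_def using N.one_closed by blast
          fix w assume "w \<in> M'"
          then obtain i :: nat where i: "w \<in> N" "?q w = ?q x [^]\<^bsub>Q\<^esub> i" by (auto simp: M'_def)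
          have wc: "w \<in> carrier G" using i by auto
          have "?q (inv w) \<otimes>\<^bsub>Q\<^esub> ?q w = \<one>\<^bsub>Q\<^esub>" using qm[of "inv w" w] wc qM[of \<one>] q1 by simp
          hence "inv\<^bsub>Q\<^esub> ?q w = ?q (inv w)" using Qm[of "inv w"] Qm[of w] wc by (intro Q.inv_equality) auto
          moreover have "?q w [^]\<^bsub>Q\<^esub> (p - 1) \<otimes>\<^bsub>Q\<^esub> ?q w = \<one>\<^bsub>Q\<^esub>"
            using qp[OF i(1)] pp by (metis Q.nat_pow_Suc Suc_pred')
          hence "inv\<^bsub>Q\<^esub> ?q w = ?q w [^]\<^bsub>Q\<^esub> (p - 1)" using Qm[of w] wc by (intro Q.inv_equality) auto
          ultimately have "?q (inv w) = ?q x [^]\<^bsub>Q\<^esub> (i * (p - 1))" using i(2) Q.nat_pow_pow[OF xc(2)] by simp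
          thus "inv w \<in> M'" using i by (auto simp: M'_def)
          fix v assume "v \<in> M'"
          then obtain j :: nat where j: "v \<in> N" "?q v = ?q x [^]\<^bsub>Q\<^esub> j" by (auto simp: M'_def)
          have "?q (w \<otimes> v) = ?q x [^]\<^bsub>Q\<^esub> (i + j)" using qm[of w v] i j Q.nat_pow_mult[OF xc(2)] by simp
          thus "w \<otimes> v \<in> M'" using i j by (auto simp: M'_def)
        qed (auto simp: M'_def)
        have MM': "M \<subseteq> M'"
        proof
          fix w assume w: "w \<in> M"
          have "?q w = ?q x [^]\<^bsub>Q\<^esub> (0::nat)" using qM[of w] w q1 by simp
          moreover have "w \<in> N" using w M(3) by blast
          ultimately show "w \<in> M'" unfolding M'_def by blast
        qed
        have "x \<in> M'" unfolding M'_def using x Q.nat_pow_eone[OF xc(2)] by (intro CollectI conjI exI[of _ "1::nat"]) (simp_all only:)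
        hence "M \<noteq> M'" using False by blast
        hence "M' \<notin> S" using max MM' by blast
        hence "a \<in> M'" using sM' MM' M(2) by (auto simp: S_def M'_def)
        then obtain k :: nat where k: "?q a = ?q x [^]\<^bsub>Q\<^esub> k" by (auto simp: M'_def)
        have "\<not> p dvd k"
        proof
          assume "p dvd k"
          then obtain t where "k = p * t" by (auto elim: dvdE)
          hence "?q a = (?q x [^]\<^bsub>Q\<^esub> p) [^]\<^bsub>Q\<^esub> t" using k Q.nat_pow_pow[OF xc(2), of p t] by (simp only:)
          hence "?q a = \<one>\<^bsub>Q\<^esub>" by (simp only: qp[OF x] Q.nat_pow_one)
          hence "?q a = M" by (simp only: q1)
          thus False using qM[OF ac(1)] M(4) by simp
        qed
        hence "coprime k p" using p by (metis coprime_commute prime_imp_coprime)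
        then obtain l where l: "[k * l = Suc 0] (mod p)" using cong_solve_coprime_nat by blast
        have "?q (a [^] l) = ?q x [^]\<^bsub>Q\<^esub> (k * l)" using qpow[OF ac(1), of l] k Q.nat_pow_pow[OF xc(2)] by simp
        also have "k * l = p * (k * l div p) + 1" using l prime_gt_1_nat[OF p] by (metis cong_def mod_less mult_div_mod_eq One_nat_def)
        also have "?q x [^]\<^bsub>Q\<^esub> (p * (k * l div p) + 1) = (?q x [^]\<^bsub>Q\<^esub> p) [^]\<^bsub>Q\<^esub> (k * l div p) \<otimes>\<^bsub>Q\<^esub> ?q x"
          using xc(2) by (simp add: Q.nat_pow_pow)
        also have "\<dots> = ?q x" by (simp only: qp[OF x] Q.nat_pow_one Q.l_one[OF xc(2)])
        finally show ?thesis by metis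
      qed
      have cen: "?q (g \<otimes> a \<otimes> inv g) = ?q a" if "g \<in> carrier G" for g
        using coset_eq_iff[OF nM, of "g \<otimes> a \<otimes> inv g" a] com[OF that ac(2)] that ac(1) by simp
      have "\<exists>c\<in>?X. (\<forall>x\<in>N. c x = 1 \<longleftrightarrow> x \<in> M) \<and> (\<forall>x\<in>N. \<forall>i::nat. ?q x = ?q (a [^] i) \<longrightarrow> c x = omega p ^ i)"
        by (rule central_char_exists[OF p N(1) nM oM' M(3) ac(2) M(4) pw[OF ac(2)]]) (erule gen, erule cen)
      then obtain c where "c \<in> ?X" "\<forall>x\<in>N. c x = 1 \<longleftrightarrow> x \<in> M" by (elim bexE conjE)
      thus False using a M(4) by blast
    qed
  qed
  ultimately show ?thesis unfolding D_def by (rule equalityI)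
qed

text \<open>The cosets of the dual elements \<open>ns j\<close> form the basis. The characters
  \<open>cs j\<close> descend to coordinates on the quotient, and the last clause of
  \<open>dual_pair\<close> makes them jointly injective.\<close>

lemma has_Fp_dim_dual:
  assumes p: "prime p" and N: "N \<lhd> G" "openin (topo G) N"
    and d: "dual_pair p N (central_chars p G N) m cs ns"
    and D: "D = {a\<in>N. \<forall>c\<in>central_chars p G N. c a = 1}"
  shows "has_Fp_dim p ((G\<lparr>carrier := N\<rparr>) Mod D) m"
proof -
  interpret N: normal N G by fact
  have pp: "p > 0" using p prime_gt_0_nat by blast
  let ?X = "central_chars p G N"
  note C = central_charsD[OF _ N(1) pp]
  let ?GN = "G\<lparr>carrier := N\<rparr>" and ?W = "(G\<lparr>carrier := N\<rparr>) Mod D"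
  interpret GN: group ?GN by (rule N.subgroup_is_group[OF is_group])
  have DN: "D \<subseteq> N" using D by blast
  have nD: "D \<lhd> G" unfolding D by (rule common_char_kernel[OF N(1) pp])
  have sD: "subgroup D G" by (rule normal_imp_subgroup[OF nD])
  interpret D: subgroup D G by (rule sD)
  interpret Dn: normal D G by (rule nD)
  have sDN: "subgroup D ?GN" using subgroup_incl[OF sD N.is_subgroup DN] .
  have inN: "inv\<^bsub>?GN\<^esub> x = inv x" if "x \<in> N" for x using m_inv_consistent[OF N.is_subgroup that] .
  have nDN: "D \<lhd> ?GN"
    unfolding GN.normal_inv_iff using sDN Dn.inv_op_closed2 by (auto simp: inN)
  interpret W: group ?W by (rule normal.factorgroup_is_group[OF nDN])
  have cW: "carrier ?W = (\<lambda>x. D #> x) ` N"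
    by (auto simp: FactGroup_def RCOSETS_def r_coset_def)
  have mW: "(D #> x) \<otimes>\<^bsub>?W\<^esub> (D #> y) = D #> (x \<otimes> y)" if "x \<in> N" "y \<in> N" for x y
  proof -
    have "(D #> x) \<otimes>\<^bsub>?W\<^esub> (D #> y) = (D #> x) <#> (D #> y)" by (simp add: FactGroup_def set_mult_def)
    thus ?thesis using Dn.rcos_sum that by simp
  qed
  have DeqI: "D #> x = D #> y \<longleftrightarrow> (\<forall>c\<in>?X. c x = c y)" if "x \<in> N" "y \<in> N" for x y
  proof -
    have "D #> x = D #> y \<longleftrightarrow> x \<otimes> inv y \<in> D" using coset_eq_iff[OF nD] that by simp
    also have "\<dots> \<longleftrightarrow> (\<forall>c\<in>?X. c (x \<otimes> inv y) = 1)" using that by (simp add: D)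
    also have "\<dots> \<longleftrightarrow> (\<forall>c\<in>?X. c x = c y)"
    proof (rule ball_cong[OF HOL.refl])
      fix c assume c: "c \<in> ?X"
      show "c (x \<otimes> inv y) = 1 \<longleftrightarrow> c x = c y"
      proof -
        have "c (x \<otimes> inv y) = c x / c y"
          using C(3)[OF c that(1), of "inv y"] C(8)[OF c that(2)] that by (simp add: divide_inverse)
        thus ?thesis using C(2)[OF c that(2)] by simp
      qed
    qed
    finally show ?thesis .
  qed
  interpret W: comm_group ?W
  proof (rule W.group_comm_groupI)
    fix A B assume "A \<in> carrier ?W" "B \<in> carrier ?W"
    then obtain x y where xy: "x \<in> N" "y \<in> N" "A = D #> x" "B = D #> y" unfolding cW by blast
    have "D #> (x \<otimes> y) = D #> (y \<otimes> x)"
    proof -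
      have "c (x \<otimes> y) = c (y \<otimes> x)" if "c \<in> ?X" for c
        using C(3)[OF that xy(1,2)] C(3)[OF that xy(2,1)] by (simp add: mult.commute)
      thus ?thesis using DeqI[of "x \<otimes> y" "y \<otimes> x"] xy by blast
    qed
    thus "A \<otimes>\<^bsub>?W\<^esub> B = B \<otimes>\<^bsub>?W\<^esub> A" using xy mW by simp
  qed
  have dp: "\<And>j. j < m \<Longrightarrow> cs j \<in> ?X" "\<And>j. j < m \<Longrightarrow> ns j \<in> N"
      "\<And>i j. i < m \<Longrightarrow> j < m \<Longrightarrow> cs i (ns j) = (if i = j then omega p else 1)"
      "\<And>w c. w \<in> N \<Longrightarrow> (\<And>j. j < m \<Longrightarrow> cs j w = 1) \<Longrightarrow> c \<in> ?X \<Longrightarrow> c w = 1"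
    using d by (auto simp: dual_pair_def)
  \<comment> \<open>The j-th coordinate, written multiplicatively. All elements of a coset of
    \<open>D\<close> give the same value, since \<open>D\<close> is killed by every central
    character.\<close>
  define val where "val j A = cs j (SOME x. x \<in> A)" for j A
  have val: "val j (D #> x) = cs j x" if "j < m" "x \<in> N" for j x
  proof -
    have "x \<in> D #> x" using rcos_self[OF N.mem_carrier[OF that(2)] sD] .
    hence "(SOME w. w \<in> D #> x) \<in> D #> x" by (rule someI)
    then obtain e where e: "e \<in> D" "(SOME w. w \<in> D #> x) = e \<otimes> x" unfolding r_coset_def by blast
    have "cs j (e \<otimes> x) = cs j e * cs j x" using C(3)[OF dp(1)[OF that(1)]] e(1) DN that(2) by blast
    also have "cs j e = 1" using e(1) dp(1)[OF that(1)] by (simp add: D)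
    finally show ?thesis unfolding val_def e(2) by simp
  qed
  have val_mult: "val j (A \<otimes>\<^bsub>?W\<^esub> B) = val j A * val j B" if "j < m" "A \<in> carrier ?W" "B \<in> carrier ?W" for j A B
  proof -
    from that(2,3) obtain x y where xy: "x \<in> N" "y \<in> N" "A = D #> x" "B = D #> y" unfolding cW by (elim imageE)
    thus ?thesis using mW[of x y] val[OF that(1)] C(3)[OF dp(1)[OF that(1)]] by simp
  qed
  have val_one: "val j \<one>\<^bsub>?W\<^esub> = 1" if "j < m" for j
  proof -
    have "\<one>\<^bsub>?W\<^esub> = D #> \<one>" using coset_join2[OF one_closed sD D.one_closed] by (simp add: FactGroup_def)
    thus ?thesis using val[OF that N.one_closed] C(7)[OF dp(1)[OF that]] by simp
  qed
  have val_pow: "val j (A [^]\<^bsub>?W\<^esub> (k::nat)) = val j A ^ k" if "j < m" "A \<in> carrier ?W" for j A k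
    by (induction k) (use val_mult[OF that(1)] val_one[OF that(1)] that in \<open>auto simp del: FactGroup_def simp: mult.commute\<close>)
  have val_prod: "val j (finprod ?W f B) = (\<Prod>b\<in>B. val j (f b))" if "j < m" "finite B" "f \<in> B \<rightarrow> carrier ?W" for j f B
    using that(2,3)
  proof induction
    case empty show ?case using val_one[OF that(1)] W.finprod_empty by simp
  next
    case (insert b B)
    have "finprod ?W f (insert b B) = f b \<otimes>\<^bsub>?W\<^esub> finprod ?W f B"
      using insert by (intro W.finprod_insert) auto
    moreover have "finprod ?W f B \<in> carrier ?W" using insert by (intro W.finprod_closed) auto
    moreover have "f b \<in> carrier ?W" using insert by auto
    ultimately show ?case using val_mult[OF that(1)] insert by simp
  qed
  have val_inj: "A = B" if "A \<in> carrier ?W" "B \<in> carrier ?W" "\<And>j. j < m \<Longrightarrow> val j A = val j B" for A B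
  proof -
    from that(1,2) obtain x y where xy: "x \<in> N" "y \<in> N" "A = D #> x" "B = D #> y" unfolding cW by (elim imageE)
    have "cs j (x \<otimes> inv y) = 1" if "j < m" for j
      using C(3)[OF dp(1)[OF that] xy(1), of "inv y"] C(8)[OF dp(1)[OF that] xy(2)] C(2)[OF dp(1)[OF that] xy(2)]
        \<open>\<And>j. j < m \<Longrightarrow> val j A = val j B\<close>[OF that] val[OF that] xy by simp
    hence "x \<otimes> inv y \<in> D" using dp(4)[of "x \<otimes> inv y"] xy by (simp add: D)
    thus ?thesis using coset_eq_iff[OF nD] xy by simp
  qed
  define b where "b i = D #> ns i" for i
  have bW: "b i \<in> carrier ?W" if "i < m" for i unfolding cW b_def using dp(2)[OF that] by blast
  have valb: "val j (b i) = (if j = i then omega p else 1)" if "i < m" "j < m" for i j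
    unfolding b_def using val[OF that(2) dp(2)[OF that(1)]] dp(3)[OF that(2,1)] by simp
  have om1: "omega p \<noteq> 1" using omega_power_eq_1[OF p, of 1] p by (simp add: prime_nat_iff)
  have bi: "inj_on b {..<m}"
  proof (rule inj_onI)
    fix i j assume "i \<in> {..<m}" "j \<in> {..<m}" "b i = b j"
    thus "i = j" using valb[of i i] valb[of j i] om1 by (auto split: if_splits)
  qed
  let ?B = "b ` {..<m}" and ?\<Phi> = "\<lambda>c. finprod ?W (\<lambda>b. b [^]\<^bsub>?W\<^esub> (c b :: nat)) (b ` {..<m})"
  have Bp: "(\<lambda>b. b [^]\<^bsub>?W\<^esub> (c b :: nat)) \<in> ?B \<rightarrow> carrier ?W" for c using bW by auto
  have val\<Phi>: "val j (?\<Phi> c) = omega p ^ c (b j)" if "j < m" for j c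
  proof -
    have "val j (?\<Phi> c) = (\<Prod>x\<in>?B. val j (x [^]\<^bsub>?W\<^esub> c x))" by (rule val_prod[OF that _ Bp]) simp
    also have "\<dots> = (\<Prod>i<m. val j (b i [^]\<^bsub>?W\<^esub> c (b i)))" by (subst prod.reindex[OF bi]) simp
    also have "\<dots> = (\<Prod>i<m. if i = j then omega p ^ c (b j) else 1)"
      by (rule prod.cong) (use val_pow[OF that] bW valb that in auto)
    also have "\<dots> = omega p ^ c (b j)" using that by simp
    finally show ?thesis .
  qed
  have \<Phi>W: "?\<Phi> c \<in> carrier ?W" for c by (rule W.finprod_closed[OF Bp])
  have "bij_betw ?\<Phi> (?B \<rightarrow>\<^sub>E {..<p}) (carrier ?W)"
    unfolding bij_betw_def
  proof
    show "inj_on ?\<Phi> (?B \<rightarrow>\<^sub>E {..<p})"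
    proof (rule inj_onI)
      fix c c' assume cc: "c \<in> ?B \<rightarrow>\<^sub>E {..<p}" "c' \<in> ?B \<rightarrow>\<^sub>E {..<p}" "?\<Phi> c = ?\<Phi> c'"
      have "c (b j) = c' (b j)" if "j < m" for j
      proof -
        have "omega p ^ c (b j) = omega p ^ c' (b j)" using val\<Phi>[OF that, of c] val\<Phi>[OF that, of c'] cc(3) by simp
        moreover have "c (b j) \<in> {..<p}" "c' (b j) \<in> {..<p}" using cc(1,2) that by auto
        ultimately show ?thesis using omega_powers(1)[OF pp] by (auto dest: inj_onD)
      qed
      thus "c = c'" using cc(1,2) by (intro extensionalityI[of _ ?B]) (auto simp: PiE_def)
    qed
    show "?\<Phi> ` (?B \<rightarrow>\<^sub>E {..<p}) = carrier ?W"
    proof (intro equalityI subsetI)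
      fix A assume A: "A \<in> carrier ?W"
      have "\<exists>k<p. val j A = omega p ^ k" if "j < m" for j
      proof -
        obtain x where x: "x \<in> N" "A = D #> x" using A unfolding cW by (elim imageE)
        have "val j A \<in> mu p" using val[OF that x(1)] C(1)[OF dp(1)[OF that] x(1)] x(2) by simp
        thus ?thesis using omega_powers(2)[OF pp] by (auto simp: image_iff)
      qed
      then obtain k where k: "\<And>j. j < m \<Longrightarrow> k j < p" "\<And>j. j < m \<Longrightarrow> val j A = omega p ^ k j" by metis
      define c where "c = (\<lambda>x\<in>?B. k (inv_into {..<m} b x))"
      have cb: "c (b j) = k j" if "j < m" for j using that inv_into_f_f[OF bi, of j] by (simp add: c_def)
      have c: "c \<in> ?B \<rightarrow>\<^sub>E {..<p}" using cb k(1) by (auto simp: c_def)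
      have "A = ?\<Phi> c" by (rule val_inj[OF A \<Phi>W]) (simp add: val\<Phi> cb k(2))
      thus "A \<in> ?\<Phi> ` (?B \<rightarrow>\<^sub>E {..<p})" by (rule image_eqI[of A ?\<Phi> c, OF _ c])
    qed (use \<Phi>W in blast)
  qed
  thus ?thesis unfolding has_Fp_dim_def
    using bW card_image[OF bi] by (intro exI[of _ ?B] conjI) auto
qed

end

lemma has_Fp_dim_card:
  assumes "has_Fp_dim p W r" shows "card (carrier W) = p ^ r"
proof -
  obtain B where B: "finite B" "card B = r"
     "bij_betw (\<lambda>c. finprod W (\<lambda>b. b [^]\<^bsub>W\<^esub> (c b :: nat)) B) (B \<rightarrow>\<^sub>E {..<p}) (carrier W)"
    using assms unfolding has_Fp_dim_def by blast
  thus ?thesis using bij_betw_same_card[OF B(3)] by (simp add: card_PiE)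
qed

lemma (in pfree) dual_pair_exists:
  assumes "group H" "finite (carrier H)" "\<exists>k. order H = p ^ k"
    "\<phi> \<in> hom F H" "\<phi> ` carrier F = carrier H" "openin (topo F) (kernel F H \<phi>)"
  shows "\<exists>m cs ns. dual_pair p (kernel F H \<phi>) (central_chars p F (kernel F H \<phi>)) m cs ns"
proof -
  have pp: "p > 0" using prime prime_gt_0_nat by blast
  interpret \<phi>: group_hom F H \<phi> using assms is_group by (simp add: group_hom_iff)
  note k = \<phi>.normal_kernel
  show ?thesis
  proof (rule dual_basis[OF is_group \<phi>.subgroup_kernel prime central_chars_finite[OF assms]])
    fix c assume c: "c \<in> central_chars p F (kernel F H \<phi>)"
    show "c \<in> kernel F H \<phi> \<rightarrow>\<^sub>E mu p" by (rule central_charsD(10)[OF c k pp])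
    show "c (a \<otimes> b) = c a * c b" if "a \<in> kernel F H \<phi>" "b \<in> kernel F H \<phi>" for a b
      by (rule central_charsD(3)[OF c k pp that])
    show "(\<lambda>a\<in>kernel F H \<phi>. c a * d a) \<in> central_chars p F (kernel F H \<phi>)"
      if "d \<in> central_chars p F (kernel F H \<phi>)" for d
      by (rule central_chars_closed(2)[OF k assms(6) pp c that])
  qed (rule central_chars_closed(1)[OF k assms(6) pp])
qed

text \<open>As \<open>relation_rank\<close> is a chosen number, two things are needed: a
  presentation on \<open>gen_rank H\<close> generators exists, and every dimension that a
  presentation can yield satisfies the formula. The second holds because \<open>N/N^p[N,F]\<close>
  is dual to the central characters of \<open>N\<close>, which are counted by the cocycles of
  \<open>H\<close>, and a dimension is determined by the cardinality.\<close>

lemma relation_rank_count: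
  fixes H :: "'h gstruct"
  assumes p: "prime p" and H: "finite_p_gamma_group p H"
  shows "card (cocycles p H) * p ^ gen_rank H = p ^ relation_rank p H * p ^ (order H - 1)"
proof -
  have fH: "finite_gamma_group H" and oH: "\<exists>k. order H = p ^ k" using H by (auto simp: finite_p_gamma_group_def)
  note H' = finite_gammaD[OF fH]
  interpret H: group H by (rule H'(1))
  let ?d = "gen_rank H"
  let ?F = "free_pro_p p ?d" and ?D = "free_gamma_group {..<?d} id"
  let ?y = "\<lambda>i. completion_map (p_gamma_groups p) ?D (free_gen {..<?d} i)"
  interpret F: pfree ?F p "{..<?d}" ?y by (rule pfree_free_pro_p(1)[OF p])
  have triv: "\<And>x. x \<in> carrier ?F \<Longrightarrow> act ?F x = x" by (rule pfree_free_pro_p(2)[OF p])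
  interpret fw: free_words "{..<?d}" id by unfold_locales auto
  interpret D: tg ?D by (rule fw.FG_tg)
  interpret c: completed ?D "p_gamma_groups p" by (rule D.p_completed)
  let ?P = "\<lambda>\<phi>. \<phi> \<in> hom ?F H \<and> \<phi> ` carrier ?F = carrier H \<and> continuous_map (topo ?F) (topo H) \<phi>"
  let ?W = "\<lambda>\<phi>. (?F\<lparr>carrier := kernel ?F H \<phi>\<rparr>) Mod p_commutator p ?F (kernel ?F H \<phi>)"
  have ex: "\<exists>\<phi>. ?P \<phi>"
  proof -
    have "\<exists>k. \<exists>A\<subseteq>carrier H. finite A \<and> card A = k \<and> generate H A = carrier H"
    proof -
      have "generate H (carrier H) = carrier H"
        using H.generate_incl[of "carrier H"] by (auto intro: generate.incl)
      thus ?thesis using H'(2) by blast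
    qed
    from LeastI_ex[OF this] obtain A where A: "A \<subseteq> carrier H" "finite A" "card A = ?d" "generate H A = carrier H"
      unfolding gen_rank_def by blast
    obtain e where e: "bij_betw e {..<?d} A" using ex_bij_betw_nat_finite[OF A(2)] A(3) by (auto simp: atLeast0LessThan)
    have eA: "i \<in> {..<?d} \<Longrightarrow> e i \<in> carrier H" for i using e A(1) by (auto simp: bij_betw_def)
    obtain \<phi> where \<phi>: "\<phi> \<in> hom ?F H" "openin (topo ?F) (kernel ?F H \<phi>)" "\<forall>i\<in>{..<?d}. \<phi> (?y i) = e i"
      using F.univ[OF H'(1,2) oH, of e] eA by blast
    interpret \<phi>: group_hom ?F H \<phi> using \<phi> F.is_group H'(1) by (simp add: group_hom_iff)
    have "A \<subseteq> \<phi> ` carrier ?F"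
    proof
      fix h assume "h \<in> A"
      then obtain i where "i \<in> {..<?d}" "h = e i" using e by (auto simp: bij_betw_def)
      thus "h \<in> \<phi> ` carrier ?F" using \<phi>(3) F.y_closed by (metis imageI)
    qed
    hence "generate H A \<subseteq> \<phi> ` carrier ?F" using H.generate_subgroup_incl \<phi>.img_is_subgroup by blast
    hence "\<phi> ` carrier ?F = carrier H" using A(4) \<phi>.hom_closed by blast
    moreover have "continuous_map (topo ?F) (topo H) \<phi>"
      unfolding continuous_map_def using F.fibre_open[OF \<phi>(1) H'(1) \<phi>(2)] F.topspace_eq H'(3) by auto
    ultimately show ?thesis using \<phi>(1) by blast
  qed
  have key: "\<exists>m. has_Fp_dim p (?W \<phi>) m \<and> card (cocycles p H) * p ^ ?d = p ^ m * p ^ (order H - 1)" if P: "?P \<phi>" for \<phi>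
  proof -
    let ?N = "kernel ?F H \<phi>"
    have h: "\<phi> \<in> hom ?F H" "\<phi> ` carrier ?F = carrier H" using P by auto
    interpret \<phi>: group_hom ?F H \<phi> using h F.is_group H'(1) by (simp add: group_hom_iff)
    have "openin (topo H) {\<one>\<^bsub>H\<^esub>}" using H'(3) by simp
    hence "openin (topo ?F) {x \<in> topspace (topo ?F). \<phi> x \<in> {\<one>\<^bsub>H\<^esub>}}"
      using P openin_continuous_map_preimage by blast
    hence o: "openin (topo ?F) ?N" using F.topspace_eq by (simp add: kernel_def)
    obtain m cs ns where d: "dual_pair p ?N (central_chars p ?F ?N) m cs ns"
      using F.dual_pair_exists[OF H'(1,2) oH h o] by blast
    \<comment> \<open>The free pro-p group has the trivial involution, so \<open>H\<close> is given
      the trivial one too; then \<open>\<phi>\<close> is equivariant and the finiteness of the index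
      of its kernel can be quoted.\<close>
    define T where "T = H\<lparr>act := \<lambda>x. x\<rparr>"
    have T: "finite_gamma_group T"
      using H' group_cong_gamma(1)[of T H] by (intro finite_gammaI) (auto simp: T_def hom_def)
    have "\<phi> \<in> ghom ?F T"
      using h o triv group_cong_gamma(3)[of T H] by (auto simp: ghom_def T_def kernel_def hom_def)
    hence "finite (rcosets\<^bsub>?F\<^esub> (kernel ?F T \<phi>))" by (rule F.rcosets_kernel_dvd(1)[OF T])
    hence fr: "finite (rcosets\<^bsub>?F\<^esub> ?N)" by (simp add: kernel_def T_def)
    have "p_commutator p ?F ?N = {a\<in>?N. \<forall>c\<in>central_chars p ?F ?N. c a = 1}"
    proof (rule F.p_commutator_eq[OF p \<phi>.normal_kernel o fr triv F.central_chars_finite[OF H'(1,2) oH h o]])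
      fix S a assume "closedin (topo ?F) S" "a \<in> carrier ?F" "a \<notin> S"
      thus "\<exists>L. L \<lhd> ?F \<and> openin (topo ?F) L \<and> finite (rcosets\<^bsub>?F\<^esub> L) \<and> (\<forall>d\<in>S. a \<otimes>\<^bsub>?F\<^esub> inv\<^bsub>?F\<^esub> d \<notin> L)"
        using c.separate_closed[of S a] unfolding free_pro_p_def by blast
    qed
    from F.has_Fp_dim_dual[OF p \<phi>.normal_kernel o d this] have "has_Fp_dim p (?W \<phi>) m" .
    moreover have "card (central_chars p ?F ?N) = p ^ m" using d by (simp add: dual_pair_def)
    ultimately show ?thesis using F.card_central_chars[OF H'(1,2) oH h o HOL.refl] by auto
  qed
  let ?R = "\<lambda>r. \<exists>\<phi>. ?P \<phi> \<and> has_Fp_dim p (?W \<phi>) r"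
  have "relation_rank p H = (SOME r. ?R r)"
    unfolding relation_rank_def Let_def by (simp add: conj_assoc)
  moreover have "?R (SOME r. ?R r)"
  proof (rule someI_ex)
    obtain \<phi> where \<phi>: "?P \<phi>" using ex by blast
    obtain m where "has_Fp_dim p (?W \<phi>) m" using key[OF \<phi>] by blast
    thus "\<exists>r. ?R r" using \<phi> by blast
  qed
  ultimately have "?R (relation_rank p H)" by (simp only:)
  then obtain \<phi> where \<phi>: "?P \<phi>" "has_Fp_dim p (?W \<phi>) (relation_rank p H)" by blast
  obtain m where m: "has_Fp_dim p (?W \<phi>) m" "card (cocycles p H) * p ^ ?d = p ^ m * p ^ (order H - 1)"
    using key[OF \<phi>(1)] by blast
  have "p ^ relation_rank p H = p ^ m" using has_Fp_dim_card[OF m(1)] has_Fp_dim_card[OF \<phi>(2)] by simp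
  thus ?thesis using m(2) by simp
qed

section \<open>Full-rank matrices and the probability of generating a kernel\<close>

lemma mu_pow_mod: "x \<in> mu p \<Longrightarrow> x ^ (a mod p) = x ^ a"
proof -
  assume x: "x \<in> mu p"
  have "x ^ a = x ^ (p * (a div p) + a mod p)" by simp
  also have "\<dots> = (x ^ p) ^ (a div p) * x ^ (a mod p)" unfolding power_add power_mult by simp
  also have "\<dots> = x ^ (a mod p)" using x by (simp add: mu_def)
  finally show ?thesis by simp
qed

lemma mu_prod: "(\<And>j. j \<in> A \<Longrightarrow> f j \<in> mu p) \<Longrightarrow> (\<Prod>j\<in>A. f j) \<in> mu p"
  by (induction A rule: infinite_finite_induct) auto

text \<open>Linear independence of the rows of \<open>R\<close> over the field with \<open>p\<close> elements, written multiplicatively.\<close>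

definition indep :: "nat \<Rightarrow> 'i set \<Rightarrow> nat \<Rightarrow> (nat \<Rightarrow> 'i \<Rightarrow> complex) \<Rightarrow> bool" where
  "indep p I m R \<longleftrightarrow> (\<forall>e::nat\<Rightarrow>nat. (\<forall>i\<in>I. (\<Prod>j<m. R j i ^ e j) = 1) \<longrightarrow> (\<forall>j<m. p dvd e j))"

text \<open>A further row preserves independence exactly when it avoids the span of the first
  \<open>m\<close> rows, and that span has p^m elements. The truncated subtractions cause no error:
  with more rows than columns the factor at i = \<open>card I\<close> is 0.\<close>

lemma card_indep:
  assumes p: "prime p" and I: "finite I"
  shows "finite {R \<in> {..<m} \<rightarrow>\<^sub>E (I \<rightarrow>\<^sub>E mu p). indep p I m R} \<and>
    card {R \<in> {..<m} \<rightarrow>\<^sub>E (I \<rightarrow>\<^sub>E mu p). indep p I m R} = (\<Prod>i<m. p ^ card I - p ^ i)"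
proof (induction m)
  case 0
  have "{R \<in> {..<0::nat} \<rightarrow>\<^sub>E (I \<rightarrow>\<^sub>E mu p). indep p I 0 R} = {\<lambda>_. undefined}" by (auto simp: indep_def)
  thus ?case by simp
next
  case (Suc m)
  have pp: "p > 0" using p prime_gt_0_nat by blast
  let ?V = "I \<rightarrow>\<^sub>E mu p"
  define S where "S = {R \<in> {..<m} \<rightarrow>\<^sub>E ?V. indep p I m R}"
  define S' where "S' = {R \<in> {..<Suc m} \<rightarrow>\<^sub>E ?V. indep p I (Suc m) R}"
  define sp where "sp R = (\<lambda>e. \<lambda>i\<in>I. \<Prod>j<m. R j i ^ e j) ` ({..<m} \<rightarrow>\<^sub>E {..<p})" for R :: "nat \<Rightarrow> 'a \<Rightarrow> complex"
  have finV: "finite ?V" "card ?V = p ^ card I" using I card_mu[OF pp] by (auto intro: finite_PiE simp: card_PiE)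
  have Rmu: "R j i \<in> mu p" if "R \<in> {..<k} \<rightarrow>\<^sub>E ?V" "j < k" "i \<in> I" for R k j i using that by (auto simp: PiE_iff)
  have spV: "sp R \<subseteq> ?V" if "R \<in> {..<m} \<rightarrow>\<^sub>E ?V" for R
    unfolding sp_def using mu_prod[of "{..<m}" _ p] Rmu[OF that] by auto
  have card_sp: "card (sp R) = p ^ m" if "R \<in> S" for R
  proof -
    have R: "R \<in> {..<m} \<rightarrow>\<^sub>E ?V" "indep p I m R" using that by (auto simp: S_def)
    have "inj_on (\<lambda>e. \<lambda>i\<in>I. \<Prod>j<m. R j i ^ e j) ({..<m} \<rightarrow>\<^sub>E {..<p})"
    proof (rule inj_onI)
      fix e e' assume e: "e \<in> {..<m} \<rightarrow>\<^sub>E {..<p}" "e' \<in> {..<m} \<rightarrow>\<^sub>E {..<p}"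
        "(\<lambda>i\<in>I. \<Prod>j<m. R j i ^ e j) = (\<lambda>i\<in>I. \<Prod>j<m. R j i ^ e' j)"
      \<comment> \<open>The exponent \<open>p - 1\<close> stands for -1, so this is the quotient of
        the two combinations that are assumed equal.\<close>
      have "(\<Prod>j<m. R j i ^ (e j + (p - 1) * e' j)) = 1" if i: "i \<in> I" for i
      proof -
        have eq: "(\<Prod>j<m. R j i ^ e j) = (\<Prod>j<m. R j i ^ e' j)" using fun_cong[OF e(3), of i] i by simp
        have "(\<Prod>j<m. R j i ^ (e j + (p - 1) * e' j)) = (\<Prod>j<m. R j i ^ e j) * (\<Prod>j<m. R j i ^ ((p - 1) * e' j))"
          by (simp add: power_add prod.distrib)
        also have "\<dots> = (\<Prod>j<m. R j i ^ e' j * R j i ^ ((p - 1) * e' j))" by (simp only: eq prod.distrib)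
        also have "\<dots> = (\<Prod>j<m. 1)"
        proof (rule prod.cong[OF HOL.refl])
          fix j assume j: "j \<in> {..<m}"
          have "R j i ^ e' j * R j i ^ ((p - 1) * e' j) = R j i ^ (p * e' j)"
            using pp by (simp add: diff_mult_distrib flip: power_add)
          thus "R j i ^ e' j * R j i ^ ((p - 1) * e' j) = 1"
            using Rmu[OF R(1) _ i, of j] j by (simp add: mu_def power_mult)
        qed
        finally show ?thesis by simp
      qed
      hence d: "p dvd e j + (p - 1) * e' j" if "j < m" for j
        using R(2)[unfolded indep_def, rule_format, of "\<lambda>j. e j + (p - 1) * e' j"] that by blast
      have "e j = e' j" if j: "j < m" for j
      proof -
        have lt: "e j < p" "e' j < p" using e(1,2) j by (auto simp: PiE_iff)
        have "int p dvd int (e j + (p - 1) * e' j)" using d[OF j] by (simp only: of_nat_dvd_iff)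
        moreover have "int (e j + (p - 1) * e' j) = (int (e j) - int (e' j)) + int p * int (e' j)"
          using pp by (cases p) (auto simp: algebra_simps)
        ultimately have "int p dvd int (e j) - int (e' j)" by (metis dvd_add_left_iff dvd_triv_left)
        hence "[int (e j) = int (e' j)] (mod int p)" by (simp add: cong_iff_dvd_diff)
        thus ?thesis using lt by (simp add: cong_int_iff cong_less_modulus_unique_nat)
      qed
      thus "e = e'" using e(1,2) by (intro extensionalityI[of _ "{..<m}"]) (auto simp: PiE_def)
    qed
    from card_image[OF this] show ?thesis unfolding sp_def by (simp add: card_PiE)
  qed
  have step: "R'(m := r) \<in> S' \<longleftrightarrow> r \<notin> sp R'" if R': "R' \<in> S" and r: "r \<in> ?V" for R' r
  proof -
    have RV: "R' \<in> {..<m} \<rightarrow>\<^sub>E ?V" "indep p I m R'" using R' by (auto simp: S_def)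
    have upd: "R'(m := r) \<in> {..<Suc m} \<rightarrow>\<^sub>E ?V"
      unfolding lessThan_Suc by (rule PiE_fun_upd[OF r RV(1)])
    have prd: "(\<Prod>j<Suc m. (R'(m := r)) j i ^ e j) = (\<Prod>j<m. R' j i ^ e j) * r i ^ e m" for e i
      by simp
    have rmu: "r i \<in> mu p" if "i \<in> I" for i using r that by (auto simp: PiE_iff)
    show ?thesis
    proof
      assume "R'(m := r) \<in> S'"
      hence ind: "indep p I (Suc m) (R'(m := r))" by (simp add: S'_def)
      show "r \<notin> sp R'"
      proof
        assume "r \<in> sp R'"
        then obtain e where e: "r = (\<lambda>i\<in>I. \<Prod>j<m. R' j i ^ e j)" by (auto simp: sp_def)
        define e' where "e' = e(m := p - 1)"
        have "(\<Prod>j<Suc m. (R'(m := r)) j i ^ e' j) = 1" if i: "i \<in> I" for i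
        proof -
          have "(\<Prod>j<m. R' j i ^ e' j) = r i" using i by (simp add: e e'_def)
          hence "(\<Prod>j<Suc m. (R'(m := r)) j i ^ e' j) = r i * r i ^ (p - 1)" unfolding prd by (simp add: e'_def)
          also have "\<dots> = r i ^ p" using pp by (metis power_Suc Suc_pred')
          finally show ?thesis using rmu[OF i] by (simp add: mu_def)
        qed
        hence "p dvd e' m" using ind[unfolded indep_def, rule_format, of e' m] by blast
        hence "p dvd p - 1" by (simp add: e'_def)
        thus False using prime_gt_1_nat[OF p] by (auto dest: dvd_imp_le)
      qed
    next
      assume rn: "r \<notin> sp R'"
      have "indep p I (Suc m) (R'(m := r))"
        unfolding indep_def
      proof (intro allI impI)
        fix e :: "nat \<Rightarrow> nat" and j
        assume "\<forall>i\<in>I. (\<Prod>j<Suc m. (R'(m := r)) j i ^ e j) = 1" and j: "j < Suc m"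
        hence rel: "(\<Prod>j<m. R' j i ^ e j) * r i ^ e m = 1" if "i \<in> I" for i using that prd by simp
        have "p dvd e m"
        proof (rule ccontr)
          assume "\<not> p dvd e m"
          hence "coprime (e m) p" using p by (metis coprime_commute prime_imp_coprime)
          then obtain l where l: "[e m * l = Suc 0] (mod p)" using cong_solve_coprime_nat by blast
          have lm: "(e m * l) mod p = 1" using l prime_gt_1_nat[OF p] by (simp add: cong_def)
          \<comment> \<open>Solves the relation for the last row: \<open>l\<close> inverts
            \<open>e m\<close> modulo \<open>p\<close>, and \<open>l * (p - 1)\<close> stands for
            \<open>- l\<close>. Reduction modulo \<open>p\<close> brings the exponents into the
            range used by \<open>sp\<close>.\<close>
          define f where "f = (\<lambda>j\<in>{..<m}. (e j * (l * (p - 1))) mod p)"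
          have "r i = (\<Prod>j<m. R' j i ^ f j)" if i: "i \<in> I" for i
          proof -
            have ri: "r i ^ (e m * l) = r i" using mu_pow_mod[OF rmu[OF i], of "e m * l"] lm by simp
            have Pm: "(\<Prod>j<m. R' j i ^ e j) \<in> mu p" using Rmu[OF RV(1) _ i] by (intro mu_prod) auto
            have "(\<Prod>j<m. R' j i ^ f j) = (\<Prod>j<m. (R' j i ^ e j) ^ (l * (p - 1)))"
              by (rule prod.cong) (use mu_pow_mod[OF Rmu[OF RV(1) _ i]] in \<open>auto simp: f_def power_mult[symmetric]\<close>)
            also have "\<dots> = (\<Prod>j<m. R' j i ^ e j) ^ (l * (p - 1))" by (simp add: prod_power_distrib)
            also have "\<dots> = (\<Prod>j<m. R' j i ^ e j) ^ (l * (p - 1)) * ((\<Prod>j<m. R' j i ^ e j) * r i ^ e m) ^ l" using rel[OF i] by simp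
            also have "\<dots> = (\<Prod>j<m. R' j i ^ e j) ^ (l * (p - 1) + l) * r i ^ (e m * l)"
              by (simp add: power_add power_mult_distrib power_mult)
            also have "l * (p - 1) + l = p * l" using pp by (simp add: diff_mult_distrib2)
            also have "(\<Prod>j<m. R' j i ^ e j) ^ (p * l) = 1" using Pm by (simp add: mu_def power_mult)
            finally show ?thesis using ri by simp
          qed
          hence "r = (\<lambda>i\<in>I. \<Prod>j<m. R' j i ^ f j)" using r by (intro extensionalityI[of _ I]) (auto simp: PiE_def)
          moreover have "f \<in> {..<m} \<rightarrow>\<^sub>E {..<p}" using pp by (auto simp: f_def)
          ultimately show False using rn by (auto simp: sp_def)
        qed
        have "(\<Prod>j<m. R' j i ^ e j) = 1" if i: "i \<in> I" for i
        proof -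
          have "r i ^ e m = 1" using \<open>p dvd e m\<close> rmu[OF i] by (auto simp: mu_def power_mult elim!: dvdE)
          thus ?thesis using rel[OF i] by simp
        qed
        hence "\<forall>j<m. p dvd e j" using RV(2) by (auto simp: indep_def)
        thus "p dvd e j" using j \<open>p dvd e m\<close> by (cases "j = m") auto
      qed
      thus "R'(m := r) \<in> S'" using upd by (simp add: S'_def)
    qed
  qed
  have "S' = (\<lambda>(R', r). R'(m := r)) ` (SIGMA R':S. ?V - sp R')"
  proof (intro equalityI subsetI)
    fix R assume R: "R \<in> S'"
    hence RV: "R \<in> {..<Suc m} \<rightarrow>\<^sub>E ?V" "indep p I (Suc m) R" by (auto simp: S'_def)
    define R' where "R' = restrict R {..<m}"
    have eq: "R'(m := R m) = R"
      using RV(1) by (intro extensionalityI[of _ "{..<Suc m}"]) (auto simp: R'_def PiE_def extensional_def less_Suc_eq)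
    have "indep p I m R'"
      unfolding indep_def
    proof (intro allI impI)
      fix e :: "nat \<Rightarrow> nat" and j
      assume *: "\<forall>i\<in>I. (\<Prod>j<m. R' j i ^ e j) = 1" and j: "j < m"
      have "(\<Prod>j<Suc m. R j i ^ (e(m := 0)) j) = 1" if "i \<in> I" for i
        using *[rule_format, OF that] by (simp add: R'_def)
      thus "p dvd e j" using RV(2)[unfolded indep_def, rule_format, of "e(m := 0)" j] j by simp
    qed
    hence R'S: "R' \<in> S" using RV(1) by (auto simp: S_def R'_def)
    moreover have rV: "R m \<in> ?V" using RV(1) by (auto simp: PiE_iff)
    ultimately have "R m \<notin> sp R'" using step[OF R'S rV] R eq by simp
    thus "R \<in> (\<lambda>(R', r). R'(m := r)) ` (SIGMA R':S. ?V - sp R')"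
      using R'S rV eq by (intro image_eqI[of R _ "(R', R m)"]) auto
  qed (use step in auto)
  moreover have "inj_on (\<lambda>(R', r). R'(m := r)) (SIGMA R':S. ?V - sp R')"
  proof (rule inj_onI)
    fix u v assume u: "u \<in> (SIGMA R':S. ?V - sp R')" "v \<in> (SIGMA R':S. ?V - sp R')"
      "(\<lambda>(R', r). R'(m := r)) u = (\<lambda>(R', r). R'(m := r)) v"
    obtain R r Q q where uv: "u = (R, r)" "v = (Q, q)" by (cases u, cases v) auto
    have eq: "R(m := r) = Q(m := q)" using u(3) uv by simp
    have "R \<in> extensional {..<m}" "Q \<in> extensional {..<m}" using u uv by (auto simp: S_def PiE_def)
    moreover have "R x = Q x" if "x \<in> {..<m}" for x using fun_cong[OF eq, of x] that by simp
    ultimately have "R = Q" by (intro extensionalityI[of _ "{..<m}"]) auto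
    thus "u = v" using fun_cong[OF eq, of m] uv by simp
  qed
  ultimately have "card S' = card (SIGMA R':S. ?V - sp R')" by (simp add: card_image)
  also have "\<dots> = (\<Sum>R'\<in>S. card (?V - sp R'))" using Suc finV by (intro card_SigmaI) (auto simp: S_def)
  also have "\<dots> = (\<Sum>R'\<in>S. p ^ card I - p ^ m)"
  proof (rule sum.cong[OF HOL.refl])
    fix R assume R: "R \<in> S"
    have sub: "sp R \<subseteq> ?V" using spV R by (auto simp: S_def)
    thus "card (?V - sp R) = p ^ card I - p ^ m"
      using card_Diff_subset[OF finite_subset[OF sub finV(1)] sub] card_sp[OF R] finV(2) by simp
  qed
  also have "\<dots> = card S * (p ^ card I - p ^ m)" by simp
  also have "\<dots> = (\<Prod>i<Suc m. p ^ card I - p ^ i)" using Suc by (simp add: S_def)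
  finally have c: "card S' = (\<Prod>i<Suc m. p ^ card I - p ^ i)" .
  have "finite S'"
    by (rule finite_subset[of _ "{..<Suc m} \<rightarrow>\<^sub>E ?V"]) (use finV in \<open>auto simp: S'_def intro: finite_PiE\<close>)
  thus ?case using c by (simp add: S'_def)
qed

text \<open>The fibre of \<open>Y\<close> through \<open>h\<close> is the translate by
  \<open>h\<close> of the fixed subgroup, so all nonempty fibres have the same size.\<close>

lemma card_Y_Fix:
  assumes "tg G" "finite (carrier G)"
  shows "order G = card (Y G ` carrier G) * card {h \<in> carrier G. act G h = h}"
proof -
  interpret tg G by fact
  let ?Fix = "{h \<in> carrier G. act G h = h}"
  have "card {x \<in> carrier G. Y G x = y} = card ?Fix" if "y \<in> Y G ` carrier G" for y
  proof -
    obtain h where h: "h \<in> carrier G" "y = Y G h" using \<open>y \<in> Y G ` carrier G\<close> by auto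
    have YF: "Y G (f \<otimes>\<^bsub>G\<^esub> h) = Y G h" if "f \<in> ?Fix" for f
      using that h(1) by (simp add: Y_def act_mult inv_mult_group m_assoc)
    have "{x \<in> carrier G. Y G x = y} = (\<lambda>f. f \<otimes>\<^bsub>G\<^esub> h) ` ?Fix"
    proof (intro equalityI subsetI)
      fix x assume "x \<in> {x \<in> carrier G. Y G x = y}"
      hence x: "x \<in> carrier G" "inv\<^bsub>G\<^esub> x \<otimes>\<^bsub>G\<^esub> act G x = inv\<^bsub>G\<^esub> h \<otimes>\<^bsub>G\<^esub> act G h" using h by (auto simp: Y_def)
      have "act G x = x \<otimes>\<^bsub>G\<^esub> (inv\<^bsub>G\<^esub> h \<otimes>\<^bsub>G\<^esub> act G h)" using x(1) by (simp flip: x(2))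
      hence "act G (x \<otimes>\<^bsub>G\<^esub> inv\<^bsub>G\<^esub> h) = x \<otimes>\<^bsub>G\<^esub> inv\<^bsub>G\<^esub> h" using x(1) h(1) by (simp add: act_mult act_inv m_assoc)
      moreover have "x = (x \<otimes>\<^bsub>G\<^esub> inv\<^bsub>G\<^esub> h) \<otimes>\<^bsub>G\<^esub> h" using x h by (simp add: m_assoc)
      ultimately show "x \<in> (\<lambda>f. f \<otimes>\<^bsub>G\<^esub> h) ` ?Fix" using x h by blast
    qed (use YF h in auto)
    moreover have "inj_on (\<lambda>f. f \<otimes>\<^bsub>G\<^esub> h) ?Fix" using h by (auto intro!: inj_onI)
    ultimately show ?thesis by (simp add: card_image)
  qed
  moreover have "card (carrier G) = (\<Sum>y\<in>Y G ` carrier G. card {x \<in> carrier G. Y G x = y})"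
    using sum.image_gen[OF assms(2), of "\<lambda>_. 1 :: nat" "Y G"] by simp
  ultimately show ?thesis by (simp add: order_def)
qed

text \<open>The fibres over \<open>H\<close> are left translates of the kernel, so each has Haar
  measure \<open>1 / order H\<close>.\<close>

lemma (in tg) fibre_measure:
  assumes haar: "haar_prob G \<nu>" and H: "group H" "finite (carrier H)" and \<phi>: "\<phi> \<in> hom G H" "\<phi> ` carrier G = carrier H"
    "openin (topo G) (kernel G H \<phi>)" and B: "B \<subseteq> carrier H"
  shows "measure \<nu> {x \<in> carrier G. \<phi> x \<in> B} = card B / order H"
proof -
  interpret \<nu>: prob_space \<nu> using haar by (simp add: haar_prob_def)
  interpret \<phi>: group_hom G H \<phi> using \<phi> is_group H by (simp add: group_hom_iff)
  have osets: "U \<in> sets \<nu>" if "openin (topo G) U" for U using haar that by (auto simp: haar_prob_def)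
  let ?f = "\<lambda>h. {x \<in> carrier G. \<phi> x = h}"
  have fs: "?f h \<in> sets \<nu>" for h using fibre_open[OF \<phi>(1) H(1) \<phi>(3), of "{h}"] osets by simp
  have eq: "measure \<nu> (?f h) = measure \<nu> (?f \<one>\<^bsub>H\<^esub>)" if "h \<in> carrier H" for h
  proof -
    have "h \<in> \<phi> ` carrier G" using that \<phi>(2) by simp
    then obtain g where g: "g \<in> carrier G" "\<phi> g = h" by auto
    have "?f h = l_coset G g (?f \<one>\<^bsub>H\<^esub>)"
    proof (intro equalityI subsetI)
      fix x assume x: "x \<in> ?f h"
      hence xc: "x \<in> carrier G" "\<phi> x = h" by auto
      have "inv g \<otimes> x \<in> ?f \<one>\<^bsub>H\<^esub>" using xc g that by simp
      moreover have "x \<in> {g \<otimes> (inv g \<otimes> x)}" using xc g by simp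
      ultimately show "x \<in> l_coset G g (?f \<one>\<^bsub>H\<^esub>)" unfolding l_coset_def by (rule UN_I)
    qed (use g in \<open>auto simp: l_coset_def\<close>)
    thus ?thesis using haar g(1) fs by (simp add: haar_prob_def measure_def)
  qed
  have un: "measure \<nu> {x \<in> carrier G. \<phi> x \<in> B} = card B * measure \<nu> (?f \<one>\<^bsub>H\<^esub>)" if B: "B \<subseteq> carrier H" for B
  proof -
    have "{x \<in> carrier G. \<phi> x \<in> B} = (\<Union>h\<in>B. ?f h)" by blast
    hence "measure \<nu> {x \<in> carrier G. \<phi> x \<in> B} = (\<Sum>h\<in>B. measure \<nu> (?f h))"
      using \<nu>.finite_measure_finite_Union[of B ?f] fs finite_subset[OF B H(2)] by (auto simp: disjoint_family_on_def)
    also have "\<dots> = (\<Sum>h\<in>B. measure \<nu> (?f \<one>\<^bsub>H\<^esub>))" by (intro sum.cong[OF HOL.refl] eq subsetD[OF B])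
    finally show ?thesis by simp
  qed
  have "{x \<in> carrier G. \<phi> x \<in> carrier H} = space \<nu>" using haar by (auto simp: haar_prob_def)
  hence "1 = order H * measure \<nu> (?f \<one>\<^bsub>H\<^esub>)" using un[of "carrier H"] \<nu>.prob_space by (simp add: order_def)
  moreover define q where "q = measure \<nu> (?f \<one>\<^bsub>H\<^esub>)"
  ultimately have "1 = order H * q" by (simp only:)
  hence "q = 1 / order H" by (cases "order H = 0") (auto simp: field_simps)
  thus ?thesis using un[OF B] unfolding q_def[symmetric] by simp
qed

definition no_fixed_char :: "nat \<Rightarrow> 'a gstruct \<Rightarrow> 'a set \<Rightarrow> bool" where
  "no_fixed_char p F N \<longleftrightarrow> (\<forall>c\<in>central_chars p F N. (\<forall>a\<in>N. c (act F a) = c a) \<longrightarrow> c = (\<lambda>a\<in>N. 1))"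

text \<open>The product of \<open>c\<close> with its composite with the involution is a central
  character fixed by the involution, hence trivial.\<close>

lemma (in tg) no_fixed_char_inverse:
  assumes N: "N \<lhd> G" "gamma_subgroup G N" "openin (topo G) N" and p: "p > 0" and np: "no_fixed_char p G N"
    and c: "c \<in> central_chars p G N" and a: "a \<in> N"
  shows "c (act G a) = inverse (c a)"
proof -
  interpret N: normal N G by fact
  have aN: "act G x \<in> N" if "x \<in> N" for x using N(2) that by (auto simp: gamma_subgroup_def)
  let ?d = "\<lambda>a\<in>N. c a * (\<lambda>a\<in>N. c (act G a)) a"
  have "?d \<in> central_chars p G N"
    using central_chars_closed(2)[OF N(1,3) p c central_chars_closed(3)[OF N(1,3) p c N(2)]] .
  moreover have "\<forall>a\<in>N. ?d (act G a) = ?d a"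
  proof
    fix x assume x: "x \<in> N"
    show "?d (act G x) = ?d x" using x aN[OF x] act_act[OF N.mem_carrier[OF x]] by (simp add: mult.commute)
  qed
  ultimately have "?d = (\<lambda>a\<in>N. 1)" using np by (simp add: no_fixed_char_def)
  from fun_cong[OF this, of a] have "c a * c (act G a) = 1" using a by simp
  thus ?thesis by (metis inverse_unique)
qed

text \<open>The event is a disjoint union of boxes, one for each independent matrix
  \<open>R\<close>; a box prescribes, for each i, that \<open>Y (s i)\<close> lies in
  \<open>N\<close> and that the basis characters take the values in column i of \<open>R\<close>
  there. By uniformity every box has the same measure, so the probability is the number of
  independent matrices times that of one box.\<close>

lemma (in gfree) measure_generates_kernel:
  fixes K :: "'k set"
  assumes H: "finite_gamma_group H" "order H = p ^ h" and \<phi>: "\<phi> \<in> gsurj F H" and N: "N = kernel F H \<phi>"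
    and np: "no_fixed_char p F N" and m: "card (central_chars p F N) = p ^ m" and haar: "haar_prob F \<nu>" and K: "finite K"
  defines "E \<equiv> {s \<in> space (PiM K (\<lambda>_. \<nu>)). generates_kernel p N (s ` K)}"
  shows "E \<in> sets (PiM K (\<lambda>_. \<nu>))"
    "measure (PiM K (\<lambda>_. \<nu>)) E = (\<Prod>i<m. 1 - real p ^ i / real p ^ card K) / real (card (Y H ` carrier H)) ^ card K"
proof -
  note H' = finite_gammaD[OF H(1)]
  interpret H: tg H by (rule H'(6))
  have pp: "p > 0" using prime prime_gt_0_nat by blast
  have gh: "\<phi> \<in> ghom F H" and surj: "\<phi> ` carrier F = carrier H" using \<phi> by (auto simp: gsurj_def)
  note k = ghom_kernel[OF gh H'(6), folded N]
  interpret N: normal N F by (rule k(1))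
  interpret \<phi>: group_hom F H \<phi> using ghom_kernel(5)[OF gh H'(6)] .
  have hom: "\<phi> \<in> hom F H" and oker: "openin (topo F) (kernel F H \<phi>)" using gh by (auto simp: ghom_def)
  have oH: "\<exists>k. order H = p ^ k" using H by blast
  let ?X = "central_chars p F N"
  note C = central_charsD[OF _ k(1) pp]
  from dual_pair_exists[OF H'(1,2) oH hom surj oker, folded N]
  obtain m' cs ns where dp0: "dual_pair p N ?X m' cs ns" by (elim exE)
  hence "p ^ m' = p ^ m" using m by (simp add: dual_pair_def)
  hence "m' = m" by (rule power_inject_exp[OF prime_gt_1_nat[OF prime], THEN iffD1])
  with dp0 have dp: "dual_pair p N ?X m cs ns" by (simp only:)
  have D: "\<And>j. j < m \<Longrightarrow> cs j \<in> ?X" "\<And>j. j < m \<Longrightarrow> ns j \<in> N"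
      "\<And>i j. i < m \<Longrightarrow> j < m \<Longrightarrow> cs i (ns j) = (if i = j then omega p else 1)"
      "\<And>c. c \<in> ?X \<Longrightarrow> (\<And>j. j < m \<Longrightarrow> c (ns j) = 1) \<Longrightarrow> c = (\<lambda>a\<in>N. 1)"
    using dp by (auto simp: dual_pair_def)
  interpret \<nu>: prob_space \<nu> using haar by (simp add: haar_prob_def)
  have osets: "U \<in> sets \<nu>" if "openin (topo F) U" for U using haar that by (auto simp: haar_prob_def)
  have space: "space \<nu> = carrier F" using haar by (simp add: haar_prob_def)
  let ?T = "{..<m} \<rightarrow>\<^sub>E mu p"
  have NI: "x \<in> N \<longleftrightarrow> x \<in> carrier F \<and> \<phi> x = \<one>\<^bsub>H\<^esub>" for x by (simp only: N kernel_def mem_Collect_eq)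
  have aN: "act F x \<in> N" if "x \<in> N" for x using k(2) that by (auto simp: gamma_subgroup_def)
  define A where "A t = {g \<in> carrier F. Y F g \<in> N \<and> (\<forall>j<m. cs j (Y F g) = t j)}" for t :: "nat \<Rightarrow> complex"
  \<comment> \<open>Rests on
    \<open>Y(n g) = (inv g \<otimes> ?w \<otimes> g) \<otimes> Y(g)\<close>. The conjugation is
    invisible to the characters, and since these are inverted by the involution, \<open>?w\<close>
    contributes an inverse square.\<close>
  have shift: "Y F (n \<otimes> g) \<in> N \<and> (\<forall>j<m. cs j (Y F (n \<otimes> g)) = cs j (Y F g) * inverse (cs j n) ^ 2)"
    if n: "n \<in> N" and g: "g \<in> carrier F" "Y F g \<in> N" for n g
  proof -
    have nc: "n \<in> carrier F" using n by auto
    let ?w = "inv n \<otimes> act F n"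
    have wN: "?w \<in> N" using n aN[OF n] by (intro N.m_closed N.m_inv_closed)
    have conj: "inv g \<otimes> ?w \<otimes> g \<in> N" using N.inv_op_closed1[OF g(1) wN] .
    have eq: "Y F (n \<otimes> g) = (inv g \<otimes> ?w \<otimes> g) \<otimes> Y F g"
      using nc g by (simp add: Y_def act_mult inv_mult_group m_assoc)
    have "cs j (Y F (n \<otimes> g)) = cs j (Y F g) * inverse (cs j n) ^ 2" if j: "j < m" for j
    proof -
      note c = D(1)[OF j]
      have "cs j (Y F (n \<otimes> g)) = cs j ?w * cs j (Y F g)"
        unfolding eq using C(3)[OF c conj g(2)] C(9)[OF c g(1) wN] by simp
      also have "cs j ?w = inverse (cs j n) * inverse (cs j n)"
        using C(3)[OF c N.m_inv_closed[OF n] aN[OF n]] C(8)[OF c n] no_fixed_char_inverse[OF k(1,2,3) pp np c n] by simp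
      finally show ?thesis by (simp add: power2_eq_square)
    qed
    thus ?thesis unfolding eq using N.m_closed[OF conj g(2)] eq by simp
  qed
  have trans: "l_coset F n (A t) = A t'"
    if n: "n \<in> N" and t: "\<And>j. j < m \<Longrightarrow> t' j = t j * inverse (cs j n) ^ 2" for n t t'
  proof (intro equalityI subsetI)
    fix x assume "x \<in> l_coset F n (A t)"
    then obtain g where g: "g \<in> A t" "x = n \<otimes> g" by (auto simp: l_coset_def)
    thus "x \<in> A t'" using shift[OF n, of g] n t by (auto simp: A_def)
  next
    fix x assume x: "x \<in> A t'"
    have nc: "n \<in> carrier F" using n by auto
    have xc: "x \<in> carrier F" using x by (simp add: A_def)
    have s: "Y F (inv n \<otimes> x) \<in> N" "\<And>j. j < m \<Longrightarrow> cs j (Y F (inv n \<otimes> x)) = t' j * inverse (cs j (inv n)) ^ 2"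
      using shift[OF N.m_inv_closed[OF n], of x] x by (auto simp: A_def)
    have "cs j (Y F (inv n \<otimes> x)) = t j" if j: "j < m" for j
      using s(2)[OF j] t[OF j] C(8)[OF D(1)[OF j] n] C(2)[OF D(1)[OF j] n] by (simp add: field_simps)
    hence "inv n \<otimes> x \<in> A t" using s(1) nc xc by (simp add: A_def)
    moreover have "x = n \<otimes> (inv n \<otimes> x)" using nc xc by simp
    ultimately show "x \<in> l_coset F n (A t)" unfolding l_coset_def by blast
  qed
  have oA: "openin (topo F) (A t)" for t
  proof -
    define M where "M = (\<Inter>j<m. {a\<in>N. cs j a = 1}) \<inter> N"
    have oM: "openin (topo F) M"
    proof (cases "m = 0")
      case True thus ?thesis using k(3) by (simp add: M_def)
    next
      case False
      have "openin (topo F) (\<Inter>((\<lambda>j. {a\<in>N. cs j a = 1}) ` {..<m}))"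
        using False C(5)[OF D(1)] by (intro openin_Inter) auto
      thus ?thesis unfolding M_def using k(3) by (rule openin_Int)
    qed
    have "A t = (\<Union>g\<in>A t. M #> g)"
    proof (intro equalityI subsetI)
      fix g assume g: "g \<in> A t"
      have "\<one> \<in> M" using C(7)[OF D(1)] N.one_closed by (auto simp: M_def)
      moreover have "g = \<one> \<otimes> g" using g by (simp add: A_def)
      ultimately show "g \<in> (\<Union>g\<in>A t. M #> g)" using g unfolding r_coset_def by blast
    next
      fix x assume "x \<in> (\<Union>g\<in>A t. M #> g)"
      then obtain g n where g: "g \<in> A t" "n \<in> M" "x = n \<otimes> g" by (auto simp: r_coset_def)
      hence nN: "n \<in> N" "\<And>j. j < m \<Longrightarrow> cs j n = 1" by (auto simp: M_def)
      have "l_coset F n (A t) = A t" by (rule trans[OF nN(1)]) (simp add: nN(2))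
      moreover have "x \<in> l_coset F n (A t)" using g by (auto simp: l_coset_def)
      ultimately show "x \<in> A t" by simp
    qed
    moreover have "openin (topo F) (\<Union>g\<in>A t. M #> g)"
      using rtrans_open[OF _ oM] by (intro openin_Union) (auto simp: A_def)
    ultimately show ?thesis by simp
  qed
  have As: "A t \<in> sets \<nu>" for t using osets oA by blast
  have Aeq: "measure \<nu> (A t) = measure \<nu> (A t')" if t: "t \<in> ?T" "t' \<in> ?T" for t t'
  proof -
    \<comment> \<open>The exponent (p+1)/2 is the inverse of 2 modulo the odd prime
      \<open>p\<close>, so \<open>z j\<close> is a square root of \<open>t j / t' j\<close>.
      Translating by an element with these character values carries \<open>A t\<close> to
      \<open>A t'\<close>.\<close>
    define z where "z j = (t j / t' j) ^ ((p + 1) div 2)" for j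
    have tm: "t j \<in> mu p" "t' j \<in> mu p" if "j < m" for j using t that by (auto simp: PiE_iff)
    have "z j \<in> mu p" if "j < m" for j unfolding z_def using tm[OF that] by simp
    then obtain n where n: "n \<in> N" "\<forall>j<m. cs j n = z j"
      using dual_surj[OF is_group N.is_subgroup pp _ _ dp, of z] C(3,7) by blast
    have "t' j = t j * inverse (cs j n) ^ 2" if j: "j < m" for j
    proof -
      have q: "t j / t' j \<in> mu p" using tm[OF j] by simp
      have "(p + 1) div 2 * 2 = p + 1" using odd_p by (intro dvd_div_mult_self) simp
      hence "z j ^ 2 = (t j / t' j) ^ (p + 1)" by (simp only: z_def power_mult[symmetric])
      also have "\<dots> = t j / t' j" using q by (simp add: mu_def)
      finally have "z j ^ 2 = t j / t' j" .
      thus ?thesis using n(2) j mu_nz[OF pp tm(1)[OF j]] mu_nz[OF pp tm(2)[OF j]] by (simp add: power_inverse)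
    qed
    hence "l_coset F n (A t) = A t'" by (rule trans[OF n(1)])
    moreover have "emeasure \<nu> (l_coset F n (A t)) = emeasure \<nu> (A t)"
      using haar As n(1) by (auto simp: haar_prob_def)
    ultimately show ?thesis by (simp add: measure_def)
  qed
  let ?y = "card (Y H ` carrier H)"
  have y0: "?y > 0" using H'(2) by (simp add: card_gt_0_iff) (use H.one_closed in blast)
  have finT: "finite ?T" "card ?T = p ^ m" using card_mu[OF pp] by (auto intro: finite_PiE simp: card_PiE)
  have A_meas: "measure \<nu> (A t) = 1 / (?y * p ^ m)" if t: "t \<in> ?T" for t
  proof -
    \<comment> \<open>\<open>Y F g\<close> lies in \<open>N\<close> exactly when
      \<open>\<phi> g\<close> is fixed by the involution. The sets \<open>A t\<close> therefore
      partition an event of measure \<open>card ?Fix / order H = 1 / ?y\<close> into p^m pieces of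
      equal measure.\<close>
    let ?Fix = "{h \<in> carrier H. act H h = h}"
    have "Y F g \<in> N \<longleftrightarrow> \<phi> g \<in> ?Fix" if g: "g \<in> carrier F" for g
    proof -
      have "\<phi> (Y F g) = inv\<^bsub>H\<^esub> (\<phi> g) \<otimes>\<^bsub>H\<^esub> act H (\<phi> g)" using g gh by (simp add: Y_def ghom_def)
      moreover have "inv\<^bsub>H\<^esub> (\<phi> g) \<otimes>\<^bsub>H\<^esub> act H (\<phi> g) = \<one>\<^bsub>H\<^esub> \<longleftrightarrow> act H (\<phi> g) = \<phi> g"
        using g by (metis H.act_closed H.inv_closed H.inv_equality H.inv_inv H.l_inv \<phi>.hom_closed)
      ultimately show ?thesis using g by (simp add: NI)
    qed
    hence "{g \<in> carrier F. \<phi> g \<in> ?Fix} = {g \<in> carrier F. Y F g \<in> N}" by blast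
    also have "\<dots> = (\<Union>t\<in>?T. A t)"
    proof (intro equalityI subsetI)
      fix g assume g: "g \<in> {g \<in> carrier F. Y F g \<in> N}"
      have "cs j (Y F g) \<in> mu p" if "j < m" for j using C(1)[OF D(1)[OF that]] g by simp
      hence "(\<lambda>j\<in>{..<m}. cs j (Y F g)) \<in> ?T" by auto
      moreover have "g \<in> A (\<lambda>j\<in>{..<m}. cs j (Y F g))" using g by (simp add: A_def)
      ultimately show "g \<in> (\<Union>t\<in>?T. A t)" by blast
    qed (auto simp: A_def)
    finally have "measure \<nu> {g \<in> carrier F. \<phi> g \<in> ?Fix} = measure \<nu> (\<Union>t\<in>?T. A t)" by simp
    also have "\<dots> = (\<Sum>t\<in>?T. measure \<nu> (A t))"
    proof (rule \<nu>.finite_measure_finite_Union[OF finT(1)])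
      show "disjoint_family_on A ?T"
        unfolding disjoint_family_on_def
      proof (intro ballI impI)
        fix t t' assume tt: "t \<in> ?T" "t' \<in> ?T" "t \<noteq> t'"
        have "t = t'" if "g \<in> A t \<inter> A t'" for g
          using tt(1,2) that by (intro extensionalityI[of _ "{..<m}"]) (auto simp: PiE_def A_def)
        thus "A t \<inter> A t' = {}" using tt(3) by blast
      qed
    qed (use As in auto)
    also have "\<dots> = (\<Sum>t'\<in>?T. measure \<nu> (A t))" using Aeq[OF _ t] by (intro sum.cong) auto
    also have "\<dots> = p ^ m * measure \<nu> (A t)" using finT(2) by simp
    finally have 1: "measure \<nu> {g \<in> carrier F. \<phi> g \<in> ?Fix} = p ^ m * measure \<nu> (A t)" .
    have 2: "measure \<nu> {g \<in> carrier F. \<phi> g \<in> ?Fix} = card ?Fix / order H"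
      by (rule fibre_measure[OF haar H'(1,2) hom surj oker]) blast
    have o: "order H = ?y * card ?Fix" by (rule card_Y_Fix[OF H'(6,2)])
    have "order H > 0" using H.order_gt_0_iff_finite H'(2) by blast
    hence "card ?Fix > 0" using o by (metis gr0I mult_0_right)
    hence "card ?Fix / order H = 1 / ?y" using o by simp
    with 1 2 have 3: "p ^ m * measure \<nu> (A t) = 1 / ?y" by (simp only:)
    have "real (p ^ m) > 0" using pp by simp
    thus ?thesis using 3 y0 by (simp add: field_simps)
  qed
  let ?M = "PiM K (\<lambda>_. \<nu>)"
  interpret P: finite_product_prob_space "\<lambda>_. \<nu>" K
    by unfold_locales (use K in auto)
  define box where "box R = Pi\<^sub>E K (\<lambda>i. A (\<lambda>j. R j i))" for R :: "nat \<Rightarrow> 'k \<Rightarrow> complex"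
  define G where "G = {R \<in> {..<m} \<rightarrow>\<^sub>E (K \<rightarrow>\<^sub>E mu p). indep p K m R}"
  have ci: "finite G" "card G = (\<Prod>i<m. p ^ card K - p ^ i)" using card_indep[OF prime K, of m] by (auto simp: G_def)
  have boxs: "box R \<in> sets ?M" for R unfolding box_def using As K by (intro sets_PiM_I_finite) auto
  have A_cong: "A t = A t'" if "\<And>j. j < m \<Longrightarrow> t j = t' j" for t t' using that by (auto simp: A_def)
  have boxm: "measure ?M (box R) = (1 / (?y * p ^ m)) ^ card K" if "R \<in> G" for R
  proof -
    have RK: "R j i \<in> mu p" if "j < m" "i \<in> K" for j i using \<open>R \<in> G\<close> that by (auto simp: G_def PiE_iff)
    have "measure \<nu> (A (\<lambda>j. R j i)) = 1 / (?y * p ^ m)" if "i \<in> K" for i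
    proof -
      have "A (\<lambda>j. R j i) = A (\<lambda>j\<in>{..<m}. R j i)" by (rule A_cong) simp
      moreover have "(\<lambda>j\<in>{..<m}. R j i) \<in> ?T" using RK that by auto
      ultimately show ?thesis using A_meas by simp
    qed
    hence "(\<Prod>i\<in>K. measure \<nu> (A (\<lambda>j. R j i))) = (1 / (?y * p ^ m)) ^ card K" by simp
    thus ?thesis unfolding box_def using P.finite_measure_PiM_emb[of "\<lambda>i. A (\<lambda>j. R j i)"] As by simp
  qed
  have cprod: "(\<lambda>a\<in>N. \<Prod>j<q. cs j a ^ e j) \<in> ?X" if "q \<le> m" for q and e :: "nat \<Rightarrow> nat"
    using that
  proof (induction q)
    case 0 show ?case using central_chars_closed(1)[OF k(1,3) pp] by (simp only: lessThan_0 prod.empty)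
  next
    case (Suc q)
    have pw: "(\<lambda>a\<in>N. cs q a ^ i) \<in> ?X" for i
    proof (induction i)
      case 0 show ?case using central_chars_closed(1)[OF k(1,3) pp] by (simp only: power_0)
    next
      case (Suc i)
      have "(\<lambda>a\<in>N. cs q a ^ Suc i) = (\<lambda>a\<in>N. cs q a * (\<lambda>a\<in>N. cs q a ^ i) a)" by auto
      moreover have "cs q \<in> ?X" using \<open>Suc q \<le> m\<close> by (intro D(1)) simp
      ultimately show ?case using central_chars_closed(2)[OF k(1,3) pp _ Suc] by (simp only:)
    qed
    have eq: "(\<lambda>a\<in>N. \<Prod>j<Suc q. cs j a ^ e j) = (\<lambda>a\<in>N. (\<lambda>a\<in>N. \<Prod>j<q. cs j a ^ e j) a * (\<lambda>a\<in>N. cs q a ^ e q) a)"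
      by auto
    have "q \<le> m" using Suc.prems by simp
    show ?case unfolding eq by (rule central_chars_closed(2)[OF k(1,3) pp Suc.IH[OF \<open>q \<le> m\<close>] pw])
  qed
  \<comment> \<open>A relation among the rows of \<open>R\<close> is a character that vanishes on
    all \<open>Y (f i)\<close>. From independence to characters, the exponents of \<open>c\<close>
    in the basis are read off at the dual elements \<open>ns j\<close>, and dividing
    \<open>c\<close> by that product leaves the trivial character.\<close>
  have good: "(\<forall>c\<in>?X. c \<noteq> (\<lambda>a\<in>N. 1) \<longrightarrow> (\<exists>s\<in>f ` K. c (Y F s) \<noteq> 1)) \<longleftrightarrow> indep p K m R"
    if YN: "\<And>i. i \<in> K \<Longrightarrow> Y F (f i) \<in> N" and R: "\<And>i j. i \<in> K \<Longrightarrow> j < m \<Longrightarrow> cs j (Y F (f i)) = R j i" for f R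
  proof
    assume L: "\<forall>c\<in>?X. c \<noteq> (\<lambda>a\<in>N. 1) \<longrightarrow> (\<exists>s\<in>f ` K. c (Y F s) \<noteq> 1)"
    show "indep p K m R"
      unfolding indep_def
    proof (intro allI impI)
      fix e :: "nat \<Rightarrow> nat" and j assume e: "\<forall>i\<in>K. (\<Prod>j<m. R j i ^ e j) = 1" and j: "j < m"
      let ?c = "\<lambda>a\<in>N. \<Prod>j<m. cs j a ^ e j"
      have "?c (Y F (f i)) = 1" if "i \<in> K" for i
        using YN[OF that] R[OF that] e that by simp
      hence "\<not> (\<exists>s\<in>f ` K. ?c (Y F s) \<noteq> 1)" by blast
      hence "?c = (\<lambda>a\<in>N. 1)" using bspec[OF L cprod[OF order_refl, of e]] by blast
      from fun_cong[OF this, of "ns j"] have "(\<Prod>i<m. cs i (ns j) ^ e i) = 1" using D(2)[OF j] by simp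
      moreover have "(\<Prod>i<m. cs i (ns j) ^ e i) = (\<Prod>i<m. if i = j then omega p ^ e j else 1)"
        by (rule prod.cong) (use D(3)[OF _ j] in auto)
      ultimately have "omega p ^ e j = 1" using j by simp
      thus "p dvd e j" using omega_power_eq_1[OF prime] by simp
    qed
  next
    assume ind: "indep p K m R"
    show "\<forall>c\<in>?X. c \<noteq> (\<lambda>a\<in>N. 1) \<longrightarrow> (\<exists>s\<in>f ` K. c (Y F s) \<noteq> 1)"
    proof (intro ballI impI)
      fix c assume c: "c \<in> ?X" "c \<noteq> (\<lambda>a\<in>N. 1)"
      show "\<exists>s\<in>f ` K. c (Y F s) \<noteq> 1"
      proof (rule ccontr)
        assume "\<not> ?thesis"
        hence c1: "\<And>i. i \<in> K \<Longrightarrow> c (Y F (f i)) = 1" by blast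
        have "\<exists>e. c (ns j) = omega p ^ e" if "j < m" for j
          using C(1)[OF c(1) D(2)[OF that]] omega_powers(2)[OF pp] by (auto simp: image_iff)
        then obtain e where e: "\<And>j. j < m \<Longrightarrow> c (ns j) = omega p ^ e j" by metis
        let ?q = "\<lambda>a\<in>N. \<Prod>j<m. cs j a ^ (e j * (p - 1))"
        let ?d = "\<lambda>a\<in>N. c a * ?q a"
        have dX: "?d \<in> ?X" by (rule central_chars_closed(2)[OF k(1,3) pp c(1) cprod[OF order_refl]])
        have "?d (ns j) = 1" if j: "j < m" for j
        proof -
          have "(\<Prod>i<m. cs i (ns j) ^ (e i * (p - 1))) = (\<Prod>i<m. if i = j then omega p ^ (e j * (p - 1)) else 1)"
            by (rule prod.cong) (use D(3)[OF _ j] in auto)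
          hence "?d (ns j) = omega p ^ e j * omega p ^ (e j * (p - 1))" using e[OF j] D(2)[OF j] j by simp
          also have "\<dots> = omega p ^ (p * e j)" using pp by (simp add: diff_mult_distrib2 mult.commute flip: power_add)
          finally show ?thesis using omega_power_eq_1[OF prime] by simp
        qed
        hence d1: "?d = (\<lambda>a\<in>N. 1)" by (rule D(4)[OF dX])
        have "(\<Prod>j<m. R j i ^ (e j * (p - 1))) = 1" if i: "i \<in> K" for i
          using fun_cong[OF d1, of "Y F (f i)"] YN[OF i] c1[OF i] R[OF i] by simp
        hence "p dvd e j * (p - 1)" if "j < m" for j
          using ind[unfolded indep_def, rule_format, of "\<lambda>j. e j * (p - 1)"] that by blast
        moreover have "\<not> p dvd p - 1" using prime_gt_1_nat[OF prime] by (auto dest: dvd_imp_le)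
        ultimately have "p dvd e j" if "j < m" for j using that prime by (metis prime_dvd_mult_iff)
        hence "c (ns j) = 1" if "j < m" for j using e[OF that] that omega_power_eq_1[OF prime] by simp
        thus False using D(4)[OF c(1)] c(2) by blast
      qed
    qed
  qed
  have gk: "generates_kernel p N S \<longleftrightarrow> (\<forall>s\<in>S. Y F s \<in> N) \<and> (\<forall>c\<in>?X. c \<noteq> (\<lambda>a\<in>N. 1) \<longrightarrow> (\<exists>s\<in>S. c (Y F s) \<noteq> 1))" for S
    unfolding generates_kernel_iff[OF prime H \<phi> N] using no_fixed_char_inverse[OF k(1,2,3) pp np] by blast
  have E_eq: "E = (\<Union>R\<in>G. box R)"
  proof (intro equalityI subsetI)
    fix s assume "s \<in> E"
    hence s: "s \<in> K \<rightarrow>\<^sub>E carrier F" "generates_kernel p N (s ` K)" by (auto simp: E_def space_PiM space)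
    define R where "R = (\<lambda>j\<in>{..<m}. \<lambda>i\<in>K. cs j (Y F (s i)))"
    have YN: "Y F (s i) \<in> N" if "i \<in> K" for i using s(2) that by (auto simp: generates_kernel_def)
    have "indep p K m R" using good[of s R] YN s(2) unfolding gk by (auto simp: R_def)
    moreover have "R \<in> {..<m} \<rightarrow>\<^sub>E (K \<rightarrow>\<^sub>E mu p)" using C(1)[OF D(1)] YN by (auto simp: R_def)
    ultimately have "R \<in> G" by (simp add: G_def)
    moreover have "s \<in> box R" using s(1) YN by (auto simp: box_def A_def R_def PiE_iff)
    ultimately show "s \<in> (\<Union>R\<in>G. box R)" by blast
  next
    fix s assume "s \<in> (\<Union>R\<in>G. box R)"
    then obtain R where R: "R \<in> G" "s \<in> box R" by blast
    have sA: "s i \<in> A (\<lambda>j. R j i)" if "i \<in> K" for i using R(2) that by (auto simp: box_def)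
    have "generates_kernel p N (s ` K)"
      unfolding gk using good[of s R] sA R(1) by (auto simp: A_def G_def)
    moreover have "s \<in> K \<rightarrow>\<^sub>E carrier F" using R(2) by (auto simp: box_def A_def PiE_iff)
    ultimately show "s \<in> E" by (simp add: E_def space_PiM space)
  qed
  thus "E \<in> sets ?M" using ci(1) boxs by (simp add: sets.finite_UN)
  have "measure ?M E = (\<Sum>R\<in>G. measure ?M (box R))"
    unfolding E_eq
  proof (rule P.finite_measure_finite_Union[OF ci(1)])
    show "disjoint_family_on box G"
      unfolding disjoint_family_on_def
    proof (intro ballI impI)
      fix R R' assume RR: "R \<in> G" "R' \<in> G" "R \<noteq> R'"
      have "R = R'" if s: "s \<in> box R \<inter> box R'" for s
      proof (rule extensionalityI[of _ "{..<m}"])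
        fix j assume j: "j \<in> {..<m}"
        show "R j = R' j"
        proof (rule extensionalityI[of _ K])
          fix i assume i: "i \<in> K"
          have "s i \<in> A (\<lambda>j. R j i)" "s i \<in> A (\<lambda>j. R' j i)" using s i by (auto simp: box_def)
          thus "R j i = R' j i" using j by (auto simp: A_def)
        qed (use RR j in \<open>auto simp: G_def PiE_def\<close>)
      qed (use RR in \<open>auto simp: G_def PiE_def\<close>)
      thus "box R \<inter> box R' = {}" using RR(3) by blast
    qed
  qed (use boxs in auto)
  also have "\<dots> = real (card G) * (1 / (?y * p ^ m)) ^ card K" using boxm by simp
  also have "\<dots> = (\<Prod>i<m. real (p ^ card K - p ^ i)) * (1 / (real p ^ card K) ^ m) / real ?y ^ card K"
    using ci(2) by (simp add: power_divide power_mult_distrib power_mult[symmetric] mult.commute)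
  also have "(\<Prod>i<m. real (p ^ card K - p ^ i)) * (1 / (real p ^ card K) ^ m) = (\<Prod>i<m. real (p ^ card K - p ^ i) / real p ^ card K)"
    by (simp add: prod_dividef)
  \<comment> \<open>For \<open>m\<close> greater than \<open>card K\<close> the subtraction of
    naturals is truncated in some factors, but both products then contain the factor 0 at i =
    \<open>card K\<close>.\<close>
  also have "\<dots> = (\<Prod>i<m. 1 - real p ^ i / real p ^ card K)"
  proof (cases "m \<le> card K")
    case True
    show ?thesis
    proof (rule prod.cong[OF HOL.refl])
      fix i assume "i \<in> {..<m}"
      hence "p ^ i \<le> p ^ card K" using True pp by (intro power_increasing) auto
      thus "real (p ^ card K - p ^ i) / real p ^ card K = 1 - real p ^ i / real p ^ card K"
        using pp by (simp add: of_nat_diff diff_divide_distrib)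
    qed
  next
    case False
    hence k: "card K \<in> {..<m}" by simp
    have "(\<Prod>i<m. real (p ^ card K - p ^ i) / real p ^ card K) = 0" by (rule prod_zero) (use k in auto)
    moreover have "(\<Prod>i<m. 1 - real p ^ i / real p ^ card K) = 0" by (rule prod_zero) (use k pp in auto)
    ultimately show ?thesis by (simp only:)
  qed
  finally show "measure ?M E = (\<Prod>i<m. 1 - real p ^ i / real p ^ card K) / real ?y ^ card K" .
qed

section \<open>Presentable groups\<close>

lemma gsurjD:
  assumes "\<phi> \<in> gsurj G A"
  shows "\<phi> \<in> ghom G A" "\<phi> \<in> hom G A" "\<phi> ` carrier G = carrier A" "openin (topo G) (kernel G A \<phi>)"
    "\<And>x. x \<in> carrier G \<Longrightarrow> \<phi> (act G x) = act A (\<phi> x)" "\<And>x. x \<in> carrier G \<Longrightarrow> \<phi> x \<in> carrier A"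
    "\<And>a. a \<in> carrier A \<Longrightarrow> \<exists>x. x \<in> carrier G \<and> \<phi> x = a"
proof -
  show 1: "\<phi> \<in> ghom G A" "\<phi> \<in> hom G A" "\<phi> ` carrier G = carrier A" "openin (topo G) (kernel G A \<phi>)"
    "\<And>x. x \<in> carrier G \<Longrightarrow> \<phi> (act G x) = act A (\<phi> x)"
    using assms by (auto simp: gsurj_def ghom_def)
  show "\<And>x. x \<in> carrier G \<Longrightarrow> \<phi> x \<in> carrier A" using hom_in_carrier[OF 1(2)] .
  fix a assume "a \<in> carrier A"
  hence "a \<in> \<phi> ` carrier G" using 1(3) by simp
  thus "\<exists>x. x \<in> carrier G \<and> \<phi> x = a" by auto
qed

lemma (in tg) closed_normal_gamma_gen_props:
  assumes "S \<subseteq> carrier G"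
  shows "closed_normal_gamma_gen G S \<lhd> G" "gamma_subgroup G (closed_normal_gamma_gen G S)"
    "closedin (topo G) (closed_normal_gamma_gen G S)" "S \<subseteq> closed_normal_gamma_gen G S"
    "\<And>K. \<lbrakk>K \<lhd> G; gamma_subgroup G K; closedin (topo G) K; S \<subseteq> K\<rbrakk> \<Longrightarrow> closed_normal_gamma_gen G S \<subseteq> K"
proof -
  let ?F = "{K. (K \<lhd> G \<and> gamma_subgroup G K \<and> closedin (topo G) K) \<and> S \<subseteq> K}"
  have "carrier G \<lhd> G" by (simp add: normal_inv_iff subgroup_self)
  moreover have "closedin (topo G) (carrier G)" using topspace_eq closedin_topspace by metis
  ultimately have c: "carrier G \<in> ?F"
    using assms subgroup_self by (auto simp: gamma_subgroup_def)
  have eq: "closed_normal_gamma_gen G S = \<Inter>?F" by (simp add: closed_normal_gamma_gen_def hull_def)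
  have s: "subgroup (\<Inter>?F) G" using c by (intro subgroups_Inter) (auto simp: gamma_subgroup_def)
  have "x \<otimes> h \<otimes> inv x \<in> K" if "x \<in> carrier G" "h \<in> \<Inter>?F" "K \<in> ?F" for x h K
  proof -
    have "K \<lhd> G" "h \<in> K" using that(2,3) by blast+
    thus ?thesis using that(1) normal.inv_op_closed2 by metis
  qed
  hence f: "\<forall>x\<in>carrier G. \<forall>h\<in>\<Inter>?F. x \<otimes> h \<otimes> inv x \<in> \<Inter>?F" by (meson InterI)
  show "closed_normal_gamma_gen G S \<lhd> G" unfolding eq by (rule normal_inv_iff[THEN iffD2, OF conjI[OF s f]])
  show "gamma_subgroup G (closed_normal_gamma_gen G S)" unfolding eq using s by (auto simp: gamma_subgroup_def)
  show "closedin (topo G) (closed_normal_gamma_gen G S)" unfolding eq using c by (intro closedin_Inter) auto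
  show "S \<subseteq> closed_normal_gamma_gen G S" unfolding eq by auto
  show "\<And>K. \<lbrakk>K \<lhd> G; gamma_subgroup G K; closedin (topo G) K; S \<subseteq> K\<rbrakk> \<Longrightarrow> closed_normal_gamma_gen G S \<subseteq> K"
    unfolding eq by auto
qed

lemma ghom_Y:
  assumes "tg G" "tg A" "\<phi> \<in> ghom G A" "x \<in> carrier G" shows "\<phi> (Y G x) = Y A (\<phi> x)"
proof -
  interpret G: tg G by fact
  interpret group_hom G A \<phi> by (rule G.ghom_kernel(5)[OF assms(3,2)])
  show ?thesis using assms(3,4) by (simp add: Y_def ghom_def)
qed

lemma odd_square_trivial:
  assumes "group A" "finite (carrier A)" "odd (order A)" "z \<in> carrier A" "z = inv\<^bsub>A\<^esub> z"
  shows "z = \<one>\<^bsub>A\<^esub>"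
proof -
  interpret group A by fact
  have zz: "z \<otimes>\<^bsub>A\<^esub> z = \<one>\<^bsub>A\<^esub>" using assms(4,5) by (metis r_inv)
  obtain t where t: "order A = 2 * t + 1" using assms(3) by (metis oddE)
  have "\<one>\<^bsub>A\<^esub> = z [^]\<^bsub>A\<^esub> (2 * t + 1)" using pow_order_eq_1[OF assms(4)] t by simp
  also have "\<dots> = (z [^]\<^bsub>A\<^esub> (2::nat)) [^]\<^bsub>A\<^esub> t \<otimes>\<^bsub>A\<^esub> z" using assms(4) by (simp add: nat_pow_pow)
  also have "z [^]\<^bsub>A\<^esub> (2::nat) = \<one>\<^bsub>A\<^esub>" using zz assms(4) by (simp add: numeral_2_eq_2)
  finally show ?thesis using assms(4) by simp
qed

lemma presentable_quotient_map:
  assumes p: "prime p" "odd p" and H: "finite_gamma_group H" "order H = p ^ h"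
    and pr: "presentable (p_gamma_groups p) u H"
  obtains n S \<psi> where "S \<subseteq> carrier (completion (p_gamma_groups p) (\<F> n))"
    "\<psi> \<in> gsurj (completion (p_gamma_groups p) (\<F> n)) H"
    "kernel (completion (p_gamma_groups p) (\<F> n)) H \<psi> =
      closed_normal_gamma_gen (completion (p_gamma_groups p) (\<F> n)) (Y (completion (p_gamma_groups p) (\<F> n)) ` S)"
proof -
  obtain n S where S: "S \<subseteq> carrier (completion (p_gamma_groups p) (\<F> n))"
    "H \<cong>\<^sub>\<Gamma> Y_quotient (completion (p_gamma_groups p) (\<F> n)) S"
    using pr unfolding presentable_def by blast
  interpret F: gfree "\<F> n" p "{1..n}" "\<lambda>i. Y (free_pro_odd n) (x_gen n i)" by (rule gfree_Fn[OF p])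
  interpret c: completed "\<F> n" "p_gamma_groups p" by (rule F.p_completed)
  interpret Gh: tg c.Gh by (rule c.Gh_tg)
  have YS: "Y c.Gh ` S \<subseteq> carrier c.Gh" using S(1) by auto
  note R = Gh.closed_normal_gamma_gen_props[OF YS]
  have "gamma_quotient c.Gh (closed_normal_gamma_gen c.Gh (Y c.Gh ` S)) \<cong>\<^sub>\<Gamma> H"
    using finite_gamma_iso_sym[OF S(2) H(1)] by (simp add: Y_quotient_def)
  from Gh.quotient_iso_ghom(1)[OF R(1,2) this H(1)] show ?thesis using that S(1) by blast
qed

text \<open>The images of the generators of \<open>\<F> n\<close> are inverted, hence values of
  \<open>Y\<close>, which gives the first claim. For the second, the map from \<open>\<F> n\<close>
  to \<open>H\<close> lifts to \<open>E\<close>, because each generator can be sent to an inverted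
  preimage. Multiplying by a central fixed element does not change \<open>Y\<close>, so the image of
  the lift contains all of \<open>Y(E)\<close> and the lift is onto. The relators die in
  \<open>E\<close>, hence the lift factors through \<open>H\<close> and the kernel of
  \<open>\<pi>\<close> is trivial.\<close>

lemma presentable_generated:
  assumes p: "prime p" "odd p" and H: "finite_gamma_group H" "order H = p ^ h"
    and pr: "presentable (p_gamma_groups p) u H" and K: "subgroup K H" "Y H ` carrier H \<subseteq> K"
  shows "K = carrier H"
    and "\<And>(E :: 'e gstruct) \<pi> e. \<lbrakk>finite_gamma_group E; order E = p ^ e; \<pi> \<in> gsurj E H;
      \<And>z. z \<in> kernel E H \<pi> \<Longrightarrow> act E z = z; \<And>z x. z \<in> kernel E H \<pi> \<Longrightarrow> x \<in> carrier E \<Longrightarrow> x \<otimes>\<^bsub>E\<^esub> z = z \<otimes>\<^bsub>E\<^esub> x;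
      \<And>K. subgroup K E \<Longrightarrow> Y E ` carrier E \<subseteq> K \<Longrightarrow> K = carrier E\<rbrakk> \<Longrightarrow> kernel E H \<pi> = {\<one>\<^bsub>E\<^esub>}"
proof -
  note H' = finite_gammaD[OF H(1)]
  interpret H: tg H by (rule H'(6))
  obtain n S \<psi> where S: "S \<subseteq> carrier (completion (p_gamma_groups p) (\<F> n))"
    and \<psi>: "\<psi> \<in> gsurj (completion (p_gamma_groups p) (\<F> n)) H"
    and ker: "kernel (completion (p_gamma_groups p) (\<F> n)) H \<psi> =
      closed_normal_gamma_gen (completion (p_gamma_groups p) (\<F> n)) (Y (completion (p_gamma_groups p) (\<F> n)) ` S)"
    by (rule presentable_quotient_map[OF p H pr])
  let ?y = "\<lambda>i. Y (free_pro_odd n) (x_gen n i)"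
  interpret F: gfree "\<F> n" p "{1..n}" ?y by (rule gfree_Fn[OF p])
  interpret c: completed "\<F> n" "p_gamma_groups p" by (rule F.p_completed)
  interpret Gh: tg c.Gh by (rule c.Gh_tg)
  note s = gsurjD[OF \<psi>]
  obtain L where L: "L \<in> c.J" "\<And>f h. \<lbrakk>f \<in> carrier c.Gh; h \<in> carrier c.Gh; f L = h L\<rbrakk> \<Longrightarrow> \<psi> f = \<psi> h"
    using c.hom_factor[OF s(2) H'(1) s(4)] by blast
  interpret \<psi>: group_hom c.Gh H \<psi> by (rule Gh.ghom_kernel(5)[OF s(1) H'(6)])
  interpret i: group_hom "\<F> n" c.Gh c.\<iota> using c.iota_hom F.is_group c.Gh_group by (simp add: group_hom_iff)
  define \<phi> where "\<phi> x = \<psi> (c.\<iota> x)" for x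
  have dense: "\<exists>g\<in>carrier (\<F> n). f L = c.\<iota> g L \<and> \<psi> f = \<phi> g" if f: "f \<in> carrier c.Gh" for f
  proof -
    obtain g where g: "g \<in> carrier (\<F> n)" "f L = L #>\<^bsub>\<F> n\<^esub> g" using c.mem_rep[OF f L(1)] .
    thus ?thesis using L(2)[OF f c.iota_closed[OF g(1)]] c.iota_at[OF L(1), of g] by (auto simp: \<phi>_def)
  qed
  have \<phi>hom: "\<phi> \<in> hom (\<F> n) H" by (rule homI) (auto simp: \<phi>_def)
  have \<phi>o: "openin (topo (\<F> n)) (kernel (\<F> n) H \<phi>)"
  proof (rule F.open_superset[of _ L])
    show "subgroup (kernel (\<F> n) H \<phi>) (\<F> n)"
      using group_hom.subgroup_kernel[of "\<F> n" H \<phi>] \<phi>hom F.is_group H'(1) by (simp add: group_hom_iff)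
    show "openin (topo (\<F> n)) L" by (rule c.JD(3)[OF L(1)])
    show "\<one>\<^bsub>\<F> n\<^esub> \<in> L" by (rule subgroup.one_closed[OF c.JD(5)[OF L(1)]])
    show "L \<subseteq> kernel (\<F> n) H \<phi>"
    proof
      fix g assume g: "g \<in> L"
      have gc: "g \<in> carrier (\<F> n)" using g c.JD(6)[OF L(1)] by blast
      have "c.\<iota> g L = \<one>\<^bsub>c.Gh\<^esub> L"
        using c.iota_at[OF L(1)] F.coset_join2[OF gc c.JD(5)[OF L(1)] g] L(1) by (simp add: c.Gh_simps(3))
      hence "\<psi> (c.\<iota> g) = \<psi> \<one>\<^bsub>c.Gh\<^esub>" using L(2)[OF c.iota_closed[OF gc] Gh.one_closed] by blast
      thus "g \<in> kernel (\<F> n) H \<phi>" using gc \<psi>.hom_one by (simp add: kernel_def \<phi>_def)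
    qed
  qed
  have \<phi>act: "\<phi> (act (\<F> n) x) = act H (\<phi> x)" if "x \<in> carrier (\<F> n)" for x
    using that c.iota_act[OF that] s(5)[OF c.iota_closed[OF that]] by (simp add: \<phi>_def)
  have \<phi>surj: "\<exists>x\<in>carrier (\<F> n). \<phi> x = a" if "a \<in> carrier H" for a
  proof -
    from s(7)[OF that] obtain f where f: "f \<in> carrier c.Gh" "\<psi> f = a" by blast
    thus ?thesis using dense[OF f(1)] by auto
  qed
  have oddH: "odd (order H)" using H(2) p(2) by simp
  have yY: "\<exists>d\<in>carrier H. Y H d = \<phi> (?y i)" if i: "i \<in> {1..n}" for i
  proof (rule Y_root[OF H(1) oddH])
    show "\<phi> (?y i) \<in> carrier H" using hom_in_carrier[OF \<phi>hom F.y_closed[OF i]] .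
    have "act H (\<phi> (?y i)) = \<phi> (inv\<^bsub>\<F> n\<^esub> (?y i))" using \<phi>act[OF F.y_closed[OF i]] F.act_y[OF i] by simp
    also have "\<dots> = inv\<^bsub>H\<^esub> (\<phi> (?y i))" using group_hom.hom_inv[of "\<F> n" H \<phi>] \<phi>hom F.is_group H'(1) F.y_closed[OF i]
      by (simp add: group_hom_iff)
    finally show "act H (\<phi> (?y i)) = inv\<^bsub>H\<^esub> (\<phi> (?y i))" .
  qed
  have "\<phi> x \<in> K" if "x \<in> carrier (\<F> n)" for x
  proof (rule F.image_in[OF \<phi>hom H'(1) \<phi>o K(1) _ that])
    fix i assume "i \<in> {1..n}"
    then obtain d where d: "d \<in> carrier H" "Y H d = \<phi> (?y i)" using yY by blast
    have "Y H d \<in> K" using d(1) K(2) by blast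
    thus "\<phi> (?y i) \<in> K" unfolding d(2) .
  qed
  hence "carrier H \<subseteq> K" using \<phi>surj by blast
  thus "K = carrier H" using subgroup.subset[OF K(1)] by blast
  fix E :: "'e gstruct" and \<pi> and e
  assume E: "finite_gamma_group E" "order E = p ^ e" and \<pi>: "\<pi> \<in> gsurj E H"
    and fixd: "\<And>z. z \<in> kernel E H \<pi> \<Longrightarrow> act E z = z"
    and cen: "\<And>z x. z \<in> kernel E H \<pi> \<Longrightarrow> x \<in> carrier E \<Longrightarrow> x \<otimes>\<^bsub>E\<^esub> z = z \<otimes>\<^bsub>E\<^esub> x"
    and gen: "\<And>K. subgroup K E \<Longrightarrow> Y E ` carrier E \<subseteq> K \<Longrightarrow> K = carrier E"
  note E' = finite_gammaD[OF E(1)]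
  interpret E: tg E by (rule E'(6))
  note sp = gsurjD[OF \<pi>]
  interpret \<pi>: group_hom E H \<pi> by (rule E.ghom_kernel(5)[OF sp(1) H'(6)])
  \<comment> \<open>A value of \<open>Y\<close> is lifted by applying \<open>Y\<close> to a lift of
    its argument; the result is again inverted.\<close>
  have "\<exists>e\<in>carrier E. act E e = inv\<^bsub>E\<^esub> e \<and> \<pi> e = \<phi> (?y i)" if i: "i \<in> {1..n}" for i
  proof -
    obtain d where d: "d \<in> carrier H" "Y H d = \<phi> (?y i)" using yY[OF i] by blast
    obtain d' where d': "d' \<in> carrier E" "\<pi> d' = d" using sp(7)[OF d(1)] by blast
    show ?thesis using d d' ghom_Y[OF E'(6) H'(6) sp(1) d'(1)] E.act_Y[OF d'(1)] by (intro bexI[of _ "Y E d'"]) auto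
  qed
  then obtain ee where ee: "\<And>i. i \<in> {1..n} \<Longrightarrow> ee i \<in> carrier E" "\<And>i. i \<in> {1..n} \<Longrightarrow> act E (ee i) = inv\<^bsub>E\<^esub> (ee i)"
    "\<And>i. i \<in> {1..n} \<Longrightarrow> \<pi> (ee i) = \<phi> (?y i)" by metis
  obtain \<theta> where \<theta>: "\<theta> \<in> ghom (\<F> n) E" "\<forall>i\<in>{1..n}. \<theta> (?y i) = ee i"
  proof -
    have oE: "\<exists>k. order E = p ^ k" using E(2) by blast
    have "\<exists>\<theta>\<in>ghom (\<F> n) E. \<forall>i\<in>{1..n}. \<theta> (?y i) = ee i" by (rule F.guniv[OF E(1) oE]) (erule ee(1), erule ee(2))
    then obtain \<theta> where "\<theta> \<in> ghom (\<F> n) E" "\<forall>i\<in>{1..n}. \<theta> (?y i) = ee i" by (elim bexE)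
    thus ?thesis by (rule that)
  qed
  note k\<theta> = F.ghom_kernel[OF \<theta>(1) E'(6)]
  interpret \<theta>: group_hom "\<F> n" E \<theta> by (rule k\<theta>(5))
  have \<pi>\<theta>: "\<pi> (\<theta> x) = \<phi> x" if "x \<in> carrier (\<F> n)" for x
  proof (rule F.hom_unique[OF _ \<phi>hom H'(1) _ \<phi>o _ that])
    show "(\<lambda>x. \<pi> (\<theta> x)) \<in> hom (\<F> n) H" by (rule homI) auto
    have "subgroup (kernel (\<F> n) H (\<lambda>x. \<pi> (\<theta> x))) (\<F> n)"
      using group_hom.subgroup_kernel[of "\<F> n" H "\<lambda>x. \<pi> (\<theta> x)"] \<open>(\<lambda>x. \<pi> (\<theta> x)) \<in> hom (\<F> n) H\<close> F.is_group H'(1)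
      by (simp add: group_hom_iff)
    thus "openin (topo (\<F> n)) (kernel (\<F> n) H (\<lambda>x. \<pi> (\<theta> x)))"
      by (rule F.open_superset[OF _ k\<theta>(3)]) (auto simp: kernel_def)
    show "\<pi> (\<theta> (?y i)) = \<phi> (?y i)" if "i \<in> {1..n}" for i using \<theta>(2) ee(3)[OF that] that by simp
  qed
  have im: "\<theta> ` carrier (\<F> n) = carrier E"
  proof (rule gen)
    show "subgroup (\<theta> ` carrier (\<F> n)) E" by (rule \<theta>.img_is_subgroup)
    show "Y E ` carrier E \<subseteq> \<theta> ` carrier (\<F> n)"
    proof
      fix w assume "w \<in> Y E ` carrier E"
      then obtain v where v: "v \<in> carrier E" "w = Y E v" by auto
      obtain x where x: "x \<in> carrier (\<F> n)" "\<phi> x = \<pi> v" using \<phi>surj[of "\<pi> v"] v by auto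
      have tx: "\<theta> x \<in> carrier E" using x by simp
      let ?z = "inv\<^bsub>E\<^esub> (\<theta> x) \<otimes>\<^bsub>E\<^esub> v"
      have z: "?z \<in> kernel E H \<pi>" using x v tx \<pi>\<theta>[OF x(1)] by (simp add: kernel_def)
      have zc: "?z \<in> carrier E" using tx v by simp
      have vz: "v = \<theta> x \<otimes>\<^bsub>E\<^esub> ?z" using tx v by simp
      \<comment> \<open>\<open>?z\<close> is fixed by the involution and central, so it cancels
        against its inverse inside \<open>Y\<close>.\<close>
      have "Y E (\<theta> x \<otimes>\<^bsub>E\<^esub> ?z) = inv\<^bsub>E\<^esub> ?z \<otimes>\<^bsub>E\<^esub> (Y E (\<theta> x) \<otimes>\<^bsub>E\<^esub> ?z)"
        using tx zc E.act_mult[OF tx zc] fixd[OF z] by (simp add: Y_def E.inv_mult_group[OF tx zc] E.m_assoc del: E.cancel_simps)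
      also have "Y E (\<theta> x) \<otimes>\<^bsub>E\<^esub> ?z = ?z \<otimes>\<^bsub>E\<^esub> Y E (\<theta> x)" using cen[OF z] tx by simp
      also have "inv\<^bsub>E\<^esub> ?z \<otimes>\<^bsub>E\<^esub> (?z \<otimes>\<^bsub>E\<^esub> Y E (\<theta> x)) = Y E (\<theta> x)"
        by (rule E.cancel_simps(2)[OF zc E.Y_closed[OF tx]])
      also have "\<dots> = \<theta> (Y (\<F> n) x)" using ghom_Y[OF F.tg_axioms E'(6) \<theta>(1) x(1)] by simp
      finally show "w \<in> \<theta> ` carrier (\<F> n)" using v(2) vz x(1) by (metis F.Y_closed imageI)
    qed
  qed
  have KJ: "kernel (\<F> n) E \<theta> \<in> c.J" by (rule F.kernel_p_index[OF p(1) E \<theta>(1)])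
  note ex = c.ext_ghom[OF \<theta>(1) E'(6) KJ]
  note kex = Gh.ghom_kernel[OF ex(1) E'(6)]
  interpret ex: group_hom c.Gh E "c.ext \<theta> E" by (rule kex(5))
  have exhom: "c.ext \<theta> E \<in> hom c.Gh E" "openin (topo c.Gh) (kernel c.Gh E (c.ext \<theta> E))" using ex(1) by (auto simp: ghom_def)
  obtain L' where L': "L' \<in> c.J" "\<And>f h. \<lbrakk>f \<in> carrier c.Gh; h \<in> carrier c.Gh; f L' = h L'\<rbrakk> \<Longrightarrow> c.ext \<theta> E f = c.ext \<theta> E h"
    using c.hom_factor[OF exhom(1) E'(1) exhom(2)] by blast
  \<comment> \<open>At this common level both \<open>\<psi>\<close> and the extension of
    \<open>\<theta>\<close> factor, so they can be compared at an element \<open>g\<close> of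
    \<open>\<F> n\<close> approximating \<open>f\<close>.\<close>
  have LL: "L \<inter> L' \<in> c.J" by (rule F.completion_index_Int[OF c.Cfin L(1) L'(1)])
  have agree: "\<pi> (c.ext \<theta> E f) = \<psi> f" if f: "f \<in> carrier c.Gh" for f
  proof -
    obtain g where g: "g \<in> carrier (\<F> n)" "f (L \<inter> L') = (L \<inter> L') #>\<^bsub>\<F> n\<^esub> g" using c.mem_rep[OF f LL] .
    have e: "f (L \<inter> L') = c.\<iota> g (L \<inter> L')" using g(2) c.iota_at[OF LL] by simp
    have "f L = c.\<iota> g L" "f L' = c.\<iota> g L'"
      using c.mem_agree_up[OF f c.iota_closed[OF g(1)] LL _ _ e] L(1) L'(1) by auto
    hence "\<psi> f = \<phi> g" "c.ext \<theta> E f = c.ext \<theta> E (c.\<iota> g)"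
      using L(2)[OF f c.iota_closed[OF g(1)]] L'(2)[OF f c.iota_closed[OF g(1)]] by (auto simp: \<phi>_def)
    thus ?thesis using ex(2)[OF g(1)] \<pi>\<theta>[OF g(1)] by simp
  qed
  have YS: "Y c.Gh ` S \<subseteq> carrier c.Gh" using S by auto
  note R = Gh.closed_normal_gamma_gen_props[OF YS]
  have oddE: "odd (order E)" using E(2) p(2) by simp
  have "Y c.Gh ` S \<subseteq> kernel c.Gh E (c.ext \<theta> E)"
  proof
    fix w assume "w \<in> Y c.Gh ` S"
    then obtain v where v: "v \<in> S" "w = Y c.Gh v" by auto
    have vc: "v \<in> carrier c.Gh" using v S by blast
    have wR: "w \<in> kernel c.Gh H \<psi>" using R(4) v ker by auto
    let ?z = "c.ext \<theta> E w"
    have wc: "w \<in> carrier c.Gh" using wR by (simp add: kernel_def)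
    have z1: "?z = Y E (c.ext \<theta> E v)" using ghom_Y[OF c.Gh_tg E'(6) ex(1) vc] v by simp
    have "\<pi> ?z = \<one>\<^bsub>H\<^esub>" using agree[OF wc] wR by (simp add: kernel_def)
    hence "?z \<in> kernel E H \<pi>" using wc by (simp add: kernel_def)
    hence "act E ?z = ?z" by (rule fixd)
    moreover have "act E ?z = inv\<^bsub>E\<^esub> ?z" unfolding z1 using E.act_Y vc by simp
    ultimately have "?z = \<one>\<^bsub>E\<^esub>" using odd_square_trivial[OF E'(1,2) oddE, of ?z] wc by simp
    thus "w \<in> kernel c.Gh E (c.ext \<theta> E)" using wc by (simp add: kernel_def)
  qed
  hence sub: "kernel c.Gh H \<psi> \<subseteq> kernel c.Gh E (c.ext \<theta> E)" unfolding ker by (rule R(5)[OF kex(1,2,4)])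
  show "kernel E H \<pi> = {\<one>\<^bsub>E\<^esub>}"
  proof (intro equalityI subsetI)
    fix z assume z: "z \<in> kernel E H \<pi>"
    hence "z \<in> c.ext \<theta> E ` carrier c.Gh" using ex(3) im by (simp add: kernel_def)
    then obtain f where f: "f \<in> carrier c.Gh" "z = c.ext \<theta> E f" by auto
    have "f \<in> kernel c.Gh H \<psi>" using agree[OF f(1)] z f by (simp add: kernel_def)
    hence "f \<in> kernel c.Gh E (c.ext \<theta> E)" using sub by blast
    thus "z \<in> {\<one>\<^bsub>E\<^esub>}" using f(2) by (simp add: kernel_def)
  qed (simp add: kernel_def)
qed

text \<open>The forbidden extension is the quotient of \<open>F\<close> by the kernel of
  \<open>c\<close>. Invariance of \<open>c\<close> under conjugation makes the image of
  \<open>N\<close> central, invariance under the involution makes it fixed. The quotient is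
  generated by values of \<open>Y\<close>, since it has odd order and is generated by the inverted
  images of the \<open>y i\<close>.\<close>

lemma (in gfree) presentable_no_fixed_char:
  fixes H :: "'h gstruct"
  assumes H: "finite_gamma_group H" "order H = p ^ h" and pr: "presentable (p_gamma_groups p) u H"
    and \<phi>: "\<phi> \<in> gsurj F H" and N: "N = kernel F H \<phi>"
  shows "no_fixed_char p F N"
  unfolding no_fixed_char_def
proof (intro ballI impI, rule ccontr)
  fix c assume c: "c \<in> central_chars p F N" "\<forall>a\<in>N. c (act F a) = c a" "c \<noteq> (\<lambda>a\<in>N. 1)"
  note H' = finite_gammaD[OF H(1)]
  interpret H: tg H by (rule H'(6))
  have pp: "p > 0" using prime prime_gt_0_nat by blast
  note s = gsurjD[OF \<phi>]
  note k = ghom_kernel[OF s(1) H'(6), folded N]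
  interpret N: normal N F by (rule k(1))
  interpret \<phi>: group_hom F H \<phi> by (rule k(5))
  note C = central_charsD[OF c(1) k(1) pp]
  let ?K = "{a\<in>N. c a = 1}"
  have aN: "act F x \<in> N" if "x \<in> N" for x using k(2) that by (auto simp: gamma_subgroup_def)
  have sg: "sign_char F N c" using c(2) by blast
  note sk = sign_char_kernel[OF prime H \<phi> N c(1,3) sg]
  note K = sk(1) and g = sk(2)
  let ?E = "gamma_quotient F ?K"
  note qf = quotient_finite[OF sk(1-4)]
  interpret E: tg ?E by (rule finite_gammaD(6)[OF qf(1)])
  note qs = gsurjD[OF qf(2)]
  let ?q = "\<lambda>x. ?K #> x"
  interpret q: group_hom F ?E ?q by (rule ghom_kernel(5)[OF qs(1) E.tg_axioms])
  have qeq: "?q x = ?q z \<longleftrightarrow> x \<otimes> inv z \<in> ?K" if "x \<in> carrier F" "z \<in> carrier F" for x z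
    using coset_eq_iff[OF K that] .
  have oE: "order ?E = p ^ (h + 1)" using sk(5) by (simp add: order_def)
  have NI: "x \<in> N \<longleftrightarrow> x \<in> carrier F \<and> \<phi> x = \<one>\<^bsub>H\<^esub>" for x by (simp only: N kernel_def mem_Collect_eq)
  define \<pi> where "\<pi> X = \<phi> (SOME x. x \<in> X)" for X
  have \<pi>: "\<pi> (?q x) = \<phi> x" if x: "x \<in> carrier F" for x
  proof -
    have "x \<in> ?q x" using rcos_self[OF x normal_imp_subgroup[OF K]] .
    hence "(SOME w. w \<in> ?q x) \<in> ?q x" by (rule someI)
    then obtain a where a: "a \<in> ?K" "(SOME w. w \<in> ?q x) = a \<otimes> x" unfolding r_coset_def by blast
    have "a \<in> carrier F" "\<phi> a = \<one>\<^bsub>H\<^esub>" using a(1) NI by auto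
    thus ?thesis unfolding \<pi>_def a(2) using x by simp
  qed
  have Erep: "\<exists>x\<in>carrier F. X = ?q x" if "X \<in> carrier ?E" for X using qs(7)[OF that] by blast
  have \<pi>s: "\<pi> \<in> gsurj ?E H"
    unfolding gsurj_def ghom_def
  proof (intro CollectI conjI ballI homI)
    fix X Z assume "X \<in> carrier ?E" "Z \<in> carrier ?E"
    then obtain x z where xz: "x \<in> carrier F" "X = ?q x" "z \<in> carrier F" "Z = ?q z" using Erep[of X] Erep[of Z] by blast
    have "X \<otimes>\<^bsub>?E\<^esub> Z = ?q (x \<otimes> z)" using q.hom_mult[OF xz(1,3)] xz by (simp only:)
    hence "\<pi> (X \<otimes>\<^bsub>?E\<^esub> Z) = \<phi> (x \<otimes> z)" using \<pi>[OF m_closed[OF xz(1,3)]] by (simp only:)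
    thus "\<pi> (X \<otimes>\<^bsub>?E\<^esub> Z) = \<pi> X \<otimes>\<^bsub>H\<^esub> \<pi> Z" using \<phi>.hom_mult[OF xz(1,3)] xz(2,4) \<pi>[OF xz(1)] \<pi>[OF xz(3)] by (simp only:)
  next
    fix X assume "X \<in> carrier ?E"
    then obtain x where x: "x \<in> carrier F" "X = ?q x" using Erep by blast
    show "\<pi> X \<in> carrier H" using x \<pi> by simp
    have "act ?E X = ?q (act F x)" using qs(5)[OF x(1)] x(2) by (simp only:)
    thus "\<pi> (act ?E X) = act H (\<pi> X)" using x(2) \<pi>[OF x(1)] \<pi>[OF act_closed[OF x(1)]] s(5)[OF x(1)] by (simp only:)
  next
    have "kernel ?E H \<pi> \<subseteq> carrier ?E" by (auto simp: kernel_def)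
    thus "openin (topo ?E) (kernel ?E H \<pi>)" using finite_gammaD(3)[OF qf(1)] by simp
    show "\<pi> ` carrier ?E = carrier H"
    proof (intro equalityI subsetI)
      fix a assume "a \<in> carrier H"
      then obtain x where x: "x \<in> carrier F" "\<phi> x = a" using s(7) by blast
      have "a = \<pi> (?q x)" using \<pi>[OF x(1)] x(2) by (simp only:)
      thus "a \<in> \<pi> ` carrier ?E" using q.hom_closed[OF x(1)] by (rule image_eqI)
    next
      fix a assume "a \<in> \<pi> ` carrier ?E"
      then obtain X where X: "X \<in> carrier ?E" "a = \<pi> X" by blast
      then obtain x where "x \<in> carrier F" "X = ?q x" using Erep by blast
      thus "a \<in> carrier H" using X \<pi> by simp
    qed
  qed
  have kerE: "\<exists>a\<in>N. X = ?q a" if "X \<in> kernel ?E H \<pi>" for X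
  proof -
    have X: "X \<in> carrier ?E" "\<pi> X = \<one>\<^bsub>H\<^esub>" using that unfolding kernel_def by blast+
    then obtain x where "x \<in> carrier F" "X = ?q x" using Erep by blast
    thus ?thesis using X(2) \<pi> NI by auto
  qed
  have Nc: "a \<in> N \<Longrightarrow> a \<in> carrier F" for a by simp
  have kfix: "act ?E X = X" if X: "X \<in> kernel ?E H \<pi>" for X
  proof -
    obtain a where a: "a \<in> N" "X = ?q a" using kerE[OF X] by blast
    have "act F a \<otimes> inv a \<in> ?K"
      using a(1) aN[OF a(1)] C(3)[OF aN[OF a(1)], of "inv a"] C(8)[OF a(1)] c(2) C(2)[OF a(1)] by simp
    hence "?q (act F a) = ?q a" using qeq[of "act F a" a] Nc[OF a(1)] by simp
    thus ?thesis using qs(5)[OF Nc[OF a(1)]] a(2) by (simp only:)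
  qed
  have kcen: "X \<otimes>\<^bsub>?E\<^esub> Z = Z \<otimes>\<^bsub>?E\<^esub> X" if Z: "Z \<in> kernel ?E H \<pi>" and X: "X \<in> carrier ?E" for X Z
  proof -
    obtain a where a: "a \<in> N" "Z = ?q a" using kerE[OF Z] by blast
    obtain x where x: "x \<in> carrier F" "X = ?q x" using Erep[OF X] by blast
    have ac: "a \<in> carrier F" using a by simp
    have xa: "x \<otimes> a \<otimes> inv x \<in> N" by (rule N.inv_op_closed2[OF x(1) a(1)])
    have "x \<otimes> a \<otimes> inv (a \<otimes> x) = x \<otimes> a \<otimes> inv x \<otimes> inv a" using x ac by (simp add: inv_mult_group m_assoc)
    also have "\<dots> \<in> ?K"
      using C(3)[OF xa N.m_inv_closed[OF a(1)]] C(4)[OF x(1) a(1)] C(8)[OF a(1)] C(2)[OF a(1)] N.m_closed[OF xa N.m_inv_closed[OF a(1)]] by simp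
    finally have "?q (x \<otimes> a) = ?q (a \<otimes> x)" using qeq[of "x \<otimes> a" "a \<otimes> x"] x ac by simp
    thus ?thesis using q.hom_mult[OF x(1) ac] q.hom_mult[OF ac x(1)] x(2) a(2) by (simp only:)
  qed
  have Egen: "K' = carrier ?E" if K': "subgroup K' ?E" "Y ?E ` carrier ?E \<subseteq> K'" for K'
  proof -
    have oddE: "odd (order ?E)" using oE odd_p by simp
    have "?q x \<in> K'" if x: "x \<in> carrier F" for x
    proof (rule image_in[OF qs(2) E.is_group qs(4) K'(1) _ x])
      fix i assume i: "i \<in> I"
      have "act ?E (?q (y i)) = ?q (inv (y i))" using qs(5)[OF y_closed[OF i]] act_y[OF i] by (simp only:)
      also have "\<dots> = inv\<^bsub>?E\<^esub> (?q (y i))" by (rule q.hom_inv[OF y_closed[OF i]])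
      finally have "\<exists>d\<in>carrier ?E. Y ?E d = ?q (y i)" by (rule Y_root[OF qf(1) oddE q.hom_closed[OF y_closed[OF i]]])
      thus "?q (y i) \<in> K'" using K'(2) by blast
    qed
    hence "carrier ?E \<subseteq> K'" using Erep by blast
    thus ?thesis using subgroup.subset[OF K'(1)] by blast
  qed
  have "kernel ?E H \<pi> = {\<one>\<^bsub>?E\<^esub>}"
    by (rule presentable_generated(2)[OF prime odd_p H pr H.subgroup_self _ qf(1) oE \<pi>s])
      (rule image_subsetI, erule H.Y_closed, erule kfix, erule (1) kcen, erule (1) Egen)
  moreover obtain a where a: "a \<in> N" "c a \<noteq> 1" using char_nontrivial[OF c(1,3) k(1) pp] by blast
  have "?q a \<in> kernel ?E H \<pi>" using q.hom_closed[OF Nc[OF a(1)]] \<pi>[OF Nc[OF a(1)]] a(1) NI by (simp add: kernel_def)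
  ultimately have "?q a = ?K" by simp
  moreover have "a \<in> ?q a" using rcos_self[OF Nc[OF a(1)] normal_imp_subgroup[OF K]] .
  ultimately have "a \<in> ?K" by simp
  thus False using a(2) by simp
qed

section \<open>Turning a generating tuple into a presentation with distinct relators\<close>

lemma injective_choice:
  assumes "finite K" "\<And>i. i \<in> K \<Longrightarrow> infinite (A i)"
  shows "\<exists>g. inj_on g K \<and> (\<forall>i\<in>K. g i \<in> A i)"
  using assms
proof (induction rule: finite_induct)
  case (insert i K)
  then obtain g where g: "inj_on g K" "\<forall>i\<in>K. g i \<in> A i" by auto
  have "infinite (A i - g ` K)" using insert by simp
  then obtain a where a: "a \<in> A i - g ` K" using infinite_imp_nonempty by blast
  show ?case
  proof (intro exI conjI)
    show "inj_on (g(i := a)) (insert i K)" using g(1) a insert(2) by (auto simp: inj_on_def)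
    show "\<forall>j\<in>insert i K. (g(i := a)) j \<in> A j" using g(2) a insert(2) by auto
  qed
qed simp

text \<open>Send every generator to a primitive root of unity of order p^j, in the group of all such
  roots with inversion as the involution. With p^j greater than \<open>d\<close>, the d-th power
  stays nontrivial there.\<close>

lemma (in gfree) generator_power_separated:
  assumes i: "i \<in> I" and d: "d > 0"
  shows "\<exists>L\<in>p_index p F. y i [^] (d::nat) \<notin> L"
proof -
  obtain j where j: "d < p ^ j" using power_gt_expt[of p d] prime prime_ge_2_nat by (metis Suc_le_lessD numeral_2_eq_2)
  let ?q = "p ^ j"
  have q0: "?q > 0" using prime prime_gt_0_nat by simp
  define A :: "complex gstruct" where "A = \<lparr>carrier = mu ?q, mult = (\<lambda>a b. a * b), one = 1, topo = discrete_topology (mu ?q), act = inverse\<rparr>"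
  have As: "carrier A = mu ?q" "mult A = (\<lambda>a b. a * b)" "one A = 1" "topo A = discrete_topology (mu ?q)" "act A = inverse"
    by (simp_all add: A_def)
  have gA: "group A"
  proof (rule groupI)
    fix x assume "x \<in> carrier A"
    hence "inverse x \<in> carrier A" "inverse x \<otimes>\<^bsub>A\<^esub> x = \<one>\<^bsub>A\<^esub>" using mu_nz[OF q0, of x] by (simp_all add: As)
    thus "\<exists>z\<in>carrier A. z \<otimes>\<^bsub>A\<^esub> x = \<one>\<^bsub>A\<^esub>" by blast
  qed (simp_all add: As)
  interpret A: group A by (rule gA)
  have invA: "inv\<^bsub>A\<^esub> x = inverse x" if "x \<in> mu ?q" for x
    by (rule A.inv_equality) (use that mu_nz[OF q0] in \<open>auto simp: As\<close>)
  have fA: "finite_gamma_group A"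
    by (rule finite_gammaI[OF gA]) (auto simp: As card_mu(2)[OF q0] hom_def)
  have oA: "order A = p ^ j" by (simp add: order_def As card_mu(1)[OF q0])
  hence oA': "\<exists>k. order A = p ^ k" by blast
  have powA: "x [^]\<^bsub>A\<^esub> (k::nat) = x ^ k" for x k
    by (induction k) (simp_all add: As mult.commute)
  have w: "omega ?q \<in> mu ?q" by (rule omega_mu[OF q0])
  have "\<exists>\<phi>\<in>ghom F A. \<forall>i\<in>I. \<phi> (y i) = omega ?q"
    by (rule guniv[OF fA oA']) (simp_all add: As w invA)
  then obtain \<phi> where \<phi>: "\<phi> \<in> ghom F A" "\<phi> (y i) = omega ?q" using i by blast
  note k = ghom_kernel[OF \<phi>(1) finite_gammaD(6)[OF fA]]
  interpret \<phi>: group_hom F A \<phi> by (rule k(5))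
  have "kernel F A \<phi> \<in> p_index p F" by (rule kernel_p_index[OF prime fA oA \<phi>(1)])
  moreover have "y i [^] d \<notin> kernel F A \<phi>"
  proof
    assume "y i [^] d \<in> kernel F A \<phi>"
    hence "omega ?q ^ d = 1"
      using \<phi>.hom_nat_pow[OF y_closed[OF i], of d] \<phi>(2) powA by (simp add: kernel_def As)
    hence "omega ?q ^ d = omega ?q ^ 0" by simp
    hence "d = 0" using omega_powers(1)[OF q0] j q0 by (auto simp: inj_on_def)
    thus False using d by simp
  qed
  ultimately show ?thesis by blast
qed

text \<open>\<open>Y(s m)\<close> is the product of \<open>inv m\<close>, \<open>Y(s)\<close> and
  the image of \<open>m\<close> under the involution. The outer factors are killed by all central
  characters, since the composite of a central character with the involution is again one, and by
  \<open>generates_kernel_iff\<close> only character values matter.\<close>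

lemma (in gfree) generates_kernel_perturb:
  fixes K :: "'k set"
  assumes H: "finite_gamma_group H" "order H = p ^ h" and \<phi>: "\<phi> \<in> gsurj F H" and N: "N = kernel F H \<phi>"
    and s: "\<And>i. i \<in> K \<Longrightarrow> s i \<in> carrier F" and gk: "generates_kernel p N (s ` K)"
    and m: "\<And>i. i \<in> K \<Longrightarrow> m i \<in> N" "\<And>i c. i \<in> K \<Longrightarrow> c \<in> central_chars p F N \<Longrightarrow> c (m i) = 1"
  shows "generates_kernel p N ((\<lambda>i. s i \<otimes> m i) ` K)"
proof -
  have pp: "p > 0" using prime prime_gt_0_nat by blast
  note sj = gsurjD[OF \<phi>]
  note k = ghom_kernel[OF sj(1) finite_gammaD(6)[OF H(1)], folded N]
  interpret N: normal N F by (rule k(1))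
  have aN: "act F x \<in> N" if "x \<in> N" for x using k(2) that by (auto simp: gamma_subgroup_def)
  have eq: "Y F (s i \<otimes> m i) = inv (m i) \<otimes> (Y F (s i) \<otimes> act F (m i))" if "i \<in> K" for i
    using s[OF that] N.mem_carrier[OF m(1)[OF that]] by (simp add: Y_def act_mult inv_mult_group m_assoc)
  note g = gk[unfolded generates_kernel_iff[OF prime H \<phi> N]]
  have YN: "Y F (s i) \<in> N" if "i \<in> K" for i using g that by blast
  have ce: "c (Y F (s i \<otimes> m i)) = c (Y F (s i))" if i: "i \<in> K" and c: "c \<in> central_chars p F N" for c i
  proof -
    note C = central_charsD[OF c k(1) pp]
    note mi = m(1)[OF i]
    have ca: "(\<lambda>a\<in>N. c (act F a)) \<in> central_chars p F N" by (rule central_chars_closed(3)[OF k(1,3) pp c k(2)])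
    have "c (act F (m i)) = 1" using m(2)[OF i ca] mi by simp
    moreover have "c (inv (m i)) = 1" using C(8)[OF mi] m(2)[OF i c] by simp
    ultimately show ?thesis
      unfolding eq[OF i] C(3)[OF N.m_inv_closed[OF mi] N.m_closed[OF YN[OF i] aN[OF mi]]] C(3)[OF YN[OF i] aN[OF mi]] by simp
  qed
  show ?thesis
    unfolding generates_kernel_iff[OF prime H \<phi> N]
  proof (intro conjI ballI impI)
    fix z assume "z \<in> (\<lambda>i. s i \<otimes> m i) ` K"
    then obtain i where i: "i \<in> K" "z = s i \<otimes> m i" by blast
    show "Y F z \<in> N" unfolding i(2) eq[OF i(1)]
      by (intro N.m_closed N.m_inv_closed m(1)[OF i(1)] YN[OF i(1)] aN)
  next
    fix c assume c: "c \<in> central_chars p F N" and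
      c2: "c \<noteq> (\<lambda>a\<in>N. 1) \<and> sign_char F N c"
    have "\<exists>s\<in>s ` K. c (Y F s) \<noteq> 1" by (rule mp[OF bspec[OF conjunct2[OF g] c] c2])
    then obtain i where i: "i \<in> K" "c (Y F (s i)) \<noteq> 1" by blast
    have "c (Y F (s i \<otimes> m i)) \<noteq> 1" unfolding ce[OF i(1) c] by (rule i(2))
    thus "\<exists>s\<in>(\<lambda>i. s i \<otimes> m i) ` K. c (Y F s) \<noteq> 1" using i(1) by blast
  qed
qed

text \<open>It has to be shown that the closed normal subgroup generated by the relators in the
  completion is the full kernel of the map to \<open>H\<close>. An element outside it is already
  separated at one finite level. Pulling that level back to \<open>G\<close> gives a member of the
  index that contains \<open>Y(S)\<close>, hence contains \<open>N\<close>, and this contradicts the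
  separation.\<close>

lemma (in tg) closed_normal_gen_completion:
  assumes p: "prime p" and H: "finite_gamma_group H" "order H = p ^ h" and \<phi>: "\<phi> \<in> gsurj G H" and N: "N = kernel G H \<phi>"
    and s: "S \<subseteq> carrier G" and gk: "generates_kernel p N S"
  defines "C \<equiv> p_gamma_groups p"
  shows "H \<cong>\<^sub>\<Gamma> Y_quotient (completion C G) (completion_map C G ` S)"
proof -
  interpret c: completed G C unfolding C_def by (rule p_completed)
  interpret Gh: tg c.Gh by (rule c.Gh_tg)
  note H' = finite_gammaD[OF H(1)]
  interpret i: group_hom G c.Gh c.\<iota> using c.iota_hom is_group c.Gh_group by (simp add: group_hom_iff)
  note sj = gsurjD[OF \<phi>]
  note k = ghom_kernel[OF sj(1) H'(6), folded N]
  interpret N: normal N G by (rule k(1))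
  have J: "c.J = {N. N \<lhd> G \<and> gamma_subgroup G N \<and> openin (topo G) N \<and> finite (rcosets N) \<and> (\<exists>k. card (rcosets N) = p ^ k)}"
    unfolding C_def by (rule index_p[OF p])
  have NJ: "N \<in> c.J" unfolding N C_def by (rule kernel_p_index[OF p H sj(1)])
  note ex = c.ext_ghom[OF sj(1) H'(6) NJ[unfolded N], folded N]
  let ?S = "c.\<iota> ` S"
  have YS: "Y c.Gh ` ?S \<subseteq> carrier c.Gh" using s by auto
  let ?R = "closed_normal_gamma_gen c.Gh (Y c.Gh ` ?S)"
  note R = Gh.closed_normal_gamma_gen_props[OF YS]
  note kex = Gh.ghom_kernel[OF ex(1) H'(6)]
  have gN: "\<And>s. s \<in> S \<Longrightarrow> Y G s \<in> N" "\<And>M. M \<in> c.J \<Longrightarrow> \<forall>s\<in>S. Y G s \<in> M \<Longrightarrow> N \<subseteq> M"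
    using gk unfolding generates_kernel_def C_def by blast+
  have eqR: "?R = kernel c.Gh H (c.ext \<phi> H)"
  proof
    show "?R \<subseteq> kernel c.Gh H (c.ext \<phi> H)"
    proof (rule R(5)[OF kex(1,2,4)], rule subsetI)
      fix w assume "w \<in> Y c.Gh ` ?S"
      then obtain v where v: "v \<in> S" "w = Y c.Gh (c.\<iota> v)" by blast
      have vc: "v \<in> carrier G" using v s by blast
      have w: "w = c.\<iota> (Y G v)" using v(2) c.iota_Y[OF vc] by simp
      have "w N = N" unfolding w c.iota_at[OF NJ] by (rule coset_join2[OF Y_closed[OF vc] N.subgroup_axioms gN(1)[OF v(1)]])
      thus "w \<in> kernel c.Gh H (c.ext \<phi> H)" unfolding ex(4) using w c.iota_closed[OF Y_closed[OF vc]] by simp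
    qed
    show "kernel c.Gh H (c.ext \<phi> H) \<subseteq> ?R"
    proof (rule subsetI, rule ccontr)
      fix f assume "f \<in> kernel c.Gh H (c.ext \<phi> H)" and fR: "f \<notin> ?R"
      hence f: "f \<in> carrier c.Gh" "f N = N" unfolding ex(4) by auto
      have "openin (topo c.Gh) (carrier c.Gh - ?R)" using R(3) Gh.topspace_eq by (metis closedin_def)
      then obtain L0 where L0: "L0 \<in> c.J" "{h\<in>carrier c.Gh. h L0 = f L0} \<subseteq> carrier c.Gh - ?R"
        unfolding c.openin_Gh using f(1) fR by blast
      \<comment> \<open>Intersecting with \<open>N\<close> puts the level below \<open>N\<close>
        while keeping the separation from \<open>?R\<close>.\<close>
      define L where "L = L0 \<inter> N"
      have L: "L \<in> c.J" unfolding L_def by (rule completion_index_Int[OF c.Cfin L0(1) NJ])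
      have LR: "r L \<noteq> f L" if r: "r \<in> ?R" for r
      proof
        assume e: "r L = f L"
        have rc: "r \<in> carrier c.Gh" using r normal_imp_subgroup[OF R(1)] subgroup.subset by blast
        have "r L0 = f L0" by (rule c.mem_agree_up[OF rc f(1) L L0(1) _ e]) (simp add: L_def)
        thus False using L0(2) rc r by blast
      qed
      interpret R: normal ?R c.Gh by (rule R(1))
      note LD = c.JD[OF L]
      \<comment> \<open>The preimage in \<open>G\<close> of the image of \<open>?R\<close> at level
        \<open>L\<close>. It contains \<open>L\<close>, so its index is again a power of
        \<open>p\<close>.\<close>
      define N1 where "N1 = {g\<in>carrier G. \<exists>r\<in>?R. r L = L #> g}"
      have mL: "(L #> a) <#> (L #> b) = L #> (a \<otimes> b)" if "a \<in> carrier G" "b \<in> carrier G" for a b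
        by (rule c.coset_mult[OF L that])
      have iL: "(inv\<^bsub>c.Gh\<^esub> r) L = L #> inv a" if r: "r \<in> carrier c.Gh" "a \<in> carrier G" "r L = L #> a" for r a
      proof -
        obtain b where b: "b \<in> carrier G" "(inv\<^bsub>c.Gh\<^esub> r) L = L #> b"
          using c.mem_rep[OF Gh.inv_closed[OF r(1)] L] .
        have "L #> (b \<otimes> a) = (inv\<^bsub>c.Gh\<^esub> r \<otimes>\<^bsub>c.Gh\<^esub> r) L" unfolding c.mult_at[OF L] b(2) r(3) mL[OF b(1) r(2)] ..
        also have "\<dots> = L #> \<one>" using r(1) c.Gh_simps(3) L LD(6) by simp
        finally have "b \<otimes> a \<in> L" using coset_eq_iff[OF LD(1), of "b \<otimes> a" "\<one>"] b(1) r(2) by simp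
        hence "L #> b = L #> inv a" using coset_eq_iff[OF LD(1), of b "inv a"] b(1) r(2) by simp
        thus ?thesis using b(2) by simp
      qed
      have rep: "\<And>r. r \<in> ?R \<Longrightarrow> r \<in> carrier c.Gh" by (rule R.mem_carrier)
      have sub: "subgroup N1 G"
      proof (rule subgroupI)
        show "N1 \<subseteq> carrier G" by (auto simp: N1_def)
        have "\<one>\<^bsub>c.Gh\<^esub> L = L #> \<one>" using c.Gh_simps(3) L LD(6) by simp
        hence "\<one> \<in> N1" unfolding N1_def using R.one_closed by blast
        thus "N1 \<noteq> {}" by blast
      next
        fix a assume "a \<in> N1"
        then obtain r where r: "a \<in> carrier G" "r \<in> ?R" "r L = L #> a" unfolding N1_def by blast
        have "(inv\<^bsub>c.Gh\<^esub> r) L = L #> inv a" by (rule iL[OF rep[OF r(2)] r(1,3)])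
        thus "inv a \<in> N1" unfolding N1_def using r R.m_inv_closed[OF r(2)] by blast
      next
        fix a b assume "a \<in> N1" "b \<in> N1"
        then obtain r t where r: "a \<in> carrier G" "r \<in> ?R" "r L = L #> a" "b \<in> carrier G" "t \<in> ?R" "t L = L #> b" unfolding N1_def by blast
        have "(r \<otimes>\<^bsub>c.Gh\<^esub> t) L = L #> (a \<otimes> b)" unfolding c.mult_at[OF L] r(3,6) by (rule mL[OF r(1,4)])
        thus "a \<otimes> b \<in> N1" unfolding N1_def using r R.m_closed[OF r(2,5)] by blast
      qed
      have nor: "N1 \<lhd> G"
      proof (rule normal_inv_iff[THEN iffD2, OF conjI[OF sub]], intro ballI)
        fix x a assume x: "x \<in> carrier G" and "a \<in> N1"
        then obtain r where r: "a \<in> carrier G" "r \<in> ?R" "r L = L #> a" unfolding N1_def by blast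
        let ?x = "c.\<iota> x"
        have xc: "?x \<in> carrier c.Gh" by (rule c.iota_closed[OF x])
        have "(?x \<otimes>\<^bsub>c.Gh\<^esub> r \<otimes>\<^bsub>c.Gh\<^esub> inv\<^bsub>c.Gh\<^esub> ?x) L = L #> (x \<otimes> a \<otimes> inv x)"
          unfolding c.mult_at[OF L] iL[OF xc x c.iota_at[OF L]] c.iota_at[OF L] r(3) mL[OF x r(1)]
          by (rule mL) (use x r in auto)
        thus "x \<otimes> a \<otimes> inv x \<in> N1" unfolding N1_def using R.inv_op_closed2[OF xc r(2)] x r(1) by blast
      qed
      have gam: "gamma_subgroup G N1"
        unfolding gamma_subgroup_def
      proof (intro conjI subsetI sub)
        fix b assume "b \<in> act G ` N1"
        then obtain a r where r: "a \<in> carrier G" "r \<in> ?R" "r L = L #> a" "b = act G a" unfolding N1_def by blast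
        have "act c.Gh r L = L #> b" unfolding c.act_at[OF L] r(3,4) by (rule act_coset[OF LD(2) r(1)])
        moreover have "act c.Gh r \<in> ?R" using R(2) r(2) by (auto simp: gamma_subgroup_def)
        moreover have "b \<in> carrier G" unfolding r(4) by (rule act_closed[OF r(1)])
        ultimately show "b \<in> N1" unfolding N1_def by blast
      qed
      have LN1: "L \<subseteq> N1"
      proof
        fix a assume a: "a \<in> L"
        have ac: "a \<in> carrier G" using a LD(6) by blast
        have "\<one>\<^bsub>c.Gh\<^esub> L = L #> a" using c.Gh_simps(3) L coset_join2[OF ac LD(5) a] by simp
        thus "a \<in> N1" unfolding N1_def using R.one_closed ac by blast
      qed
      note d = index_dvd[OF nor gam LD(1-4) LN1]
      obtain l where l: "card (rcosets L) = p ^ l" using L unfolding J by blast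
      have "N1 \<in> c.J" unfolding J using nor gam d l divides_primepow_nat[OF p] by auto
      moreover have "\<forall>s\<in>S. Y G s \<in> N1"
      proof
        fix v assume v: "v \<in> S"
        have vc: "v \<in> carrier G" using v s by blast
        have "c.\<iota> (Y G v) \<in> ?R" unfolding c.iota_Y[OF vc] using R(4) v by blast
        thus "Y G v \<in> N1" unfolding N1_def using c.iota_at[OF L, of "Y G v"] Y_closed[OF vc] by blast
      qed
      ultimately have NN1: "N \<subseteq> N1" by (rule gN(2))
      obtain g where g: "g \<in> carrier G" "f L = L #> g" using c.mem_rep[OF f(1) L] .
      have "f N = N #> g" by (rule c.mem_up[OF f(1) L NJ _ g]) (simp add: L_def)
      hence "N #> g = N" using f(2) by simp
      hence "g \<in> N" by (rule coset_join1[OF _ g(1) N.subgroup_axioms])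
      hence "g \<in> N1" using NN1 by blast
      thus False using LR g(2) unfolding N1_def by auto
    qed
  qed
  have es: "c.ext \<phi> H \<in> gsurj c.Gh H" using ex(1,3) sj(3) by (simp add: gsurj_def)
  have q: "gamma_quotient c.Gh ?R \<cong>\<^sub>\<Gamma> H"
    unfolding eqR by (rule Gh.quotient_iso[OF es H'(1,3,6)])
  note qi = Gh.quotient_iso_ghom[OF R(1,2) q H(1)]
  show ?thesis
    unfolding Y_quotient_def by (rule finite_gamma_iso_sym[OF q Gh.quotient_finite(1)[OF R(1,2) qi(2,3)]])
qed

text \<open>The set \<open>S\<close> must have exactly \<open>card K\<close> elements although \<open>s\<close> need not be injective; multiplying the \<open>s\<^sub>i\<close> by
  powers of a generator in the common kernel of the characters separates their images.\<close>

lemma (in gfree) generates_kernel_presentable: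
  fixes K :: "'k set"
  assumes H: "finite_gamma_group H" "order H = p ^ h" and \<phi>: "\<phi> \<in> gsurj F H" and N: "N = kernel F H \<phi>"
    and K: "finite K" and s: "\<And>i. i \<in> K \<Longrightarrow> s i \<in> carrier F" and gk: "generates_kernel p N (s ` K)" and I: "I \<noteq> {}"
  shows "\<exists>S. S \<subseteq> carrier (completion (p_gamma_groups p) F) \<and> finite S \<and> card S = card K \<and>
    H \<cong>\<^sub>\<Gamma> Y_quotient (completion (p_gamma_groups p) F) S"
proof -
  interpret c: completed F "p_gamma_groups p" by (rule p_completed)
  interpret Gh: tg c.Gh by (rule c.Gh_tg)
  interpret i: group_hom F c.Gh c.\<iota> using c.iota_hom is_group c.Gh_group by (simp add: group_hom_iff)
  have pp: "p > 0" using prime prime_gt_0_nat by blast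
  note sj = gsurjD[OF \<phi>]
  note k = ghom_kernel[OF sj(1) finite_gammaD(6)[OF H(1)], folded N]
  interpret N: normal N F by (rule k(1))
  interpret \<phi>: group_hom F H \<phi> by (rule k(5))
  obtain i0 where i0: "i0 \<in> I" using I by blast
  let ?y = "y i0"
  have yc: "?y \<in> carrier F" by (rule y_closed[OF i0])
  \<comment> \<open>The factor \<open>order H\<close> brings the power of the generator into
    \<open>N\<close>; the further factor \<open>p\<close> makes every central character trivial on
    it.\<close>
  define q where "q = order H * p"
  have q0: "q > 0" using H(2) pp by (simp add: q_def)
  define m where "m t = ?y [^] (q * t)" for t :: nat
  have mc: "m t \<in> carrier F" for t using yc by (simp add: m_def)
  have yN: "?y [^] order H \<in> N"
    unfolding N kernel_def mem_Collect_eq \<phi>.hom_nat_pow[OF yc]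
    using nat_pow_closed[OF yc] \<phi>.H.pow_order_eq_1[OF \<phi>.hom_closed[OF yc]] by (rule conjI)
  have powN: "a [^] (j::nat) \<in> N" if "a \<in> N" for a j by (induction j) (simp_all add: that)
  have m_eq: "m t = ((?y [^] order H) [^] p) [^] t" for t using yc by (simp add: m_def q_def nat_pow_pow)
  have mN: "m t \<in> N" for t unfolding m_eq by (intro powN yN)
  have mchar: "c (m t) = 1" if c: "c \<in> central_chars p F N" for c t
  proof -
    note C = central_charsD[OF c k(1) pp]
    have cp: "c (a [^] (j::nat)) = c a ^ j" if "a \<in> N" for a j
      by (induction j) (simp_all add: C(7) C(3)[OF powN[OF that] that] mult.commute)
    have "c ((?y [^] order H) [^] p) = 1" using cp[OF yN, of p] C(1)[OF yN] by (simp add: mu_def)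
    thus ?thesis unfolding m_eq using cp[OF powN[OF yN, of p], of t] by simp
  qed
  have inj: "inj (\<lambda>t. c.\<iota> (s i \<otimes> m t))" if i: "i \<in> K" for i
  proof (rule linorder_injI)
    fix a b :: nat assume ab: "a < b"
    obtain L where L: "L \<in> c.J" "?y [^] (q * (b - a)) \<notin> L"
      using generator_power_separated[OF i0, of "q * (b - a)"] q0 ab by auto
    note LD = c.JD[OF L(1)]
    show "c.\<iota> (s i \<otimes> m a) \<noteq> c.\<iota> (s i \<otimes> m b)"
    proof
      assume "c.\<iota> (s i \<otimes> m a) = c.\<iota> (s i \<otimes> m b)"
      hence "c.\<iota> (s i) \<otimes>\<^bsub>c.Gh\<^esub> c.\<iota> (m b) = c.\<iota> (s i) \<otimes>\<^bsub>c.Gh\<^esub> c.\<iota> (m a)"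
        using i.hom_mult[OF s[OF i] mc[of a]] i.hom_mult[OF s[OF i] mc[of b]] by simp
      hence "c.\<iota> (m b) = c.\<iota> (m a)"
        using Gh.Units_l_cancel[of "c.\<iota> (s i)" "c.\<iota> (m b)" "c.\<iota> (m a)"] s[OF i] mc by simp
      hence "L #> m b = L #> m a" using c.iota_at[OF L(1), of "m b"] c.iota_at[OF L(1), of "m a"] by simp
      hence 1: "m b \<otimes> inv (m a) \<in> L" using coset_eq_iff[OF LD(1) mc mc] by blast
      have "q * a \<le> q * b" using ab by simp
      hence "q * b = q * (b - a) + q * a" by (simp add: diff_mult_distrib2)
      hence "m b = ?y [^] (q * (b - a)) \<otimes> m a" unfolding m_def using nat_pow_mult[OF yc, of "q * (b - a)" "q * a"] by simp
      hence "m b \<otimes> inv (m a) = ?y [^] (q * (b - a))" using mc[of a] yc by (simp add: m_assoc)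
      thus False using 1 L(2) by simp
    qed
  qed
  \<comment> \<open>Each relator has infinitely many admissible perturbations with different images
    in the completion, so pairwise distinct images can be selected.\<close>
  have "\<exists>g. inj_on g K \<and> (\<forall>i\<in>K. g i \<in> range (\<lambda>t. c.\<iota> (s i \<otimes> m t)))"
    by (rule injective_choice[OF K]) (use inj range_inj_infinite in blast)
  then obtain g where g: "inj_on g K" "\<And>i. i \<in> K \<Longrightarrow> \<exists>t. g i = c.\<iota> (s i \<otimes> m t)"
    unfolding image_iff by blast
  then obtain t where t: "\<And>i. i \<in> K \<Longrightarrow> g i = c.\<iota> (s i \<otimes> m (t i))" by metis
  let ?S = "(\<lambda>i. s i \<otimes> m (t i)) ` K"
  have Sc: "?S \<subseteq> carrier F" using s mc by auto
  have "generates_kernel p N ?S"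
    by (rule generates_kernel_perturb[OF H \<phi> N s gk, where m = "\<lambda>i. m (t i)"]) (simp_all add: mN mchar)
  hence iso: "H \<cong>\<^sub>\<Gamma> Y_quotient c.Gh (c.\<iota> ` ?S)"
    by (rule closed_normal_gen_completion[OF prime H \<phi> N Sc])
  have "c.\<iota> ` ?S = g ` K" unfolding image_image by (rule image_cong[OF HOL.refl]) (simp add: t)
  moreover have "c.\<iota> ` ?S \<subseteq> carrier c.Gh" using Sc by auto
  moreover have "card (g ` K) = card K" by (rule card_image[OF g(1)])
  ultimately show ?thesis using iso K by (intro exI[of _ "g ` K"]) (simp only: finite_imageI)
qed

section \<open>The limit probability\<close>

text \<open>Elements of \<open>gsurj\<close> are unconstrained outside the carrier, so
  \<open>gsurj\<close> itself is unsuitable for counting; the tuple of values at the generators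
  records a surjection exactly on the carrier.\<close>

definition gen_tuples :: "'i set \<Rightarrow> ('i \<Rightarrow> 'a) \<Rightarrow> 'a gstruct \<Rightarrow> 'h gstruct \<Rightarrow> ('i \<Rightarrow> 'h) set" where
  "gen_tuples I y F H = (\<lambda>\<phi>. \<lambda>i\<in>I. \<phi> (y i)) ` gsurj F H"

lemma (in gfree) gsurj_unique:
  assumes H: "finite_gamma_group H" and \<phi>: "\<phi> \<in> gsurj F H" "\<psi> \<in> gsurj F H"
    and eq: "(\<lambda>i\<in>I. \<phi> (y i)) = (\<lambda>i\<in>I. \<psi> (y i))" and x: "x \<in> carrier F"
  shows "\<phi> x = \<psi> x"
proof (rule hom_unique[OF gsurjD(2)[OF \<phi>(1)] gsurjD(2)[OF \<phi>(2)] finite_gammaD(1)[OF H] gsurjD(4)[OF \<phi>(1)] gsurjD(4)[OF \<phi>(2)] _ x])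
  fix i assume "i \<in> I"
  thus "\<phi> (y i) = \<psi> (y i)" using fun_cong[OF eq, of i] by simp
qed

lemma (in gfree) gen_tuples_subset:
  assumes H: "finite_gamma_group H" "order H = p ^ h"
  shows "gen_tuples I y F H \<subseteq> I \<rightarrow>\<^sub>E Y H ` carrier H"
proof
  fix a assume "a \<in> gen_tuples I y F H"
  then obtain \<phi> where \<phi>: "\<phi> \<in> gsurj F H" "a = (\<lambda>i\<in>I. \<phi> (y i))" by (auto simp: gen_tuples_def)
  note s = gsurjD[OF \<phi>(1)]
  interpret \<phi>: group_hom F H \<phi> by (rule ghom_kernel(5)[OF s(1) finite_gammaD(6)[OF H(1)]])
  have oH: "odd (order H)" using H(2) odd_p by simp
  have "\<phi> (y i) \<in> Y H ` carrier H" if i: "i \<in> I" for i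
  proof -
    have "act H (\<phi> (y i)) = inv\<^bsub>H\<^esub> \<phi> (y i)"
      using s(5)[OF y_closed[OF i]] act_y[OF i] \<phi>.hom_inv[OF y_closed[OF i]] by simp
    from Y_root[OF H(1) oH \<phi>.hom_closed[OF y_closed[OF i]] this] show ?thesis by (metis imageI)
  qed
  thus "a \<in> I \<rightarrow>\<^sub>E Y H ` carrier H" unfolding \<phi>(2) by auto
qed

text \<open>A tuple that takes every value of \<open>Y\<close> on \<open>H\<close> comes from a
  surjection, because these values generate \<open>H\<close>. The error term is a union bound over
  the value that is missed.\<close>

lemma (in gfree) gen_tuples_lower:
  assumes H: "finite_gamma_group H" "order H = p ^ h"
    and gen: "\<And>K. subgroup K H \<Longrightarrow> Y H ` carrier H \<subseteq> K \<Longrightarrow> K = carrier H"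
  shows "card (Y H ` carrier H) ^ card I \<le>
    card (gen_tuples I y F H) + card (Y H ` carrier H) * (card (Y H ` carrier H) - 1) ^ card I"
proof -
  note H' = finite_gammaD[OF H(1)]
  interpret H: tg H by (rule H'(6))
  let ?Y = "Y H ` carrier H"
  have fY: "finite ?Y" using H'(2) by simp
  have oH: "\<exists>k. order H = p ^ k" using H(2) by blast
  have "(I \<rightarrow>\<^sub>E ?Y) \<subseteq> gen_tuples I y F H \<union> (\<Union>v\<in>?Y. I \<rightarrow>\<^sub>E (?Y - {v}))"
  proof (rule subsetI, rule UnCI)
    fix a assume a: "a \<in> I \<rightarrow>\<^sub>E ?Y" and n: "a \<notin> (\<Union>v\<in>?Y. I \<rightarrow>\<^sub>E (?Y - {v}))"
    have sub: "?Y \<subseteq> a ` I"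
    proof (rule subsetI, rule ccontr)
      fix v assume v: "v \<in> ?Y" "v \<notin> a ` I"
      have "a \<in> I \<rightarrow>\<^sub>E (?Y - {v})" using a v(2) by (auto simp: PiE_iff)
      thus False using n v(1) by blast
    qed
    have aY: "a i \<in> ?Y" if "i \<in> I" for i using a that by (rule PiE_mem)
    have ac: "a i \<in> carrier H" if "i \<in> I" for i using aY[OF that] by auto
    have aa: "act H (a i) = inv\<^bsub>H\<^esub> a i" if "i \<in> I" for i using aY[OF that] H.act_Y by auto
    have "\<exists>\<phi>\<in>ghom F H. \<forall>i\<in>I. \<phi> (y i) = a i"
      by (rule guniv[OF H(1) oH]) (erule ac, erule aa)
    then obtain \<phi> where \<phi>: "\<phi> \<in> ghom F H" "\<forall>i\<in>I. \<phi> (y i) = a i" by blast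
    interpret \<phi>: group_hom F H \<phi> by (rule ghom_kernel(5)[OF \<phi>(1) H'(6)])
    have "a ` I \<subseteq> \<phi> ` carrier F" using \<phi>(2) y_closed by (metis image_subset_iff imageI)
    hence "\<phi> ` carrier F = carrier H" using gen[OF \<phi>.img_is_subgroup] sub by blast
    hence "\<phi> \<in> gsurj F H" using \<phi>(1) by (simp add: gsurj_def)
    moreover have "a = (\<lambda>i\<in>I. \<phi> (y i))" using a \<phi>(2) by (auto simp: PiE_iff extensional_def restrict_def)
    ultimately show "a \<in> gen_tuples I y F H" unfolding gen_tuples_def by blast
  qed
  moreover have fin: "finite (gen_tuples I y F H)"
    using gen_tuples_subset[OF H] finite_PiE[OF finI, of "\<lambda>_. ?Y"] fY finite_subset by blast
  moreover have "finite (\<Union>v\<in>?Y. I \<rightarrow>\<^sub>E (?Y - {v}))" by (intro finite_UN_I fY finite_PiE finI) (use fY in auto)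
  ultimately have "card (I \<rightarrow>\<^sub>E ?Y) \<le> card (gen_tuples I y F H) + card (\<Union>v\<in>?Y. I \<rightarrow>\<^sub>E (?Y - {v}))"
    by (meson card_Un_le card_mono finite_UnI order_trans)
  also have "card (\<Union>v\<in>?Y. I \<rightarrow>\<^sub>E (?Y - {v})) \<le> (\<Sum>v\<in>?Y. card (I \<rightarrow>\<^sub>E (?Y - {v})))" by (rule card_UN_le[OF fY])
  also have "(\<Sum>v\<in>?Y. card (I \<rightarrow>\<^sub>E (?Y - {v}))) = (\<Sum>v\<in>?Y. (card ?Y - 1) ^ card I)"
    by (rule sum.cong[OF HOL.refl]) (simp add: card_PiE finI fY)
  finally show ?thesis by (simp add: card_PiE finI)
qed

text \<open>Composition with automorphisms acts freely on the surjections, and two surjections lie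
  in the same orbit exactly when they have the same kernel.\<close>

lemma (in gfree) card_gen_tuples:
  assumes H: "finite_gamma_group H" "order H = p ^ h"
  shows "finite (kernel F H ` gsurj F H)"
    "card (gen_tuples I y F H) = card (kernel F H ` gsurj F H) * card (gamma_Aut H)"
proof -
  note H' = finite_gammaD[OF H(1)]
  interpret H: tg H by (rule H'(6))
  let ?T = "gen_tuples I y F H" and ?N = "kernel F H ` gsurj F H"
  \<comment> \<open>Well defined on tuples: surjections with the same tuple agree on
    \<open>carrier F\<close>, so they have the same kernel.\<close>
  define ker where "ker a = kernel F H (SOME \<phi>. \<phi> \<in> gsurj F H \<and> a = (\<lambda>i\<in>I. \<phi> (y i)))" for a
  have ker: "ker (\<lambda>i\<in>I. \<phi> (y i)) = kernel F H \<phi>" if \<phi>: "\<phi> \<in> gsurj F H" for \<phi>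
  proof -
    let ?\<psi> = "SOME \<psi>. \<psi> \<in> gsurj F H \<and> (\<lambda>i\<in>I. \<phi> (y i)) = (\<lambda>i\<in>I. \<psi> (y i))"
    have "?\<psi> \<in> gsurj F H \<and> (\<lambda>i\<in>I. \<phi> (y i)) = (\<lambda>i\<in>I. ?\<psi> (y i))"
      by (rule someI[of _ \<phi>]) (simp add: \<phi>)
    hence "\<phi> x = ?\<psi> x" if "x \<in> carrier F" for x using gsurj_unique[OF H(1) \<phi> _ _ that] by blast
    thus ?thesis unfolding ker_def kernel_def by auto
  qed
  have fT: "finite ?T"
    using gen_tuples_subset[OF H] finite_PiE[OF finI, of "\<lambda>_. Y H ` carrier H"] H'(2) finite_subset by blast
  have kT: "ker ` ?T = ?N" unfolding gen_tuples_def image_image by (rule image_cong[OF HOL.refl]) (rule ker)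
  show fN: "finite ?N" unfolding kT[symmetric] using fT by simp
  have fib: "card {a \<in> ?T. ker a = N} = card (gamma_Aut H)" if "N \<in> ?N" for N
  proof -
    from that obtain \<phi> where \<phi>: "\<phi> \<in> gsurj F H" "N = kernel F H \<phi>" by blast
    note s = gsurjD[OF \<phi>(1)]
    interpret \<phi>: group_hom F H \<phi> by (rule ghom_kernel(5)[OF s(1) H'(6)])
    let ?b = "\<lambda>\<alpha>. \<lambda>i\<in>I. \<alpha> (\<phi> (y i))"
    have autD: "\<alpha> \<in> hom H H" "bij_betw \<alpha> (carrier H) (carrier H)" "\<alpha> \<in> extensional (carrier H)"
      "\<And>x. x \<in> carrier H \<Longrightarrow> \<alpha> (act H x) = act H (\<alpha> x)" if "\<alpha> \<in> gamma_Aut H" for \<alpha>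
      using that by (auto simp: gamma_Aut_def auto_def Bij_def)
    have comp: "(\<lambda>x. \<alpha> (\<phi> x)) \<in> gsurj F H" "kernel F H (\<lambda>x. \<alpha> (\<phi> x)) = N" if \<alpha>: "\<alpha> \<in> gamma_Aut H" for \<alpha>
    proof -
      note A = autD[OF \<alpha>]
      interpret \<alpha>: group_hom H H \<alpha> using A(1) H'(1) by (simp add: group_hom_iff)
      have "\<alpha> h = \<one>\<^bsub>H\<^esub> \<longleftrightarrow> h = \<one>\<^bsub>H\<^esub>" if "h \<in> carrier H" for h
        using inj_on_eq_iff[OF bij_betw_imp_inj_on[OF A(2)] that H.one_closed] \<alpha>.hom_one by simp
      thus k: "kernel F H (\<lambda>x. \<alpha> (\<phi> x)) = N" unfolding \<phi>(2) kernel_def by auto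
      have "(\<lambda>x. \<alpha> (\<phi> x)) ` carrier F = carrier H"
        using A(2) s(3) unfolding image_image[symmetric, of \<alpha> \<phi>] by (simp add: bij_betw_def)
      moreover have "(\<lambda>x. \<alpha> (\<phi> x)) \<in> hom F H" by (rule homI) (auto simp: \<alpha>.hom_mult)
      moreover have "openin (topo F) (kernel F H (\<lambda>x. \<alpha> (\<phi> x)))" unfolding k \<phi>(2) by (rule s(4))
      ultimately show "(\<lambda>x. \<alpha> (\<phi> x)) \<in> gsurj F H" using s(5,6) A(4) by (simp add: gsurj_def ghom_def)
    qed
    have "bij_betw ?b (gamma_Aut H) {a \<in> ?T. ker a = N}"
      unfolding bij_betw_def
    proof
      show "inj_on ?b (gamma_Aut H)"
      proof (rule inj_onI)
        fix \<alpha> \<beta> assume ab: "\<alpha> \<in> gamma_Aut H" "\<beta> \<in> gamma_Aut H" and e: "?b \<alpha> = ?b \<beta>"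
        have "\<alpha> h = \<beta> h" if h: "h \<in> carrier H" for h
        proof -
          obtain x where x: "x \<in> carrier F" "\<phi> x = h" using s(7)[OF h] by blast
          show ?thesis using gsurj_unique[OF H(1) comp(1)[OF ab(1)] comp(1)[OF ab(2)] e x(1)] x(2) by simp
        qed
        thus "\<alpha> = \<beta>" using autD(3)[OF ab(1)] autD(3)[OF ab(2)] by (rule extensionalityI[rotated -1])
      qed
      show "?b ` gamma_Aut H = {a \<in> ?T. ker a = N}"
      proof (intro equalityI subsetI)
        fix a assume "a \<in> ?b ` gamma_Aut H"
        then obtain \<alpha> where \<alpha>: "\<alpha> \<in> gamma_Aut H" "a = ?b \<alpha>" by blast
        have "a \<in> ?T" unfolding gen_tuples_def using \<alpha>(2) by (rule image_eqI[OF _ comp(1)[OF \<alpha>(1)]])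
        moreover have "ker a = N" unfolding \<alpha>(2) ker[OF comp(1)[OF \<alpha>(1)]] by (rule comp(2)[OF \<alpha>(1)])
        ultimately show "a \<in> {a \<in> ?T. ker a = N}" by simp
      next
        fix a assume "a \<in> {a \<in> ?T. ker a = N}"
        then obtain \<psi> where \<psi>: "\<psi> \<in> gsurj F H" "a = (\<lambda>i\<in>I. \<psi> (y i))" "ker a = N" unfolding gen_tuples_def by blast
        note t = gsurjD[OF \<psi>(1)]
        interpret \<psi>: group_hom F H \<psi> by (rule ghom_kernel(5)[OF t(1) H'(6)])
        have kk: "kernel F H \<psi> = kernel F H \<phi>" using \<psi> ker[OF \<psi>(1)] \<phi>(2) by simp
        have eq: "\<phi> x = \<phi> z \<longleftrightarrow> \<psi> x = \<psi> z" if "x \<in> carrier F" "z \<in> carrier F" for x z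
        proof -
          have "\<phi> x = \<phi> z \<longleftrightarrow> x \<otimes> inv z \<in> kernel F H \<phi>"
            using that H.inv_solve_right'[of "\<one>\<^bsub>H\<^esub>" "\<phi> x" "\<phi> z"] by (auto simp: kernel_def)
          moreover have "\<psi> x = \<psi> z \<longleftrightarrow> x \<otimes> inv z \<in> kernel F H \<psi>"
            using that H.inv_solve_right'[of "\<one>\<^bsub>H\<^esub>" "\<psi> x" "\<psi> z"] by (auto simp: kernel_def)
          ultimately show ?thesis using kk by simp
        qed
        have "\<exists>x. \<forall>h\<in>carrier H. x h \<in> carrier F \<and> \<phi> (x h) = h" using s(7) by metis
        then obtain \<xi> where \<xi>: "\<And>h. h \<in> carrier H \<Longrightarrow> \<xi> h \<in> carrier F" "\<And>h. h \<in> carrier H \<Longrightarrow> \<phi> (\<xi> h) = h" by blast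
        \<comment> \<open>The automorphism relating two surjections with the same kernel, obtained
          by applying \<open>\<psi>\<close> after a section \<open>\<xi>\<close> of
          \<open>\<phi>\<close>.\<close>
        define \<alpha> where "\<alpha> = (\<lambda>h\<in>carrier H. \<psi> (\<xi> h))"
        have \<alpha>: "\<alpha> (\<phi> x) = \<psi> x" if x: "x \<in> carrier F" for x
        proof -
          have "\<phi> (\<xi> (\<phi> x)) = \<phi> x" using \<xi>(2) x by simp
          hence "\<psi> (\<xi> (\<phi> x)) = \<psi> x" using eq[OF \<xi>(1) x] x by simp
          thus ?thesis using x by (simp add: \<alpha>_def)
        qed
        have "\<alpha> \<in> hom H H"
        proof (rule homI)
          fix g h assume gh: "g \<in> carrier H" "h \<in> carrier H"
          have "\<alpha> (g \<otimes>\<^bsub>H\<^esub> h) = \<alpha> (\<phi> (\<xi> g \<otimes> \<xi> h))" using \<xi> gh by simp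
          also have "\<dots> = \<psi> (\<xi> g) \<otimes>\<^bsub>H\<^esub> \<psi> (\<xi> h)" using \<alpha>[OF m_closed[OF \<xi>(1)[OF gh(1)] \<xi>(1)[OF gh(2)]]] \<xi>(1) gh by simp
          finally show "\<alpha> (g \<otimes>\<^bsub>H\<^esub> h) = \<alpha> g \<otimes>\<^bsub>H\<^esub> \<alpha> h" using gh by (simp add: \<alpha>_def)
        qed (use \<xi>(1) in \<open>simp add: \<alpha>_def\<close>)
        moreover have "bij_betw \<alpha> (carrier H) (carrier H)"
        proof (rule bij_betwI')
          fix g h assume gh: "g \<in> carrier H" "h \<in> carrier H"
          show "(\<alpha> g = \<alpha> h) = (g = h)" using eq[OF \<xi>(1)[OF gh(1)] \<xi>(1)[OF gh(2)]] \<xi>(2) gh by (simp add: \<alpha>_def)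
        next
          fix g assume "g \<in> carrier H" thus "\<alpha> g \<in> carrier H" using \<xi>(1) by (simp add: \<alpha>_def)
        next
          fix h assume "h \<in> carrier H"
          then obtain x where "x \<in> carrier F" "\<psi> x = h" using t(7) by blast
          thus "\<exists>g\<in>carrier H. h = \<alpha> g" using \<alpha> by (intro bexI[of _ "\<phi> x"]) auto
        qed
        moreover have "\<alpha> (act H h) = act H (\<alpha> h)" if h: "h \<in> carrier H" for h
        proof -
          have "act H h = \<phi> (act F (\<xi> h))" using s(5)[OF \<xi>(1)[OF h]] \<xi>(2)[OF h] by simp
          hence "\<alpha> (act H h) = \<psi> (act F (\<xi> h))" using \<alpha>[OF act_closed[OF \<xi>(1)[OF h]]] by simp
          thus ?thesis using t(5)[OF \<xi>(1)[OF h]] h by (simp add: \<alpha>_def)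
        qed
        moreover have "\<alpha> \<in> extensional (carrier H)" by (simp add: \<alpha>_def)
        moreover have "continuous_map (topo H) (topo H) \<alpha>"
          unfolding H'(3) using \<xi>(1) by (simp add: \<alpha>_def continuous_map_from_discrete_topology Pi_iff)
        ultimately have "\<alpha> \<in> gamma_Aut H" by (simp add: gamma_Aut_def auto_def Bij_def)
        moreover have "a = ?b \<alpha>" unfolding \<psi>(2) by (rule restrict_ext) (simp add: \<alpha> y_closed)
        ultimately show "a \<in> ?b ` gamma_Aut H" by blast
      qed
    qed
    thus ?thesis by (simp add: bij_betw_same_card)
  qed
  have "?T = (\<Union>N\<in>?N. {a \<in> ?T. ker a = N})" unfolding kT[symmetric] by blast
  hence "card ?T = card (\<Union>N\<in>?N. {a \<in> ?T. ker a = N})" by (rule arg_cong)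
  also have "\<dots> = (\<Sum>N\<in>?N. card {a \<in> ?T. ker a = N})"
    by (rule card_UN_disjoint[OF fN]) (use fT in auto)
  also have "\<dots> = (\<Sum>N\<in>?N. card (gamma_Aut H))" by (rule sum.cong[OF HOL.refl]) (rule fib)
  finally show "card ?T = card ?N * card (gamma_Aut H)" by simp
qed

text \<open>The events for different kernels are disjoint, since each kernel would be the least
  member of the index containing \<open>Y(S)\<close>. The kernels are finite in number and
  contribute equally, so measures simply add up.\<close>

lemma (in gfree) event_measure:
  fixes K :: "'k set"
  assumes H: "finite_gamma_group H" "order H = p ^ h"
    and np: "\<And>N. N \<in> kernel F H ` gsurj F H \<Longrightarrow> no_fixed_char p F N"
    and haar: "haar_prob F \<nu>" and K: "finite K"
    and m: "\<And>N. N \<in> kernel F H ` gsurj F H \<Longrightarrow> card (central_chars p F N) = p ^ m"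
  defines "E \<equiv> {s \<in> space (PiM K (\<lambda>_. \<nu>)). \<exists>\<phi>\<in>gsurj F H. generates_kernel p (kernel F H \<phi>) (s ` K)}"
  shows "E \<in> sets (PiM K (\<lambda>_. \<nu>))"
    "measure (PiM K (\<lambda>_. \<nu>)) E = real (card (kernel F H ` gsurj F H)) *
      ((\<Prod>i<m. 1 - real p ^ i / real p ^ card K) / real (card (Y H ` carrier H)) ^ card K)"
proof -
  let ?N = "kernel F H ` gsurj F H" and ?M = "PiM K (\<lambda>_. \<nu>)"
  let ?E = "\<lambda>N. {s \<in> space ?M. generates_kernel p N (s ` K)}"
  have EU: "E = (\<Union>N\<in>?N. ?E N)" unfolding E_def by blast
  have 1: "?E N \<in> sets ?M" "measure ?M (?E N) = (\<Prod>i<m. 1 - real p ^ i / real p ^ card K) / real (card (Y H ` carrier H)) ^ card K"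
    if N: "N \<in> ?N" for N
  proof -
    obtain \<phi> where \<phi>: "\<phi> \<in> gsurj F H" "N = kernel F H \<phi>" using N by blast
    show "?E N \<in> sets ?M" by (rule measure_generates_kernel(1)[OF H \<phi> np[OF N] m[OF N] haar K])
    show "measure ?M (?E N) = (\<Prod>i<m. 1 - real p ^ i / real p ^ card K) / real (card (Y H ` carrier H)) ^ card K"
      by (rule measure_generates_kernel(2)[OF H \<phi> np[OF N] m[OF N] haar K])
  qed
  note fN = card_gen_tuples(1)[OF H]
  have sub: "?E ` ?N \<subseteq> sets ?M" using 1(1) by blast
  show "E \<in> sets ?M" unfolding EU by (rule sets.finite_UN[OF fN]) (rule 1(1))
  have NJ: "N \<in> p_index p F" if N: "N \<in> ?N" for N
  proof -
    obtain \<phi> where \<phi>: "\<phi> \<in> gsurj F H" "N = kernel F H \<phi>" using N by blast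
    show ?thesis unfolding \<phi>(2) by (rule kernel_p_index[OF prime H gsurjD(1)[OF \<phi>(1)]])
  qed
  have disj: "disjoint_family_on ?E ?N"
    unfolding disjoint_family_on_def
  proof (intro ballI impI, rule ccontr)
    fix N N' assume N: "N \<in> ?N" "N' \<in> ?N" "N \<noteq> N'" and "?E N \<inter> ?E N' \<noteq> {}"
    then obtain s where s: "generates_kernel p N (s ` K)" "generates_kernel p N' (s ` K)" by blast
    have "N \<subseteq> N'" "N' \<subseteq> N" using s NJ[OF N(1)] NJ[OF N(2)] unfolding generates_kernel_def by blast+
    thus False using N(3) by blast
  qed
  have pr: "prob_space \<nu>" using haar by (simp add: haar_prob_def)
  interpret P: prob_space ?M by (rule prob_space_PiM) (rule pr)
  have "measure ?M E = (\<Sum>N\<in>?N. measure ?M (?E N))"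
    unfolding EU by (rule P.finite_measure_finite_Union[OF fN sub disj])
  also have "\<dots> = (\<Sum>N\<in>?N. (\<Prod>i<m. 1 - real p ^ i / real p ^ card K) / real (card (Y H ` carrier H)) ^ card K)"
    by (rule sum.cong[OF HOL.refl]) (rule 1(2))
  finally show "measure ?M E = real (card ?N) * ((\<Prod>i<m. 1 - real p ^ i / real p ^ card K) / real (card (Y H ` carrier H)) ^ card K)"
    by (simp only: sum_constant)
qed

section \<open>Replacing the class of all p-groups by a finite class\<close>

definition truncated_class :: "nat \<Rightarrow> nat \<Rightarrow> nat gstruct set" where
  "truncated_class p k = (\<Union>m\<le>k. canonical m) \<inter> p_gamma_groups p"

lemma truncated_class_finite: "finite_class (truncated_class p k)"
  by (auto simp: finite_class_def truncated_class_def finite_canonical p_gamma_groups_def finite_p_gamma_group_def)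

lemma (in tg) truncated_index:
  assumes p: "prime p"
  shows "completion_index (truncated_class p k) G \<subseteq> p_index p G"
    and "\<And>N j. \<lbrakk>N \<lhd> G; gamma_subgroup G N; openin (topo G) N; finite (rcosets N); card (rcosets N) = p ^ j; p ^ j \<le> k\<rbrakk>
      \<Longrightarrow> N \<in> completion_index (truncated_class p k) G"
proof -
  let ?D = "truncated_class p k" and ?Q = "\<lambda>m. \<exists>k. m = p ^ k"
  have "gamma_closure ?D \<subseteq> fin_class ?Q"
  proof (rule gamma_closure_fin_class)
    show "?D \<subseteq> fin_class ?Q" unfolding p_gamma_groups_eq[symmetric] by (auto simp: truncated_class_def)
    show "?Q 1" by (rule exI[of _ 0]) simp
    show "?Q a" if "?Q b" "a dvd b" for a b using that divides_primepow_nat[OF p] by auto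
    show "?Q (a * b)" if "?Q a" "?Q b" for a b using that by (metis power_add)
  qed
  hence "gamma_closure ?D \<subseteq> gamma_closure (p_gamma_groups p)" unfolding p_gamma_groups_eq[symmetric] by (auto intro: gamma_closure.base)
  thus "completion_index ?D G \<subseteq> p_index p G" by (auto simp: completion_index_def)
  fix N j assume N: "N \<lhd> G" "gamma_subgroup G N" "openin (topo G) N" "finite (rcosets N)" and j: "card (rcosets N) = p ^ j" "p ^ j \<le> k"
  show "N \<in> completion_index ?D G"
  proof (rule completion_indexI[OF N], rule subsetI)
    fix A assume "A \<in> canonical (card (rcosets N)) \<inter> {A. finite_gamma_group A}"
    hence A: "A \<in> canonical (p ^ j)" "finite_gamma_group A" using j by auto
    thus "A \<in> ?D" using canonical_order[OF A(1)] j(2)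
      by (auto simp: truncated_class_def p_gamma_groups_def finite_p_gamma_group_def)
  qed
qed

text \<open>A failure of minimality is witnessed by the kernel of a central character of \<open>N\<close>, which has index
  \<open>p\<^sup>h\<^sup>+\<^sup>1\<close>.\<close>

lemma (in tg) truncated_minimal:
  assumes p: "prime p" and H: "finite_gamma_group H" "order H = p ^ h" and \<phi>: "\<phi> \<in> gsurj G H" and N: "N = kernel G H \<phi>"
    and min: "\<And>M. M \<in> completion_index (truncated_class p (p ^ (h + 1))) G \<Longrightarrow> N \<subseteq> M"
    and M: "M \<in> p_index p G"
  shows "N \<subseteq> M"
proof (rule ccontr)
  assume nM: "\<not> N \<subseteq> M"
  have pp: "p > 0" using p prime_gt_0_nat by blast
  note s = gsurjD(1)[OF \<phi>]
  note k = ghom_kernel[OF s finite_gammaD(6)[OF H(1)], folded N]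
  from sign_char_separating[OF p kernel_p_index[OF p H s, folded N] M nM]
  obtain c where c: "c \<in> central_chars p G N" "c \<noteq> (\<lambda>a\<in>N. 1)" "sign_char G N c" by blast
  have "{a\<in>N. c a = 1} \<in> completion_index (truncated_class p (p ^ (h + 1))) G"
    by (rule truncated_index(2)[OF p sign_char_kernel[OF p H \<phi> N c] order_refl])
  from min[OF this] char_nontrivial[OF c(1,2) k(1) pp] show False by blast
qed

text \<open>Both sides assert a surjection whose kernel is least in the respective index. The
  smaller index suffices to test minimality by \<open>truncated_minimal\<close>. The group
  \<open>H'\<close> is a copy of \<open>H\<close> on \<open>nat\<close>, the type of groups that
  basic open sets refer to.\<close>

lemma (in tg) completion_truncated:
  fixes H' :: "nat gstruct"
  assumes p: "prime p" and H: "finite_gamma_group H" "order H = p ^ h" and H': "finite_gamma_group H'" "H \<cong>\<^sub>\<Gamma> H'"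
  shows "completion (p_gamma_groups p) G \<cong>\<^sub>\<Gamma> H \<longleftrightarrow> completion (truncated_class p (p ^ (h + 1))) G \<cong>\<^sub>\<Gamma> H'"
proof -
  let ?D = "truncated_class p (p ^ (h + 1))"
  have o: "order H' = p ^ h" using gamma_iso_order[OF H'(2)] H(2) by simp
  interpret c: completed G "p_gamma_groups p" by (rule p_completed)
  interpret d: completed G ?D by (unfold_locales) (use truncated_class_finite in \<open>auto simp: finite_class_def\<close>)
  have "completion (p_gamma_groups p) G \<cong>\<^sub>\<Gamma> H \<longleftrightarrow> completion (p_gamma_groups p) G \<cong>\<^sub>\<Gamma> H'"
    using gamma_iso_trans[OF _ H'(2)] gamma_iso_trans[OF _ finite_gamma_iso_sym[OF H'(2) H(1)]] by blast
  moreover have "(kernel G H' \<phi> \<in> c.J \<and> (\<forall>N\<in>c.J. kernel G H' \<phi> \<subseteq> N)) \<longleftrightarrow> (kernel G H' \<phi> \<in> d.J \<and> (\<forall>N\<in>d.J. kernel G H' \<phi> \<subseteq> N))"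
    if \<phi>: "\<phi> \<in> gsurj G H'" for \<phi>
  proof -
    note k = ghom_kernel[OF gsurjD(1)[OF \<phi>] finite_gammaD(6)[OF H'(1)]]
    have q: "gamma_quotient G (kernel G H' \<phi>) \<cong>\<^sub>\<Gamma> H'"
      using quotient_iso[OF \<phi>] finite_gammaD[OF H'(1)] by blast
    note r = quotient_iso_ghom[OF k(1,2) q H'(1)]
    have 1: "card (rcosets kernel G H' \<phi>) = p ^ h" using r(4) o by simp
    have "kernel G H' \<phi> \<in> d.J"
      by (rule truncated_index(2)[OF p k(1-3) r(3) 1]) (use p prime_ge_1_nat[OF p] in simp)
    moreover have "d.J \<subseteq> c.J" by (rule truncated_index(1)[OF p])
    ultimately show ?thesis using truncated_minimal[OF p H'(1) o \<phi> HOL.refl] by blast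
  qed
  ultimately show ?thesis unfolding c.completion_iso_iff[OF H'(1)] d.completion_iso_iff[OF H'(1)] by blast
qed

text \<open>This places the event into the algebra on which \<open>is_mu\<close> prescribes limits:
  the class of all p-\<open>\<Gamma>\<close>-groups is infinite, and basic open sets allow only
  finite classes.\<close>

lemma V_basic_open:
  assumes p: "prime p" and H: "finite_p_gamma_group p H"
  shows "V (p_gamma_groups p) H \<in> basic_opens"
proof -
  obtain h where h: "finite_gamma_group H" "order H = p ^ h" using H by (auto simp: finite_p_gamma_group_def)
  obtain H' :: "nat gstruct" where H': "finite_gamma_group H'" "H \<cong>\<^sub>\<Gamma> H'" using canonical_copy[OF h(1)] by blast
  let ?D = "truncated_class p (p ^ (h + 1))"
  have "completion (p_gamma_groups p) G \<cong>\<^sub>\<Gamma> H \<longleftrightarrow> completion ?D G \<cong>\<^sub>\<Gamma> H'" if "c \<in> \<P>" "G \<in> c" for c G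
  proof -
    have "gamma_group G" using that by (auto simp: \<P>_def iso_class_def)
    then interpret tg G by (rule gamma_group_tg)
    show ?thesis by (rule completion_truncated[OF p h H'])
  qed
  hence "V (p_gamma_groups p) H = V ?D H'" unfolding V_def by blast
  thus ?thesis unfolding basic_opens_def using truncated_class_finite H'(1) by blast
qed

text \<open>Members of an isomorphism class are only copies of a coset group, so passage to the
  quotient is described by a map. The last clause is the topological quotient property, restricted
  to subsets of the carrier.\<close>

definition gamma_quotient_map :: "'a gstruct \<Rightarrow> 'b gstruct \<Rightarrow> ('a \<Rightarrow> 'b) \<Rightarrow> bool" where
  "gamma_quotient_map G K \<theta> \<longleftrightarrow> \<theta> \<in> hom G K \<and> \<theta> ` carrier G = carrier K \<and>
     (\<forall>x\<in>carrier G. \<theta> (act G x) = act K (\<theta> x)) \<and>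
     (\<forall>U\<subseteq>carrier K. openin (topo K) U \<longleftrightarrow> openin (topo G) {x\<in>carrier G. \<theta> x \<in> U})"

lemma (in tg) gamma_quotient_map_iso:
  assumes R: "R \<lhd> G" "gamma_subgroup G R" and K: "tg K" "K \<cong>\<^sub>\<Gamma> gamma_quotient G R"
  obtains \<theta> where "gamma_quotient_map G K \<theta>" "kernel G K \<theta> = R"
proof -
  interpret K: tg K by fact
  let ?Q = "gamma_quotient G R"
  obtain h where h0: "h \<in> iso ?Q K" "homeomorphic_map (topo ?Q) (topo K) h"
    "\<forall>x\<in>carrier ?Q. h (act ?Q x) = act K (h x)"
    using K.tg_iso_sym[OF K(2)] unfolding gamma_iso_def by blast
  have "bij_betw h (carrier ?Q) (carrier K)" "h \<in> hom ?Q K" using h0(1) unfolding iso_def by blast+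
  note h = h0(1,2) bspec[OF h0(3)] this
  note qt = quotient_tg[OF R]
  interpret h: group_hom ?Q K h using qt(1) h(5) K.is_group by (simp only: group_hom_iff)
  have sR: "subgroup R G" by (rule normal_imp_subgroup[OF R(1)])
  have cosin: "R #> x \<in> rcosets R" if "x \<in> carrier G" for x using that by (auto simp: RCOSETS_def)
  define \<theta> where "\<theta> x = h (R #> x)" for x
  have UN: "\<Union>(rcosets R) = carrier G" by (rule rcosets_part_G[OF sR])
  have "openin (topo ?Q) (rcosets R)"
    unfolding openin_gamma_quotient[OF R(1)] UN using openin_topspace[of "topo G"] topspace_eq by simp
  hence ts: "topspace (topo ?Q) = rcosets R"
    using openin_gamma_quotient[OF R(1)] openin_subset openin_topspace by (metis subset_antisym)
  have qm: "quotient_map (topo ?Q) (topo K) h" using h(2) by (simp add: homeomorphic_map_def)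
  have op: "openin (topo K) U \<longleftrightarrow> openin (topo G) {x\<in>carrier G. \<theta> x \<in> U}" if U: "U \<subseteq> carrier K" for U
  proof -
    have "\<Union>{X\<in>rcosets R. h X \<in> U} = {x\<in>carrier G. \<theta> x \<in> U}"
    proof (intro equalityI subsetI)
      fix x assume "x \<in> \<Union>{X\<in>rcosets R. h X \<in> U}"
      then obtain X where X: "X \<in> rcosets R" "h X \<in> U" "x \<in> X" by blast
      have xc: "x \<in> carrier G" using UN X by blast
      obtain g where "g \<in> carrier G" "X = R #> g" using X(1) by (auto simp: RCOSETS_def)
      hence "X = R #> x" using repr_independence[OF _ _ sR] X(3) by blast
      thus "x \<in> {x\<in>carrier G. \<theta> x \<in> U}" using xc X(2) by (simp add: \<theta>_def)
    next
      fix x assume "x \<in> {x\<in>carrier G. \<theta> x \<in> U}"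
      hence x: "x \<in> carrier G" "h (R #> x) \<in> U" by (auto simp: \<theta>_def)
      thus "x \<in> \<Union>{X\<in>rcosets R. h X \<in> U}" using cosin[OF x(1)] rcos_self[OF x(1) sR] by blast
    qed
    moreover have "openin (topo K) U \<longleftrightarrow> openin (topo ?Q) {X\<in>rcosets R. h X \<in> U}"
      using qm U K.topspace_eq ts unfolding quotient_map_def by metis
    moreover have "{X\<in>rcosets R. h X \<in> U} \<subseteq> rcosets R" by blast
    ultimately show ?thesis unfolding openin_gamma_quotient[OF R(1)] by simp
  qed
  have hm: "\<theta> \<in> hom G K"
  proof (rule homI)
    fix x z assume xz: "x \<in> carrier G" "z \<in> carrier G"
    have "R #> (x \<otimes> z) = (R #> x) \<otimes>\<^bsub>?Q\<^esub> (R #> z)" by (rule hom_mult[OF qt(4) xz])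
    moreover have "R #> x \<in> carrier ?Q" "R #> z \<in> carrier ?Q" using hom_in_carrier[OF qt(4)] xz by blast+
    ultimately show "\<theta> (x \<otimes> z) = \<theta> x \<otimes>\<^bsub>K\<^esub> \<theta> z" unfolding \<theta>_def using h.hom_mult by (simp only:)
  next
    fix x assume "x \<in> carrier G"
    from hom_in_carrier[OF qt(4) this] show "\<theta> x \<in> carrier K" unfolding \<theta>_def by (rule h.hom_closed)
  qed
  have "\<theta> ` carrier G = h ` (rcosets R)" unfolding \<theta>_def by (auto simp: RCOSETS_def)
  hence sur: "\<theta> ` carrier G = carrier K" using h(4) by (simp add: bij_betw_def)
  have ac: "\<theta> (act G x) = act K (\<theta> x)" if x: "x \<in> carrier G" for x
    using h(3)[OF hom_in_carrier[OF qt(4) x]] act_coset[OF R(2) x] by (simp add: \<theta>_def)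
  have "\<theta> x = \<one>\<^bsub>K\<^esub> \<longleftrightarrow> x \<in> R" if x: "x \<in> carrier G" for x
  proof -
    have "\<theta> x = \<one>\<^bsub>K\<^esub> \<longleftrightarrow> h (R #> x) = h \<one>\<^bsub>?Q\<^esub>" unfolding \<theta>_def h.hom_one ..
    also have "\<dots> \<longleftrightarrow> R #> x = \<one>\<^bsub>?Q\<^esub>"
      by (rule inj_on_eq_iff[OF bij_betw_imp_inj_on[OF h(4)] hom_in_carrier[OF qt(4) x] monoid.one_closed[OF group.is_monoid[OF qt(1)]]])
    also have "\<dots> \<longleftrightarrow> x \<in> R" using coset_join1[OF _ x sR] coset_join2[OF x sR] by auto
    finally show ?thesis .
  qed
  hence ke: "kernel G K \<theta> = R" using subgroup.subset[OF sR] by (auto simp: kernel_def)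
  show thesis by (rule that[of \<theta>]) (use hm sur ac op ke in \<open>auto simp: gamma_quotient_map_def\<close>)
qed

lemma gamma_quotient_map_pull:
  assumes \<theta>: "gamma_quotient_map G K \<theta>" and t: "tg G" "tg K" "tg A" and \<psi>: "\<psi> \<in> gsurj K A"
  shows "(\<lambda>x. \<psi> (\<theta> x)) \<in> gsurj G A"
proof -
  interpret G: tg G by fact
  interpret K: tg K by fact
  note q = \<theta>[unfolded gamma_quotient_map_def]
  note s = gsurjD[OF \<psi>]
  interpret \<psi>: group_hom K A \<psi> by (rule K.ghom_kernel(5)[OF s(1) t(3)])
  interpret \<theta>: group_hom G K \<theta> using q G.is_group K.is_group by (simp add: group_hom_iff)
  have "kernel G A (\<lambda>x. \<psi> (\<theta> x)) = {x\<in>carrier G. \<theta> x \<in> kernel K A \<psi>}" by (auto simp: kernel_def)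
  moreover have "kernel K A \<psi> \<subseteq> carrier K" by (auto simp: kernel_def)
  ultimately have "openin (topo G) (kernel G A (\<lambda>x. \<psi> (\<theta> x)))" using q s(4) by simp
  moreover have "(\<lambda>x. \<psi> (\<theta> x)) \<in> hom G A" by (rule homI) auto
  moreover have "(\<lambda>x. \<psi> (\<theta> x)) ` carrier G = carrier A"
    unfolding image_image[symmetric, of \<psi> \<theta>] using q s(3) by simp
  ultimately show ?thesis using q s(5) by (simp add: gsurj_def ghom_def)
qed

lemma gamma_quotient_map_descend:
  assumes \<theta>: "gamma_quotient_map G K \<theta>" and t: "tg G" "tg K" "tg A" and \<phi>: "\<phi> \<in> gsurj G A"
    and k: "kernel G K \<theta> \<subseteq> kernel G A \<phi>"
  shows "\<exists>\<psi>\<in>gsurj K A. \<forall>x\<in>carrier G. \<psi> (\<theta> x) = \<phi> x"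
proof -
  interpret G: tg G by fact
  interpret K: tg K by fact
  interpret A: tg A by fact
  note q = \<theta>[unfolded gamma_quotient_map_def]
  note s = gsurjD[OF \<phi>]
  interpret \<phi>: group_hom G A \<phi> by (rule G.ghom_kernel(5)[OF s(1) t(3)])
  interpret \<theta>: group_hom G K \<theta> using q G.is_group K.is_group by (simp add: group_hom_iff)
  have eq: "\<phi> x = \<phi> z" if xz: "x \<in> carrier G" "z \<in> carrier G" and e: "\<theta> x = \<theta> z" for x z
  proof -
    have "x \<otimes>\<^bsub>G\<^esub> inv\<^bsub>G\<^esub> z \<in> kernel G K \<theta>" using xz e by (simp add: kernel_def)
    with k have "x \<otimes>\<^bsub>G\<^esub> inv\<^bsub>G\<^esub> z \<in> kernel G A \<phi>" by blast
    hence "\<phi> x \<otimes>\<^bsub>A\<^esub> inv\<^bsub>A\<^esub> \<phi> z = \<one>\<^bsub>A\<^esub>" using xz by (simp add: kernel_def)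
    thus ?thesis using A.inv_solve_right'[of "\<one>\<^bsub>A\<^esub>" "\<phi> x" "\<phi> z"] xz by simp
  qed
  have "\<theta> ` carrier G = carrier K" using q by blast
  moreover have "\<forall>a\<in>\<theta> ` carrier G. \<exists>x\<in>carrier G. \<theta> x = a" by blast
  ultimately have "\<forall>a\<in>carrier K. \<exists>x\<in>carrier G. \<theta> x = a" by (simp only:)
  then obtain \<xi> where \<xi>: "\<And>a. a \<in> carrier K \<Longrightarrow> \<xi> a \<in> carrier G" "\<And>a. a \<in> carrier K \<Longrightarrow> \<theta> (\<xi> a) = a" by metis
  define \<psi> where "\<psi> a = \<phi> (\<xi> a)" for a
  have \<psi>: "\<psi> (\<theta> x) = \<phi> x" if x: "x \<in> carrier G" for x
    unfolding \<psi>_def by (rule eq) (use x \<xi> in auto)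
  have hm: "\<psi> \<in> hom K A"
  proof (rule homI)
    fix a b assume ab: "a \<in> carrier K" "b \<in> carrier K"
    have "\<psi> (a \<otimes>\<^bsub>K\<^esub> b) = \<psi> (\<theta> (\<xi> a \<otimes>\<^bsub>G\<^esub> \<xi> b))" using \<xi> ab by simp
    also have "\<dots> = \<psi> a \<otimes>\<^bsub>A\<^esub> \<psi> b" using \<psi>[OF G.m_closed[OF \<xi>(1)[OF ab(1)] \<xi>(1)[OF ab(2)]]] \<xi>(1) ab by (simp add: \<psi>_def)
    finally show "\<psi> (a \<otimes>\<^bsub>K\<^esub> b) = \<psi> a \<otimes>\<^bsub>A\<^esub> \<psi> b" .
  qed (use \<xi>(1) in \<open>simp add: \<psi>_def\<close>)
  have "{x\<in>carrier G. \<theta> x \<in> kernel K A \<psi>} = kernel G A \<phi>" using \<psi> by (auto simp: kernel_def)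
  moreover have "kernel K A \<psi> \<subseteq> carrier K" by (auto simp: kernel_def)
  ultimately have o: "openin (topo K) (kernel K A \<psi>)" using q s(4) by simp
  have ac: "\<psi> (act K a) = act A (\<psi> a)" if a: "a \<in> carrier K" for a
  proof -
    have "act K a = \<theta> (act G (\<xi> a))" using q \<xi>[OF a] by simp
    thus ?thesis using \<psi>[OF G.act_closed[OF \<xi>(1)[OF a]]] s(5)[OF \<xi>(1)[OF a]] by (simp add: \<psi>_def)
  qed
  have "\<psi> ` carrier K = carrier A"
  proof (intro equalityI subsetI)
    fix b assume "b \<in> carrier A"
    then obtain x where "x \<in> carrier G" "\<phi> x = b" using s(7) by blast
    thus "b \<in> \<psi> ` carrier K" using \<psi> by (intro image_eqI[of _ _ "\<theta> x"]) auto
  qed (use hom_in_carrier[OF hm] in auto)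
  hence "\<psi> \<in> gsurj K A" using hm o ac by (simp add: gsurj_def ghom_def)
  thus ?thesis using \<psi> by blast
qed

text \<open>Members of the index of \<open>K\<close> correspond to those members of the index of
  \<open>G\<close> that contain \<open>Y(S)\<close>: surjections from \<open>K\<close> pull back to
  \<open>G\<close>, and surjections from \<open>G\<close> killing \<open>[Y(S)]\<close> descend. A
  member of the index is open, hence closed, so it contains \<open>[Y(S)]\<close> as soon as it
  contains \<open>Y(S)\<close>.\<close>

lemma (in tg) completion_quotient_iff:
  assumes p: "prime p" and H: "finite_gamma_group H" "order H = p ^ h" and S: "S \<subseteq> carrier G"
    and K: "tg K" "K \<cong>\<^sub>\<Gamma> Y_quotient G S"
  shows "completion (p_gamma_groups p) K \<cong>\<^sub>\<Gamma> H \<longleftrightarrow> (\<exists>\<phi>\<in>gsurj G H. generates_kernel p (kernel G H \<phi>) S)"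
proof -
  interpret K: tg K by fact
  interpret c: completed K "p_gamma_groups p" by (rule K.p_completed)
  note H' = finite_gammaD[OF H(1)]
  have Cf: "finite_gamma_group A" if "A \<in> p_gamma_groups p" for A
    using that by (auto simp: p_gamma_groups_def finite_p_gamma_group_def)
  have ci: "M \<in> p_index p G \<longleftrightarrow> (\<exists>A \<in> gamma_closure (p_gamma_groups p). \<exists>\<phi> \<in> gsurj G A. kernel G A \<phi> = M)" for M
    by (rule completion_index_iff) (erule Cf)
  have ck: "M \<in> c.J \<longleftrightarrow> (\<exists>A \<in> gamma_closure (p_gamma_groups p). \<exists>\<phi> \<in> gsurj K A. kernel K A \<phi> = M)" for M
    by (rule K.completion_index_iff) (erule Cf)
  have fcl: "finite_gamma_group A" if "A \<in> gamma_closure (p_gamma_groups p)" for A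
    by (rule gamma_closure_finite[OF _ that]) (erule Cf)
  have YS: "Y G ` S \<subseteq> carrier G" using S by auto
  let ?R = "closed_normal_gamma_gen G (Y G ` S)"
  note R = closed_normal_gamma_gen_props[OF YS]
  obtain \<theta> where \<theta>: "gamma_quotient_map G K \<theta>" "kernel G K \<theta> = ?R"
    using gamma_quotient_map_iso[OF R(1,2) K[unfolded Y_quotient_def]] .
  have q: "\<theta> \<in> hom G K" "\<theta> ` carrier G = carrier K" using \<theta>(1) unfolding gamma_quotient_map_def by blast+
  have \<theta>c: "\<theta> x \<in> carrier K" if "x \<in> carrier G" for x using hom_in_carrier[OF q(1) that] .
  have \<theta>s: "\<exists>x\<in>carrier G. \<theta> x = a" if "a \<in> carrier K" for a using that unfolding q(2)[symmetric] by blast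
  have \<theta>1: "\<theta> x = \<one>\<^bsub>K\<^esub>" if "x \<in> ?R" for x using that unfolding \<theta>(2)[symmetric] by (simp add: kernel_def)
  show ?thesis
    unfolding c.completion_iso_iff[OF H(1)]
  proof
    assume "\<exists>\<psi>\<in>gsurj K H. kernel K H \<psi> \<in> c.J \<and> (\<forall>N\<in>c.J. kernel K H \<psi> \<subseteq> N)"
    then obtain \<psi> where \<psi>: "\<psi> \<in> gsurj K H" "\<And>N. N \<in> c.J \<Longrightarrow> kernel K H \<psi> \<subseteq> N" by blast
    interpret \<psi>: group_hom K H \<psi> by (rule K.ghom_kernel(5)[OF gsurjD(1)[OF \<psi>(1)] H'(6)])
    note pl = gamma_quotient_map_pull[OF \<theta>(1) tg_axioms K(1) H'(6) \<psi>(1)]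
    have "generates_kernel p (kernel G H (\<lambda>x. \<psi> (\<theta> x))) S"
      unfolding generates_kernel_def
    proof (intro conjI ballI impI)
      fix s assume s: "s \<in> S"
      have "Y G s \<in> ?R" using R(4) s by blast
      thus "Y G s \<in> kernel G H (\<lambda>x. \<psi> (\<theta> x))" using \<theta>1 YS s by (auto simp: kernel_def)
    next
      fix M assume M: "M \<in> p_index p G" "\<forall>s\<in>S. Y G s \<in> M"
      have MD: "M \<lhd> G" "gamma_subgroup G M" "openin (topo G) M" using M(1) unfolding index_p[OF p] by blast+
      have RM: "?R \<subseteq> M" by (rule R(5)) (use M MD open_subgroup_closed[OF normal_imp_subgroup[OF MD(1)] MD(3)] in auto)
      obtain A \<alpha> where A: "A \<in> gamma_closure (p_gamma_groups p)" "\<alpha> \<in> gsurj G A" "kernel G A \<alpha> = M"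
        using M(1) unfolding ci by blast
      have fA: "finite_gamma_group A" by (rule fcl[OF A(1)])
      have kk: "kernel G K \<theta> \<subseteq> kernel G A \<alpha>" using RM \<theta>(2) A(3) by simp
      obtain \<beta> where \<beta>: "\<beta> \<in> gsurj K A" "\<And>x. x \<in> carrier G \<Longrightarrow> \<beta> (\<theta> x) = \<alpha> x"
        using gamma_quotient_map_descend[OF \<theta>(1) tg_axioms K(1) finite_gammaD(6)[OF fA] A(2) kk] by blast
      have "kernel K A \<beta> \<in> c.J" unfolding ck using A(1) \<beta>(1) by blast
      from \<psi>(2)[OF this] show "kernel G H (\<lambda>x. \<psi> (\<theta> x)) \<subseteq> M"
        unfolding A(3)[symmetric] kernel_def using \<beta>(2) \<theta>c by force
    qed
    thus "\<exists>\<phi>\<in>gsurj G H. generates_kernel p (kernel G H \<phi>) S" using pl by blast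
  next
    assume "\<exists>\<phi>\<in>gsurj G H. generates_kernel p (kernel G H \<phi>) S"
    then obtain \<phi> where \<phi>: "\<phi> \<in> gsurj G H" "\<And>s. s \<in> S \<Longrightarrow> Y G s \<in> kernel G H \<phi>"
      "\<And>M. M \<in> p_index p G \<Longrightarrow> \<forall>s\<in>S. Y G s \<in> M \<Longrightarrow> kernel G H \<phi> \<subseteq> M"
      unfolding generates_kernel_def by blast
    note k = ghom_kernel[OF gsurjD(1)[OF \<phi>(1)] H'(6)]
    have Rk: "kernel G K \<theta> \<subseteq> kernel G H \<phi>" unfolding \<theta>(2) by (rule R(5)[OF k(1,2,4)]) (use \<phi>(2) in blast)
    obtain \<psi> where \<psi>: "\<psi> \<in> gsurj K H" "\<And>x. x \<in> carrier G \<Longrightarrow> \<psi> (\<theta> x) = \<phi> x"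
      using gamma_quotient_map_descend[OF \<theta>(1) tg_axioms K(1) H'(6) \<phi>(1) Rk] by blast
    have "kernel K H \<psi> \<in> c.J" by (rule K.kernel_p_index[OF p H gsurjD(1)[OF \<psi>(1)]])
    moreover have "kernel K H \<psi> \<subseteq> N" if N: "N \<in> c.J" for N
    proof -
      obtain A \<beta> where A: "A \<in> gamma_closure (p_gamma_groups p)" "\<beta> \<in> gsurj K A" "kernel K A \<beta> = N"
        using N unfolding ck by blast
      have fA: "finite_gamma_group A" by (rule fcl[OF A(1)])
      note tA = finite_gammaD(6)[OF fA]
      note pl = gamma_quotient_map_pull[OF \<theta>(1) tg_axioms K(1) tA A(2)]
      interpret \<beta>: group_hom K A \<beta> by (rule K.ghom_kernel(5)[OF gsurjD(1)[OF A(2)] tA])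
      let ?M = "kernel G A (\<lambda>x. \<beta> (\<theta> x))"
      have "?M \<in> p_index p G" unfolding ci using A(1) pl by blast
      moreover have "\<forall>s\<in>S. Y G s \<in> ?M"
      proof
        fix s assume s: "s \<in> S"
        hence "Y G s \<in> ?R" using R(4) by blast
        thus "Y G s \<in> ?M" using \<theta>1 YS s by (auto simp: kernel_def)
      qed
      ultimately have sub: "kernel G H \<phi> \<subseteq> ?M" by (rule \<phi>(3))
      show ?thesis
      proof
        fix a assume a: "a \<in> kernel K H \<psi>"
        hence ac: "a \<in> carrier K" by (simp add: kernel_def)
        then obtain x where x: "x \<in> carrier G" "\<theta> x = a" using \<theta>s by blast
        have "x \<in> kernel G H \<phi>" using a x \<psi>(2)[OF x(1)] by (simp add: kernel_def)
        hence "x \<in> ?M" using sub by blast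
        thus "a \<in> N" using x ac unfolding A(3)[symmetric] by (simp add: kernel_def)
      qed
    qed
    ultimately show "\<exists>\<psi>\<in>gsurj K H. kernel K H \<psi> \<in> c.J \<and> (\<forall>N\<in>c.J. kernel K H \<psi> \<subseteq> N)" using \<psi>(1) by blast
  qed
qed

text \<open>The definition of \<open>V\<close> asks for one member of the class with the right
  completion; by \<open>completion_quotient_iff\<close> all members give the same answer, and that
  answer can be read off from \<open>S\<close>.\<close>

lemma (in tg) Y_quotient_in_V:
  assumes p: "prime p" and H: "finite_gamma_group H" "order H = p ^ h" and S: "S \<subseteq> carrier G"
  shows "iso_class (Y_quotient G S) \<in> V (p_gamma_groups p) H \<longleftrightarrow>
    iso_class (Y_quotient G S) \<in> \<P> \<and> (\<exists>\<phi>\<in>gsurj G H. generates_kernel p (kernel G H \<phi>) S)"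
proof (cases "iso_class (Y_quotient G S) \<in> \<P>")
  case True
  then obtain X :: "nat set gstruct" where X: "iso_class (Y_quotient G S) = iso_class X" "in_P X" unfolding \<P>_def by blast
  have "gamma_group X" using X(2) by (simp add: in_P_def admissible_def pro_odd_def)
  hence XK: "X \<in> iso_class (Y_quotient G S)" unfolding X(1) unfolding iso_class_def using gamma_iso_refl by blast
  have "completion (p_gamma_groups p) K \<cong>\<^sub>\<Gamma> H \<longleftrightarrow> (\<exists>\<phi>\<in>gsurj G H. generates_kernel p (kernel G H \<phi>) S)"
    if "K \<in> iso_class (Y_quotient G S)" for K
    by (rule completion_quotient_iff[OF p H S]) (use that gamma_group_tg in \<open>auto simp: iso_class_def\<close>)
  thus ?thesis using True XK unfolding V_def by blast
qed (simp add: V_def)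

text \<open>The substitution is i = m - 1 - t. In the new form the exponents depend on
  \<open>k\<close> and \<open>m\<close> only through \<open>k - m\<close>, which is constant along
  the limit, while \<open>m\<close> only affects the number of factors.\<close>

lemma prod_reversed:
  assumes p: "p > 0"
  shows "(\<Prod>i<m. 1 - real p ^ i / real p ^ k) = (\<Prod>t<m. 1 - real p powi (- (1 + int k - int m + int t)))"
proof -
  have "(\<Prod>i<m. 1 - real p ^ i / real p ^ k) = (\<Prod>i<m. 1 - real p ^ (m - Suc i) / real p ^ k)"
    by (rule prod.nat_diff_reindex[symmetric])
  also have "\<dots> = (\<Prod>t<m. 1 - real p powi (- (1 + int k - int m + int t)))"
  proof (rule prod.cong[OF HOL.refl])
    fix t assume t: "t \<in> {..<m}"
    have "- (1 + int k - int m + int t) = int (m - Suc t) - int k" using t by simp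
    hence "real p powi (- (1 + int k - int m + int t)) = real p powi int (m - Suc t) / real p powi int k"
      using p by (simp only: power_int_diff of_nat_0_less_iff less_imp_neq[symmetric] of_nat_eq_0_iff not_False_eq_True simp_thms)
    thus "1 - real p ^ (m - Suc t) / real p ^ k = 1 - real p powi (- (1 + int k - int m + int t))" by simp
  qed
  finally show ?thesis .
qed

text \<open>The deviations of the factors from 1 form a geometric series, whatever the sign of
  \<open>c\<close>, so the infinite product converges; the number of factors tends to infinity with
  \<open>n\<close>.\<close>

lemma prod_limit:
  assumes p: "p \<ge> (2::nat)"
  shows "(\<lambda>n. \<Prod>t<r + n - d. 1 - real p powi (- (c + int t))) \<longlonglongrightarrow> (\<Prod>t. 1 - real p powi (- (c + int t)))"
proof -
  let ?f = "\<lambda>t. 1 - real p powi (- (c + int t))"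
  have p0: "real p \<noteq> 0" using p by simp
  have "norm (?f t - 1) = real p powi (- c) * (1 / real p) ^ t" for t
  proof -
    have "norm (?f t - 1) = real p powi (- (c + int t))" by simp
    also have "\<dots> = real p powi (- c - int t)" by (rule arg_cong[of _ _ "(powi) (real p)"]) simp
    also have "\<dots> = real p powi (- c) * (1 / real p) ^ t"
      using p0 by (simp add: power_int_diff power_divide)
    finally show ?thesis .
  qed
  hence "summable (\<lambda>t. norm (?f t - 1))" using p by (simp add: summable_mult summable_geometric)
  hence "convergent_prod ?f" by (intro abs_convergent_prod_imp_convergent_prod summable_imp_abs_convergent_prod)
  hence "(\<lambda>n. \<Prod>t\<le>n. ?f t) \<longlonglongrightarrow> prodinf ?f" by (rule convergent_prod_LIMSEQ)
  hence "(\<lambda>n. \<Prod>t<Suc n. ?f t) \<longlonglongrightarrow> prodinf ?f" by (simp only: lessThan_Suc_atMost)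
  hence 1: "(\<lambda>n. \<Prod>t<n. ?f t) \<longlonglongrightarrow> prodinf ?f" by (rule LIMSEQ_imp_Suc)
  have "filterlim (\<lambda>n. r + n - d) at_top sequentially"
    unfolding filterlim_at_top eventually_sequentially
  proof (intro allI)
    fix Z :: nat show "\<exists>N. \<forall>n\<ge>N. Z \<le> r + n - d" by (rule exI[of _ "Z + d"]) auto
  qed
  from filterlim_compose[OF 1 this] show ?thesis .
qed

text \<open>After division by q^n the error term in \<open>lo\<close> is q times a power of (q-1)/q,
  which is less than 1.\<close>

lemma tuple_ratio_limit:
  fixes T :: "nat \<Rightarrow> nat"
  assumes q: "q > (0::nat)" and up: "\<And>n. T n \<le> q ^ n" and lo: "\<And>n. q ^ n \<le> T n + q * (q - 1) ^ n"
  shows "(\<lambda>n. real (T n) / real q ^ n) \<longlonglongrightarrow> 1"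
proof (rule tendsto_sandwich)
  have qn: "real q ^ n > 0" for n using q by simp
  have q1: "real (q - 1) = real q - 1" using q by (simp add: of_nat_diff)
  have "1 - real q * ((real q - 1) / real q) ^ n \<le> real (T n) / real q ^ n" for n
  proof -
    have "real (q ^ n) \<le> real (T n + q * (q - 1) ^ n)" using lo by (rule of_nat_mono)
    hence "real q ^ n \<le> real (T n) + real q * (real q - 1) ^ n" by (simp only: of_nat_add of_nat_mult of_nat_power q1)
    hence "real q ^ n / real q ^ n \<le> (real (T n) + real q * (real q - 1) ^ n) / real q ^ n"
      using qn[of n] by (intro divide_right_mono) simp_all
    thus ?thesis using qn[of n] q by (simp add: add_divide_distrib power_divide)
  qed
  thus "\<forall>\<^sub>F n in sequentially. 1 - real q * ((real q - 1) / real q) ^ n \<le> real (T n) / real q ^ n" by simp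
  have "real (T n) / real q ^ n \<le> 1" for n
  proof -
    have "real (T n) \<le> real (q ^ n)" using up by (rule of_nat_mono)
    thus ?thesis using qn[of n] by simp
  qed
  thus "\<forall>\<^sub>F n in sequentially. real (T n) / real q ^ n \<le> 1" by simp
  have "norm ((real q - 1) / real q) < 1" using q by simp
  hence "(\<lambda>n. ((real q - 1) / real q) ^ n) \<longlonglongrightarrow> 0" by (rule LIMSEQ_power_zero)
  from tendsto_diff[OF tendsto_const tendsto_mult[OF tendsto_const this], of 1 "real q"]
  show "(\<lambda>n. 1 - real q * ((real q - 1) / real q) ^ n) \<longlonglongrightarrow> 1" by simp
qed simp

text \<open>As the probability of \<^const>\<open>\<P>\<close> tends to 1, it is not necessary to know that the random group lies in
  \<^const>\<open>\<P>\<close> for a given \<open>s\<close>.\<close>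

lemma event_limit:
  fixes H :: "'h gstruct"
  assumes p: "prime p" "odd p" and haar: "\<And>n. haar_prob (\<F> n) (\<nu> n)" and mu: "is_mu \<nu> u \<mu>"
    and H: "finite_gamma_group H" "order H = p ^ h"
  defines "M n \<equiv> PiM {..<nat (int n + u)} (\<lambda>_. \<nu> n)"
  defines "E n \<equiv> {s \<in> space (M n). \<exists>\<phi>\<in>gsurj (\<F> n) H.
    tg.generates_kernel (\<F> n) p (kernel (\<F> n) H \<phi>) (s ` {..<nat (int n + u)})}"
  assumes meas: "\<forall>\<^sub>F n in sequentially. E n \<in> sets (M n)"
  shows "(\<lambda>n. measure (M n) (E n)) \<longlonglongrightarrow> measure \<mu> (V (p_gamma_groups p) H)"
proof -
  let ?V = "V (p_gamma_groups p) H" and ?K = "\<lambda>n. {..<nat (int n + u)}"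
  define A where "A n = {s \<in> space (M n). iso_class (Y_quotient (\<F> n) (s ` ?K n)) \<in> \<P>}" for n
  define B where "B n = {s \<in> space (M n). iso_class (Y_quotient (\<F> n) (s ` ?K n)) \<in> ?V}" for n
  have BAE: "B n = A n \<inter> E n" for n
  proof -
    interpret F: gfree "\<F> n" p "{1..n}" "\<lambda>i. Y (free_pro_odd n) (x_gen n i)" by (rule gfree_Fn[OF p])
    have "iso_class (Y_quotient (\<F> n) (s ` ?K n)) \<in> ?V \<longleftrightarrow> iso_class (Y_quotient (\<F> n) (s ` ?K n)) \<in> \<P> \<and>
      (\<exists>\<phi>\<in>gsurj (\<F> n) H. F.generates_kernel p (kernel (\<F> n) H \<phi>) (s ` ?K n))" if "s \<in> space (M n)" for s
    proof (rule F.Y_quotient_in_V[OF p(1) H])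
      show "s ` ?K n \<subseteq> carrier (\<F> n)" using that haar[of n] by (auto simp: M_def space_PiM haar_prob_def PiE_iff)
    qed
    thus ?thesis unfolding A_def B_def E_def by blast
  qed
  have mu': "\<And>U. U \<in> basic_algebra \<Longrightarrow> (\<lambda>n. prob_X (\<nu> n) u n U) \<longlonglongrightarrow> measure \<mu> U" "prob_space \<mu>" "space \<mu> = \<P>"
    using mu by (auto simp: is_mu_def)
  have "\<P> \<in> basic_algebra" unfolding basic_algebra_def hull_def using algebra.top by auto
  hence "(\<lambda>n. prob_X (\<nu> n) u n \<P>) \<longlonglongrightarrow> measure \<mu> \<P>" by (rule mu'(1))
  moreover have "prob_X (\<nu> n) u n \<P> = measure (M n) (A n)" for n by (simp only: prob_X_def Let_def M_def A_def)
  moreover have "measure \<mu> \<P> = 1" using prob_space.prob_space[OF mu'(2)] mu'(3) by simp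
  ultimately have a: "(\<lambda>n. measure (M n) (A n)) \<longlonglongrightarrow> 1" by (simp only:)
  have "?V \<in> basic_algebra"
    unfolding basic_algebra_def hull_def using V_basic_open[OF p(1), of H] H by (auto simp: finite_p_gamma_group_def)
  hence "(\<lambda>n. prob_X (\<nu> n) u n ?V) \<longlonglongrightarrow> measure \<mu> ?V" by (rule mu'(1))
  moreover have "prob_X (\<nu> n) u n ?V = measure (M n) (B n)" for n by (simp only: prob_X_def Let_def M_def B_def)
  ultimately have b: "(\<lambda>n. measure (M n) (B n)) \<longlonglongrightarrow> measure \<mu> ?V" by (simp only:)
  have "\<forall>\<^sub>F n in sequentially. measure (M n) (A n) > 0" using order_tendstoD(1)[OF a, of 0] by simp
  with meas have ev: "\<forall>\<^sub>F n in sequentially. 0 \<le> measure (M n) (E n) - measure (M n) (B n) \<and>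
    measure (M n) (E n) - measure (M n) (B n) \<le> 1 - measure (M n) (A n)"
  proof eventually_elim
    case (elim n)
    have pn: "prob_space (\<nu> n)" using haar[of n] by (simp add: haar_prob_def)
    interpret P: prob_space "M n" unfolding M_def by (rule prob_space_PiM) (rule pn)
    \<comment> \<open>The constant \<open>measure\<close> vanishes on sets outside the
      sigma-algebra, so a positive value certifies that \<open>A n\<close> is measurable.\<close>
    have A: "A n \<in> sets (M n)"
    proof (rule ccontr)
      assume "A n \<notin> sets (M n)"
      hence "measure (M n) (A n) = 0" by (rule measure_notin_sets)
      thus False using elim(2) by simp
    qed
    \<comment> \<open>Since \<open>B n = A n \<inter> E n\<close>, the discrepancy is
      \<open>E n - A n\<close>, which lies in the complement of \<open>A n\<close> and so has
      measure tending to 0.\<close>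
    have "measure (M n) (E n) = measure (M n) (B n \<union> (E n - A n))" by (rule arg_cong[of _ _ "measure (M n)"]) (auto simp: BAE)
    also have "\<dots> = measure (M n) (B n) + measure (M n) (E n - A n)"
      by (rule P.finite_measure_Union) (use A elim(1) in \<open>auto simp: BAE\<close>)
    finally have e: "measure (M n) (E n) - measure (M n) (B n) = measure (M n) (E n - A n)" by simp
    have "measure (M n) (E n - A n) \<le> measure (M n) (space (M n) - A n)"
      by (rule P.finite_measure_mono) (use A sets.sets_into_space[OF elim(1)] in auto)
    also have "\<dots> = 1 - measure (M n) (A n)" by (rule P.prob_compl[OF A])
    finally show ?case unfolding e by simp
  qed
  have "(\<lambda>n. measure (M n) (E n) - measure (M n) (B n)) \<longlonglongrightarrow> 0"
  proof (rule tendsto_sandwich[OF _ _ tendsto_const[of 0]])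
    show "(\<lambda>n. 1 - measure (M n) (A n)) \<longlonglongrightarrow> 0" using tendsto_diff[OF tendsto_const a, of 1] by simp
  qed (use ev in \<open>auto elim: eventually_mono\<close>)
  from tendsto_add[OF this b] show ?thesis by simp
qed

text \<open>The counting formula is compared with \<open>relation_rank_count\<close>; the number of
  cocycles and the power with exponent \<open>order H - 1\<close> cancel. The bound on
  \<open>gen_rank H\<close> makes the natural subtraction exact.\<close>

lemma (in gfree) card_central_chars_rank:
  fixes H :: "'h gstruct"
  assumes H: "finite_gamma_group H" "order H = p ^ h" and N: "N \<in> kernel F H ` gsurj F H" and d: "gen_rank H \<le> card I"
  shows "card (central_chars p F N) = p ^ (relation_rank p H + card I - gen_rank H)"
proof -
  note H' = finite_gammaD[OF H(1)]
  have oH: "\<exists>k. order H = p ^ k" using H(2) by blast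
  have p0: "p > 0" using prime prime_gt_0_nat by blast
  obtain \<phi> where \<phi>: "\<phi> \<in> gsurj F H" "N = kernel F H \<phi>" using N by blast
  note 1 = card_central_chars[OF H'(1,2) oH gsurjD(2,3,4)[OF \<phi>(1)] \<phi>(2)]
  have "finite_p_gamma_group p H" using H(1) oH by (simp add: finite_p_gamma_group_def)
  note 2 = relation_rank_count[OF prime this]
  have "card (central_chars p F N) * p ^ gen_rank H * p ^ (order H - 1) = card (cocycles p H) * p ^ card I * p ^ gen_rank H"
    using 1 by (simp add: mult.commute mult.left_commute)
  also have "\<dots> = p ^ relation_rank p H * p ^ (order H - 1) * p ^ card I"
    using 2 by (simp add: mult.commute mult.left_commute)
  finally have "card (central_chars p F N) * p ^ gen_rank H = p ^ (relation_rank p H + card I)"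
    using p0 by (simp add: power_add mult.commute mult.left_commute)
  also have "relation_rank p H + card I = relation_rank p H + card I - gen_rank H + gen_rank H" using d by simp
  finally show ?thesis using p0 by (simp add: power_add)
qed

theorem theorem7p3:
  fixes p :: nat and u :: int and H :: "'h gstruct"
    and \<nu> :: "nat \<Rightarrow> fr_elem measure" and \<mu> :: "gclass measure"
  assumes "prime p" and "odd p"
    and "\<And>n. haar_prob (\<F> n) (\<nu> n)"
    and "is_mu \<nu> u \<mu>"
    and "finite_p_gamma_group p H"
  shows "(presentable (p_gamma_groups p) u H \<longrightarrow>
      measure \<mu> (V (p_gamma_groups p) H) =
        1 / (real (card (gamma_Aut H)) * real (card (Y H ` carrier H)) powi u) *
        (\<Prod>k. 1 - real p powi
            (- (1 + u + int (gen_rank H) - int (relation_rank p H) + int k))))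
    \<and> (\<not> presentable (p_gamma_groups p) u H \<longrightarrow>
      measure \<mu> (V (p_gamma_groups p) H) = 0)"
proof -
  note p = assms(1,2)
  have p0: "p > 0" and p2: "p \<ge> 2" using prime_gt_0_nat[OF p(1)] prime_ge_2_nat[OF p(1)] .
  obtain h where H: "finite_gamma_group H" "order H = p ^ h" using assms(5) by (auto simp: finite_p_gamma_group_def)
  note H' = finite_gammaD[OF H(1)]
  interpret H: tg H by (rule H'(6))
  let ?V = "V (p_gamma_groups p) H" and ?k = "\<lambda>n. nat (int n + u)" and ?y = "\<lambda>n i. Y (free_pro_odd n) (x_gen n i)"
  define M where "M n = PiM {..<?k n} (\<lambda>_. \<nu> n)" for n
  define E where "E n = {s \<in> space (M n). \<exists>\<phi>\<in>gsurj (\<F> n) H. tg.generates_kernel (\<F> n) p (kernel (\<F> n) H \<phi>) (s ` {..<?k n})}" for n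
  have lim: "(\<lambda>n. measure (M n) (E n)) \<longlonglongrightarrow> measure \<mu> ?V" if "\<forall>\<^sub>F n in sequentially. E n \<in> sets (M n)"
    using that unfolding E_def M_def by (rule event_limit[OF p assms(3,4) H])
  let ?d = "gen_rank H" and ?r = "relation_rank p H" and ?q = "card (Y H ` carrier H)"
  \<comment> \<open>Only large \<open>n\<close> matter for the limit. These bounds make
    \<open>nat (int n + u)\<close> and \<open>?r + n - ?d\<close> honest values and provide a
    generator with which relators can be made distinct.\<close>
  have large: "\<forall>\<^sub>F n in sequentially. 0 \<le> int n + u \<and> 1 \<le> n \<and> ?d \<le> n"
    unfolding eventually_sequentially by (rule exI[of _ "nat (- u) + 1 + ?d"]) auto
  show ?thesis
  proof (intro conjI impI)
    assume pr: "presentable (p_gamma_groups p) u H"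
    have gen: "K = carrier H" if "subgroup K H" "Y H ` carrier H \<subseteq> K" for K
      by (rule presentable_generated(1)[OF p H pr that])
    have q0: "?q > 0" using H'(2) H.one_closed by (auto simp: card_gt_0_iff)
    define T where "T n = card (gen_tuples {1..n} (?y n) (\<F> n) H)" for n
    define \<N> where "\<N> n = kernel (\<F> n) H ` gsurj (\<F> n) H" for n
    have TN: "T n = card (\<N> n) * card (gamma_Aut H)" and up: "T n \<le> ?q ^ n" and lo: "?q ^ n \<le> T n + ?q * (?q - 1) ^ n" for n
    proof -
      interpret F: gfree "\<F> n" p "{1..n}" "?y n" by (rule gfree_Fn[OF p])
      show "T n = card (\<N> n) * card (gamma_Aut H)" unfolding T_def \<N>_def by (rule F.card_gen_tuples(2)[OF H])
      have "T n \<le> card ({1..n} \<rightarrow>\<^sub>E Y H ` carrier H)"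
        unfolding T_def by (rule card_mono[OF finite_PiE F.gen_tuples_subset[OF H]]) (use H'(2) in auto)
      thus "T n \<le> ?q ^ n" by (simp add: card_PiE)
      have "?q ^ card {1..n} \<le> T n + ?q * (?q - 1) ^ card {1..n}"
        unfolding T_def by (rule F.gen_tuples_lower[OF H]) (rule gen)
      thus "?q ^ n \<le> T n + ?q * (?q - 1) ^ n" by simp
    qed
    have ratio: "(\<lambda>n. real (T n) / real ?q ^ n) \<longlonglongrightarrow> 1" by (rule tuple_ratio_limit[OF q0 up lo])
    \<comment> \<open>A zero cardinality would make every \<open>T n\<close> zero, against the ratio
      tending to 1.\<close>
    have aut: "card (gamma_Aut H) \<noteq> 0"
    proof
      assume "card (gamma_Aut H) = 0"
      hence "(\<lambda>n. 0 :: real) \<longlonglongrightarrow> 1" using ratio TN by simp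
      thus False using LIMSEQ_unique[OF _ tendsto_const[of "0::real"]] by fastforce
    qed
    \<comment> \<open>The denominator |Y(H)|^(n+u) is split: the part with exponent n normalises the
      number of tuples, the part with exponent u belongs to the constant.\<close>
    have val: "E n \<in> sets (M n) \<and> measure (M n) (E n) = real (T n) / real ?q ^ n *
        (1 / (real (card (gamma_Aut H)) * real ?q powi u)) * (\<Prod>t<?r + n - ?d. 1 - real p powi (- (1 + u + int ?d - int ?r + int t)))"
      if n: "0 \<le> int n + u \<and> 1 \<le> n \<and> ?d \<le> n" for n
    proof -
      interpret F: gfree "\<F> n" p "{1..n}" "?y n" by (rule gfree_Fn[OF p])
      have np: "no_fixed_char p (\<F> n) N" if "N \<in> kernel (\<F> n) H ` gsurj (\<F> n) H" for N
        using that F.presentable_no_fixed_char[OF H pr] by blast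
      have m: "card (central_chars p (\<F> n) N) = p ^ (?r + n - ?d)" if "N \<in> kernel (\<F> n) H ` gsurj (\<F> n) H" for N
        using F.card_central_chars_rank[OF H that] n by simp
      have fin: "finite {..<?k n}" by simp
      have 1: "E n \<in> sets (M n)"
        unfolding E_def M_def by (rule F.event_measure(1)[OF H _ assms(3) fin]) (erule np, erule m)
      have "measure (M n) (E n) = real (card (\<N> n)) * ((\<Prod>i<?r + n - ?d. 1 - real p ^ i / real p ^ card {..<?k n}) / real ?q ^ card {..<?k n})"
        unfolding E_def M_def \<N>_def by (rule F.event_measure(2)[OF H _ assms(3) fin]) (erule np, erule m)
      also have "card {..<?k n} = ?k n" by simp
      also have "(\<Prod>i<?r + n - ?d. 1 - real p ^ i / real p ^ ?k n) = (\<Prod>t<?r + n - ?d. 1 - real p powi (- (1 + int (?k n) - int (?r + n - ?d) + int t)))"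
        by (rule prod_reversed[OF p0])
      also have "1 + int (?k n) - int (?r + n - ?d) = 1 + u + int ?d - int ?r" using n by simp
      also have "real ?q ^ ?k n = real ?q ^ n * real ?q powi u"
      proof -
        have "real ?q ^ ?k n = real ?q powi (int (?k n))" by (rule power_int_of_nat[symmetric])
        also have "int (?k n) = int n + u" using n by simp
        also have "real ?q powi (int n + u) = real ?q ^ n * real ?q powi u" using q0 by (subst power_int_add) auto
        finally show ?thesis .
      qed
      also have "real (card (\<N> n)) = real (T n) / real (card (gamma_Aut H))" using TN[of n] aut by simp
      finally have "measure (M n) (E n) = real (T n) / real (card (gamma_Aut H)) *
        ((\<Prod>t<?r + n - ?d. 1 - real p powi (- (1 + u + int ?d - int ?r + int t))) / (real ?q ^ n * real ?q powi u))" .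
      thus ?thesis using 1 by simp
    qed
    have "\<forall>\<^sub>F n in sequentially. E n \<in> sets (M n)" using large by (rule eventually_mono) (use val in blast)
    from lim[OF this] have l1: "(\<lambda>n. measure (M n) (E n)) \<longlonglongrightarrow> measure \<mu> ?V" .
    let ?c = "1 / (real (card (gamma_Aut H)) * real ?q powi u)"
    have "(\<lambda>n. real (T n) / real ?q ^ n * ?c * (\<Prod>t<?r + n - ?d. 1 - real p powi (- (1 + u + int ?d - int ?r + int t))))
        \<longlonglongrightarrow> 1 * ?c * (\<Prod>t. 1 - real p powi (- (1 + u + int ?d - int ?r + int t)))"
      by (intro tendsto_mult ratio tendsto_const prod_limit[OF p2])
    moreover have "\<forall>\<^sub>F n in sequentially. real (T n) / real ?q ^ n * ?c * (\<Prod>t<?r + n - ?d. 1 - real p powi (- (1 + u + int ?d - int ?r + int t)))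
        = measure (M n) (E n)"
      using large by (rule eventually_mono) (use val in simp)
    ultimately have "(\<lambda>n. measure (M n) (E n)) \<longlonglongrightarrow> 1 * ?c * (\<Prod>t. 1 - real p powi (- (1 + u + int ?d - int ?r + int t)))"
      by (rule Lim_transform_eventually)
    from LIMSEQ_unique[OF l1 this]
    show "measure \<mu> ?V = ?c * (\<Prod>k. 1 - real p powi (- (1 + u + int ?d - int ?r + int k)))" by simp
  next
    assume npr: "\<not> presentable (p_gamma_groups p) u H"
    \<comment> \<open>A sample in the event would yield a presentation of \<open>H\<close> with
      exactly n+u relators, once they are made distinct in the completion.\<close>
    have em: "E n = {}" if n: "0 \<le> int n + u \<and> 1 \<le> n \<and> ?d \<le> n" for n
    proof (rule ccontr)
      interpret F: gfree "\<F> n" p "{1..n}" "?y n" by (rule gfree_Fn[OF p])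
      assume "E n \<noteq> {}"
      then obtain s \<phi> where s: "s \<in> space (M n)" "\<phi> \<in> gsurj (\<F> n) H" "F.generates_kernel p (kernel (\<F> n) H \<phi>) (s ` {..<?k n})"
        unfolding E_def by blast
      have sc: "s i \<in> carrier (\<F> n)" if "i \<in> {..<?k n}" for i
        using s(1) that assms(3)[of n] by (auto simp: M_def space_PiM haar_prob_def PiE_iff)
      have "{1..n} \<noteq> {}" using n by simp
      from F.generates_kernel_presentable[OF H s(2) HOL.refl finite_lessThan sc s(3) this]
      obtain S where "S \<subseteq> carrier (completion (p_gamma_groups p) (\<F> n))" "finite S" "card S = ?k n"
        "H \<cong>\<^sub>\<Gamma> Y_quotient (completion (p_gamma_groups p) (\<F> n)) S" by auto
      moreover have "int (?k n) = int n + u" using n by simp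
      ultimately have "presentable (p_gamma_groups p) u H" unfolding presentable_def by metis
      thus False using npr by simp
    qed
    have "\<forall>\<^sub>F n in sequentially. E n \<in> sets (M n)" using large by (rule eventually_mono) (simp add: em)
    from lim[OF this] have l1: "(\<lambda>n. measure (M n) (E n)) \<longlonglongrightarrow> measure \<mu> ?V" .
    have "\<forall>\<^sub>F n in sequentially. 0 = measure (M n) (E n)" using large by (rule eventually_mono) (simp add: em)
    from Lim_transform_eventually[OF tendsto_const this] have "(\<lambda>n. measure (M n) (E n)) \<longlonglongrightarrow> 0" .
    from LIMSEQ_unique[OF l1 this] show "measure \<mu> ?V = 0" .
  qed
qed

end
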